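(* Let $R>1$, $c>-2$, and let $T\in\mathcal{B}(H)$ satisfy $\sigma(T)\subset A_R$. Then $T\in\mathbb{CDLA}_R(c)$ if and only if there exists $A\in\mathcal{B}(H)$ with $A>0$ and $2+c-A>0$ such that $T/R\in\mathcal{C}_{2+c-A}$ and $T^{-1}/R\in\mathcal{C}_A$.
   Context: $H$ is a complex Hilbert space, $\mathcal{B}(H)$ the bounded operators on $H$, and scalars are identified with multiples of the identity. $X\ge 0$ means $X$ is a positive operator; $X>0$ means $X$ is strictly positive (positive and bounded below, i.e. positive and invertible). The annulus is $A_R=\{z\in\mathbb{C}: 1/R<|z|<R\}$. $\mathcal{A}(A_R)$ is the uniform algebra of continuous functions on $\overline{A_R}$ that are holomorphic on $A_R$, with the supremum norm. Each $f\in\mathcal{A}(A_R)$ has a Laurent expansion $f=\sum_{n\in\mathbb{Z}}a_nz^n$ on $A_R$. Class $\mathcal{C}_A$: for $A\in\mathcal{B}(H)$ with $A>0$, $\mathcal{C}_A$ is the class of all $T\in\mathcal{B}(H)$ for which there exist a Hilbert space $K\supset H$ and a unitary $U\in\mathcal{B}(K)$ such that $A^{-1/2}T^nA^{-1/2}=P_HU^n|_H$ for all $n=1,2,\dots$, where $P_H$ is the orthogonal projection of $K$ onto $H$. Double-layer potential kernel: $\partial A_R$ is positively oriented (outer circle counter-clockwise, inner circle clockwise), $s$ denotes arc length and $\sigma=\sigma(s)$ the arc-length parametrization. For $\sigma(s)\notin\sigma(T)$, $$\mu(\sigma(s),T)=\frac{1}{2\pi i}\Big(\sigma'(s)(\sigma(s)-T)^{-1}-\overline{\sigma'(s)}\,(\overline{\sigma(s)}-T^*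 )^{-1}\Big).$$ Class $\mathbb{CDLA}_R(c)$: for $R>1$, $c>-2$ and $T\in\mathcal{B}(H)$ with $\sigma(T)\subset A_R$, $T\in\mathbb{CDLA}_R(c)$ means that the linear map $S_{R,c}:\mathcal{A}(A_R)\to\mathcal{B}(H)$, $$S_{R,c}\Big(f=\sum_{n\in\mathbb{Z}}a_nz^n\Big)=\frac{1}{2+c}\Big[\int_{\partial A_R}\mu(\sigma,T)f(\sigma)\,ds+ca_0\Big],$$ is completely contractive, i.e. for every $m\ge1$ the entrywise map $[f_{ij}]\mapsto[S_{R,c}(f_{ij})]$ from $M_m(\mathcal{A}(A_R))$ (norm $\sup_{z\in\overline{A_R}}\|[f_{ij}(z)]\|$) to $\mathcal{B}(H^{(m)})$, $H^{(m)}=H\oplus\cdots\oplus H$, is a contraction. *)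

theory Defs
  imports "HOL-Analysis.Analysis" "HOL-Algebra.Module"
begin

section \<open>Complex Hilbert spaces as types\<close>

class complex_vector = real_vector +
  fixes scaleC :: "complex \<Rightarrow> 'a \<Rightarrow> 'a" (infixr "*\<^sub>C" 75)
  assumes scaleC_add_right: "a *\<^sub>C (x + y) = a *\<^sub>C x + a *\<^sub>C y"
    and scaleC_add_left: "(a + b) *\<^sub>C x = a *\<^sub>C x + b *\<^sub>C x"
    and scaleC_scaleC: "a *\<^sub>C (b *\<^sub>C x) = (a * b) *\<^sub>C x"
    and scaleR_scaleC: "r *\<^sub>R x = complex_of_real r *\<^sub>C x"

text \<open>The inner product is linear in the first argument. Positivity and definiteness follow from
  \<open>cinner_self\<close>; completeness is part of \<^class>\<open>banach\<close>.\<close>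

class chilbert_space = complex_vector + banach +
  fixes cinner :: "'a \<Rightarrow> 'a \<Rightarrow> complex"
  assumes cinner_commute: "cinner x y = cnj (cinner y x)"
    and cinner_add_left: "cinner (x + y) z = cinner x z + cinner y z"
    and cinner_scaleC_left: "cinner (a *\<^sub>C x) y = a * cinner x y"
    and cinner_self: "cinner x x = complex_of_real ((norm x)\<^sup>2)"

lemma norm_scaleC: "norm (a *\<^sub>C x) = cmod a * norm (x::'a::chilbert_space)"
proof -
  have "complex_of_real ((norm (a *\<^sub>C x))\<^sup>2) = a * cnj (a * cinner x x)"
    by (metis cinner_commute cinner_scaleC_left cinner_self)
  also have "\<dots> = (a * cnj a) * complex_of_real ((norm x)\<^sup>2)"
    by (simp add: cinner_self)
  also have "\<dots> = complex_of_real ((cmod a * norm x)\<^sup>2)"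
    by (metis complex_norm_square of_real_mult of_real_power power_mult_distrib)
  finally have "(norm (a *\<^sub>C x))\<^sup>2 = (cmod a * norm x)\<^sup>2"
    using of_real_eq_iff by blast
  then show ?thesis
    by simp
qed

lemma bounded_linear_scaleC: "bounded_linear (\<lambda>x::'a::chilbert_space. a *\<^sub>C x)"
proof (rule bounded_linear_intro[where K = "cmod a"])
  fix r :: real and x :: 'a
  show "a *\<^sub>C (r *\<^sub>R x) = r *\<^sub>R (a *\<^sub>C x)"
    by (simp add: scaleR_scaleC scaleC_scaleC mult.commute)
qed (simp_all add: scaleC_add_right norm_scaleC mult.commute)

lemma scaleC_minus_right: "a *\<^sub>C (- x) = - (a *\<^sub>C (x::'a::chilbert_space))"
  using bounded_linear.linear[OF bounded_linear_scaleC] linear_uminus linear_neg by blast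

lemma scaleC_diff_right: "a *\<^sub>C (x - y) = a *\<^sub>C x - a *\<^sub>C (y::'a::chilbert_space)"
  using bounded_linear.linear[OF bounded_linear_scaleC] linear_diff by blast

lemma scaleC_zero_right [simp]: "a *\<^sub>C (0::'a::chilbert_space) = 0"
  using bounded_linear.linear[OF bounded_linear_scaleC] linear_0 by blast

instantiation complex :: chilbert_space
begin

definition scaleC_complex :: "complex \<Rightarrow> complex \<Rightarrow> complex"
  where "scaleC_complex a x = a * x"

definition cinner_complex :: "complex \<Rightarrow> complex \<Rightarrow> complex"
  where "cinner_complex x y = x * cnj y"

instance
proof
  fix a b x y z :: complex and r :: real
  show "a *\<^sub>C (x + y) = a *\<^sub>C x + a *\<^sub>C y" "(a + b) *\<^sub>C x = a *\<^sub>C x + b *\<^sub>C x"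
    "a *\<^sub>C b *\<^sub>C x = (a * b) *\<^sub>C x" "r *\<^sub>R x = complex_of_real r *\<^sub>C x"
    unfolding scaleC_complex_def
    by (rule distrib_left distrib_right mult.assoc[symmetric] scaleR_conv_of_real)+
  show "cinner x y = cnj (cinner y x)"
    by (simp add: cinner_complex_def)
  show "cinner (x + y) z = cinner x z + cinner y z"
    by (simp add: cinner_complex_def distrib_right)
  show "cinner (a *\<^sub>C x) y = a * cinner x y"
    by (simp add: cinner_complex_def scaleC_complex_def)
  show "cinner x x = complex_of_real ((norm x)\<^sup>2)"
    by (simp only: cinner_complex_def complex_norm_square)
qed

end


section \<open>The algebra of bounded operators\<close>

text \<open>\<open>'h bop\<close> is the algebra of bounded complex-linear operators on \<open>'h\<close>, with composition as
  multiplication; \<open>T ^ n\<close> is the iterate and scalars act through \<open>*\<^sub>R\<close> and \<open>*\<^sub>C\<close>.\<close>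

typedef (overloaded) 'h bop =
  "{f :: 'h::chilbert_space \<Rightarrow>\<^sub>L 'h. \<forall>a x. blinfun_apply f (a *\<^sub>C x) = a *\<^sub>C blinfun_apply f x}"
  morphisms blinfun_of_bop Bop
  by (rule exI[of _ 0]) simp

setup_lifting type_definition_bop

lift_definition bop_apply :: "'h::chilbert_space bop \<Rightarrow> 'h \<Rightarrow> 'h" is blinfun_apply .

lemma bop_eqI: "(\<And>x. bop_apply S x = bop_apply T x) \<Longrightarrow> S = T"
  by transfer (rule blinfun_eqI)

lemma bop_apply_scaleC: "bop_apply T (a *\<^sub>C x) = a *\<^sub>C bop_apply T x"
  by transfer simp

lemma bounded_linear_bop_apply: "bounded_linear (bop_apply T)"
  by transfer (rule blinfun.bounded_linear_right)

instantiation bop :: (chilbert_space) real_normed_vector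
begin

lift_definition norm_bop :: "'a bop \<Rightarrow> real" is norm .
lift_definition minus_bop :: "'a bop \<Rightarrow> 'a bop \<Rightarrow> 'a bop" is minus
  by (simp add: blinfun.diff_left scaleC_diff_right)
definition dist_bop :: "'a bop \<Rightarrow> 'a bop \<Rightarrow> real"
  where "dist_bop S T = norm (S - T)"
definition uniformity_bop :: "('a bop \<times> 'a bop) filter"
  where [code del]: "uniformity_bop = (INF e\<in>{0 <..}. principal {(x, y). dist x y < e})"
definition open_bop :: "'a bop set \<Rightarrow> bool"
  where [code del]: "open_bop S = (\<forall>x\<in>S. \<forall>\<^sub>F (x', y) in uniformity. x' = x \<longrightarrow> y \<in> S)"
lift_definition uminus_bop :: "'a bop \<Rightarrow> 'a bop" is uminus
  by (simp add: blinfun.minus_left scaleC_minus_right)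
lift_definition zero_bop :: "'a bop" is 0
  by simp
lift_definition plus_bop :: "'a bop \<Rightarrow> 'a bop \<Rightarrow> 'a bop" is plus
  by (simp add: blinfun.add_left scaleC_add_right)
lift_definition scaleR_bop :: "real \<Rightarrow> 'a bop \<Rightarrow> 'a bop" is scaleR
  by (simp add: blinfun.scaleR_left scaleR_scaleC scaleC_scaleC mult.commute)
definition sgn_bop :: "'a bop \<Rightarrow> 'a bop"
  where "sgn_bop x = scaleR (inverse (norm x)) x"

instance
proof
  fix S T W :: "'a bop" and r q :: real
  show "dist S T = norm (S - T)"
    by (rule dist_bop_def)
  show "sgn S = inverse (norm S) *\<^sub>R S"
    by (rule sgn_bop_def)
  show "(uniformity :: ('a bop \<times> 'a bop) filter) = (INF e\<in>{0 <..}. principal {(x, y). dist x y < e})"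
    by (rule uniformity_bop_def)
  show "open U = (\<forall>x\<in>U. \<forall>\<^sub>F (x', y) in uniformity. x' = x \<longrightarrow> y \<in> U)" for U :: "'a bop set"
    by (rule open_bop_def)
  show "S + T + W = S + (T + W)"
    by transfer (rule add.assoc)
  show "S + T = T + S"
    by transfer (rule add.commute)
  show "0 + S = S"
    by transfer simp
  show "- S + S = 0"
    by transfer simp
  show "S - T = S + - T"
    by transfer simp
  show "r *\<^sub>R (S + T) = r *\<^sub>R S + r *\<^sub>R T"
    by transfer (rule scaleR_add_right)
  show "(r + q) *\<^sub>R S = r *\<^sub>R S + q *\<^sub>R S"
    by transfer (rule scaleR_add_left)
  show "r *\<^sub>R q *\<^sub>R S = (r * q) *\<^sub>R S"
    by transfer simp
  show "1 *\<^sub>R S = S"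
    by transfer simp
  show "norm S = 0 \<longleftrightarrow> S = 0"
    by transfer simp
  show "norm (S + T) \<le> norm S + norm T"
    by transfer (rule norm_triangle_ineq)
  show "norm (r *\<^sub>R S) = \<bar>r\<bar> * norm S"
    by transfer simp
qed

end

instance bop :: (chilbert_space) banach
proof
  fix X :: "nat \<Rightarrow> 'a bop"
  assume "Cauchy X"
  then have "Cauchy (\<lambda>n. blinfun_of_bop (X n))"
    by (simp add: Cauchy_def dist_norm norm_bop.rep_eq minus_bop.rep_eq)
  then obtain L where L: "(\<lambda>n. blinfun_of_bop (X n)) \<longlonglongrightarrow> L"
    using Cauchy_convergent convergent_def by blast
  have lim: "(\<lambda>n. bop_apply (X n) x) \<longlonglongrightarrow> blinfun_apply L x" for x
    unfolding bop_apply.rep_eq by (intro blinfun.tendsto L tendsto_const)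
  have "blinfun_apply L (a *\<^sub>C x) = a *\<^sub>C blinfun_apply L x" for a x
  proof (rule LIMSEQ_unique)
    show "(\<lambda>n. bop_apply (X n) (a *\<^sub>C x)) \<longlonglongrightarrow> blinfun_apply L (a *\<^sub>C x)"
      by (rule lim)
    show "(\<lambda>n. bop_apply (X n) (a *\<^sub>C x)) \<longlonglongrightarrow> a *\<^sub>C blinfun_apply L x"
      unfolding bop_apply_scaleC by (rule bounded_linear.tendsto[OF bounded_linear_scaleC lim])
  qed
  then have L': "blinfun_of_bop (Bop L) = L"
    by (intro Bop_inverse) simp
  have "X \<longlonglongrightarrow> Bop L"
    using L by (simp add: LIMSEQ_def dist_norm norm_bop.rep_eq minus_bop.rep_eq L')
  then show "convergent X"
    by (rule convergentI)
qed

instantiation bop :: (chilbert_space) complex_vector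
begin

lift_definition scaleC_bop :: "complex \<Rightarrow> 'a bop \<Rightarrow> 'a bop"
  is "\<lambda>a f. Blinfun (\<lambda>x. a *\<^sub>C blinfun_apply f x)"
  by (simp add: bounded_linear_Blinfun_apply bounded_linear_compose[OF bounded_linear_scaleC]
      blinfun.bounded_linear_right scaleC_scaleC mult.commute)

lemma bop_apply_scaleC_left: "bop_apply (a *\<^sub>C T) x = a *\<^sub>C bop_apply T x"
  by transfer (simp add: bounded_linear_Blinfun_apply bounded_linear_compose[OF bounded_linear_scaleC]
      blinfun.bounded_linear_right)

instance
proof
  fix a b :: complex and r :: real and S T :: "'a bop"
  have add: "bop_apply (S + T) x = bop_apply S x + bop_apply T x" for S T :: "'a bop" and x
    by transfer (rule blinfun.add_left)
  have sc: "bop_apply (r *\<^sub>R S) x = r *\<^sub>R bop_apply S x" for S :: "'a bop" and x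
    by transfer (rule blinfun.scaleR_left)
  show "a *\<^sub>C (S + T) = a *\<^sub>C S + a *\<^sub>C T" "(a + b) *\<^sub>C S = a *\<^sub>C S + b *\<^sub>C S"
    "a *\<^sub>C b *\<^sub>C S = (a * b) *\<^sub>C S" "r *\<^sub>R S = complex_of_real r *\<^sub>C S"
    by (rule bop_eqI, simp add: add sc bop_apply_scaleC_left scaleC_add_right scaleC_add_left
        scaleC_scaleC scaleR_scaleC)+
qed

end

instantiation bop :: (chilbert_space) "{monoid_mult, real_normed_algebra}"
begin

lift_definition times_bop :: "'a bop \<Rightarrow> 'a bop \<Rightarrow> 'a bop" is blinfun_compose
  by simp
lift_definition one_bop :: "'a bop" is id_blinfun
  by simp

lemma bop_apply_ring:
  "bop_apply (S + T) x = bop_apply S x + bop_apply T x"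
  "bop_apply (r *\<^sub>R S) x = r *\<^sub>R bop_apply S x"
  "bop_apply (S * T) x = bop_apply S (bop_apply T x)"
  "bop_apply 1 x = x"
  by (transfer, simp add: blinfun.add_left blinfun.scaleR_left)+

instance
proof
  fix r :: real and S T W :: "'a bop"
  note lin = bounded_linear.linear[OF bounded_linear_bop_apply]
  show "1 * S = S" "S * 1 = S" "S * T * W = S * (T * W)" "(S + T) * W = S * W + T * W"
    "S * (T + W) = S * T + S * W" "r *\<^sub>R S * T = r *\<^sub>R (S * T)" "S * r *\<^sub>R T = r *\<^sub>R (S * T)"
    by (rule bop_eqI, simp add: bop_apply_ring linear_add[OF lin] linear_scale[OF lin])+
  show "norm (S * T) \<le> norm S * norm T"
    by transfer (rule norm_blinfun_compose)
qed

end

lemma bop_apply_diff: "bop_apply (S - T) x = bop_apply S x - bop_apply T x"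
  by transfer (rule blinfun.diff_left)

lemma bop_apply_minus: "bop_apply (- S) x = - bop_apply S x"
  by transfer (rule blinfun.minus_left)

lemma bop_apply_zero: "bop_apply 0 x = 0"
  by transfer (rule blinfun.zero_left)

lemmas bop_apply_simps [simp] =
  bop_apply_ring bop_apply_diff bop_apply_minus bop_apply_zero bop_apply_scaleC_left

definition bop_invertible :: "'h::chilbert_space bop \<Rightarrow> bool"
  where "bop_invertible T \<longleftrightarrow> (\<exists>S. S * T = 1 \<and> T * S = 1)"

definition bop_inv :: "'h::chilbert_space bop \<Rightarrow> 'h bop"
  where "bop_inv T = (THE S. S * T = 1 \<and> T * S = 1)"

definition bop_adj :: "'h::chilbert_space bop \<Rightarrow> 'h bop"
  where "bop_adj T = (THE S. \<forall>x y. cinner (bop_apply T x) y = cinner x (bop_apply S y))"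

definition bop_spectrum :: "'h::chilbert_space bop \<Rightarrow> complex set"
  where "bop_spectrum T = {z. \<not> bop_invertible (z *\<^sub>C 1 - T)}"

definition bop_positive :: "'h::chilbert_space bop \<Rightarrow> bool"
  where "bop_positive T \<longleftrightarrow> (\<forall>x. cinner (bop_apply T x) x \<in> \<real> \<and> 0 \<le> Re (cinner (bop_apply T x) x))"

definition bop_strictly_positive :: "'h::chilbert_space bop \<Rightarrow> bool"
  where "bop_strictly_positive T \<longleftrightarrow> bop_positive T \<and> bop_invertible T"

definition bop_sqrt :: "'h::chilbert_space bop \<Rightarrow> 'h bop"
  where "bop_sqrt A = (THE B. bop_positive B \<and> B * B = A)"

definition bop_inv_sqrt :: "'h::chilbert_space bop \<Rightarrow> 'h bop"
  where "bop_inv_sqrt A = bop_inv (bop_sqrt A)"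


section \<open>Hilbert spaces on a carrier set\<close>

text \<open>The dilation space in the definition of the classes \<open>C\<^sub>A\<close> is existentially quantified, so it
  cannot be a type. It is a vector space over the complex numbers in the sense of HOL-Algebra (the
  ring operations \<open>mult\<close> and \<open>one\<close> of the record are unused), with an inner product for which it is
  complete.\<close>

definition complex_ring :: "complex ring"
  where "complex_ring = \<lparr>carrier = UNIV, mult = (*), one = 1, zero = 0, add = (+)\<rparr>"

record 'k ip_space = "(complex, 'k) module" +
  ip :: "'k \<Rightarrow> 'k \<Rightarrow> complex"

definition ip_norm :: "('k, 'z) ip_space_scheme \<Rightarrow> 'k \<Rightarrow> real"
  where "ip_norm K x = sqrt (Re (ip K x x))"

locale hilbert_space = Module.module complex_ring K
  for K :: "('k, 'z) ip_space_scheme" (structure) +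
  assumes ip_commute: "\<lbrakk>x \<in> carrier K; y \<in> carrier K\<rbrakk> \<Longrightarrow> ip K x y = cnj (ip K y x)"
    and ip_add_left: "\<lbrakk>x \<in> carrier K; y \<in> carrier K; z \<in> carrier K\<rbrakk>
      \<Longrightarrow> ip K (x \<oplus> y) z = ip K x z + ip K y z"
    and ip_smult_left: "\<lbrakk>x \<in> carrier K; y \<in> carrier K\<rbrakk> \<Longrightarrow> ip K (a \<odot> x) y = a * ip K x y"
    and ip_pos: "\<lbrakk>x \<in> carrier K; x \<noteq> \<zero>\<rbrakk> \<Longrightarrow> 0 < Re (ip K x x)"
    and complete: "\<lbrakk>\<And>n::nat. X n \<in> carrier K;
        \<And>e. 0 < e \<Longrightarrow> \<exists>N. \<forall>m\<ge>N. \<forall>n\<ge>N. ip_norm K (X m \<ominus> X n) < e\<rbrakk>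
      \<Longrightarrow> \<exists>x\<in>carrier K. (\<lambda>n. ip_norm K (X n \<ominus> x)) \<longlonglongrightarrow> 0"

definition unitary_on :: "('k, 'z) ip_space_scheme \<Rightarrow> ('k \<Rightarrow> 'k) \<Rightarrow> bool"
  where "unitary_on K U \<longleftrightarrow>
    bij_betw U (carrier K) (carrier K) \<and>
    (\<forall>x\<in>carrier K. \<forall>y\<in>carrier K. U (x \<oplus>\<^bsub>K\<^esub> y) = U x \<oplus>\<^bsub>K\<^esub> U y) \<and>
    (\<forall>a. \<forall>x\<in>carrier K. U (a \<odot>\<^bsub>K\<^esub> x) = a \<odot>\<^bsub>K\<^esub> U x) \<and>
    (\<forall>x\<in>carrier K. \<forall>y\<in>carrier K. ip K (U x) (U y) = ip K x y)"

definition isometric_embedding ::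
    "('k, 'z) ip_space_scheme \<Rightarrow> ('h::chilbert_space \<Rightarrow> 'k) \<Rightarrow> bool"
  where "isometric_embedding K V \<longleftrightarrow>
    (\<forall>x. V x \<in> carrier K) \<and>
    (\<forall>x y. V (x + y) = V x \<oplus>\<^bsub>K\<^esub> V y) \<and>
    (\<forall>a x. V (a *\<^sub>C x) = a \<odot>\<^bsub>K\<^esub> V x) \<and>
    (\<forall>x y. ip K (V x) (V y) = cinner x y)"

definition is_orth_proj :: "('k, 'z) ip_space_scheme \<Rightarrow> 'k set \<Rightarrow> 'k \<Rightarrow> 'k \<Rightarrow> bool"
  where "is_orth_proj K M x y \<longleftrightarrow> y \<in> M \<and> (\<forall>z\<in>M. ip K (x \<ominus>\<^bsub>K\<^esub> y) z = 0)"


section \<open>The classes \<open>C\<^sub>A\<close>\<close>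

text \<open>\<open>H\<close> is identified with the range of the isometry \<open>V\<close>, and \<open>K\<close> ranges over the Hilbert spaces
  whose carrier is a set of elements of \<open>'k\<close>.\<close>

definition dilation_class_in :: "'k itself \<Rightarrow> 'h::chilbert_space bop \<Rightarrow> 'h bop set"
  where "dilation_class_in _ A = {T. \<exists>(K :: 'k ip_space) V U.
    hilbert_space K \<and> isometric_embedding K V \<and> unitary_on K U \<and>
    (\<forall>n\<ge>1. \<forall>h. is_orth_proj K (range V) ((U ^^ n) (V h))
      (V (bop_apply (bop_inv_sqrt A * T ^ n * bop_inv_sqrt A) h)))}"

text \<open>The choice of \<open>'k\<close> is immaterial once it is large enough: a dilation on a Hilbert space
  carried by any type at all yields one carried by \<open>int \<Rightarrow> 'h \<Rightarrow> complex\<close>. One passes to the smallest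
  closed subspace containing all \<open>U\<^sup>n H\<close>, \<open>n \<in> \<int>\<close>, where a vector \<open>x\<close> is determined by the numbers
  \<open>\<langle>x, U\<^sup>n h\<rangle>\<close>. So \<open>dilation_class\<close> below is the class obtained by quantifying over all Hilbert
  spaces.\<close>

lemma complex_ring_simps [simp]:
  "carrier complex_ring = UNIV" "x \<otimes>\<^bsub>complex_ring\<^esub> y = x * y" "\<one>\<^bsub>complex_ring\<^esub> = 1"
  "\<zero>\<^bsub>complex_ring\<^esub> = 0" "x \<oplus>\<^bsub>complex_ring\<^esub> y = x + y"
  by (simp_all add: complex_ring_def)

lemma cring_complex_ring: "cring complex_ring"
proof (rule cringI)
  show "abelian_group complex_ring"
    by (rule abelian_groupI) (auto intro: exI[of _ "- x" for x])
  show "Group.comm_monoid complex_ring"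
    by (rule comm_monoidI) auto
qed (auto simp: algebra_simps)

context hilbert_space
begin

lemma ip_zero_left: "y \<in> carrier K \<Longrightarrow> ip K \<zero> y = 0"
  using ip_add_left[of \<zero> \<zero> y] by simp

lemma ip_minus_left: "\<lbrakk>x \<in> carrier K; y \<in> carrier K\<rbrakk> \<Longrightarrow> ip K (\<ominus> x) y = - ip K x y"
  using ip_add_left[of "\<ominus> x" x y] by (simp add: ip_zero_left l_neg eq_neg_iff_add_eq_0)

lemma ip_diff_left:
  "\<lbrakk>x \<in> carrier K; y \<in> carrier K; z \<in> carrier K\<rbrakk> \<Longrightarrow> ip K (x \<ominus> y) z = ip K x z - ip K y z"
  by (simp add: a_minus_def ip_add_left ip_minus_left)

lemma ip_add_right:
  "\<lbrakk>x \<in> carrier K; y \<in> carrier K; z \<in> carrier K\<rbrakk> \<Longrightarrow> ip K x (y \<oplus> z) = ip K x y + ip K x z"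
  by (metis add.m_closed complex_cnj_add ip_add_left ip_commute)

lemma ip_smult_right:
  "\<lbrakk>x \<in> carrier K; y \<in> carrier K\<rbrakk> \<Longrightarrow> ip K x (a \<odot> y) = cnj a * ip K x y"
  by (metis UNIV_I complex_cnj_mult complex_ring_simps(1) ip_commute ip_smult_left smult_closed)

lemma ip_self_nonneg: "x \<in> carrier K \<Longrightarrow> 0 \<le> Re (ip K x x)"
  using ip_pos ip_zero_left by (cases "x = \<zero>") (force, force simp: less_imp_le)

lemma ip_self_real: "x \<in> carrier K \<Longrightarrow> ip K x x = complex_of_real (Re (ip K x x))"
  by (metis Reals_cnj_iff complex_is_Real_iff complex_of_real_def complex_surj ip_commute
      of_real_Re)

lemma Cauchy_Schwarz:
  assumes "x \<in> carrier K" "y \<in> carrier K"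
  shows "cmod (ip K x y) \<le> ip_norm K x * ip_norm K y"
proof (cases "y = \<zero>")
  case True
  then have "ip K x y = 0"
    using assms by (metis complex_cnj_zero ip_commute ip_zero_left)
  then show ?thesis
    using assms by (simp add: ip_norm_def ip_self_nonneg)
next
  case False
  define p where "p = Re (ip K y y)"
  define w where "w = ip K x y"
  define t where "t = - w / complex_of_real p"
  have p: "0 < p"
    unfolding p_def using assms(2) False by (rule ip_pos)
  have yy: "ip K y y = complex_of_real p"
    unfolding p_def using assms(2) by (rule ip_self_real)
  have yx: "ip K y x = cnj w"
    unfolding w_def using assms by (intro ip_commute)
  have ty: "t \<odot> y \<in> carrier K"
    using assms by simp
  have "ip K (x \<oplus> t \<odot> y) (x \<oplus> t \<odot> y)
      = ip K x x + cnj t * w + t * cnj w + t * cnj t * complex_of_real p"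
    using assms ty
    by (simp add: ip_add_left ip_add_right ip_smult_left ip_smult_right yy yx algebra_simps
        flip: w_def)
  also have "cnj t = - cnj w / complex_of_real p"
    by (simp add: t_def)
  also have "ip K x x + - cnj w / complex_of_real p * w + t * cnj w
      + t * (- cnj w / complex_of_real p) * complex_of_real p
      = ip K x x - (w * cnj w) / complex_of_real p"
    using p by (simp add: t_def field_simps)
  also have "w * cnj w = complex_of_real ((cmod w)\<^sup>2)"
    by (simp only: complex_norm_square)
  finally have "Re (ip K (x \<oplus> t \<odot> y) (x \<oplus> t \<odot> y)) = Re (ip K x x) - (cmod w)\<^sup>2 / p"
    by (simp flip: of_real_divide)
  moreover have "0 \<le> Re (ip K (x \<oplus> t \<odot> y) (x \<oplus> t \<odot> y))"
    using assms ty by (intro ip_self_nonneg) simp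
  ultimately have "(cmod w)\<^sup>2 / p \<le> Re (ip K x x)"
    by linarith
  then have "(cmod w)\<^sup>2 \<le> Re (ip K x x) * p"
    using p by (simp add: pos_divide_le_eq)
  then show ?thesis
    by (simp add: ip_norm_def real_le_rsqrt flip: real_sqrt_mult w_def p_def)
qed

end

definition transported ::
    "('k, 'z) ip_space_scheme \<Rightarrow> 'k set \<Rightarrow> ('k \<Rightarrow> 'l) \<Rightarrow> 'l ip_space"
  where "transported K S \<phi> = (let \<psi> = inv_into S \<phi> in
    \<lparr>carrier = \<phi> ` S, mult = undefined, one = undefined, zero = \<phi> \<zero>\<^bsub>K\<^esub>,
     add = (\<lambda>x y. \<phi> (\<psi> x \<oplus>\<^bsub>K\<^esub> \<psi> y)), smult = (\<lambda>a x. \<phi> (a \<odot>\<^bsub>K\<^esub> \<psi> x)),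
     ip = (\<lambda>x y. ip K (\<psi> x) (\<psi> y))\<rparr>)"

definition perp :: "('k, 'z) ip_space_scheme \<Rightarrow> 'k set \<Rightarrow> 'k set"
  where "perp K N = {x \<in> carrier K. \<forall>y\<in>N. ip K x y = 0}"

context hilbert_space
begin

lemma transported_minus:
  assumes S: "S \<subseteq> carrier K" "\<And>x y. \<lbrakk>x \<in> S; y \<in> S\<rbrakk> \<Longrightarrow> x \<oplus> y \<in> S" "\<And>x. x \<in> S \<Longrightarrow> \<ominus> x \<in> S"
    and inj: "inj_on \<phi> S" and grp: "abelian_group (transported K S \<phi>)"
    and xy: "x \<in> S" "y \<in> S"
  shows "\<phi> x \<ominus>\<^bsub>transported K S \<phi>\<^esub> \<phi> y = \<phi> (x \<ominus> y)"
proof -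
  interpret T: abelian_group "transported K S \<phi>" by fact
  have psi: "inv_into S \<phi> (\<phi> u) = u" if "u \<in> S" for u
    using inj that by (rule inv_into_f_f)
  have "\<ominus>\<^bsub>transported K S \<phi>\<^esub> \<phi> y = \<phi> (\<ominus> y)"
    using S xy by (intro T.minus_equality) (auto simp: transported_def Let_def psi subset_iff l_neg)
  moreover have "\<phi> x \<oplus>\<^bsub>transported K S \<phi>\<^esub> \<phi> (\<ominus> y) = \<phi> (x \<oplus> \<ominus> y)"
    using S xy by (simp add: transported_def Let_def psi)
  ultimately show ?thesis
    by (simp add: a_minus_def)
qed

lemma perp_closed:
  assumes "N \<subseteq> carrier K"
  shows "perp K N \<subseteq> carrier K" "\<zero> \<in> perp K N"
    "\<lbrakk>x \<in> perp K N; y \<in> perp K N\<rbrakk> \<Longrightarrow> x \<oplus> y \<in> perp K N"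
    "x \<in> perp K N \<Longrightarrow> \<ominus> x \<in> perp K N"
    "x \<in> perp K N \<Longrightarrow> a \<odot> x \<in> perp K N"
  using assms
  by (auto simp: perp_def subset_iff ip_zero_left ip_add_left ip_minus_left ip_smult_left)

lemma hilbert_space_transported:
  assumes N: "N \<subseteq> carrier K" and S_def: "S = perp K N" and inj: "inj_on \<phi> S"
  shows "hilbert_space (transported K S \<phi>)"
proof -
  note S = perp_closed[OF N, folded S_def]
  have SK: "x \<in> carrier K" if "x \<in> S" for x
    using S(1) that by blast
  let ?T = "transported K S \<phi>"
  have psi: "inv_into S \<phi> (\<phi> u) = u" if "u \<in> S" for u
    using inj that by (rule inv_into_f_f)
  have T: "carrier ?T = \<phi> ` S" "\<zero>\<^bsub>?T\<^esub> = \<phi> \<zero>"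
    "\<And>x y. \<lbrakk>x \<in> S; y \<in> S\<rbrakk> \<Longrightarrow> \<phi> x \<oplus>\<^bsub>?T\<^esub> \<phi> y = \<phi> (x \<oplus> y)"
    "\<And>a x. x \<in> S \<Longrightarrow> a \<odot>\<^bsub>?T\<^esub> \<phi> x = \<phi> (a \<odot> x)"
    "\<And>x y. \<lbrakk>x \<in> S; y \<in> S\<rbrakk> \<Longrightarrow> ip ?T (\<phi> x) (\<phi> y) = ip K x y"
    by (simp_all add: transported_def Let_def psi)
  have grp: "abelian_group ?T"
  proof (rule abelian_groupI)
    fix x assume "x \<in> carrier ?T"
    then obtain u where u: "u \<in> S" "x = \<phi> u"
      by (auto simp: T)
    then show "\<exists>y\<in>carrier ?T. y \<oplus>\<^bsub>?T\<^esub> x = \<zero>\<^bsub>?T\<^esub>"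
      using S by (intro bexI[of _ "\<phi> (\<ominus> u)"]) (auto simp: T SK l_neg)
  qed (auto simp: T S SK a_ac)
  have mod: "Module.module complex_ring ?T"
    by (rule moduleI[OF cring_complex_ring grp])
      (auto simp: T S SK smult_l_distr smult_r_distr smult_assoc1
        smult_l_distr[simplified] smult_assoc1[simplified] smult_one[simplified])
  have minus: "\<phi> x \<ominus>\<^bsub>?T\<^esub> \<phi> y = \<phi> (x \<ominus> y)" if "x \<in> S" "y \<in> S" for x y
    using S inj grp that by (intro transported_minus) auto
  have Sminus: "x \<ominus> y \<in> S" if "x \<in> S" "y \<in> S" for x y
    using S that by (simp add: a_minus_def)
  have nrm: "ip_norm ?T (\<phi> x) = ip_norm K x" if "x \<in> S" for x
    using that by (simp add: ip_norm_def T)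
  show ?thesis
  proof (intro hilbert_space.intro mod hilbert_space_axioms.intro)
    fix x y assume "x \<in> carrier ?T" "y \<in> carrier ?T"
    then obtain u v where "u \<in> S" "v \<in> S" "x = \<phi> u" "y = \<phi> v"
      by (auto simp: T)
    then show "ip ?T x y = cnj (ip ?T y x)"
      using ip_commute[of u v] by (simp add: T SK)
  next
    fix x y z assume "x \<in> carrier ?T" "y \<in> carrier ?T" "z \<in> carrier ?T"
    then show "ip ?T (x \<oplus>\<^bsub>?T\<^esub> y) z = ip ?T x z + ip ?T y z"
      by (auto simp: T S SK ip_add_left)
  next
    fix x y a assume "x \<in> carrier ?T" "y \<in> carrier ?T"
    then show "ip ?T (a \<odot>\<^bsub>?T\<^esub> x) y = a * ip ?T x y"
      by (auto simp: T S SK ip_smult_left)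
  next
    fix x assume "x \<in> carrier ?T" "x \<noteq> \<zero>\<^bsub>?T\<^esub>"
    then show "0 < Re (ip ?T x x)"
      by (auto simp: T SK intro!: ip_pos)
  next
    fix X :: "nat \<Rightarrow> _"
    assume X: "\<And>n. X n \<in> carrier ?T"
      and C: "\<And>e. 0 < e \<Longrightarrow> \<exists>M. \<forall>m\<ge>M. \<forall>n\<ge>M. ip_norm ?T (X m \<ominus>\<^bsub>?T\<^esub> X n) < e"
    have "\<exists>Y. \<forall>n. Y n \<in> S \<and> X n = \<phi> (Y n)"
      using X by (intro choice) (auto simp: T)
    then obtain Y where Y: "\<And>n. Y n \<in> S" "\<And>n. X n = \<phi> (Y n)"
      by blast
    have "\<exists>M. \<forall>m\<ge>M. \<forall>n\<ge>M. ip_norm K (Y m \<ominus> Y n) < e" if "0 < e" for e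
      using C[OF that] by (simp add: Y minus nrm Sminus)
    then obtain y where y: "y \<in> carrier K" and lim: "(\<lambda>n. ip_norm K (Y n \<ominus> y)) \<longlonglongrightarrow> 0"
      using complete[of Y] Y SK by blast
    have "ip K y z = 0" if z: "z \<in> N" for z
    proof -
      have zK: "z \<in> carrier K"
        using N z by blast
      have "cmod (ip K y z) \<le> ip_norm K (Y n \<ominus> y) * ip_norm K z" for n
      proof -
        have "ip K (Y n) z = 0"
          using Y(1)[of n] z by (simp add: S_def perp_def)
        then have "cmod (ip K y z) = cmod (ip K (Y n \<ominus> y) z)"
          using Y(1) y zK by (simp add: ip_diff_left SK)
        then show ?thesis
          using Cauchy_Schwarz[of "Y n \<ominus> y" z] Y(1) y zK by (simp add: SK)
      qed
      moreover have "(\<lambda>n. ip_norm K (Y n \<ominus> y) * ip_norm K z) \<longlonglongrightarrow> 0"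
        using tendsto_mult_right[OF lim, of "ip_norm K z"] by simp
      ultimately have "cmod (ip K y z) \<le> 0"
        by (meson LIMSEQ_le_const)
      then show ?thesis by simp
    qed
    then have "y \<in> S"
      using y by (simp add: S_def perp_def)
    then show "\<exists>x\<in>carrier ?T. (\<lambda>n. ip_norm ?T (X n \<ominus>\<^bsub>?T\<^esub> x)) \<longlonglongrightarrow> 0"
      using lim by (intro bexI[of _ "\<phi> y"]) (simp_all add: Y minus nrm Sminus T)
  qed
qed

end

lemma dilation_class_in_subset:
  fixes A :: "'h::chilbert_space bop"
  shows "dilation_class_in TYPE('k) A \<subseteq> dilation_class_in TYPE(int \<Rightarrow> 'h \<Rightarrow> complex) A"
proof
  fix T assume "T \<in> dilation_class_in TYPE('k) A"
  then obtain K :: "'k ip_space" and V :: "'h \<Rightarrow> 'k" and U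
    where K: "hilbert_space K" and V: "isometric_embedding K V" and U: "unitary_on K U"
      and dil: "\<And>n h. 1 \<le> n \<Longrightarrow> is_orth_proj K (range V) ((U ^^ n) (V h))
        (V (bop_apply (bop_inv_sqrt A * T ^ n * bop_inv_sqrt A) h))"
    unfolding dilation_class_in_def by blast
  interpret hilbert_space K by fact
  define W where "W = inv_into (carrier K) U"
  have Ubij: "bij_betw U (carrier K) (carrier K)"
    using U by (simp add: unitary_on_def)
  have UK: "U x \<in> carrier K" if "x \<in> carrier K" for x
    using Ubij that by (rule bij_betwE[THEN bspec])
  have WK: "W x \<in> carrier K" and UW: "U (W x) = x" if "x \<in> carrier K" for x
    using bij_betwE[OF bij_betw_inv_into[OF Ubij]] bij_betw_inv_into_right[OF Ubij] that
    by (auto simp: W_def)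
  have WU: "W (U x) = x" if "x \<in> carrier K" for x
    using bij_betw_inv_into_left[OF Ubij that] by (simp add: W_def)
  have Uip: "ip K (U x) (U y) = ip K x y" if "x \<in> carrier K" "y \<in> carrier K" for x y
    using U that by (simp add: unitary_on_def)
  have Uip': "ip K (U x) y = ip K x (W y)" if "x \<in> carrier K" "y \<in> carrier K" for x y
    using Uip[of x "W y"] that by (simp add: WK UW)
  have Wip': "ip K (W x) y = ip K x (U y)" if "x \<in> carrier K" "y \<in> carrier K" for x y
    using Uip[of "W x" y] that by (simp add: WK UW)
  have VK: "V h \<in> carrier K" for h
    using V by (simp add: isometric_embedding_def)
  define Z where "Z n = (if 0 \<le> n then U ^^ nat n else W ^^ nat (- n))" for n :: int
  have UpK: "(U ^^ n) x \<in> carrier K" and WpK: "(W ^^ n) x \<in> carrier K"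
    if "x \<in> carrier K" for n x
    using that by (induction n) (auto simp: UK WK)
  have ZK: "Z n x \<in> carrier K" if "x \<in> carrier K" for n x
    using that by (simp add: Z_def UpK WpK)
  have UZ: "U (Z n x) = Z (n + 1) x" if "x \<in> carrier K" for n x
  proof (cases "0 \<le> n")
    case True
    then show ?thesis
      by (simp add: Z_def nat_add_distrib)
  next
    case False
    then obtain m where m: "n = - int (Suc m)"
      by (metis int_cases le_cases of_nat_0_le_iff)
    then have "Z n x = W (Z (n + 1) x)"
      by (cases m) (auto simp: Z_def nat_add_distrib nat_diff_distrib)
    then show ?thesis
      using that by (simp add: UW ZK)
  qed
  have WZ: "W (Z n x) = Z (n - 1) x" if "x \<in> carrier K" for n x
    using UZ[of x "n - 1"] WU[of "Z (n - 1) x"] that by (simp add: ZK)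
  define M where "M = {Z n (V h) | n h. True}"
  have MK: "M \<subseteq> carrier K"
    by (auto simp: M_def ZK VK)
  have UM: "U x \<in> M" and WM: "W x \<in> M" if "x \<in> M" for x
    using that VK unfolding M_def by (force simp: UZ, force simp: WZ)
  define N where "N = perp K M"
  have NK: "N \<subseteq> carrier K"
    by (auto simp: N_def perp_def)
  have UN: "U x \<in> N" and WN: "W x \<in> N" if "x \<in> N" for x
    using that MK UM WM by (auto simp: N_def perp_def UK WK Uip' Wip' subset_iff)
  define S where "S = perp K N"
  have SK: "x \<in> carrier K" if "x \<in> S" for x
    using that by (auto simp: S_def perp_def)
  have US: "U x \<in> S" and WS: "W x \<in> S" if "x \<in> S" for x
    using that NK UN WN by (auto simp: S_def perp_def UK WK Uip' Wip' subset_iff)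
  have MS: "M \<subseteq> S"
    using MK ip_commute by (fastforce simp: S_def N_def perp_def)
  have VS: "V h \<in> S" for h
  proof -
    have "V h = Z 0 (V h)" by (simp add: Z_def)
    then have "V h \<in> M" unfolding M_def by blast
    then show ?thesis using MS by blast
  qed
  note S = perp_closed[OF NK, folded S_def]
  have Sminus: "x \<ominus>\<^bsub>K\<^esub> y \<in> S" if "x \<in> S" "y \<in> S" for x y
    using S that by (simp add: a_minus_def)
  define \<phi> where "\<phi> x = (\<lambda>n h. ip K x (Z n (V h)))" for x
  have inj: "inj_on \<phi> S"
  proof (rule inj_onI)
    fix x y assume xy: "x \<in> S" "y \<in> S" "\<phi> x = \<phi> y"
    have "ip K x (Z n (V h)) = ip K y (Z n (V h))" for n h
      using xy(3) by (simp add: \<phi>_def fun_eq_iff)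
    then have "ip K (x \<ominus>\<^bsub>K\<^esub> y) (Z n (V h)) = 0" for n h
      using xy by (simp add: ip_diff_left SK ZK VK)
    then have "x \<ominus>\<^bsub>K\<^esub> y \<in> N"
      using xy by (auto simp: N_def M_def perp_def SK)
    then have "ip K (x \<ominus>\<^bsub>K\<^esub> y) (x \<ominus>\<^bsub>K\<^esub> y) = 0"
      using Sminus[OF xy(1,2)] by (auto simp: S_def perp_def)
    then have "x \<ominus>\<^bsub>K\<^esub> y = \<zero>\<^bsub>K\<^esub>"
      using ip_pos[of "x \<ominus>\<^bsub>K\<^esub> y"] xy SK by fastforce
    then show "x = y"
      using xy SK minus_equality[of x "\<ominus>\<^bsub>K\<^esub> y"] by (simp add: a_minus_def)
  qed
  let ?T = "transported K S \<phi>"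
  have HT: "hilbert_space ?T"
    by (rule hilbert_space_transported[OF NK S_def inj])
  interpret T: hilbert_space ?T by (fact HT)
  have psi: "inv_into S \<phi> (\<phi> u) = u" if "u \<in> S" for u
    using inj that by (rule inv_into_f_f)
  have T: "carrier ?T = \<phi> ` S"
    "\<And>x y. \<lbrakk>x \<in> S; y \<in> S\<rbrakk> \<Longrightarrow> \<phi> x \<oplus>\<^bsub>?T\<^esub> \<phi> y = \<phi> (x \<oplus>\<^bsub>K\<^esub> y)"
    "\<And>a x. x \<in> S \<Longrightarrow> a \<odot>\<^bsub>?T\<^esub> \<phi> x = \<phi> (a \<odot>\<^bsub>K\<^esub> x)"
    "\<And>x y. \<lbrakk>x \<in> S; y \<in> S\<rbrakk> \<Longrightarrow> ip ?T (\<phi> x) (\<phi> y) = ip K x y"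
    by (simp_all add: transported_def Let_def psi)
  have minus: "\<phi> x \<ominus>\<^bsub>?T\<^esub> \<phi> y = \<phi> (x \<ominus>\<^bsub>K\<^esub> y)" if "x \<in> S" "y \<in> S" for x y
    using S inj T.abelian_group_axioms that by (intro transported_minus) auto
  define V' where "V' h = \<phi> (V h)" for h
  define U' where "U' x = \<phi> (U (inv_into S \<phi> x))" for x
  have V': "isometric_embedding ?T V'"
    using V by (simp add: isometric_embedding_def V'_def T VS)
  have U': "unitary_on ?T U'"
  proof -
    have "bij_betw U' (\<phi> ` S) (\<phi> ` S)"
      by (rule bij_betw_byWitness[where f' = "\<lambda>x. \<phi> (W (inv_into S \<phi> x))"])
        (auto simp: U'_def psi US WS UW WU SK)
    moreover have "U (x \<oplus>\<^bsub>K\<^esub> y) = U x \<oplus>\<^bsub>K\<^esub> U y" if "x \<in> S" "y \<in> S" for x y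
      using U that by (simp add: unitary_on_def SK)
    moreover have "U (a \<odot>\<^bsub>K\<^esub> x) = a \<odot>\<^bsub>K\<^esub> U x" if "x \<in> S" for a x
      using U that by (simp add: unitary_on_def SK)
    ultimately show ?thesis
      by (auto simp: unitary_on_def T U'_def psi US S SK Uip)
  qed
  have UpS: "(U ^^ n) x \<in> S" if "x \<in> S" for n x
    using that by (induction n) (auto simp: US)
  have pow: "(U' ^^ n) (V' h) = \<phi> ((U ^^ n) (V h))" for n h
    by (induction n) (simp_all add: V'_def U'_def psi UpS VS)
  have "is_orth_proj ?T (range V') ((U' ^^ n) (V' h))
      (V' (bop_apply (bop_inv_sqrt A * T ^ n * bop_inv_sqrt A) h))" if "1 \<le> n" for n h
    using dil[OF that, of h] unfolding is_orth_proj_def pow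
    by (auto simp: V'_def minus UpS VS Sminus T)
  then show "T \<in> dilation_class_in TYPE(int \<Rightarrow> 'h \<Rightarrow> complex) A"
    unfolding dilation_class_in_def using HT V' U' by blast
qed

definition dilation_class :: "'h::chilbert_space bop \<Rightarrow> 'h bop set"
  where "dilation_class A = dilation_class_in TYPE(int \<Rightarrow> 'h \<Rightarrow> complex) A"


section \<open>The double-layer potential class on the annulus\<close>

definition annulus :: "real \<Rightarrow> complex set"
  where "annulus R = {z. 1 / R < cmod z \<and> cmod z < R}"

definition annulus_algebra :: "real \<Rightarrow> (complex \<Rightarrow> complex) set"
  where "annulus_algebra R =
    {f. continuous_on (closure (annulus R)) f \<and> f holomorphic_on annulus R}"

definition laurent_coeffs :: "real \<Rightarrow> (complex \<Rightarrow> complex) \<Rightarrow> int \<Rightarrow> complex"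
  where "laurent_coeffs R f =
    (THE a. \<forall>z\<in>annulus R. ((\<lambda>n. a n * z powi n) has_sum f z) UNIV)"

text \<open>Arc-length parametrizations of the two boundary circles: the outer one of length \<open>2\<pi>R\<close>,
  counter-clockwise, and the inner one of length \<open>2\<pi>/R\<close>, clockwise.\<close>

definition outer_circle :: "real \<Rightarrow> real \<Rightarrow> complex"
  where "outer_circle R s = complex_of_real R * cis (s / R)"

definition inner_circle :: "real \<Rightarrow> real \<Rightarrow> complex"
  where "inner_circle R s = complex_of_real (1 / R) * cis (- (R * s))"

definition dlp_kernel :: "(real \<Rightarrow> complex) \<Rightarrow> real \<Rightarrow> 'h::chilbert_space bop \<Rightarrow> 'h bop"
  where "dlp_kernel \<sigma> s T = (let \<sigma>' = vector_derivative \<sigma> (at s) in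
    (1 / (2 * complex_of_real pi * \<i>)) *\<^sub>C
      (\<sigma>' *\<^sub>C bop_inv (\<sigma> s *\<^sub>C 1 - T) - cnj \<sigma>' *\<^sub>C bop_inv (cnj (\<sigma> s) *\<^sub>C 1 - bop_adj T)))"

definition dlp_integral :: "real \<Rightarrow> 'h::chilbert_space bop \<Rightarrow> (complex \<Rightarrow> complex) \<Rightarrow> 'h bop"
  where "dlp_integral R T f =
    integral {0..2 * pi * R} (\<lambda>s. f (outer_circle R s) *\<^sub>C dlp_kernel (outer_circle R) s T) +
    integral {0..2 * pi / R} (\<lambda>s. f (inner_circle R s) *\<^sub>C dlp_kernel (inner_circle R) s T)"

definition dlp_map :: "real \<Rightarrow> real \<Rightarrow> 'h::chilbert_space bop \<Rightarrow> (complex \<Rightarrow> complex) \<Rightarrow> 'h bop"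
  where "dlp_map R c T f =
    (1 / (2 + c)) *\<^sub>R (dlp_integral R T f + (complex_of_real c * laurent_coeffs R f 0) *\<^sub>C 1)"

text \<open>\<open>matrix_opnorm m M\<close> is the operator norm of the \<open>m \<times> m\<close> matrix \<open>(M i j)\<close> of operators acting
  on the \<open>m\<close>-fold orthogonal direct sum, whose elements are represented by the restrictions of
  functions \<open>nat \<Rightarrow> 'a\<close> to \<open>{..<m}\<close>. A scalar matrix acts by multiplication on \<open>\<complex>\<^sup>m\<close>.\<close>

definition matrix_opnorm :: "nat \<Rightarrow> (nat \<Rightarrow> nat \<Rightarrow> 'a \<Rightarrow> 'a::real_normed_vector) \<Rightarrow> real"
  where "matrix_opnorm m M =
    (SUP x\<in>{x. L2_set (\<lambda>j. norm (x j)) {..<m} \<le> 1}.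
      L2_set (\<lambda>i. norm (\<Sum>j<m. M i j (x j))) {..<m})"

definition CDLA :: "real \<Rightarrow> real \<Rightarrow> 'h::chilbert_space bop set"
  where "CDLA R c = {T. \<forall>m\<ge>1. \<forall>f :: nat \<Rightarrow> nat \<Rightarrow> complex \<Rightarrow> complex.
    (\<forall>i<m. \<forall>j<m. f i j \<in> annulus_algebra R) \<longrightarrow>
    matrix_opnorm m (\<lambda>i j. bop_apply (dlp_map R c T (f i j)))
      \<le> (SUP z\<in>closure (annulus R). matrix_opnorm m (\<lambda>i j w. f i j z * w))}"

end

theory Submission
  imports Defs "HOL-Complex_Analysis.Complex_Analysis"
begin

text \<open>Put \<open>P = T / R\<close> and \<open>Q = T\<^sup>-\<^sup>1 / R\<close>; both have their spectrum in the open unit disc. For such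
  an operator \<open>X\<close> let \<open>k\<^sub>X(z) = \<Sum>n\<ge>1. (z\<^sup>n X\<^sup>n + h.c.)\<close> on the unit circle (\<open>poisson_kernel\<close>). In the
  variable \<open>z = e\<^sup>-\<^sup>i\<^sup>t\<close> the double-layer kernel is \<open>k\<^sub>P + 2\<close> on the outer boundary circle, with
  \<open>\<sigma> = R / z\<close>, and \<open>k\<^sub>Q\<close> on the inner one, with \<open>\<sigma> = z / R\<close>, up to the normalization of \<open>dt\<close>
  (\<open>dlp_kernel_outer\<close>, \<open>dlp_kernel_inner\<close>). Functions in the algebra have the same mean on both
  circles, namely their constant Laurent coefficient. Hence any operator \<open>A\<close> can be taken from one
  circle to the other: \<open>(2 + c) S f\<close> is the mean over \<open>t\<close> of
  \<open>f(R / z) (k\<^sub>P(z) + (2 + c - A)) + f(z / R) (k\<^sub>Q(z) + A)\<close>, whatever \<open>A\<close> is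
  (\<open>dlp_map_has_integral\<close>). The theorem says that \<open>S\<close> is completely contractive if and only if some
  \<open>A\<close> makes both densities positive.

  The dilation classes enter because, for strictly positive \<open>B\<close>, the following are equivalent:
  \<open>X\<close> belongs to \<open>C\<^sub>B\<close>; the block Toeplitz matrices with diagonal \<open>B\<close> and entries \<open>X\<^sup>i\<^sup>-\<^sup>j\<close> below it
  are nonnegative; \<open>k\<^sub>X + B\<close> is nonnegative on the circle. From a dilation \<open>U\<close> one reads off the
  positivity of \<open>k\<^sub>X + B\<close>, which is a limit of Cesaro means of squared lengths of vectors
  \<open>\<Sum>n<N. z\<^sup>n U\<^sup>n h\<close> (\<open>dilation_classD\<close>). Conversely, nonnegative Toeplitz matrices define a positive
  Toeplitz operator \<open>F\<close> on the square summable sequences; its square root commutes with the bilateral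
  shift, which therefore is the unitary dilation (\<open>dilation_classI\<close>).

  If the two dilations exist, the two densities are positive with total mass \<open>2 + c\<close>, and such an
  average is completely contractive: a scalar matrix of norm at most \<open>C\<close>, tensored with a positive
  operator \<open>F\<close>, is bounded by \<open>C\<close> in the form of \<open>F\<close> (\<open>scalar_matrix_positive_form\<close>,
  \<open>CDLA_if_positive_kernels\<close>).

  For the other direction, a unital complete contraction is positive on matrices whose real part is
  nonnegative on the boundary (\<open>CDLA_Re_nonneg\<close>). This is applied to trigonometric squares
  \<open>g g\<^sup>*\<close>, with \<open>g = \<Sum>n. e\<^sup>i\<^sup>n\<^sup>t h n\<close> a polynomial with vector coefficients. A family of squares,
  some on the outer and some on the inner circle, is the real part of an analytic function as soon as
  the means on the two circles agree, and then the image under \<open>S\<close> is a sum of Toeplitz forms,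
  with diagonal \<open>2 + c\<close> for the outer squares and \<open>0\<close> for the inner ones
  (\<open>squares_value_nonneg\<close>). The required \<open>A\<close> has to satisfy a linear system of inequalities: its form,
  summed over the coefficients \<open>h n\<close>, is at most the outer Toeplitz form and at least the negative
  of the inner one. Nonnegativity on the families with equal means is exactly the consistency
  condition of this system, and the Hahn-Banach theorem supplies \<open>A\<close>
  (\<open>separating_operator_exists\<close>). Since \<open>P\<close> and \<open>Q\<close> are invertible, the forms on sequences of length
  two make \<open>2 + c - A\<close> and \<open>A\<close> strictly positive (\<open>toeplitz_form_strictly_positive\<close>).\<close>

section \<open>Inner product and operator algebra\<close>

lemma scaleC_one [simp]: "1 *\<^sub>C (x::'a::complex_vector) = x"
  by (metis of_real_1 scaleR_one scaleR_scaleC)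

lemma scaleC_zero_left [simp]: "0 *\<^sub>C (x::'a::complex_vector) = 0"
  by (metis of_real_0 scaleR_zero_left scaleR_scaleC)

lemma scaleC_minus_left: "(- a) *\<^sub>C (x::'a::complex_vector) = - (a *\<^sub>C x)"
  by (metis add.right_inverse add_eq_0_iff scaleC_add_left scaleC_zero_left)

lemma scaleC_decompose: "a *\<^sub>C (x::'a::complex_vector) = Re a *\<^sub>R x + Im a *\<^sub>R (\<i> *\<^sub>C x)"
proof -
  have "a = complex_of_real (Re a) + complex_of_real (Im a) * \<i>"
    by (metis complex_eq mult.commute)
  then show ?thesis
    by (metis scaleC_add_left scaleC_scaleC scaleR_scaleC)
qed

lemma cinner_add_right: "cinner x (y + z) = cinner x y + cinner x (z::'h::chilbert_space)"
  by (metis cinner_add_left cinner_commute complex_cnj_add)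

lemma cinner_scaleC_right: "cinner x (a *\<^sub>C y) = cnj a * cinner x (y::'h::chilbert_space)"
  by (metis cinner_scaleC_left cinner_commute complex_cnj_mult)

lemma cinner_scaleR_left: "cinner (r *\<^sub>R x) (y::'h::chilbert_space) = r * cinner x y"
  by (simp add: scaleR_scaleC cinner_scaleC_left)

lemma cinner_scaleR_right: "cinner x (r *\<^sub>R y) = r * cinner x (y::'h::chilbert_space)"
  by (simp add: scaleR_scaleC cinner_scaleC_right)

lemma cinner_zero_left [simp]: "cinner 0 (y::'h::chilbert_space) = 0"
  using cinner_add_left[of 0 0 y] by simp

lemma cinner_zero_right [simp]: "cinner y (0::'h::chilbert_space) = 0"
  by (metis cinner_commute cinner_zero_left complex_cnj_zero)

lemma cinner_minus_left: "cinner (- x) (y::'h::chilbert_space) = - cinner x y"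
  using cinner_add_left[of x "-x" y] by (simp add: eq_neg_iff_add_eq_0 add.commute)

lemma cinner_minus_right: "cinner x (- y) = - cinner x (y::'h::chilbert_space)"
  using cinner_add_right[of x y "-y"] by (simp add: eq_neg_iff_add_eq_0 add.commute)

lemma cinner_diff_left: "cinner (x - z) (y::'h::chilbert_space) = cinner x y - cinner z y"
  by (metis cinner_add_left cinner_minus_left diff_conv_add_uminus)

lemma cinner_diff_right: "cinner x (y - z) = cinner x y - cinner x (z::'h::chilbert_space)"
  by (metis cinner_add_right cinner_minus_right diff_conv_add_uminus)

lemma cinner_sum_left: "cinner (sum f I) (y::'h::chilbert_space) = (\<Sum>i\<in>I. cinner (f i) y)"
  by (induction I rule: infinite_finite_induct) (auto simp: cinner_add_left)

lemma cinner_sum_right: "cinner y (sum f I) = (\<Sum>i\<in>I. cinner y (f i::'h::chilbert_space))"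
  by (induction I rule: infinite_finite_induct) (auto simp: cinner_add_right)

lemmas cinner_simps = cinner_add_left cinner_add_right cinner_diff_left cinner_diff_right
  cinner_minus_left cinner_minus_right cinner_scaleC_left cinner_scaleC_right
  cinner_scaleR_left cinner_scaleR_right

lemma Re_cinner_self: "Re (cinner x x) = (norm (x::'h::chilbert_space))\<^sup>2"
  by (simp add: cinner_self)

lemma Re_cinner_commute: "Re (cinner x y) = Re (cinner y (x::'h::chilbert_space))"
  by (subst cinner_commute) simp

lemma cinner_eqI:
  assumes "\<And>y. cinner x y = cinner (z::'h::chilbert_space) y" shows "x = z"
proof -
  have "cinner (x - z) (x - z) = 0" using assms by (simp add: cinner_simps)
  then show ?thesis by (simp add: cinner_self)
qed

lemma norm_add_square:
  "(norm (x + y))\<^sup>2 = (norm x)\<^sup>2 + 2 * Re (cinner x y) + (norm (y::'h::chilbert_space))\<^sup>2"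
  using Re_cinner_commute[of y x] by (simp add: cinner_simps flip: Re_cinner_self)

lemma norm_diff_square:
  "(norm (x - y))\<^sup>2 = (norm x)\<^sup>2 - 2 * Re (cinner x y) + (norm (y::'h::chilbert_space))\<^sup>2"
  using Re_cinner_commute[of y x] by (simp add: cinner_simps flip: Re_cinner_self)

lemma positive_Re_nonneg: "bop_positive X \<Longrightarrow> 0 \<le> Re (cinner (bop_apply X x) x)"
  by (simp add: bop_positive_def)

lemma bop_apply_add: "bop_apply T (x + y) = bop_apply T x + bop_apply T y"
  and bop_apply_sub: "bop_apply T (x - y) = bop_apply T x - bop_apply T y"
  and bop_apply_neg: "bop_apply T (- y) = - bop_apply T y"
  and bop_apply_scaleR: "bop_apply T (r *\<^sub>R y) = r *\<^sub>R bop_apply T y"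
  and bop_apply_0 [simp]: "bop_apply T 0 = 0"
  and bop_apply_sum: "bop_apply T (sum f I) = (\<Sum>i\<in>I. bop_apply T (f i))"
  using bounded_linear.linear[OF bounded_linear_bop_apply[of T]]
  by (auto simp: linear_add linear_diff linear_neg linear_scale linear_0 linear_sum)

lemmas bop_lin = bop_apply_add bop_apply_sub bop_apply_neg bop_apply_scaleR bop_apply_scaleC

text \<open>A real quadratic form has a symmetric polar form: polarize along \<open>x + y\<close> and \<open>x + i y\<close>.\<close>

lemma positive_symmetric:
  assumes "bop_positive X"
  shows "cinner (bop_apply X x) y = cinner x (bop_apply X y)"
proof -
  have re: "Im (cinner (bop_apply X u) u) = 0" for u
    using assms by (auto simp: bop_positive_def complex_is_Real_iff)
  have 1: "Im (cinner (bop_apply X x) y) + Im (cinner (bop_apply X y) x) = 0"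
    using re[of "x + y"] re[of x] re[of y] by (simp add: bop_lin cinner_simps)
  have 2: "Re (cinner (bop_apply X y) x) - Re (cinner (bop_apply X x) y) = 0"
    using re[of "x + \<i> *\<^sub>C y"] re[of x] re[of y] by (simp add: bop_lin cinner_simps)
  have "cinner (bop_apply X x) y = cnj (cinner (bop_apply X y) x)"
    using 1 2 by (simp add: complex_eq_iff)
  then show ?thesis by (metis cinner_commute)
qed

lemma positive_Cauchy_Schwarz:
  assumes X: "bop_positive X"
  shows "(cmod (cinner (bop_apply X x) y))\<^sup>2
    \<le> Re (cinner (bop_apply X x) x) * Re (cinner (bop_apply X y) y)"
proof -
  define a b c where "a = Re (cinner (bop_apply X x) x)" "b = cinner (bop_apply X x) y"
    "c = Re (cinner (bop_apply X y) y)"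
  have yx: "cinner (bop_apply X y) x = cnj b"
    unfolding a_b_c_def by (metis cinner_commute positive_symmetric[OF X])
  have c0: "0 \<le> c" using X by (simp add: a_b_c_def bop_positive_def)
  have key: "0 \<le> a - 2 * t * (cmod b)\<^sup>2 + t\<^sup>2 * (cmod b)\<^sup>2 * c" for t :: real
  proof -
    define l where "l = - complex_of_real t * b"
    have "0 \<le> Re (cinner (bop_apply X (x + l *\<^sub>C y)) (x + l *\<^sub>C y))"
      using X by (simp add: bop_positive_def)
    also have "\<dots> = a + Re (cnj l * b) + Re (l * cnj b) + Re (l * cnj l * cinner (bop_apply X y) y)"
      by (simp add: bop_lin cinner_simps yx a_b_c_def(1) flip: a_b_c_def(2))
         (simp add: algebra_simps)
    also have "l * cnj l = complex_of_real (t\<^sup>2 * (cmod b)\<^sup>2)"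
    proof -
      have "b * cnj b = complex_of_real ((cmod b)\<^sup>2)" by (simp only: complex_norm_square)
      then show ?thesis by (simp add: l_def power2_eq_square mult.assoc mult.left_commute)
    qed
    also have "Re (cnj l * b) = - t * (cmod b)\<^sup>2"
      by (simp add: l_def cmod_power2) (simp add: power2_eq_square algebra_simps)
    also have "Re (l * cnj b) = - t * (cmod b)\<^sup>2"
      by (simp add: l_def cmod_power2) (simp add: power2_eq_square algebra_simps)
    also have "Re (complex_of_real (t\<^sup>2 * (cmod b)\<^sup>2) * cinner (bop_apply X y) y) = t\<^sup>2 * (cmod b)\<^sup>2 * c"
      by (simp add: a_b_c_def(3) del: of_real_mult of_real_power)
    finally show ?thesis by simp
  qed
  have "(cmod b)\<^sup>2 \<le> a * c"
  proof (cases "c = 0")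
    case True
    then have "0 \<le> a - 2 * t * (cmod b)\<^sup>2" for t using key[of t] by simp
    from this[of "(a + 1) / (2 * (cmod b)\<^sup>2)"] have "cmod b = 0"
      by (cases "cmod b = 0") (auto simp: field_simps)
    then show ?thesis using True by simp
  next
    case False
    then have "c > 0" using c0 by simp
    then show ?thesis using key[of "1 / c"]
      by (simp add: field_simps power2_eq_square)
  qed
  then show ?thesis by (simp add: a_b_c_def)
qed

lemma positive_one: "bop_positive 1"
  by (simp add: bop_positive_def cinner_self)

lemma cinner_Cauchy_Schwarz: "cmod (cinner x y) \<le> norm x * norm (y::'h::chilbert_space)"
proof -
  have "(cmod (cinner x y))\<^sup>2 \<le> (norm x * norm y)\<^sup>2"
    using positive_Cauchy_Schwarz[OF positive_one, of x y]
    by (simp add: Re_cinner_self power_mult_distrib)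
  then show ?thesis by (rule power2_le_imp_le) simp
qed

lemma bounded_bilinear_cinner: "bounded_bilinear (cinner :: 'h::chilbert_space \<Rightarrow> 'h \<Rightarrow> complex)"
  by (rule bounded_bilinear.intro)
     (auto simp: cinner_simps scaleR_conv_of_real cinner_Cauchy_Schwarz intro!: exI[of _ 1])

lemmas tendsto_cinner [tendsto_intros] = bounded_bilinear.tendsto[OF bounded_bilinear_cinner]
lemmas continuous_on_cinner [continuous_intros] =
  bounded_bilinear.continuous_on[OF bounded_bilinear_cinner]

lemma bounded_bilinear_scaleC:
  "bounded_bilinear (scaleC :: complex \<Rightarrow> 'h::chilbert_space \<Rightarrow> 'h)"
  by (rule bounded_bilinear.intro)
     (auto simp: scaleC_add_left scaleC_add_right scaleC_scaleC scaleR_scaleC[where 'a='h] norm_scaleC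
       scaleR_conv_of_real mult.commute intro!: exI[of _ 1])

lemma norm_bop_apply: "norm (bop_apply T x) \<le> norm T * norm x"
  by transfer (rule norm_blinfun)

lemma norm_bop_le: "0 \<le> K \<Longrightarrow> (\<And>x. norm (bop_apply T x) \<le> K * norm x) \<Longrightarrow> norm T \<le> K"
  by transfer (rule norm_blinfun_bound)

lemma norm_bop_scaleC: "norm (a *\<^sub>C (T::'h::chilbert_space bop)) = cmod a * norm T"
proof -
  have le: "norm (a *\<^sub>C T) \<le> cmod a * norm T" for a and T :: "'h bop"
    by (rule norm_bop_le)
       (auto simp: norm_scaleC mult.assoc intro!: mult_left_mono norm_bop_apply)
  show ?thesis
  proof (cases "a = 0")
    case False
    have "norm T = norm (inverse a *\<^sub>C (a *\<^sub>C T))"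
      using False by (simp add: scaleC_scaleC)
    also have "\<dots> \<le> cmod (inverse a) * norm (a *\<^sub>C T)" by (rule le)
    finally have "cmod a * norm T \<le> norm (a *\<^sub>C T)"
      using False by (simp add: norm_inverse norm_divide field_simps)
    then show ?thesis using le[of a T] by linarith
  qed simp
qed

lemma bounded_bilinear_scaleC_bop:
  "bounded_bilinear (scaleC :: complex \<Rightarrow> 'h::chilbert_space bop \<Rightarrow> 'h bop)"
  by (rule bounded_bilinear.intro)
     (auto simp: scaleC_add_left scaleC_add_right scaleC_scaleC scaleR_scaleC[where 'a="'h bop"] norm_bop_scaleC
       scaleR_conv_of_real mult.commute intro!: exI[of _ 1])

lemmas continuous_on_scaleC_bop [continuous_intros] =
  bounded_bilinear.continuous_on[OF bounded_bilinear_scaleC_bop]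

lemma bounded_bilinear_bop_apply:
  "bounded_bilinear (bop_apply :: 'h::chilbert_space bop \<Rightarrow> 'h \<Rightarrow> 'h)"
  by (rule bounded_bilinear.intro)
     (auto simp: bop_lin norm_bop_apply intro!: exI[of _ 1])

lemmas tendsto_bop_apply [tendsto_intros] = bounded_bilinear.tendsto[OF bounded_bilinear_bop_apply]
lemmas continuous_on_bop_apply [continuous_intros] =
  bounded_bilinear.continuous_on[OF bounded_bilinear_bop_apply]

lemma bounded_linear_bop_cinner:
  "bounded_linear (\<lambda>T::'h::chilbert_space bop. cinner (bop_apply T x) y)"
  by (rule bounded_linear_compose[OF bounded_bilinear.bounded_linear_left[OF bounded_bilinear_cinner]
        bounded_bilinear.bounded_linear_left[OF bounded_bilinear_bop_apply]])

lemma bop_scaleC_mult_left: "(a *\<^sub>C S) * T = a *\<^sub>C (S * (T::'h::chilbert_space bop))"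
  and bop_scaleC_mult_right: "S * (a *\<^sub>C T) = a *\<^sub>C (S * T)"
  by (rule bop_eqI, simp add: bop_lin)+

lemma bop_eq_cinnerI:
  "(\<And>x y. cinner (bop_apply S x) y = cinner (bop_apply T x) y) \<Longrightarrow> S = T"
  by (blast intro: bop_eqI cinner_eqI)

lemma bop_of_fun:
  fixes f :: "'h::chilbert_space \<Rightarrow> 'h"
  assumes "bounded_linear f" "\<And>x. f (\<i> *\<^sub>C x) = \<i> *\<^sub>C f x"
  obtains A where "\<And>x. bop_apply A x = f x"
proof -
  have "f (a *\<^sub>C x) = a *\<^sub>C f x" for a x
    using bounded_linear.linear[OF assms(1)] assms(2)
    by (simp add: scaleC_decompose[of a] linear_add linear_scale)
  then have "blinfun_of_bop (Bop (Blinfun f)) = Blinfun f"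
    by (intro Bop_inverse) (simp add: bounded_linear_Blinfun_apply assms(1))
  then have "bop_apply (Bop (Blinfun f)) x = f x" for x
    by (simp add: bop_apply.rep_eq bounded_linear_Blinfun_apply assms(1))
  then show thesis by (rule that)
qed

section \<open>Riesz representation and adjoints\<close>

text \<open>The representing vector minimizes \<open>\<parallel>z\<parallel>\<^sup>2 - 2 f z\<close>; a minimizing sequence is Cauchy by the
  parallelogram law.\<close>

lemma Riesz_real:
  fixes f :: "'h::chilbert_space \<Rightarrow> real"
  assumes f: "bounded_linear f"
  shows "\<exists>z. \<forall>y. f y = Re (cinner z y)"
proof -
  interpret f: bounded_linear f by fact
  obtain K where K: "\<And>x. \<bar>f x\<bar> \<le> norm x * K" "0 \<le> K"
    using f.nonneg_bounded by auto
  define J where "J z = (norm z)\<^sup>2 - 2 * f z" for z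
  have lower: "- K\<^sup>2 \<le> J z" for z
  proof -
    have "0 \<le> (norm z - K)\<^sup>2" by simp
    then show ?thesis using K(1)[of z] by (simp add: J_def power2_eq_square algebra_simps)
  qed
  define d where "d = Inf (range J)"
  have bdd: "bdd_below (range J)" using lower by (intro bdd_belowI) auto
  have dJ: "d \<le> J z" for z unfolding d_def by (intro cInf_lower bdd) simp
  have "\<exists>z. J z < d + 1 / Suc n" for n
    using cInf_lessD[of "range J" "d + 1 / Suc n"] by (auto simp: d_def)
  then obtain z where z: "\<And>n. J (z n) < d + 1 / Suc n" by metis
  have mid: "(norm (u - v))\<^sup>2 = 2 * J u + 2 * J v - 4 * J ((1/2) *\<^sub>R (u + v))" for u v
    unfolding J_def
    by (simp add: f.add f.scaleR power_mult_distrib norm_add_square norm_diff_square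
        power_divide) (simp add: field_simps)
  have close: "(norm (z m - z n))\<^sup>2 \<le> 2 / Suc m + 2 / Suc n" for m n
    using mid[of "z m" "z n"] dJ[of "(1/2) *\<^sub>R (z m + z n)"] z[of m] z[of n] by (simp add: algebra_simps)
  have "Cauchy z"
  proof (rule metric_CauchyI)
    fix e :: real assume e: "0 < e"
    obtain M where M: "4 / e\<^sup>2 < real M" using reals_Archimedean2 by blast
    have "dist (z m) (z n) < e" if "m \<ge> M" "n \<ge> M" for m n
    proof -
      have Mpos: "0 < real M" using M e by (smt (verit) divide_nonneg_nonneg zero_le_power2)
      have "2 / Suc m < 2 / M" "2 / Suc n < 2 / M" using that Mpos by (auto simp: field_simps)
      then have "(norm (z m - z n))\<^sup>2 < 4 / M" using close[of m n] by simp
      also have "4 / M < e\<^sup>2" using M e Mpos by (simp add: field_simps)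
      finally show ?thesis using e by (simp add: dist_norm power_less_imp_less_base)
    qed
    then show "\<exists>M. \<forall>m\<ge>M. \<forall>n\<ge>M. dist (z m) (z n) < e" by blast
  qed
  then obtain w where w: "z \<longlonglongrightarrow> w" using Cauchy_convergent convergent_def by blast
  have "(\<lambda>n. J (z n)) \<longlonglongrightarrow> J w"
    unfolding J_def by (intro tendsto_intros w f.tendsto)
  moreover have "(\<lambda>n. d + 1 / Suc n) \<longlonglongrightarrow> d"
    using LIMSEQ_inverse_real_of_nat_add[of d] by (simp add: inverse_eq_divide)
  ultimately have Jw: "J w \<le> d"
    using z by (meson LIMSEQ_le less_imp_le)
  have "f y = Re (cinner w y)" for y
  proof -
    define g where "g = Re (cinner w y) - f y"
    have quad: "0 \<le> 2 * t * g + t\<^sup>2 * (norm y)\<^sup>2" for t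
      using dJ[of "w + t *\<^sub>R y"] Jw
      by (simp add: J_def norm_add_square f.add f.scaleR cinner_simps power_mult_distrib g_def algebra_simps)
    define N t where "N = (norm y)\<^sup>2 + 1" "t = - g / N"
    have "0 < N" unfolding N_t_def by (smt (verit) zero_le_power2)
    then have tN: "t * N = - g" by (simp add: N_t_def)
    have "0 \<le> (2 * t * g + t\<^sup>2 * (norm y)\<^sup>2) * N\<^sup>2"
      using quad[of t] by (intro mult_nonneg_nonneg) auto
    also have "\<dots> = 2 * (t * N) * g * N + (t * N)\<^sup>2 * (norm y)\<^sup>2"
      by (simp add: power2_eq_square algebra_simps)
    also have "\<dots> = - (g\<^sup>2 * ((norm y)\<^sup>2 + 2))"
      unfolding tN by (simp add: N_t_def(1) power2_eq_square algebra_simps)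
    finally have "g\<^sup>2 * ((norm y)\<^sup>2 + 2) \<le> 0" by simp
    then have "g = 0" by (smt (verit) zero_le_power2 mult_pos_pos zero_less_power2)
    then show ?thesis by (simp add: g_def)
  qed
  then show ?thesis by blast
qed

lemma Re_cinner_eqI:
  assumes "\<And>y. Re (cinner x y) = Re (cinner (z::'h::chilbert_space) y)" shows "x = z"
proof -
  have "Re (cinner (x - z) (x - z)) = 0" using assms by (simp add: cinner_simps)
  then show ?thesis by (simp add: Re_cinner_self)
qed

lemma Im_cinner: "Im (cinner x y) = Re (cinner x (\<i> *\<^sub>C (y::'h::chilbert_space)))"
  by (simp add: cinner_simps)

text \<open>Riesz representation in the second argument gives a real-linear operator; the invariance of the form
  under \<open>i\<close> makes it commute with \<open>i\<close>.\<close>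

lemma bop_of_form:
  fixes b :: "'h::chilbert_space \<Rightarrow> 'h \<Rightarrow> real"
  assumes b: "bounded_bilinear b" and inv: "\<And>x y. b (\<i> *\<^sub>C x) (\<i> *\<^sub>C y) = b x y"
  obtains A where "\<And>x y. Re (cinner (bop_apply A x) y) = b x y"
proof -
  interpret b: bounded_bilinear b by fact
  have "\<exists>z. \<forall>y. b x y = Re (cinner z y)" for x
    by (intro Riesz_real b.bounded_linear_right)
  then obtain f where f: "\<And>x y. b x y = Re (cinner (f x) y)" by metis
  obtain K where K: "\<And>x y. norm (b x y) \<le> norm x * norm y * K" "0 \<le> K"
    using b.nonneg_bounded by auto
  have "bounded_linear f"
  proof (rule bounded_linear_intro[where K = K])
    show "f (x + y) = f x + f y" for x y
      by (rule Re_cinner_eqI) (simp add: cinner_simps b.add_left flip: f)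
    show "f (r *\<^sub>R x) = r *\<^sub>R f x" for r x
      by (rule Re_cinner_eqI) (simp add: cinner_simps b.scaleR_left flip: f)
    show "norm (f x) \<le> norm x * K" for x
    proof (cases "f x = 0")
      case False
      have "(norm (f x))\<^sup>2 = b x (f x)" by (simp add: f Re_cinner_self)
      also have "\<dots> \<le> norm x * norm (f x) * K" using K(1)[of x "f x"] by simp
      finally show ?thesis using False by (simp add: power2_eq_square)
    qed (simp add: K)
  qed
  moreover have "f (\<i> *\<^sub>C x) = \<i> *\<^sub>C f x" for x
  proof (rule Re_cinner_eqI)
    fix y :: 'h
    have "y = \<i> *\<^sub>C ((- \<i>) *\<^sub>C y)" by (simp add: scaleC_scaleC)
    then have "Re (cinner (f (\<i> *\<^sub>C x)) y) = b (\<i> *\<^sub>C x) (\<i> *\<^sub>C ((- \<i>) *\<^sub>C y))" by (simp add: f)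
    also have "\<dots> = Re (cinner (f x) ((- \<i>) *\<^sub>C y))" using inv f by simp
    also have "\<dots> = Re (cinner (\<i> *\<^sub>C f x) y)" by (simp add: cinner_simps)
    finally show "Re (cinner (f (\<i> *\<^sub>C x)) y) = Re (cinner (\<i> *\<^sub>C f x) y)" .
  qed
  ultimately show thesis using bop_of_fun that f by metis
qed

lemma adj_exists: "\<exists>!S. \<forall>x y. cinner (bop_apply T x) y = cinner x (bop_apply (S::'h::chilbert_space bop) y)"
proof -
  have bb: "bounded_bilinear (\<lambda>x y. Re (cinner x (bop_apply T y)))"
  proof (rule bounded_bilinear.intro)
    have "\<bar>Re (cinner x (bop_apply T y))\<bar> \<le> norm x * norm y * norm T" for x y
    proof -
      have "\<bar>Re (cinner x (bop_apply T y))\<bar> \<le> norm x * norm (bop_apply T y)"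
        using abs_Re_le_cmod cinner_Cauchy_Schwarz order_trans by blast
      also have "\<dots> \<le> norm x * (norm T * norm y)"
        by (intro mult_left_mono norm_bop_apply) simp
      finally show ?thesis by (simp add: algebra_simps)
    qed
    then show "\<exists>K. \<forall>x y. norm (Re (cinner x (bop_apply T y))) \<le> norm x * norm y * K" by auto
  qed (simp_all add: bop_lin cinner_simps)
  obtain S where S: "\<And>x y. Re (cinner (bop_apply S x) y) = Re (cinner x (bop_apply T y))"
    using bop_of_form[OF bb] by (auto simp: bop_lin cinner_simps)
  have "cinner (bop_apply T x) y = cinner x (bop_apply S y)" for x y
  proof (rule complex_eqI)
    show "Re (cinner (bop_apply T x) y) = Re (cinner x (bop_apply S y))" for y
      using S[of y x] Re_cinner_commute by metis
    from this[of "\<i> *\<^sub>C y"] show "Im (cinner (bop_apply T x) y) = Im (cinner x (bop_apply S y))"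
      unfolding Im_cinner by (simp add: bop_lin)
  qed
  moreover have "S = S'" if "\<And>x y. cinner x (bop_apply S y) = cinner x (bop_apply S' y)" for S S' :: "'h bop"
    by (rule bop_eqI, rule cinner_eqI) (metis cinner_commute that)
  ultimately show ?thesis by metis
qed

lemma adj_cinner: "cinner (bop_apply T x) y = cinner x (bop_apply (bop_adj T) (y::'h::chilbert_space))"
proof -
  have "\<forall>x y. cinner (bop_apply T x) y = cinner x (bop_apply (bop_adj T) y)"
    unfolding bop_adj_def by (rule theI'[OF adj_exists])
  then show ?thesis by blast
qed

lemma adj_cinner': "cinner (bop_apply (bop_adj T) x) y = cinner x (bop_apply T (y::'h::chilbert_space))"
  by (metis adj_cinner cinner_commute)

lemma adj_eqI:
  assumes "\<And>x y. cinner (bop_apply T x) y = cinner x (bop_apply (S::'h::chilbert_space bop) y)"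
  shows "bop_adj T = S"
  by (rule bop_eqI, rule cinner_eqI) (metis assms adj_cinner cinner_commute)

lemma adj_adj [simp]: "bop_adj (bop_adj T) = T"
  by (rule adj_eqI) (rule adj_cinner')

lemma adj_mult: "bop_adj (S * T) = bop_adj T * bop_adj S"
  by (rule adj_eqI) (simp add: adj_cinner)

lemma adj_one [simp]: "bop_adj 1 = 1"
  by (rule adj_eqI) simp

lemma adj_add: "bop_adj (S + T) = bop_adj S + bop_adj T"
  by (rule adj_eqI) (simp add: cinner_simps adj_cinner)

lemma adj_diff: "bop_adj (S - T) = bop_adj S - bop_adj T"
  by (rule adj_eqI) (simp add: cinner_simps adj_cinner)

lemma adj_scaleC: "bop_adj (a *\<^sub>C S) = cnj a *\<^sub>C bop_adj S"
  by (rule adj_eqI) (simp add: cinner_simps adj_cinner)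

lemma adj_scaleR: "bop_adj (a *\<^sub>R S) = a *\<^sub>R bop_adj S"
  by (rule adj_eqI) (simp add: cinner_simps adj_cinner)

lemma norm_adj: "norm (bop_adj T) = norm (T::'h::chilbert_space bop)"
proof -
  have le: "norm (bop_adj T) \<le> norm T" for T :: "'h bop"
  proof (rule norm_bop_le)
    fix x
    show "norm (bop_apply (bop_adj T) x) \<le> norm T * norm x"
    proof (cases "bop_apply (bop_adj T) x = 0")
      case False
      let ?y = "bop_apply (bop_adj T) x"
      have "(norm ?y)\<^sup>2 = Re (cinner x (bop_apply T ?y))"
        by (simp add: adj_cinner' flip: Re_cinner_self)
      also have "\<dots> \<le> norm x * norm (bop_apply T ?y)"
        using cinner_Cauchy_Schwarz complex_Re_le_cmod order_trans by blast
      also have "\<dots> \<le> norm x * (norm T * norm ?y)"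
        by (intro mult_left_mono norm_bop_apply) simp
      finally show ?thesis using False by (simp add: power2_eq_square algebra_simps)
    qed simp
  qed simp
  show ?thesis using le[of T] le[of "bop_adj T"] by simp
qed

lemma bounded_linear_adj: "bounded_linear (bop_adj :: 'h::chilbert_space bop \<Rightarrow> 'h bop)"
  by (rule bounded_linear_intro[where K = 1]) (simp_all add: adj_add adj_scaleR norm_adj)

section \<open>Inverses\<close>

lemma bop_inv_eqI:
  assumes "S * T = 1" "T * S = (1::'h::chilbert_space bop)" shows "bop_inv T = S"
  unfolding bop_inv_def
proof (rule the_equality)
  fix S' assume "S' * T = 1 \<and> T * S' = 1"
  then show "S' = S" using assms by (metis mult.assoc mult.left_neutral mult.right_neutral)
qed (use assms in simp)

lemma bop_inv_mult:
  assumes "bop_invertible T"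
  shows "bop_inv T * T = 1" "T * bop_inv T = (1::'h::chilbert_space bop)"
  using assms bop_inv_eqI[of _ T] unfolding bop_invertible_def by metis+

lemma bop_invertible_mult:
  "bop_invertible S \<Longrightarrow> bop_invertible T \<Longrightarrow> bop_invertible (S * (T::'h::chilbert_space bop))"
  unfolding bop_invertible_def by (metis mult.assoc mult.left_neutral)

lemma bop_inv_adj:
  assumes "bop_invertible T"
  shows "bop_inv (bop_adj T) = bop_adj (bop_inv (T::'h::chilbert_space bop))"
  by (rule bop_inv_eqI) (simp_all add: bop_inv_mult assms flip: adj_mult)

lemma norm_bop_power: "norm ((X::'h::chilbert_space bop) ^ n) \<le> norm X ^ n"
proof (induction n)
  case 0
  show ?case by (simp, rule norm_bop_le) auto
next
  case (Suc n)
  then show ?case using norm_mult_ineq[of X "X ^ n"]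
    by (simp, meson mult_left_mono norm_ge_zero order_trans)
qed

text \<open>The sums telescope. A spectrum in the open disc bounds the powers of \<open>X\<close>, while the norm of \<open>X\<close>
  itself may exceed one.\<close>

lemma Neumann_sums:
  fixes X :: "'h::chilbert_space bop"
  assumes "summable (\<lambda>n. norm (X ^ n))"
  shows "(\<Sum>n. X ^ n) * (1 - X) = 1" "(1 - X) * (\<Sum>n. X ^ n) = 1"
proof -
  have s: "summable (\<lambda>n. X ^ n)" by (rule summable_norm_cancel[OF assms])
  have 0: "(\<lambda>n. X ^ n) \<longlonglongrightarrow> 0" using s summable_LIMSEQ_zero by blast
  have "(\<lambda>n. X ^ n - X ^ Suc n) sums (X ^ 0 - 0)" by (rule telescope_sums'[OF 0])
  then have t: "(\<lambda>n. X ^ n * (1 - X)) sums 1" "(\<lambda>n. (1 - X) * X ^ n) sums 1"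
    by (simp_all add: algebra_simps power_commutes)
  show "(\<Sum>n. X ^ n) * (1 - X) = 1"
    using sums_unique2[OF t(1) sums_mult2[OF summable_sums[OF s], of "1 - X"]] by simp
  show "(1 - X) * (\<Sum>n. X ^ n) = 1"
    using sums_unique2[OF t(2) sums_mult[OF summable_sums[OF s], of "1 - X"]] by simp
qed

lemma Neumann_bound:
  fixes X :: "'h::chilbert_space bop"
  assumes "norm X < 1"
  shows "bop_invertible (1 - X)" "norm (bop_inv (1 - X)) \<le> 1 / (1 - norm X)"
proof -
  have s: "summable (\<lambda>n. norm (X ^ n))"
    by (rule summable_comparison_test'[of "\<lambda>n. norm X ^ n" 0])
       (use assms norm_bop_power in auto)
  show "bop_invertible (1 - X)"
    unfolding bop_invertible_def using Neumann_sums[OF s] by blast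
  have "bop_inv (1 - X) = (\<Sum>n. X ^ n)" by (rule bop_inv_eqI) (rule Neumann_sums[OF s])+
  also have "norm \<dots> \<le> (\<Sum>n. norm (X ^ n))" by (rule summable_norm[OF s])
  also have "\<dots> \<le> (\<Sum>n. norm X ^ n)"
    by (rule suminf_le[OF norm_bop_power s]) (use assms in simp)
  also have "\<dots> = 1 / (1 - norm X)" using assms by (simp add: suminf_geometric)
  finally show "norm (bop_inv (1 - X)) \<le> 1 / (1 - norm X)" .
qed

section \<open>Positive operators and their square roots\<close>

lemma positiveI:
  assumes "bop_adj X = X" "\<And>x. 0 \<le> Re (cinner (bop_apply X x) x)" shows "bop_positive X"
proof -
  have "cinner (bop_apply X x) x = cnj (cinner (bop_apply X x) x)" for x
    by (metis adj_cinner assms(1) cinner_commute)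
  then show ?thesis using assms(2) by (auto simp: bop_positive_def Reals_cnj_iff)
qed

lemma positive_adj: "bop_positive X \<Longrightarrow> bop_adj X = X"
  by (rule adj_eqI) (rule positive_symmetric)

text \<open>The Cauchy-Schwarz inequality of the form \<open>\<langle>X x, y\<rangle>\<close> at \<open>y = X x\<close> turns a bound of the quadratic
  form into a bound of \<open>\<parallel>X x\<parallel>\<close>.\<close>

lemma positive_norm_le:
  assumes X: "bop_positive X" and K: "0 \<le> K" "\<And>x. Re (cinner (bop_apply X x) x) \<le> K * (norm x)\<^sup>2"
  shows "norm X \<le> K"
proof (rule norm_bop_le[OF K(1)])
  fix x
  let ?y = "bop_apply X x"
  have "((norm ?y)\<^sup>2)\<^sup>2 = (cmod (cinner ?y ?y))\<^sup>2"
    by (simp add: cinner_self norm_power)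
  also have "\<dots> \<le> Re (cinner ?y x) * Re (cinner (bop_apply X ?y) ?y)"
    by (rule positive_Cauchy_Schwarz[OF X])
  also have "\<dots> \<le> (K * (norm x)\<^sup>2) * (K * (norm ?y)\<^sup>2)"
    by (intro mult_mono K) (simp_all add: K positive_Re_nonneg[OF X])
  finally have "((norm ?y)\<^sup>2) * ((norm ?y)\<^sup>2) \<le> (K * norm x)\<^sup>2 * (norm ?y)\<^sup>2"
    by (simp add: power2_eq_square algebra_simps)
  then have "norm ?y = 0 \<or> (norm ?y)\<^sup>2 \<le> (K * norm x)\<^sup>2"
    by (metis mult_le_cancel_right power_eq_0_iff zero_le_power2 not_less order_le_less)
  then show "norm ?y \<le> K * norm x"
    using K(1) by (metis abs_le_square_iff abs_of_nonneg mult_nonneg_nonneg norm_ge_zero)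
qed

lemma positive_Re_le: "Re (cinner (bop_apply X x) x) \<le> norm X * (norm (x::'h::chilbert_space))\<^sup>2"
proof -
  have "Re (cinner (bop_apply X x) x) \<le> norm (bop_apply X x) * norm x"
    using cinner_Cauchy_Schwarz complex_Re_le_cmod order_trans by blast
  also have "\<dots> \<le> (norm X * norm x) * norm x"
    by (intro mult_right_mono norm_bop_apply) simp
  finally show ?thesis by (simp add: power2_eq_square mult.assoc)
qed

lemma positive_scaleR: "bop_positive X \<Longrightarrow> 0 \<le> r \<Longrightarrow> bop_positive (r *\<^sub>R X)"
  by (simp add: bop_positive_def cinner_simps)

text \<open>For large \<open>K\<close> the operator \<open>1 - X / K\<close> is positive, and the lower bound of \<open>X\<close> keeps its norm below
  one; the Neumann series then inverts \<open>X / K\<close>.\<close>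

lemma positive_bounded_below_invertible:
  assumes X: "bop_positive X" and d: "0 < d" "\<And>x. d * (norm x)\<^sup>2 \<le> Re (cinner (bop_apply X x) x)"
  shows "bop_invertible X"
proof -
  define K where "K = norm X + d"
  have K: "0 < K" "d \<le> K" "norm X \<le> K" using d by (auto simp: K_def add_nonneg_pos)
  define Y where "Y = 1 - (1 / K) *\<^sub>R X"
  have Yx: "Re (cinner (bop_apply Y x) x) = (norm x)\<^sup>2 - Re (cinner (bop_apply X x) x) / K" for x
    by (simp add: Y_def cinner_simps Re_cinner_self)
  have Y0: "0 \<le> Re (cinner (bop_apply Y x) x)" for x
  proof -
    have "Re (cinner (bop_apply X x) x) \<le> norm X * (norm x)\<^sup>2" by (rule positive_Re_le)
    also have "\<dots> \<le> K * (norm x)\<^sup>2" using K by (intro mult_right_mono) auto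
    finally show ?thesis using K by (simp add: Yx field_simps)
  qed
  have Y: "bop_positive Y"
    by (rule positiveI) (simp_all add: Y0, simp add: Y_def adj_diff adj_scaleR positive_adj[OF X])
  have "norm Y \<le> 1 - d / K"
  proof (rule positive_norm_le[OF Y])
    show "0 \<le> 1 - d / K" using K d by simp
    fix x show "Re (cinner (bop_apply Y x) x) \<le> (1 - d / K) * (norm x)\<^sup>2"
      using d(2)[of x] K by (simp add: Yx field_simps)
  qed
  also have "\<dots> < 1" using K d by simp
  finally have "bop_invertible (1 - Y)" by (rule Neumann_bound)
  then obtain S where "S * (1 - Y) = 1" "(1 - Y) * S = 1" by (auto simp: bop_invertible_def)
  then have "((1 / K) *\<^sub>R S) * X = 1" "X * ((1 / K) *\<^sub>R S) = 1" by (auto simp: Y_def)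
  then show ?thesis unfolding bop_invertible_def by blast
qed

text \<open>The Taylor coefficients of \<open>sqrt (1 - x)\<close>. All but the first are nonpositive and their partial
  sums are nonnegative, so the series converges absolutely on the whole closed unit ball.\<close>

definition sqrt_coeff :: "nat \<Rightarrow> real"
  where "sqrt_coeff n = (- 1) ^ n * ((1 / 2) gchoose n)"

lemma sqrt_coeff_0 [simp]: "sqrt_coeff 0 = 1"
  by (simp add: sqrt_coeff_def)

lemma gbinomial_step: "(a gchoose Suc k) = (a gchoose k) * ((a - real k) / (real k + 1))"
  using gbinomial_mult_1[of a k] by (simp add: field_simps)

lemma sqrt_coeff_nonpos: "sqrt_coeff (Suc n) \<le> 0"
proof (induction n)
  case 0
  show ?case by (simp add: sqrt_coeff_def)
next
  case (Suc n)
  have "sqrt_coeff (Suc (Suc n)) = sqrt_coeff (Suc n) * ((real n + 1 / 2) / (real n + 2))"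
    by (simp add: sqrt_coeff_def gbinomial_step[of _ "Suc n"]) (simp add: field_simps)
  then show ?case
    using mult_nonpos_nonneg[OF Suc, of "(real n + 1 / 2) / (real n + 2)"] by simp
qed

text \<open>The partial sums are the Taylor coefficients of \<open>(1 - x)\<^sup>-\<^sup>1\<^sup>/\<^sup>2 = sqrt (1 - x) / (1 - x)\<close>.\<close>

lemma sqrt_coeff_sum_nonneg: "0 \<le> (\<Sum>k\<le>n. sqrt_coeff k)"
proof -
  have "0 \<le> (- 1) ^ n * ((- (1/2) :: real) gchoose n)"
  proof (induction n)
    case (Suc n)
    have "(- 1) ^ Suc n * ((- (1/2) :: real) gchoose Suc n)
        = ((- 1) ^ n * ((- (1/2) :: real) gchoose n)) * ((real n + 1 / 2) / (real n + 1))"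
      by (simp add: gbinomial_step[of _ n]) (simp add: field_simps)
    then show ?case using Suc by (simp add: mult_nonneg_nonneg)
  qed simp
  then show ?thesis using gbinomial_sum_lower_neg[of "1/2::real" n]
    by (simp add: sqrt_coeff_def mult.commute)
qed

lemma sqrt_coeff_summable: "summable (\<lambda>n. \<bar>sqrt_coeff n\<bar>)"
  and sqrt_coeff_suminf_nonneg: "0 \<le> 1 - (\<Sum>n. \<bar>sqrt_coeff (Suc n)\<bar>)"
proof -
  have eq: "(\<Sum>k<n. \<bar>sqrt_coeff (Suc k)\<bar>) = 1 - (\<Sum>k\<le>n. sqrt_coeff k)" for n
    by (induction n) (use sqrt_coeff_nonpos in \<open>simp_all add: abs_of_nonpos\<close>)
  have le: "(\<Sum>k<n. \<bar>sqrt_coeff (Suc k)\<bar>) \<le> 1" for n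
    using eq[of n] sqrt_coeff_sum_nonneg[of n] by simp
  have s: "summable (\<lambda>n. \<bar>sqrt_coeff (Suc n)\<bar>)"
    by (rule summableI_nonneg_bounded[OF _ le]) simp
  then show "summable (\<lambda>n. \<bar>sqrt_coeff n\<bar>)" by (subst summable_Suc_iff[symmetric])
  have "(\<Sum>n. \<bar>sqrt_coeff (Suc n)\<bar>) \<le> 1" by (rule suminf_le_const[OF s le])
  then show "0 \<le> 1 - (\<Sum>n. \<bar>sqrt_coeff (Suc n)\<bar>)" by simp
qed

lemma sqrt_coeff_convolution:
  "(\<Sum>i\<le>n. sqrt_coeff i * sqrt_coeff (n - i)) = (if n = 0 then 1 else if n = 1 then - 1 else 0)"
proof -
  have "(\<Sum>i\<le>n. sqrt_coeff i * sqrt_coeff (n - i))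
      = (\<Sum>i\<le>n. (- 1) ^ n * (((1/2::real) gchoose i) * ((1/2) gchoose (n - i))))"
    by (rule sum.cong) (simp_all add: sqrt_coeff_def algebra_simps flip: power_add)
  also have "\<dots> = (- 1) ^ n * ((1::real) gchoose n)"
    using gbinomial_Vandermonde[of "1/2::real" "1/2" n] by (simp add: atLeast0AtMost flip: sum_distrib_left)
  also have "(1::real) gchoose n = real (1 choose n)"
    by (metis binomial_gbinomial of_nat_1)
  also have "(- 1) ^ n * real (1 choose n) = (if n = 0 then 1 else if n = 1 then - 1 else 0)"
    by (cases n rule: nat.exhaust) (auto simp: binomial_eq_0)
  finally show ?thesis .
qed

text \<open>The coefficients after the first are nonpositive with sum at least \<open>-1\<close>, and the powers of \<open>X\<close> have
  norm at most one, so the leading term \<open>1\<close> dominates: the sum of the series is positive. Commuting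
  with everything that commutes with \<open>X\<close> serves the uniqueness of the square root and, for Toeplitz
  operators, its invariance under the shift.\<close>

lemma sqrt_series:
  fixes X :: "'h::chilbert_space bop"
  assumes X: "bop_positive X" "norm X \<le> 1"
  defines "B \<equiv> (\<Sum>n. sqrt_coeff n *\<^sub>R X ^ n)"
  shows "bop_positive B" "B * B = 1 - X" "C * X = X * C \<Longrightarrow> C * B = B * C"
proof -
  have X1: "norm (X ^ n) \<le> 1" for n
    using norm_bop_power[of X n] X(2) by (meson norm_ge_zero order_trans power_le_one)
  have Xx: "norm (bop_apply (X ^ n) x) \<le> norm x" for n x
    using order_trans[OF norm_bop_apply mult_right_mono[OF X1 norm_ge_zero]] by simp
  have le: "norm (sqrt_coeff n *\<^sub>R X ^ n) \<le> \<bar>sqrt_coeff n\<bar>" for n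
    using X1[of n] by (simp add: mult_left_le)
  have sn: "summable (\<lambda>n. norm (sqrt_coeff n *\<^sub>R X ^ n))"
    by (rule summable_comparison_test'[OF sqrt_coeff_summable, of 0]) (use le in simp)
  then have s: "summable (\<lambda>n. sqrt_coeff n *\<^sub>R X ^ n)" by (rule summable_norm_cancel)
  then have sums: "(\<lambda>n. sqrt_coeff n *\<^sub>R X ^ n) sums B" unfolding B_def by (rule summable_sums)
  show "C * B = B * C" if "C * X = X * C"
  proof -
    have "C * X ^ n = X ^ n * C" for n
      by (induction n) (simp_all add: that mult.assoc, metis that mult.assoc)
    then have "(\<lambda>n. C * (sqrt_coeff n *\<^sub>R X ^ n)) = (\<lambda>n. (sqrt_coeff n *\<^sub>R X ^ n) * C)" by simp
    then show ?thesis using sums_mult[OF sums, of C] sums_mult2[OF sums, of C] sums_unique2 by metis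
  qed
  have conv: "(\<Sum>i\<le>n. (sqrt_coeff i *\<^sub>R X ^ i) * (sqrt_coeff (n - i) *\<^sub>R X ^ (n - i)))
      = (\<Sum>i\<le>n. sqrt_coeff i * sqrt_coeff (n - i)) *\<^sub>R X ^ n" for n
    by (simp add: scaleR_sum_left mult.commute[where 'a=real] flip: power_add)
  have "(\<lambda>n. (\<Sum>i\<le>n. (sqrt_coeff i *\<^sub>R X ^ i) * (sqrt_coeff (n - i) *\<^sub>R X ^ (n - i)))) sums (B * B)"
    unfolding B_def by (rule Cauchy_product_sums[OF sn sn])
  then have 1: "(\<lambda>n. (if n = 0 then 1 else if n = 1 then - 1 else 0) *\<^sub>R X ^ n) sums (B * B)"
    by (simp only: conv sqrt_coeff_convolution)
  have "(\<lambda>n. (if n = 0 then 1 else if n = 1 then - 1 else 0) *\<^sub>R X ^ n)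
      sums (\<Sum>n\<in>{0,1}. (if n = 0 then 1 else if n = 1 then - 1 else 0) *\<^sub>R X ^ n)"
    by (rule sums_finite) auto
  then show "B * B = 1 - X" using sums_unique2[OF 1] by simp
  have Xn: "bop_adj (X ^ n) = X ^ n" for n
    by (induction n) (simp_all add: adj_mult positive_adj[OF X(1)] power_commutes)
  show "bop_positive B"
  proof (rule positiveI)
    have "(\<lambda>n. sqrt_coeff n *\<^sub>R X ^ n) sums bop_adj B"
      using bounded_linear.sums[OF bounded_linear_adj sums] by (simp only: adj_scaleR Xn)
    then show "bop_adj B = B" using sums by (rule sums_unique2)
    fix x
    define g where "g n = sqrt_coeff n * Re (cinner (bop_apply (X ^ n) x) x)" for n
    have "(\<lambda>n. Re (cinner (bop_apply (sqrt_coeff n *\<^sub>R X ^ n) x) x)) sums Re (cinner (bop_apply B x) x)"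
      by (intro bounded_linear.sums[OF bounded_linear_Re] bounded_linear.sums[OF bounded_linear_bop_cinner] sums)
    then have g: "g sums Re (cinner (bop_apply B x) x)" by (simp add: cinner_simps g_def[abs_def])
    have s1: "summable (\<lambda>n. \<bar>sqrt_coeff (Suc n)\<bar>)"
      using sqrt_coeff_summable by (subst summable_Suc_iff)
    have g1: "summable (\<lambda>n. g (Suc n))"
      using sums_summable[OF g] by (subst summable_Suc_iff)
    have lower: "- (\<bar>sqrt_coeff (Suc n)\<bar> * (norm x)\<^sup>2) \<le> g (Suc n)" for n
    proof -
      have "\<bar>Re (cinner (bop_apply (X ^ Suc n) x) x)\<bar> \<le> norm (bop_apply (X ^ Suc n) x) * norm x"
        using abs_Re_le_cmod cinner_Cauchy_Schwarz order_trans by blast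
      also have "\<dots> \<le> norm x * norm x"
        by (intro mult_right_mono Xx) simp
      finally have "\<bar>g (Suc n)\<bar> \<le> \<bar>sqrt_coeff (Suc n)\<bar> * (norm x)\<^sup>2"
        unfolding g_def abs_mult by (intro mult_left_mono) (simp_all add: power2_eq_square)
      then show ?thesis by linarith
    qed
    have "(\<Sum>n. - (\<bar>sqrt_coeff (Suc n)\<bar> * (norm x)\<^sup>2)) \<le> (\<Sum>n. g (Suc n))"
      by (rule suminf_le[OF lower summable_minus[OF summable_mult2[OF s1]] g1])
    then have "- ((\<Sum>n. \<bar>sqrt_coeff (Suc n)\<bar>) * (norm x)\<^sup>2) \<le> (\<Sum>n. g (Suc n))"
      by (simp only: suminf_minus[OF summable_mult2[OF s1]] suminf_mult2[OF s1])
    moreover have "(\<Sum>n. g (Suc n)) = Re (cinner (bop_apply B x) x) - (norm x)\<^sup>2"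
      using suminf_split_head[OF sums_summable[OF g]] sums_unique[OF g]
      by (simp add: g_def[of 0] Re_cinner_self)
    moreover have "0 \<le> (1 - (\<Sum>n. \<bar>sqrt_coeff (Suc n)\<bar>)) * (norm x)\<^sup>2"
      using sqrt_coeff_suminf_nonneg by simp
    ultimately show "0 \<le> Re (cinner (bop_apply B x) x)" by (simp add: algebra_simps)
  qed
qed

lemma positive_sqrt_exists:
  assumes A: "bop_positive A"
  obtains B where "bop_positive B" "B * B = A" "\<And>C. C * A = A * C \<Longrightarrow> C * B = B * (C::'h::chilbert_space bop)"
proof -
  define K where "K = norm A + 1"
  have K: "0 < K" "norm A \<le> K" by (auto simp: K_def add_nonneg_pos)
  define X where "X = 1 - (1 / K) *\<^sub>R A"
  have Xx: "Re (cinner (bop_apply X x) x) = (norm x)\<^sup>2 - Re (cinner (bop_apply A x) x) / K" for x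
    by (simp add: X_def cinner_simps Re_cinner_self)
  have X0: "0 \<le> Re (cinner (bop_apply X x) x)" for x
  proof -
    have "Re (cinner (bop_apply A x) x) \<le> norm A * (norm x)\<^sup>2" by (rule positive_Re_le)
    also have "\<dots> \<le> K * (norm x)\<^sup>2" using K by (intro mult_right_mono) auto
    finally show ?thesis using K by (simp add: Xx field_simps)
  qed
  have X: "bop_positive X"
    by (rule positiveI) (simp_all add: X0, simp add: X_def adj_diff adj_scaleR positive_adj[OF A])
  have "norm X \<le> 1"
    by (rule positive_norm_le[OF X]) (use K in \<open>simp_all add: Xx positive_Re_nonneg[OF A]\<close>)
  note B = sqrt_series[OF X this]
  define B where "B = (\<Sum>n. sqrt_coeff n *\<^sub>R X ^ n)"
  show thesis
  proof (rule that)
    show "bop_positive (sqrt K *\<^sub>R B)" using B(1) K by (intro positive_scaleR) (simp_all add: B_def)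
    have "(sqrt K *\<^sub>R B) * (sqrt K *\<^sub>R B) = K *\<^sub>R (1 - X)"
      using K B(2) by (simp add: B_def)
    then show "(sqrt K *\<^sub>R B) * (sqrt K *\<^sub>R B) = A" using K by (simp add: X_def)
    show "C * (sqrt K *\<^sub>R B) = (sqrt K *\<^sub>R B) * C" if "C * A = A * C" for C
      using B(3)[of C] that by (simp add: B_def X_def algebra_simps)
  qed
qed

text \<open>Uniqueness: a second root \<open>B\<close> commutes with the root \<open>C\<close> given by the power series, because it
  commutes with \<open>A\<close>. Hence \<open>(B - C) (B + C) = 0\<close>, the forms of \<open>B\<close> and \<open>C\<close> vanish on the range of
  \<open>B - C\<close>, and \<open>C\<close> is injective.\<close>

lemma bop_sqrt:
  fixes A :: "'h::chilbert_space bop"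
  assumes "bop_strictly_positive A"
  shows "bop_positive (bop_sqrt A)" "bop_sqrt A * bop_sqrt A = A" "bop_invertible (bop_sqrt A)"
proof -
  have A: "bop_positive A" "bop_invertible A" using assms by (auto simp: bop_strictly_positive_def)
  obtain C where C: "bop_positive C" "C * C = A" "\<And>D. D * A = A * D \<Longrightarrow> D * C = C * D"
    using positive_sqrt_exists[OF A(1)] by blast
  have inv: "bop_invertible D" if D: "D * D = A" for D
  proof -
    have "D * (D * bop_inv A) = 1" "(bop_inv A * D) * D = 1"
      using bop_inv_mult[OF A(2)] D by (simp_all add: mult.assoc) (metis mult.assoc D)
    moreover from this have "D * bop_inv A = bop_inv A * D"
      by (metis mult.assoc mult.left_neutral mult.right_neutral)
    ultimately show ?thesis unfolding bop_invertible_def by metis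
  qed
  have uniq: "B = C" if B: "bop_positive B" "B * B = A" for B
  proof -
    have com: "B * C = C * B" by (rule C(3)) (simp add: mult.assoc flip: B(2))
    define D where "D = B - C"
    have "D * (B + C) = B * B + B * C - (C * B + C * C)"
      by (simp add: D_def distrib_left left_diff_distrib)
    also have "\<dots> = A + B * C - (B * C + A)"
      unfolding B(2) C(2) com[symmetric] ..
    finally have 0: "D * (B + C) = 0" by (metis add.commute cancel_comm_monoid_add_class.diff_cancel)
    have Dadj: "bop_adj D = D" using B(1) C(1) by (simp add: D_def adj_diff positive_adj)
    have "bop_apply D x = 0" for x
    proof -
      let ?y = "bop_apply D x"
      have "cinner (bop_apply (B + C) ?y) ?y = cinner (bop_apply (D * (B + C)) ?y) x"
        using adj_cinner[of D "bop_apply (B + C) ?y" x] by (simp add: Dadj)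
      then have "Re (cinner (bop_apply B ?y) ?y) + Re (cinner (bop_apply C ?y) ?y) = 0"
        unfolding 0 by (simp add: cinner_simps) (metis plus_complex.sel(1) zero_complex.sel(1))
      then have "Re (cinner (bop_apply C ?y) ?y) = 0"
        using positive_Re_nonneg[OF B(1), of ?y] positive_Re_nonneg[OF C(1), of ?y] by linarith
      then have "(cmod (cinner (bop_apply C ?y) (bop_apply C ?y)))\<^sup>2 \<le> 0"
        using positive_Cauchy_Schwarz[OF C(1), of ?y "bop_apply C ?y"] by simp
      then have "bop_apply C ?y = 0" by (simp add: cinner_self)
      then have "bop_apply (bop_inv C * C) ?y = 0" by simp
      then show ?thesis using bop_inv_mult[OF inv[OF C(2)]] by simp
    qed
    then have "D = 0" by (intro bop_eqI) simp
    then show ?thesis by (simp add: D_def)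
  qed
  have "bop_sqrt A = C" unfolding bop_sqrt_def
  proof (rule the_equality)
    show "bop_positive C \<and> C * C = A" using C(1,2) by blast
  qed (use uniq in blast)
  then show "bop_positive (bop_sqrt A)" "bop_sqrt A * bop_sqrt A = A" "bop_invertible (bop_sqrt A)"
    using C(1,2) inv by auto
qed

lemma bop_inv_sqrt:
  fixes A :: "'h::chilbert_space bop"
  assumes "bop_strictly_positive A"
  shows "bop_inv_sqrt A * bop_sqrt A = 1" "bop_sqrt A * bop_inv_sqrt A = 1"
    "bop_adj (bop_inv_sqrt A) = bop_inv_sqrt A" "bop_inv_sqrt A * A * bop_inv_sqrt A = 1"
proof -
  note s = bop_sqrt[OF assms]
  show 1: "bop_inv_sqrt A * bop_sqrt A = 1" "bop_sqrt A * bop_inv_sqrt A = 1"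
    using bop_inv_mult[OF s(3)] by (simp_all add: bop_inv_sqrt_def)
  show "bop_adj (bop_inv_sqrt A) = bop_inv_sqrt A"
    using bop_inv_adj[OF s(3)] positive_adj[OF s(1)] by (simp add: bop_inv_sqrt_def)
  show "bop_inv_sqrt A * A * bop_inv_sqrt A = 1"
    using 1 s(2) by (metis mult.assoc mult.left_neutral)
qed

section \<open>Finite orthonormal systems\<close>

definition orthonormal :: "nat \<Rightarrow> (nat \<Rightarrow> 'h::chilbert_space) \<Rightarrow> bool"
  where "orthonormal m e \<longleftrightarrow> (\<forall>i<m. \<forall>j<m. cinner (e i) (e j) = (if i = j then 1 else 0))"

text \<open>Gram-Schmidt orthogonalization, skipping the vectors that depend linearly on the others.\<close>

lemma orthonormal_basis_exists:
  fixes vs :: "'h::chilbert_space list"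
  shows "\<exists>m e. orthonormal m e \<and> (\<forall>v\<in>set vs. v = (\<Sum>l<m. cinner v (e l) *\<^sub>C e l))"
proof (induction vs)
  case Nil
  show ?case by (auto simp: orthonormal_def intro: exI[of _ 0])
next
  case (Cons v vs)
  then obtain m and e :: "nat \<Rightarrow> 'h" where on: "orthonormal m e"
    and vs: "\<And>u. u \<in> set vs \<Longrightarrow> u = (\<Sum>l<m. cinner u (e l) *\<^sub>C e l)" by blast
  define r where "r = v - (\<Sum>l<m. cinner v (e l) *\<^sub>C e l)"
  show ?case
  proof (cases "r = 0")
    case True
    then show ?thesis using on vs by (intro exI[of _ m] exI[of _ e]) (auto simp: r_def)
  next
    case False
    define w where "w = (1 / norm r) *\<^sub>R r"
    have re: "cinner r (e j) = 0" if "j < m" for j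
    proof -
      have "(\<Sum>l<m. cinner v (e l) * cinner (e l) (e j)) = (\<Sum>l<m. if l = j then cinner v (e l) else 0)"
        using on that by (intro sum.cong) (auto simp: orthonormal_def)
      then show ?thesis using that by (simp add: r_def cinner_simps cinner_sum_left)
    qed
    have er: "cinner (e j) r = 0" if "j < m" for j
      using re[OF that] by (metis cinner_commute complex_cnj_zero)
    have ww: "cinner w w = 1" using False
      by (simp add: w_def cinner_simps cinner_self power2_eq_square)
    define e' where "e' = e(m := w)"
    have on': "orthonormal (Suc m) e'"
      using on ww re er unfolding orthonormal_def e'_def
      by (auto simp: less_Suc_eq w_def cinner_simps)
    have sum: "(\<Sum>l<m. cinner u (e' l) *\<^sub>C e' l) = (\<Sum>l<m. cinner u (e l) *\<^sub>C e l)" for u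
      by (intro sum.cong) (auto simp: e'_def)
    have "u = (\<Sum>l<Suc m. cinner u (e' l) *\<^sub>C e' l)" if u: "u \<in> set (v # vs)" for u
    proof (cases "u = v")
      case True
      have "cinner v w = cinner (r + (\<Sum>l<m. cinner v (e l) *\<^sub>C e l)) w" by (simp add: r_def)
      also have "\<dots> = complex_of_real (norm r)"
        using False er by (simp add: cinner_simps cinner_sum_left w_def cinner_self power2_eq_square)
      finally have "cinner v w *\<^sub>C w = r" using False by (simp add: w_def flip: scaleR_scaleC)
      then show ?thesis using True sum[of v] by (simp add: e'_def r_def)
    next
      case False
      then have uv: "u = (\<Sum>l<m. cinner u (e l) *\<^sub>C e l)" using vs u by simp
      have "cinner u w = cinner (\<Sum>l<m. cinner u (e l) *\<^sub>C e l) w" using uv by simp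
      also have "\<dots> = 0" using er by (simp add: cinner_simps cinner_sum_left w_def)
      finally show ?thesis using uv sum[of u] by (simp add: e'_def)
    qed
    then show ?thesis using on' by (intro exI[of _ "Suc m"] exI[of _ e']) auto
  qed
qed

section \<open>The Hahn-Banach theorem for sublinear functions\<close>

definition sublinear_on :: "'v::real_vector set \<Rightarrow> ('v \<Rightarrow> real) \<Rightarrow> bool"
  where "sublinear_on W q \<longleftrightarrow> (\<forall>x\<in>W. \<forall>y\<in>W. q (x + y) \<le> q x + q y) \<and>
    (\<forall>t>0. \<forall>x\<in>W. q (t *\<^sub>R x) = t * q x)"

lemma sublinear_on_zero:
  assumes "subspace W" "sublinear_on W q" shows "q 0 = 0"
proof -
  have "0 \<in> W" using assms(1) by (simp add: subspace_0)
  then have "q (2 *\<^sub>R 0) = 2 * q 0"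
    using assms(2) unfolding sublinear_on_def by (metis zero_less_numeral)
  then show ?thesis by simp
qed

lemma sublinear_on_lower:
  assumes "subspace W" "sublinear_on W q" "x \<in> W" shows "- q (- x) \<le> q x"
proof -
  have "- x \<in> W" using assms by (simp add: subspace_neg)
  then have "q (x + - x) \<le> q x + q (- x)" using assms(2,3) unfolding sublinear_on_def by blast
  then show ?thesis using sublinear_on_zero[OF assms(1,2)] by simp
qed

text \<open>Infima of chains of sublinear functions are sublinear, so by Zorn's lemma there is a minimal
  one below \<open>p\<close>. A minimal sublinear function \<open>q\<close> is additive: for fixed \<open>y\<close>, the function
  \<open>x \<mapsto> inf {q (x + t y) - t q y | t \<ge> 0}\<close> is sublinear and below \<open>q\<close>, hence equals \<open>q\<close>, and
  \<open>t = 1\<close> gives \<open>q x + q y \<le> q (x + y)\<close>.\<close>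

lemma Hahn_Banach_sublinear:
  fixes p :: "'v::real_vector \<Rightarrow> real"
  assumes W: "subspace W" and p: "sublinear_on W p"
  obtains g where "\<And>x y. x \<in> W \<Longrightarrow> y \<in> W \<Longrightarrow> g (x + y) = g x + g y"
    "\<And>t x. x \<in> W \<Longrightarrow> g (t *\<^sub>R x) = t * g x" "\<And>x. x \<in> W \<Longrightarrow> g x \<le> p x"
proof -
  note Wclosed = subspace_add[OF W] subspace_scale[OF W] subspace_neg[OF W] subspace_0[OF W]
  define Q where "Q = {q. (\<forall>x. x \<notin> W \<longrightarrow> q x = 0) \<and> sublinear_on W q \<and> (\<forall>x\<in>W. q x \<le> p x)}"
  define P :: "('v \<Rightarrow> real) \<Rightarrow> ('v \<Rightarrow> real) \<Rightarrow> bool" where "P q1 q2 \<longleftrightarrow> (\<forall>x. q2 x \<le> q1 x)" for q1 q2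
  have add: "q (x + y) \<le> q x + q y" if "sublinear_on W q" "x \<in> W" "y \<in> W" for q x y
    using that unfolding sublinear_on_def by blast
  have hom: "q (t *\<^sub>R x) = t * q x" if "sublinear_on W q" "x \<in> W" "0 \<le> t" for q x t
    using that sublinear_on_zero[OF W that(1)] unfolding sublinear_on_def by (cases "t = 0") auto
  have Q: "sublinear_on W q" "\<And>x. x \<in> W \<Longrightarrow> q x \<le> p x" if "q \<in> Q" for q
    using that by (auto simp: Q_def)
  have lower: "- p (- x) \<le> q x" if "q \<in> Q" "x \<in> W" for q x
    using sublinear_on_lower[OF W Q(1)[OF that(1)] that(2)] Q(2)[OF that(1), of "- x"] Wclosed that(2)
    by force
  have "\<exists>m\<in>Q. \<forall>a\<in>Q. P m a \<longrightarrow> a = m"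
  proof (rule predicate_Zorn)
    show "partial_order_on Q (relation_of P Q)"
      by (rule partial_order_on_relation_ofI) (auto simp: P_def fun_eq_iff intro: order_trans antisym)
    fix C assume "C \<in> Chains (relation_of P Q)"
    then have CQ: "C \<subseteq> Q" and chain: "\<And>a b. a \<in> C \<Longrightarrow> b \<in> C \<Longrightarrow> P a b \<or> P b a"
      by (auto simp: Chains_def relation_of_def)
    show "\<exists>u\<in>Q. \<forall>a\<in>C. P a u"
    proof (cases "C = {}")
      case True
      have "sublinear_on W (\<lambda>x. if x \<in> W then p x else 0)"
        using p Wclosed unfolding sublinear_on_def by simp
      then have "(\<lambda>x. if x \<in> W then p x else 0) \<in> Q" by (auto simp: Q_def)
      then show ?thesis using True by blast
    next
      case False
      define u where "u x = (if x \<in> W then (INF q\<in>C. q x) else 0)" for x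
      have bdd: "bdd_below ((\<lambda>q. q x) ` C)" if "x \<in> W" for x
        using lower[OF _ that] CQ by (intro bdd_belowI2) blast
      have uq: "u x \<le> q x" if "q \<in> C" "x \<in> W" for q x
        using cINF_lower[OF bdd[OF that(2)] that(1)] that by (simp add: u_def)
      have near: "\<exists>q\<in>C. q x < u x + e" if "x \<in> W" "0 < e" for x e
        using cInf_lessD[of "(\<lambda>q. q x) ` C" "u x + e"] that False by (auto simp: u_def)
      have "u (x + y) \<le> u x + u y" if xy: "x \<in> W" "y \<in> W" for x y
      proof (rule field_le_epsilon)
        fix e :: real assume e: "0 < e"
        then have e2: "0 < e / 2" by simp
        obtain q1 q2 where q: "q1 \<in> C" "q1 x < u x + e / 2" "q2 \<in> C" "q2 y < u y + e / 2"
          using near[OF xy(1) e2] near[OF xy(2) e2] by blast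
        have "P q1 q2 \<or> P q2 q1" using chain q by blast
        then obtain q' where q': "q' \<in> C" "q' x \<le> q1 x" "q' y \<le> q2 y"
          using q unfolding P_def by blast
        have "u (x + y) \<le> q' (x + y)" using uq q' Wclosed xy by blast
        also have "\<dots> \<le> q' x + q' y" using add Q(1) q'(1) CQ xy by blast
        finally show "u (x + y) \<le> u x + u y + e" using q q' by linarith
      qed
      moreover have "u (t *\<^sub>R x) = t * u x" if t: "0 < t" and x: "x \<in> W" for t x
      proof -
        have le: "u (t *\<^sub>R x) \<le> t * u x" if t: "0 < t" and x: "x \<in> W" for t x
        proof (rule field_le_epsilon)
          fix e :: real assume "0 < e"
          then obtain q where q: "q \<in> C" "q x < u x + e / t" using near[OF x, of "e / t"] t by auto
          have "u (t *\<^sub>R x) \<le> q (t *\<^sub>R x)" using uq q(1) Wclosed x by blast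
          also have "\<dots> = t * q x" using hom Q(1) q(1) CQ x t by (simp add: subset_iff)
          also have "\<dots> \<le> t * (u x + e / t)" using q(2) t by simp
          finally show "u (t *\<^sub>R x) \<le> t * u x + e" using t by (simp add: distrib_left)
        qed
        have "u ((1 / t) *\<^sub>R (t *\<^sub>R x)) \<le> (1 / t) * u (t *\<^sub>R x)"
          using le[of "1 / t" "t *\<^sub>R x"] t x Wclosed by simp
        then have "t * u x \<le> u (t *\<^sub>R x)" using t by (simp add: field_simps)
        then show ?thesis using le[OF t x] by simp
      qed
      moreover have "u x \<le> p x" if "x \<in> W" for x
        using False uq[OF _ that] Q(2)[OF _ that] CQ by (meson ex_in_conv order_trans subset_iff)
      ultimately have "u \<in> Q" by (auto simp: Q_def sublinear_on_def u_def)
      moreover have "P a u" if "a \<in> C" for a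
        using uq[OF that] CQ that by (auto simp: P_def Q_def u_def)
      ultimately show ?thesis by blast
    qed
  qed
  then obtain q where qQ: "q \<in> Q" and min: "\<And>a. a \<in> Q \<Longrightarrow> P q a \<Longrightarrow> a = q" by blast
  note q = Q(1)[OF qQ]
  have superadd: "q x + q y \<le> q (x + y)" if x: "x \<in> W" and y: "y \<in> W" for x y
  proof -
    define r where "r x = (if x \<in> W then (INF t\<in>{0..}. q (x + t *\<^sub>R y) - t * q y) else 0)" for x
    have bdd: "bdd_below ((\<lambda>t. q (x + t *\<^sub>R y) - t * q y) ` {0..})" if x: "x \<in> W" for x
    proof (rule bdd_belowI2)
      fix t :: real assume t: "t \<in> {0..}"
      have "q (t *\<^sub>R y) \<le> q (x + t *\<^sub>R y) + q (- x)"
        using add[OF q, of "x + t *\<^sub>R y" "- x"] x y Wclosed by simp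
      then show "- q (- x) \<le> q (x + t *\<^sub>R y) - t * q y" using hom[OF q y, of t] t by simp
    qed
    have rle: "r x \<le> q (x + t *\<^sub>R y) - t * q y" if "x \<in> W" "0 \<le> t" for x t
      using cINF_lower[OF bdd[OF that(1)], of t] that by (simp add: r_def)
    have near: "\<exists>t\<ge>0. q (x + t *\<^sub>R y) - t * q y < r x + e" if "x \<in> W" "0 < e" for x e
      using cInf_lessD[of "(\<lambda>t. q (x + t *\<^sub>R y) - t * q y) ` {0..}" "r x + e"] that
      by (auto simp: r_def)
    have "r (x1 + x2) \<le> r x1 + r x2" if xx: "x1 \<in> W" "x2 \<in> W" for x1 x2
    proof (rule field_le_epsilon)
      fix e :: real assume "0 < e"
      then have e2: "0 < e / 2" by simp
      obtain s t where st: "0 \<le> s" "q (x1 + s *\<^sub>R y) - s * q y < r x1 + e / 2"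
        "0 \<le> t" "q (x2 + t *\<^sub>R y) - t * q y < r x2 + e / 2"
        using near[OF xx(1) e2] near[OF xx(2) e2] by blast
      have "r (x1 + x2) \<le> q (x1 + x2 + (s + t) *\<^sub>R y) - (s + t) * q y"
        using st xx Wclosed by (intro rle) auto
      also have "x1 + x2 + (s + t) *\<^sub>R y = (x1 + s *\<^sub>R y) + (x2 + t *\<^sub>R y)"
        by (simp add: algebra_simps)
      also have "q \<dots> \<le> q (x1 + s *\<^sub>R y) + q (x2 + t *\<^sub>R y)"
        using xx y Wclosed by (intro add[OF q]) auto
      finally show "r (x1 + x2) \<le> r x1 + r x2 + e" using st by (simp add: algebra_simps)
    qed
    moreover have "r (c *\<^sub>R x) = c * r x" if c: "0 < c" and x: "x \<in> W" for c x
    proof -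
      have le: "r (c *\<^sub>R x) \<le> c * r x" if c: "0 < c" and x: "x \<in> W" for c x
      proof (rule field_le_epsilon)
        fix e :: real assume "0 < e"
        then obtain t where t: "0 \<le> t" "q (x + t *\<^sub>R y) - t * q y < r x + e / c"
          using near[OF x, of "e / c"] c by auto
        have "r (c *\<^sub>R x) \<le> q (c *\<^sub>R x + (c * t) *\<^sub>R y) - (c * t) * q y"
          using t c x Wclosed by (intro rle) auto
        also have "c *\<^sub>R x + (c * t) *\<^sub>R y = c *\<^sub>R (x + t *\<^sub>R y)" by (simp add: algebra_simps)
        also have "q \<dots> = c * q (x + t *\<^sub>R y)" using c x y Wclosed by (intro hom[OF q]) auto
        also have "c * q (x + t *\<^sub>R y) - c * t * q y = c * (q (x + t *\<^sub>R y) - t * q y)"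
          by (simp add: algebra_simps)
        also have "\<dots> \<le> c * (r x + e / c)" using t(2) c by simp
        finally show "r (c *\<^sub>R x) \<le> c * r x + e" using c by (simp add: distrib_left)
      qed
      have "r ((1 / c) *\<^sub>R (c *\<^sub>R x)) \<le> (1 / c) * r (c *\<^sub>R x)"
        using le[of "1 / c" "c *\<^sub>R x"] c x Wclosed by simp
      then have "c * r x \<le> r (c *\<^sub>R x)" using c by (simp add: field_simps)
      then show ?thesis using le[OF c x] by simp
    qed
    moreover have rq: "r x \<le> q x" if "x \<in> W" for x using rle[OF that, of 0] by simp
    ultimately have "r \<in> Q" using Q(2)[OF qQ] by (force simp: Q_def sublinear_on_def r_def)
    moreover have "P q r" using rq qQ by (auto simp: P_def Q_def r_def)
    ultimately have "r = q" by (rule min)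
    then show ?thesis using rle[OF x, of 1] by simp
  qed
  have gadd: "q (x + y) = q x + q y" if "x \<in> W" "y \<in> W" for x y
    using superadd[OF that] add[OF q that] by simp
  have neg: "q (- x) = - q x" if "x \<in> W" for x
    using gadd[of x "- x"] that Wclosed sublinear_on_zero[OF W q] by simp
  have "q (t *\<^sub>R x) = t * q x" if x: "x \<in> W" for t x
  proof (cases "0 \<le> t")
    case False
    have "q (t *\<^sub>R x) = q (- ((- t) *\<^sub>R x))" by simp
    also have "\<dots> = - q ((- t) *\<^sub>R x)" using x Wclosed by (intro neg) blast
    also have "\<dots> = t * q x" using hom[OF q x, of "- t"] False by simp
    finally show ?thesis .
  qed (use hom[OF q x] in blast)
  then show thesis using that[of q] gadd Q(2)[OF qQ] by blast
qed

section \<open>Fourier coefficients\<close>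

lemma has_integral_cis:
  "((\<lambda>t. cis (of_int k * t)) has_integral (if k = 0 then 2 * complex_of_real pi else 0)) {0..2 * pi}"
proof (cases "k = 0")
  case True
  then show ?thesis using has_integral_const_real[of "1::complex" 0 "2 * pi"]
    by (simp add: scaleR_conv_of_real)
next
  case False
  define F where "F t = cis (of_int k * t) / (\<i> * of_int k)" for t
  have "(F has_vector_derivative cis (of_int k * t)) (at t within {0..2 * pi})" for t
    unfolding F_def cis_conv_exp using False
    by (auto intro!: derivative_eq_intros has_vector_derivative_real_field simp: field_simps)
  then have "((\<lambda>t. cis (of_int k * t)) has_integral F (2 * pi) - F 0) {0..2 * pi}"
    by (intro fundamental_theorem_of_calculus) auto
  moreover have "cis (of_int k * (2 * pi)) = 1"
    using cis_multiple_2pi[of "of_int k"] by (simp add: mult.commute mult.left_commute)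
  ultimately show ?thesis using False by (simp add: F_def)
qed

text \<open>Termwise integration of an absolutely convergent trigonometric series.\<close>

lemma has_integral_Fourier_coefficient:
  fixes a :: "int \<Rightarrow> complex"
  assumes a: "(\<lambda>n. norm (a n)) summable_on UNIV"
    and f: "\<And>t. ((\<lambda>n. a n * cis (of_int n * t)) has_sum f t) UNIV"
  shows "((\<lambda>t. f t * cis (- (of_int k * t))) has_integral 2 * pi * a k) {0..2 * pi}"
proof -
  let ?g = "\<lambda>n t. a n * cis (of_int (n - k) * t)"
  have eq: "a n * cis (of_int n * t) * cis (- (of_int k * t)) = ?g n t" for n t
    by (simp add: cis_mult mult.assoc left_diff_distrib)
  have hs: "((\<lambda>n. ?g n t) has_sum f t * cis (- (of_int k * t))) UNIV" for t
    using has_sum_cmult_left[OF f[of t], of "cis (- (of_int k * t))"] by (simp add: eq)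
  have u: "uniform_limit {0..2 * pi} (\<lambda>X t. \<Sum>n\<in>X. ?g n t) (\<lambda>t. f t * cis (- (of_int k * t)))
      (finite_subsets_at_top UNIV)"
    by (rule Weierstrass_m_test_general'[OF _ hs a]) (simp add: norm_mult)
  have c: "continuous_on {0..2 * pi} (\<lambda>t. \<Sum>n\<in>X. ?g n t)" for X
    by (intro continuous_intros)
  obtain I J where I: "\<And>X. ((\<lambda>t. \<Sum>n\<in>X. ?g n t) has_integral I X) {0..2 * pi}"
    and J: "((\<lambda>t. f t * cis (- (of_int k * t))) has_integral J) {0..2 * pi}"
    and lim: "(I \<longlongrightarrow> J) (finite_subsets_at_top UNIV)"
    by (rule uniform_limit_integral[OF u c finite_subsets_at_top_neq_bot]) blast
  have "I X = 2 * pi * a k" if "finite X" "k \<in> X" for X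
  proof -
    have "((\<lambda>t. \<Sum>n\<in>X. ?g n t) has_integral
        (\<Sum>n\<in>X. a n * (if n - k = 0 then 2 * complex_of_real pi else 0))) {0..2 * pi}"
      by (intro has_integral_sum has_integral_mult_right has_integral_cis that)
    moreover have "(\<Sum>n\<in>X. a n * (if n - k = 0 then 2 * complex_of_real pi else 0))
        = (\<Sum>n\<in>X. if n = k then 2 * complex_of_real pi * a k else 0)"
      by (intro sum.cong) auto
    ultimately show ?thesis using I[of X] that by (simp add: has_integral_unique)
  qed
  then have "eventually (\<lambda>X. I X = 2 * pi * a k) (finite_subsets_at_top UNIV)"
    unfolding eventually_finite_subsets_at_top by (intro exI[of _ "{k}"]) auto
  then have "(I \<longlongrightarrow> 2 * pi * a k) (finite_subsets_at_top UNIV)"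
    by (simp add: tendsto_eventually)
  then have "J = 2 * pi * a k"
    using tendsto_unique[OF _ lim] finite_subsets_at_top_neq_bot by blast
  then show ?thesis using J by simp
qed

section \<open>Resolvents outside the spectrum\<close>

text \<open>The spectral variable is \<open>1 / z\<close>: the condition says that the spectrum lies in the open unit disc,
  and the resolvent below has the Taylor series \<open>\<Sum>n. z\<^sup>n X\<^sup>n\<close>.\<close>

definition spectrum_in_disc :: "'h::chilbert_space bop \<Rightarrow> bool"
  where "spectrum_in_disc X \<longleftrightarrow> (\<forall>z. cmod z \<le> 1 \<longrightarrow> bop_invertible (1 - z *\<^sub>C X))"

definition resolvent :: "'h::chilbert_space bop \<Rightarrow> complex \<Rightarrow> 'h bop"
  where "resolvent X z = bop_inv (1 - z *\<^sub>C X)"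

lemma resolvent_mult:
  assumes "bop_invertible (1 - z *\<^sub>C X)"
  shows "resolvent X z * (1 - z *\<^sub>C X) = 1" "(1 - z *\<^sub>C X) * resolvent X z = 1"
  using bop_inv_mult[OF assms] by (auto simp: resolvent_def)

lemma resolvent_identity:
  fixes X :: "'a::chilbert_space bop"
  assumes "bop_invertible (1 - z *\<^sub>C X)" "bop_invertible (1 - a *\<^sub>C X)"
  shows "resolvent X z - resolvent X a = (z - a) *\<^sub>C (resolvent X z * X * resolvent X a)"
proof -
  have "V * (A - B) * W = V * (A * W) - (V * B) * W" for V A B W :: "'a bop"
    by (simp add: right_diff_distrib left_diff_distrib mult.assoc)
  then have "resolvent X z * ((1 - a *\<^sub>C X) - (1 - z *\<^sub>C X)) * resolvent X a = resolvent X z - resolvent X a"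
    by (simp only: resolvent_mult[OF assms(1)] resolvent_mult[OF assms(2)] mult_1_left mult_1_right)
  moreover have "(1 - a *\<^sub>C X) - (1 - z *\<^sub>C X) = (z - a) *\<^sub>C X"
    by (rule bop_eqI) (simp add: scaleC_add_left scaleC_minus_left flip: diff_conv_add_uminus
        scaleC_add_left[of z "- a", simplified])
  ultimately show ?thesis by (simp add: bop_scaleC_mult_left bop_scaleC_mult_right)
qed

text \<open>Factor \<open>1 - z X = (1 - (z - a) X W) (1 - a X)\<close> with \<open>W = (1 - a X)\<^sup>-\<^sup>1\<close>; near \<open>a\<close> the first factor is
  inverted by a Neumann series.\<close>

lemma resolvent_local:
  fixes X :: "'h::chilbert_space bop"
  assumes a: "bop_invertible (1 - a *\<^sub>C X)"
  obtains d where "0 < d" "\<And>z. cmod (z - a) < d \<Longrightarrow>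
    bop_invertible (1 - z *\<^sub>C X) \<and> norm (resolvent X z) \<le> 2 * norm (resolvent X a)"
proof -
  define W where "W = resolvent X a"
  \<comment> \<open>The factor \<open>2\<close> makes \<open>\<parallel>(z - a) X W\<parallel>\<close> at most \<open>1/2\<close>.\<close>
  define d where "d = 1 / (2 * (norm (X * W) + 1))"
  have d: "0 < d" by (simp add: d_def add_nonneg_pos)
  have "bop_invertible (1 - z *\<^sub>C X) \<and> norm (resolvent X z) \<le> 2 * norm W" if z: "cmod (z - a) < d" for z
  proof -
    define Y where "Y = (z - a) *\<^sub>C (X * W)"
    have "norm Y \<le> d * norm (X * W)"
      unfolding Y_def norm_bop_scaleC using z by (intro mult_right_mono) auto
    also have "\<dots> = norm (X * W) / (2 * (norm (X * W) + 1))" by (simp add: d_def)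
    also have "\<dots> \<le> 1 / 2" by (subst pos_divide_le_eq) (auto simp: add_nonneg_pos)
    finally have Y: "norm Y \<le> 1 / 2" .
    then have Yi: "bop_invertible (1 - Y)" "norm (bop_inv (1 - Y)) \<le> 1 / (1 - norm Y)"
      using Neumann_bound[of Y] by auto
    have aW: "W * (1 - a *\<^sub>C X) = 1" "(1 - a *\<^sub>C X) * W = 1"
      using resolvent_mult[OF a] by (auto simp: W_def)
    have "(1 - Y) * (1 - a *\<^sub>C X) = (1 - a *\<^sub>C X) - (z - a) *\<^sub>C (X * (W * (1 - a *\<^sub>C X)))"
      by (simp only: Y_def left_diff_distrib mult_1_left bop_scaleC_mult_left mult.assoc)
    also have "\<dots> = 1 - z *\<^sub>C X" unfolding aW
      by (rule bop_eqI) (simp add: scaleC_add_left[of z "-a", simplified] scaleC_minus_left)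
    finally have f: "1 - z *\<^sub>C X = (1 - Y) * (1 - a *\<^sub>C X)" by simp
    have inv: "(W * bop_inv (1 - Y)) * (1 - z *\<^sub>C X) = 1" "(1 - z *\<^sub>C X) * (W * bop_inv (1 - Y)) = 1"
      unfolding f using aW bop_inv_mult[OF Yi(1)]
      by (metis mult.assoc mult.left_neutral)+
    have "norm (resolvent X z) = norm (W * bop_inv (1 - Y))"
      unfolding resolvent_def bop_inv_eqI[OF inv] ..
    also have "\<dots> \<le> norm W * norm (bop_inv (1 - Y))" by (rule norm_mult_ineq)
    also have "\<dots> \<le> norm W * 2"
    proof (rule mult_left_mono)
      have "1 / (1 - norm Y) \<le> 1 / (1 / 2)" using Y by (intro divide_left_mono) auto
      then show "norm (bop_inv (1 - Y)) \<le> 2" using Yi(2) by simp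
    qed simp
    finally show ?thesis using inv unfolding bop_invertible_def by (auto simp: mult.commute)
  qed
  then show thesis using that d unfolding W_def by blast
qed

lemma open_resolvent_set: "open {z. bop_invertible (1 - z *\<^sub>C X)}"
  unfolding open_dist using resolvent_local[of _ X] by (metis dist_norm mem_Collect_eq)

lemma isCont_resolvent:
  fixes X :: "'h::chilbert_space bop"
  assumes a: "bop_invertible (1 - a *\<^sub>C X)"
  shows "isCont (resolvent X) a"
proof -
  obtain d where d: "0 < d" "\<And>z. cmod (z - a) < d \<Longrightarrow>
      bop_invertible (1 - z *\<^sub>C X) \<and> norm (resolvent X z) \<le> 2 * norm (resolvent X a)"
    using resolvent_local[OF a] by blast
  define C where "C = 2 * norm (resolvent X a) * norm X * norm (resolvent X a)"
  have "norm (resolvent X z - resolvent X a) \<le> cmod (z - a) * C" if "cmod (z - a) < d" for z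
  proof -
    have "norm (resolvent X z - resolvent X a)
        = cmod (z - a) * norm (resolvent X z * X * resolvent X a)"
      using resolvent_identity[of z X a] d(2)[OF that] a by (simp add: norm_bop_scaleC)
    also have "norm (resolvent X z * X * resolvent X a) \<le> norm (resolvent X z) * norm X * norm (resolvent X a)"
      by (meson mult_right_mono norm_ge_zero norm_mult_ineq order_trans)
    also have "\<dots> \<le> C" unfolding C_def using d(2)[OF that] by (intro mult_right_mono) auto
    finally show ?thesis by (simp add: mult_left_mono)
  qed
  then have ev: "eventually (\<lambda>z. norm (resolvent X z - resolvent X a) \<le> cmod (z - a) * C) (at a)"
    unfolding eventually_at using d(1) by (auto simp: dist_norm)
  have "((\<lambda>z. cmod (z - a) * C) \<longlongrightarrow> cmod (a - a) * C) (at a)" by (intro tendsto_intros)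
  then have "((\<lambda>z. resolvent X z - resolvent X a) \<longlongrightarrow> 0) (at a)"
    using Lim_null_comparison[OF ev] by simp
  then show ?thesis unfolding isCont_def by (rule LIM_zero_cancel)
qed

lemma holomorphic_resolvent:
  "(\<lambda>z. cinner (bop_apply (resolvent X z) x) y) holomorphic_on {z. bop_invertible (1 - z *\<^sub>C X)}"
proof (rule holomorphic_onI)
  fix a assume "a \<in> {z. bop_invertible (1 - z *\<^sub>C X)}"
  then have a: "bop_invertible (1 - a *\<^sub>C X)" by simp
  let ?f = "\<lambda>z. cinner (bop_apply (resolvent X z) x) y"
  let ?u = "bop_apply X (bop_apply (resolvent X a) x)"
  have "((\<lambda>z. cinner (bop_apply (resolvent X z) ?u) y) \<longlongrightarrow> cinner (bop_apply (resolvent X a) ?u) y) (at a)"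
    using isCont_resolvent[OF a] unfolding isCont_def by (intro tendsto_intros)
  moreover have "eventually (\<lambda>z. cinner (bop_apply (resolvent X z) ?u) y = (?f z - ?f a) / (z - a)) (at a)"
  proof -
    have "eventually (\<lambda>z. z \<in> {z. bop_invertible (1 - z *\<^sub>C X)} \<and> z \<noteq> a) (at a)"
      using open_resolvent_set[of X] a by (intro eventually_conj eventually_at_in_open') (auto simp: eventually_at_filter)
    then show ?thesis
    proof (rule eventually_mono)
      fix z assume z: "z \<in> {z. bop_invertible (1 - z *\<^sub>C X)} \<and> z \<noteq> a"
      have "?f z - ?f a = cinner (bop_apply (resolvent X z - resolvent X a) x) y"
        by (simp add: cinner_simps)
      also have "\<dots> = (z - a) * cinner (bop_apply (resolvent X z) ?u) y"
        using resolvent_identity[of z X a] z a by (simp add: cinner_simps)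
      finally show "cinner (bop_apply (resolvent X z) ?u) y = (?f z - ?f a) / (z - a)" using z by simp
    qed
  qed
  ultimately have "((\<lambda>z. (?f z - ?f a) / (z - a)) \<longlongrightarrow> cinner (bop_apply (resolvent X a) ?u) y) (at a)"
    by (rule Lim_transform_eventually)
  then have "(?f has_field_derivative cinner (bop_apply (resolvent X a) ?u) y) (at a)"
    by (simp add: has_field_derivative_iff)
  then show "?f field_differentiable at a within {z. bop_invertible (1 - z *\<^sub>C X)}"
    using field_differentiable_at_within field_differentiable_def by blast
qed

text \<open>Cauchy's estimate for the scalar functions \<open>\<langle>(1 - z X)\<^sup>-\<^sup>1 x, y\<rangle>\<close>, whose Taylor coefficients
  are \<open>\<langle>X\<^sup>n x, y\<rangle>\<close>, on a disc of radius larger than one.\<close>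

lemma spectrum_in_disc_power_bound:
  fixes X :: "'h::chilbert_space bop"
  assumes X: "spectrum_in_disc X"
  obtains M q where "0 \<le> M" "0 < q" "q < 1" "\<And>n. norm (X ^ n) \<le> M * q ^ n"
proof -
  let ?S = "{z. bop_invertible (1 - z *\<^sub>C X)}"
  have "cball 0 1 \<subseteq> ?S" using X by (auto simp: spectrum_in_disc_def)
  then obtain e where e: "0 < e" "(\<Union>x\<in>cball 0 1. cball x e) \<subseteq> ?S"
    using compact_subset_open_imp_cball_epsilon_subset[OF compact_cball open_resolvent_set] by metis
  define r where "r = 1 + e"
  have r: "0 < r" "1 < r" using e by (auto simp: r_def)
  have S: "cball 0 r \<subseteq> ?S"
  proof
    fix z :: complex assume z: "z \<in> cball 0 r"
    have "\<exists>w. cmod w \<le> 1 \<and> dist w z \<le> e"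
    proof (cases "cmod z \<le> 1")
      case True
      then show ?thesis using e by (intro exI[of _ z]) auto
    next
      case False
      have "cmod z *\<^sub>R sgn z = z" using False by (cases "z = 0") (auto simp: sgn_div_norm)
      then have "(1 - cmod z) *\<^sub>R sgn z = sgn z - z" by (simp add: scaleR_diff_left)
      then have "dist (sgn z) z = cmod ((1 - cmod z) *\<^sub>R sgn z)"
        by (simp only: dist_norm)
      also have "\<dots> = cmod z - 1" using False by (auto simp: norm_sgn)
      finally show ?thesis using z False by (intro exI[of _ "sgn z"]) (auto simp: norm_sgn r_def)
    qed
    then show "z \<in> ?S" using e(2) by (force simp: subset_iff)
  qed
  have "continuous_on (cball 0 r) (resolvent X)"
    using S isCont_resolvent[of _ X] by (intro continuous_at_imp_continuous_on) blast
  then have "bounded (resolvent X ` cball 0 r)"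
    by (intro compact_imp_bounded compact_continuous_image compact_cball)
  then obtain M where "\<forall>w\<in>resolvent X ` cball 0 r. norm w \<le> M"
    unfolding bounded_iff by blast
  then have M: "norm (resolvent X z) \<le> M" if "cmod z \<le> r" for z using that by simp
  have M0: "0 \<le> M" using order_trans[OF norm_ge_zero M[of 0]] r by simp
  define \<phi> where "\<phi> x y = (\<lambda>z. cinner (bop_apply (resolvent X z) x) y)" for x y
  have hol: "\<phi> x y holomorphic_on ?S" for x y
    unfolding \<phi>_def by (rule holomorphic_resolvent)
  have exp: "\<phi> x y has_fps_expansion fps_expansion (\<phi> x y) 0" for x y
    by (rule has_fps_expansion_fps_expansion[of "ball 0 r"])
       (use r in \<open>auto intro!: holomorphic_on_subset[OF hol] order_trans[OF ball_subset_cball S]\<close>)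
  have rec: "fps_expansion (\<phi> x y) 0 = fps_const (cinner x y) + fps_X * fps_expansion (\<phi> (bop_apply X x) y) 0"
    for x y
  proof (rule fps_expansion_eqI)
    have e: "(\<lambda>z. cinner x y + z * \<phi> (bop_apply X x) y z) has_fps_expansion
        fps_const (cinner x y) + fps_X * fps_expansion (\<phi> (bop_apply X x) y) 0"
      by (intro fps_expansion_intros exp)
    have "cinner x y + z * \<phi> (bop_apply X x) y z = \<phi> x y z" if "z \<in> cball 0 r" for z
    proof -
      have "resolvent X z * (1 - z *\<^sub>C X) = 1" using S that by (intro resolvent_mult) auto
      then have "bop_apply (resolvent X z) x = x + z *\<^sub>C bop_apply (resolvent X z) (bop_apply X x)"
        by (metis (no_types, lifting) bop_apply_simps(3,4,5,8) bop_lin(2,5) diff_add_cancel)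
      then show ?thesis by (metis \<phi>_def cinner_add_left cinner_scaleC_left)
    qed
    moreover have "eventually (\<lambda>z. z \<in> ball 0 r) (nhds (0::complex))"
      using r by (intro eventually_nhds_in_open) auto
    ultimately have "eventually (\<lambda>z. cinner x y + z * \<phi> (bop_apply X x) y z = \<phi> x y z) (nhds 0)"
      by (elim eventually_mono) auto
    then show "\<phi> x y has_fps_expansion
        fps_const (cinner x y) + fps_X * fps_expansion (\<phi> (bop_apply X x) y) 0"
      using has_fps_expansion_cong[THEN iffD1, OF _ refl e] by blast
  qed
  have nth: "fps_nth (fps_expansion (\<phi> x y) 0) n = cinner (bop_apply (X ^ n) x) y" for n x y
  proof (induction n arbitrary: x)
    case 0
    show ?case by (subst rec) simp
  next
    case (Suc n)
    have "fps_nth (fps_expansion (\<phi> x y) 0) (Suc n) = fps_nth (fps_expansion (\<phi> (bop_apply X x) y) 0) n"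
      by (subst rec) simp
    then show ?case using Suc by (simp add: power_commutes flip: bop_apply_ring(3))
  qed
  have bound: "cmod (cinner (bop_apply (X ^ n) x) y) \<le> M * norm x * norm y / r ^ n" for n x y
  proof -
    have "cmod ((deriv ^^ n) (\<phi> x y) 0) \<le> fact n * (M * norm x * norm y) / r ^ n"
    proof (rule Cauchy_inequality)
      show "\<phi> x y holomorphic_on ball 0 r" "continuous_on (cball 0 r) (\<phi> x y)"
        using S by (auto intro!: holomorphic_on_subset[OF hol] holomorphic_on_imp_continuous_on
            order_trans[OF ball_subset_cball S])
      fix z assume "cmod (0 - z) = r"
      then have z: "cmod z \<le> r" by simp
      have "cmod (\<phi> x y z) \<le> norm (bop_apply (resolvent X z) x) * norm y"
        unfolding \<phi>_def by (rule cinner_Cauchy_Schwarz)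
      also have "\<dots> \<le> norm (resolvent X z) * norm x * norm y"
        by (intro mult_right_mono norm_bop_apply) auto
      also have "\<dots> \<le> M * norm x * norm y" by (intro mult_right_mono M z) auto
      finally show "cmod (\<phi> x y z) \<le> M * norm x * norm y" .
    qed (rule r)
    then show ?thesis
      by (simp add: fps_expansion_def norm_divide field_simps flip: nth)
  qed
  have "norm (X ^ n) \<le> M * (1 / r) ^ n" for n
  proof (rule norm_bop_le)
    fix x
    let ?y = "bop_apply (X ^ n) x"
    have "(norm ?y)\<^sup>2 \<le> M * norm x * norm ?y / r ^ n"
      using bound[of n x ?y] by (simp add: cinner_self norm_power)
    then have "norm ?y * norm ?y \<le> norm ?y * (M * (1 / r) ^ n * norm x)"
      by (simp add: power2_eq_square field_simps)
    then show "norm ?y \<le> M * (1 / r) ^ n * norm x"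
      using M0 r by (cases "?y = 0") (auto simp: mult_le_cancel_left)
  qed (use M0 r in simp)
  then show thesis using that[of M "1 / r"] M0 r by simp
qed

lemma power_scaleC: "(z *\<^sub>C X) ^ n = z ^ n *\<^sub>C (X::'h::chilbert_space bop) ^ n"
  by (induction n) (simp_all add: bop_scaleC_mult_left bop_scaleC_mult_right scaleC_scaleC mult.commute)

lemma spectrum_in_disc_summable:
  assumes "spectrum_in_disc X" shows "summable (\<lambda>n. norm (X ^ n))"
proof -
  obtain M q where q: "0 < q" "q < 1" and le: "\<And>n. norm (X ^ n) \<le> M * q ^ n"
    by (rule spectrum_in_disc_power_bound[OF assms]) blast
  have "summable (\<lambda>n. M * q ^ n)" using q by (intro summable_mult summable_geometric) auto
  then show ?thesis by (rule summable_comparison_test'[where N = 0]) (simp add: le)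
qed

lemma resolvent_sums:
  assumes X: "spectrum_in_disc X" and z: "cmod z \<le> 1"
  shows "(\<lambda>n. z ^ n *\<^sub>C X ^ n) sums resolvent X z"
proof -
  have s: "summable (\<lambda>n. norm ((z *\<^sub>C X) ^ n))"
  proof (rule summable_comparison_test'[OF spectrum_in_disc_summable[OF X], of 0])
    fix n
    show "norm (norm ((z *\<^sub>C X) ^ n)) \<le> norm (X ^ n)"
      using z by (simp add: power_scaleC norm_bop_scaleC norm_power mult_left_le_one_le power_le_one)
  qed
  have "resolvent X z = (\<Sum>n. (z *\<^sub>C X) ^ n)"
    unfolding resolvent_def by (rule bop_inv_eqI) (rule Neumann_sums[OF s])+
  then show ?thesis using summable_sums[OF summable_norm_cancel[OF s]] by (simp add: power_scaleC)
qed

lemma continuous_on_resolvent: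
  assumes "spectrum_in_disc X" "continuous_on S g" "\<And>t. t \<in> S \<Longrightarrow> cmod (g t) \<le> 1"
  shows "continuous_on S (\<lambda>t. resolvent X (g t))"
proof -
  have "continuous_on (g ` S) (resolvent X)"
    using assms isCont_resolvent[of _ X]
    by (intro continuous_at_imp_continuous_on) (auto simp: spectrum_in_disc_def)
  then show ?thesis using assms(2) continuous_on_compose2 by blast
qed

section \<open>Laurent expansions on the annulus\<close>

lemma open_annulus: "open (annulus R)"
  unfolding annulus_def by (intro open_Collect_conj open_Collect_less continuous_intros)

lemma closure_annulus:
  assumes R: "R > 1"
  shows "closure (annulus R) = {z. 1 / R \<le> cmod z \<and> cmod z \<le> R}"
proof
  have "closed {z. 1 / R \<le> cmod z \<and> cmod z \<le> R}"
    by (intro closed_Collect_conj closed_Collect_le continuous_intros)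
  then show "closure (annulus R) \<subseteq> {z. 1 / R \<le> cmod z \<and> cmod z \<le> R}"
    by (intro closure_minimal) (auto simp: annulus_def)
  show "{z. 1 / R \<le> cmod z \<and> cmod z \<le> R} \<subseteq> closure (annulus R)"
  proof
    fix z assume z: "z \<in> {z. 1 / R \<le> cmod z \<and> cmod z \<le> R}"
    have R': "1 / R < R" "0 < 1 / R" using R by (auto simp: field_simps) (smt (verit) mult_less_cancel_left2)
    then have "z \<noteq> 0" using z by auto
    then have zs: "z = complex_of_real (cmod z) * sgn z" by (simp add: sgn_div_norm scaleR_conv_of_real)
    have "cmod z \<in> closure {1 / R<..<R}" using z R' by simp
    then have "complex_of_real (cmod z) * sgn z \<in> (\<lambda>t. complex_of_real t * sgn z) ` closure {1 / R<..<R}"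
      by blast
    also have "\<dots> \<subseteq> closure ((\<lambda>t. complex_of_real t * sgn z) ` {1 / R<..<R})"
      by (intro continuous_image_closure_subset[of UNIV] continuous_intros) auto
    also have "\<dots> \<subseteq> closure (annulus R)"
    proof (rule closure_mono, safe)
      fix t assume "t \<in> {1 / R<..<R}"
      then have t: "1 / R < t" "t < R" by auto
      have "0 < t" using t(1) R'(2) by linarith
      then show "complex_of_real t * sgn z \<in> annulus R"
        using \<open>z \<noteq> 0\<close> t by (simp add: annulus_def norm_mult norm_sgn)
    qed
    finally show "z \<in> closure (annulus R)" using zs by simp
  qed
qed

lemma sphere_annulus: "1 / R < r \<Longrightarrow> r < R \<Longrightarrow> sphere 0 r \<subseteq> annulus R"
  by (auto simp: annulus_def)

lemma circle_integral_independent: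
  assumes g: "g holomorphic_on annulus R" and r: "0 < r" "1 / R < r" "r < R" "0 < r'" "1 / R < r'" "r' < R"
  shows "contour_integral (circlepath 0 r) g = contour_integral (circlepath 0 r') g"
proof (rule Cauchy_theorem_homotopic_loops[OF _ open_annulus g])
  show "homotopic_loops (annulus R) (circlepath 0 r) (circlepath 0 r')"
  proof (rule homotopic_loops_linear)
    fix t :: real
    define w where "w = exp (2 * complex_of_real pi * \<i> * complex_of_real t)"
    have w: "cmod w = 1" unfolding w_def by simp
    have "closed_segment (complex_of_real r * w) (complex_of_real r' * w) \<subseteq> annulus R"
    proof
      fix z assume "z \<in> closed_segment (complex_of_real r * w) (complex_of_real r' * w)"
      then obtain u where u: "0 \<le> u" "u \<le> 1" "z = (1 - u) *\<^sub>R (complex_of_real r * w) + u *\<^sub>R (complex_of_real r' * w)"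
        by (auto simp: closed_segment_def)
      define s where "s = (1 - u) * r + u * r'"
      have "z = complex_of_real s * w" by (simp add: u s_def scaleR_conv_of_real algebra_simps)
      have "s \<in> {1 / R<..<R}"
        using convexD_alt[OF convex_real_interval(8), of r "1 / R" R r' u] u r by (simp add: s_def)
      moreover have "0 < s"
        using convexD_alt[OF convex_real_interval(3), of r 0 r' u] u r by (simp add: s_def)
      ultimately show "z \<in> annulus R"
        using \<open>z = complex_of_real s * w\<close> w by (simp add: annulus_def norm_mult)
    qed
    then show "closed_segment (circlepath 0 r t) (circlepath 0 r' t) \<subseteq> annulus R"
      by (simp add: circlepath w_def)
  qed auto
qed auto

text \<open>Termwise integration of \<open>k / (1 - q)\<close> as a geometric series. With \<open>q = z / u\<close> on a circle
  outside \<open>z\<close> and \<open>q = u / z\<close> on a circle inside it, this expands the two Cauchy kernels.\<close>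

lemma circle_geometric_sums:
  assumes r: "0 < r" and k: "continuous_on (sphere 0 r) k" and q: "continuous_on (sphere 0 r) q"
    and c: "0 \<le> c" "c < 1" "\<And>u. cmod u = r \<Longrightarrow> cmod (q u) \<le> c"
  shows "(\<lambda>n. contour_integral (circlepath 0 r) (\<lambda>u. k u * q u ^ n)) sums
      contour_integral (circlepath 0 r) (\<lambda>u. k u / (1 - q u))" (is "?I sums ?J")
    and "summable (\<lambda>n. norm (contour_integral (circlepath 0 r) (\<lambda>u. k u * q u ^ n)))"
proof -
  have pi: "path_image (circlepath 0 r) = sphere 0 r" using r by simp
  note intble = contour_integrable_continuous_circlepath[of 0 r, unfolded pi]
  have "bounded (k ` sphere 0 r)" by (intro compact_imp_bounded compact_continuous_image k) simp
  then obtain B where "\<forall>w\<in>k ` sphere 0 r. norm w \<le> B" unfolding bounded_iff by blast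
  then have B: "cmod (k u) \<le> B" if "cmod u = r" for u using that by simp
  have B0: "0 \<le> B" using order_trans[OF norm_ge_zero B[of "complex_of_real r"]] r by simp
  have cI: "continuous_on (sphere 0 r) (\<lambda>u. k u * q u ^ n)" for n by (intro continuous_intros k q)
  have ne: "1 - q u \<noteq> 0" if "cmod u = r" for u using c(3)[OF that] c(2) by auto
  have cJ: "continuous_on (sphere 0 r) (\<lambda>u. k u / (1 - q u))"
    by (intro continuous_intros k q) (use ne in simp)
  have cR: "continuous_on (sphere 0 r) (\<lambda>u. k u * q u ^ n / (1 - q u))" for n
    by (intro continuous_intros k q) (use ne in simp)
  have I: "norm (?I n) \<le> (B * c ^ n) * (2 * pi * r)" for n
  proof (rule has_contour_integral_bound_circlepath[OF has_contour_integral_integral[OF intble[OF cI]] _ r])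
    fix u assume "cmod (u - 0) = r"
    then show "cmod (k u * q u ^ n) \<le> B * c ^ n"
      unfolding norm_mult norm_power using B[of u] c(3)[of u] c(1) B0
      by (intro mult_mono power_mono) auto
  qed (use B0 c in simp)
  have "summable (\<lambda>n. (B * c ^ n) * (2 * pi * r))"
    by (intro summable_mult2 summable_mult summable_geometric) (use c in auto)
  then show "summable (\<lambda>n. norm (?I n))"
    by (rule summable_comparison_test'[where N = 0]) (use I in simp)
  have part: "(\<Sum>n<N. ?I n) = ?J - contour_integral (circlepath 0 r) (\<lambda>u. k u * q u ^ N / (1 - q u))" for N
  proof -
    have "(\<Sum>n<N. ?I n) = contour_integral (circlepath 0 r) (\<lambda>u. \<Sum>n<N. k u * q u ^ n)"
      by (intro contour_integral_sum[symmetric] intble cI) simp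
    also have "\<dots> = contour_integral (circlepath 0 r) (\<lambda>u. k u / (1 - q u) - k u * q u ^ N / (1 - q u))"
    proof (rule contour_integral_eq)
      fix u assume "u \<in> path_image (circlepath 0 r)"
      then have "cmod u = r" unfolding pi by simp
      then have n: "1 - q u \<noteq> 0" by (rule ne)
      have "(\<Sum>n<N. q u ^ n) = (1 - q u ^ N) / (1 - q u)" using n by (simp add: sum_gp_strict)
      then show "(\<Sum>n<N. k u * q u ^ n) = k u / (1 - q u) - k u * q u ^ N / (1 - q u)"
        by (simp add: right_diff_distrib diff_divide_distrib flip: sum_distrib_left)
    qed
    also have "\<dots> = ?J - contour_integral (circlepath 0 r) (\<lambda>u. k u * q u ^ N / (1 - q u))"
      by (intro contour_integral_diff intble cJ cR)
    finally show ?thesis .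
  qed
  have rem: "norm (contour_integral (circlepath 0 r) (\<lambda>u. k u * q u ^ N / (1 - q u)))
      \<le> (B * c ^ N / (1 - c)) * (2 * pi * r)" for N
  proof (rule has_contour_integral_bound_circlepath[OF has_contour_integral_integral[OF intble[OF cR]] _ r])
    fix u assume u: "cmod (u - 0) = r"
    then have "1 - c \<le> cmod (1 - q u)" using norm_triangle_ineq2[of 1 "q u"] c(3)[of u] by simp
    then show "cmod (k u * q u ^ N / (1 - q u)) \<le> B * c ^ N / (1 - c)"
      unfolding norm_mult norm_power norm_divide using B[of u] c(3)[of u] c B0 u
      by (intro frac_le mult_mono power_mono mult_nonneg_nonneg) auto
  qed (use B0 c in simp)
  have "(\<lambda>N. (B * c ^ N / (1 - c)) * (2 * pi * r)) \<longlonglongrightarrow> (B * 0 / (1 - c)) * (2 * pi * r)"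
    by (intro tendsto_intros LIMSEQ_power_zero) (use c in auto)
  then have "(\<lambda>N. contour_integral (circlepath 0 r) (\<lambda>u. k u * q u ^ N / (1 - q u))) \<longlonglongrightarrow> 0"
    by (intro Lim_null_comparison[OF always_eventually[OF allI[OF rem]]]) simp
  from tendsto_diff[OF tendsto_const this]
  have "(\<lambda>N. ?J - contour_integral (circlepath 0 r) (\<lambda>u. k u * q u ^ N / (1 - q u))) \<longlonglongrightarrow> ?J - 0" .
  then show "?I sums ?J" unfolding sums_def part by simp
qed

text \<open>Cauchy's formula on the annulus follows by comparing the integrals of the holomorphic function
  \<open>(f u - f z) / (u - z)\<close> over two circles on either side of \<open>z\<close>; expanding the two Cauchy kernels
  in geometric series yields the two halves of the Laurent series.\<close>

lemma Laurent_expansion_exists: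
  assumes R: "R > 1" and f: "f holomorphic_on annulus R"
  shows "\<exists>a. \<forall>z\<in>annulus R. ((\<lambda>n::int. a n * z powi n) has_sum f z) UNIV"
proof -
  define a where "a n = contour_integral (circlepath 0 1) (\<lambda>u. f u * u powi (- n - 1)) / (2 * pi * \<i>)" for n
  have nz: "u \<noteq> 0" if "u \<in> annulus R" for u using that R by (auto simp: annulus_def)
  have R1: "1 / R < 1" using R by simp
  have hp: "(\<lambda>u. f u * u powi m) holomorphic_on annulus R" for m
    by (intro holomorphic_intros f) (use nz in auto)
  have a_r: "contour_integral (circlepath 0 r) (\<lambda>u. f u * u powi (- n - 1)) = 2 * pi * \<i> * a n"
    if "0 < r" "1 / R < r" "r < R" for r n
    using circle_integral_independent[OF hp that, of 1 "- n - 1"] R R1 by (simp add: a_def)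
  have "((\<lambda>n. a n * z powi n) has_sum f z) UNIV" if z: "z \<in> annulus R" for z
  proof -
    have zR: "1 / R < cmod z" "cmod z < R" using z by (auto simp: annulus_def)
    obtain r1 where r1: "1 / R < r1" "r1 < cmod z" using dense[OF zR(1)] by blast
    obtain r2 where r2: "cmod z < r2" "r2 < R" using dense[OF zR(2)] by blast
    have Rp: "0 < 1 / R" using R by simp
    have p: "0 < r1" "0 < r2" "r1 < R" "1 / R < r2" "0 < cmod z" using r1 r2 zR Rp by linarith+
    have z0: "z \<noteq> 0" using p by auto
    have s1: "sphere 0 r1 \<subseteq> annulus R" "sphere 0 r2 \<subseteq> annulus R"
      using sphere_annulus[OF r1(1) p(3)] sphere_annulus[OF p(4) r2(2)] by auto
    have cf: "continuous_on (sphere 0 r1) f" "continuous_on (sphere 0 r2) f"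
      using s1 f holomorphic_on_imp_continuous_on holomorphic_on_subset by blast+
    have pi: "path_image (circlepath 0 r1) = sphere 0 r1" "path_image (circlepath 0 r2) = sphere 0 r2"
      using p by auto
    have n1: "u \<noteq> 0" "u - z \<noteq> 0" "z - u \<noteq> 0" if "cmod u = r1" for u using that p r1 by auto
    have n2: "u \<noteq> 0" "u - z \<noteq> 0" if "cmod u = r2" for u using that p r2 by auto
    define J1 J2 where "J1 = contour_integral (circlepath 0 r1) (\<lambda>u. f u / (u - z))"
      "J2 = contour_integral (circlepath 0 r2) (\<lambda>u. f u / (u - z))"
    have i1: "(\<lambda>u. f u / (u - z)) contour_integrable_on circlepath 0 r1"
      "(\<lambda>u. 1 / (u - z)) contour_integrable_on circlepath 0 r1"
      by (rule contour_integrable_continuous_circlepath, unfold pi,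
          intro continuous_intros cf, use n1 in simp)+
    have i2: "(\<lambda>u. f u / (u - z)) contour_integrable_on circlepath 0 r2"
      "(\<lambda>u. 1 / (u - z)) contour_integrable_on circlepath 0 r2"
      by (rule contour_integrable_continuous_circlepath, unfold pi,
          intro continuous_intros cf, use n2 in simp)+
    have Cauchy: "J2 - J1 = 2 * pi * \<i> * f z"
    proof -
      define g where "g = (\<lambda>u. if u = z then deriv f z else (f u - f z) / (u - z))"
      have "g holomorphic_on annulus R" unfolding g_def by (rule pole_lemma_open[OF f open_annulus])
      then have eq: "contour_integral (circlepath 0 r1) g = contour_integral (circlepath 0 r2) g"
        using circle_integral_independent p r1 r2 by blast
      have "contour_integral (circlepath 0 r1) g
          = contour_integral (circlepath 0 r1) (\<lambda>u. f u / (u - z) - f z * (1 / (u - z)))"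
        by (rule contour_integral_eq, unfold pi) (use n1 in \<open>auto simp: g_def diff_divide_distrib\<close>)
      also have "\<dots> = J1 - f z * contour_integral (circlepath 0 r1) (\<lambda>u. 1 / (u - z))"
        by (simp only: J1_J2_def contour_integral_diff[OF i1(1) contour_integrable_lmul[OF i1(2)]]
            contour_integral_lmul[OF i1(2)])
      also have "contour_integral (circlepath 0 r1) (\<lambda>u. 1 / (u - z)) = 0"
      proof (rule contour_integral_unique, rule Cauchy_theorem_disc_simple[of _ 0 "cmod z"])
        show "(\<lambda>u. 1 / (u - z)) holomorphic_on ball 0 (cmod z)"
          by (intro holomorphic_intros) auto
      qed (use p r1 pi in auto)
      finally have e1: "contour_integral (circlepath 0 r1) g = J1" by simp
      have "contour_integral (circlepath 0 r2) g
          = contour_integral (circlepath 0 r2) (\<lambda>u. f u / (u - z) - f z * (1 / (u - z)))"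
        by (rule contour_integral_eq, unfold pi) (use n2 in \<open>auto simp: g_def diff_divide_distrib\<close>)
      also have "\<dots> = J2 - f z * contour_integral (circlepath 0 r2) (\<lambda>u. 1 / (u - z))"
        by (simp only: J1_J2_def contour_integral_diff[OF i2(1) contour_integrable_lmul[OF i2(2)]]
            contour_integral_lmul[OF i2(2)])
      also have "contour_integral (circlepath 0 r2) (\<lambda>u. 1 / (u - z)) = 2 * pi * \<i>"
        using contour_integral_unique[OF Cauchy_integral_circlepath_simple[of "\<lambda>_. 1" 0 r2 z]] r2 by simp
      finally show ?thesis using eq e1 by (simp add: mult.commute)
    qed
    have pos: "(\<lambda>n. 2 * pi * \<i> * (a (int n) * z powi int n)) sums J2"
      "summable (\<lambda>n. norm (2 * pi * \<i> * (a (int n) * z powi int n)))"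
    proof -
      have t: "contour_integral (circlepath 0 r2) (\<lambda>u. f u / u * (z / u) ^ n)
          = 2 * pi * \<i> * (a (int n) * z powi int n)" for n
      proof -
        have "contour_integral (circlepath 0 r2) (\<lambda>u. f u / u * (z / u) ^ n)
            = contour_integral (circlepath 0 r2) (\<lambda>u. z ^ n * (f u * u powi (- int n - 1)))"
          by (rule contour_integral_eq, unfold pi)
             (use n2 in \<open>auto simp: power_divide power_int_diff power_int_minus field_simps\<close>)
        also have "\<dots> = z ^ n * contour_integral (circlepath 0 r2) (\<lambda>u. f u * u powi (- int n - 1))"
          by (rule contour_integral_lmul, rule contour_integrable_continuous_circlepath, unfold pi)
             (intro continuous_intros cf, use n2 in auto)
        finally show ?thesis using a_r[of r2 "int n"] p r2 by (simp add: algebra_simps)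
      qed
      have J: "J2 = contour_integral (circlepath 0 r2) (\<lambda>u. f u / u / (1 - z / u))"
        unfolding J1_J2_def
        by (rule contour_integral_eq, unfold pi) (use n2 in \<open>auto simp: field_simps\<close>)
      have "continuous_on (sphere 0 r2) (\<lambda>u. f u / u)" "continuous_on (sphere 0 r2) (\<lambda>u. z / u)"
        by (intro continuous_intros cf, use n2 in auto)+
      from circle_geometric_sums[OF p(2) this, of "cmod z / r2"]
      show "(\<lambda>n. 2 * pi * \<i> * (a (int n) * z powi int n)) sums J2"
        "summable (\<lambda>n. norm (2 * pi * \<i> * (a (int n) * z powi int n)))"
        unfolding t J using p r2 by (auto simp: norm_divide)
    qed
    have neg: "(\<lambda>n. 2 * pi * \<i> * (a (- int n - 1) * z powi (- int n - 1))) sums (- J1)"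
      "summable (\<lambda>n. norm (2 * pi * \<i> * (a (- int n - 1) * z powi (- int n - 1))))"
    proof -
      have t: "contour_integral (circlepath 0 r1) (\<lambda>u. f u / z * (u / z) ^ n)
          = 2 * pi * \<i> * (a (- int n - 1) * z powi (- int n - 1))" for n
      proof -
        have "contour_integral (circlepath 0 r1) (\<lambda>u. f u / z * (u / z) ^ n)
            = contour_integral (circlepath 0 r1) (\<lambda>u. z powi (- int n - 1) * (f u * u powi (- (- int n - 1) - 1)))"
          by (rule contour_integral_eq, unfold pi)
             (use n1 z0 in \<open>auto simp: power_divide power_int_diff power_int_minus field_simps\<close>)
        also have "\<dots> = z powi (- int n - 1) * contour_integral (circlepath 0 r1) (\<lambda>u. f u * u powi (- (- int n - 1) - 1))"
          by (rule contour_integral_lmul, rule contour_integrable_continuous_circlepath, unfold pi)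
             (intro continuous_intros cf, use n1 in auto)
        also have "\<dots> = z powi (- int n - 1) * (2 * pi * \<i> * a (- int n - 1))"
          using a_r[of r1 "- int n - 1"] p r1 by simp
        finally show ?thesis by (simp add: algebra_simps)
      qed
      have "- J1 = contour_integral (circlepath 0 r1) (\<lambda>u. - (f u / (u - z)))"
        unfolding J1_J2_def by (rule contour_integral_neg[symmetric])
      also have "\<dots> = contour_integral (circlepath 0 r1) (\<lambda>u. f u / z / (1 - u / z))"
        by (rule contour_integral_eq, unfold pi) (use n1 z0 in \<open>auto simp: field_simps\<close>)
      finally have J: "- J1 = contour_integral (circlepath 0 r1) (\<lambda>u. f u / z / (1 - u / z))" .
      have "continuous_on (sphere 0 r1) (\<lambda>u. f u / z)" "continuous_on (sphere 0 r1) (\<lambda>u. u / z)"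
        by (intro continuous_intros cf, use z0 in auto)+
      from circle_geometric_sums[OF p(1) this, of "r1 / cmod z"]
      show "(\<lambda>n. 2 * pi * \<i> * (a (- int n - 1) * z powi (- int n - 1))) sums (- J1)"
        "summable (\<lambda>n. norm (2 * pi * \<i> * (a (- int n - 1) * z powi (- int n - 1))))"
        unfolding t J using p r1 by (auto simp: norm_divide)
    qed
    let ?h = "\<lambda>n. 2 * pi * \<i> * (a n * z powi n)"
    have "((\<lambda>n. ?h (int n)) has_sum J2) UNIV" "((\<lambda>n. ?h (- int n - 1)) has_sum (- J1)) UNIV"
      using pos neg by (auto intro: norm_summable_imp_has_sum)
    then have h: "(?h has_sum J2) (range int)" "(?h has_sum (- J1)) (range (\<lambda>n. - int n - 1))"
      by (subst has_sum_reindex; simp add: inj_on_def o_def)+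
    have "(?h has_sum (J2 + - J1)) (range int \<union> range (\<lambda>n. - int n - 1))"
      by (rule has_sum_Un_disjoint[OF h]) auto
    moreover have "range int \<union> range (\<lambda>n. - int n - 1) = UNIV"
    proof -
      have "n \<in> range int \<union> range (\<lambda>n. - int n - 1)" for n :: int
        by (cases "0 \<le> n") (auto intro: image_eqI[of _ _ "nat n"] image_eqI[of _ _ "nat (- n - 1)"])
      then show ?thesis by blast
    qed
    ultimately have "(?h has_sum (2 * pi * \<i> * f z)) UNIV" using Cauchy by simp
    from has_sum_cmult_right[OF this, of "1 / (2 * pi * \<i>)"] show ?thesis by simp
  qed
  then show ?thesis by blast
qed

lemma Laurent_coefficient_integral:
  fixes a :: "int \<Rightarrow> complex" and r :: real
  assumes a: "\<And>z. z \<in> annulus R \<Longrightarrow> ((\<lambda>n. a n * z powi n) has_sum f z) UNIV"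
    and r: "0 < r" "1 / R < r" "r < R"
  shows "((\<lambda>t. f (r * cis t) * cis (- (of_int k * t))) has_integral complex_of_real (2 * pi) * (a k * r powi k)) {0..2 * pi}"
proof (rule has_integral_Fourier_coefficient[of "\<lambda>n. a n * r powi n"])
  have pw: "(complex_of_real r * cis t) powi n = r powi n * cis (of_int n * t)" for n t
    by (simp add: power_int_mult_distrib cis_power_int)
  have A: "complex_of_real r * cis t \<in> annulus R" for t using r by (simp add: annulus_def norm_mult)
  show hs: "((\<lambda>n. a n * r powi n * cis (of_int n * t)) has_sum f (r * cis t)) UNIV" for t
    using a[OF A[of t]] by (simp add: pw mult.assoc)
  have "(\<lambda>n. a n * r powi n * cis (of_int n * 0)) summable_on UNIV"
    using hs[of 0] has_sum_imp_summable by blast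
  then show "(\<lambda>n. norm (a n * r powi n)) summable_on UNIV"
    by (simp add: summable_on_iff_abs_summable_on_complex)
qed

lemma Laurent_coeffs:
  assumes R: "R > 1" and f: "f holomorphic_on annulus R" and z: "z \<in> annulus R"
  shows "((\<lambda>n. laurent_coeffs R f n * z powi n) has_sum f z) UNIV"
proof -
  have "\<exists>!a. \<forall>z\<in>annulus R. ((\<lambda>n::int. a n * z powi n) has_sum f z) UNIV"
  proof (rule ex_ex1I[OF Laurent_expansion_exists[OF R f]])
    fix a b :: "int \<Rightarrow> complex"
    assume ab: "\<forall>z\<in>annulus R. ((\<lambda>n::int. a n * z powi n) has_sum f z) UNIV"
      "\<forall>z\<in>annulus R. ((\<lambda>n::int. b n * z powi n) has_sum f z) UNIV"
    have h: "((\<lambda>t. f (cis t) * cis (- (of_int k * t))) has_integral complex_of_real (2 * pi) * c k) {0..2 * pi}"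
      if "\<forall>z\<in>annulus R. ((\<lambda>n::int. c n * z powi n) has_sum f z) UNIV" for c k
      using Laurent_coefficient_integral[of R c f 1 k] that R by simp
    have "a k = b k" for k using has_integral_unique[OF h[OF ab(1)] h[OF ab(2)], of k] by simp
    then show "a = b" by auto
  qed
  from theI'[OF this] z show ?thesis unfolding laurent_coeffs_def by blast
qed

text \<open>The mean over a circle of radius \<open>r\<close> depends continuously on \<open>r\<close> up to the boundary and is
  constant in the interior.\<close>

lemma Laurent_constant_coefficient:
  fixes r :: real
  assumes R: "R > 1" and f: "f \<in> annulus_algebra R" and r: "1 / R \<le> r" "r \<le> R"
  shows "((\<lambda>t. f (r * cis t)) has_integral 2 * pi * laurent_coeffs R f 0) {0..2 * pi}"
proof -
  have fh: "f holomorphic_on annulus R" and fc: "continuous_on (closure (annulus R)) f"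
    using f by (auto simp: annulus_algebra_def)
  have RR: "1 / R < R" "0 < 1 / R" using R by (auto simp: field_simps) (smt (verit) mult_less_cancel_left2)
  have in_cl: "complex_of_real r * cis t \<in> closure (annulus R)" if "r \<in> {1 / R..R}" for r t
  proof -
    have "1 / R \<le> r" "r \<le> R" using that by auto
    moreover have "0 < r" using \<open>1 / R \<le> r\<close> RR(2) by linarith
    ultimately show ?thesis by (simp add: closure_annulus[OF R] norm_mult)
  qed
  have "continuous_on ({1 / R..R} \<times> cbox 0 (2 * pi)) (\<lambda>(r, t). f (complex_of_real r * cis t))"
    unfolding case_prod_unfold
    by (rule continuous_on_compose2[OF fc]) (auto intro!: continuous_intros in_cl)
  then have c: "continuous_on {1 / R..R} (\<lambda>r. integral (cbox 0 (2 * pi)) (\<lambda>t. f (complex_of_real r * cis t)))"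
    by (rule integral_continuous_on_param)
  have mean: "integral (cbox 0 (2 * pi)) (\<lambda>t. f (complex_of_real r * cis t)) = complex_of_real (2 * pi) * laurent_coeffs R f 0"
    if "r \<in> {1 / R<..<R}" for r
    using Laurent_coefficient_integral[of R "laurent_coeffs R f" f r 0] Laurent_coeffs[OF R fh] that RR
    by (auto intro!: integral_unique)
  have "integral (cbox 0 (2 * pi)) (\<lambda>t. f (complex_of_real r * cis t)) = complex_of_real (2 * pi) * laurent_coeffs R f 0"
    by (rule continuous_constant_on_closure[where S = "{1 / R<..<R}"
        and f = "\<lambda>r. integral (cbox 0 (2 * pi)) (\<lambda>t. f (complex_of_real r * cis t))"])
       (use c mean r RR(1) in \<open>simp_all add: closure_greaterThanLessThan del: cbox_interval\<close>)
  moreover have "(\<lambda>t. f (complex_of_real r * cis t)) integrable_on {0..2 * pi}"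
    by (intro integrable_continuous_real continuous_on_compose2[OF fc] continuous_intros)
       (use in_cl r in auto)
  ultimately show ?thesis by (simp add: has_integral_iff)
qed

section \<open>Square summable sequences in a Hilbert space\<close>

typedef (overloaded) 'h l2 =
  "{u :: int \<Rightarrow> 'h::chilbert_space. (\<lambda>n. (norm (u n))\<^sup>2) summable_on UNIV}"
  morphisms l2_nth Abs_l2
  by (rule exI[of _ "\<lambda>_. 0"]) simp

setup_lifting type_definition_l2

lemma summable_l2: "(\<lambda>n. (norm (l2_nth u n))\<^sup>2) summable_on UNIV"
  by transfer

lemma l2_eqI: "(\<And>n. l2_nth u n = l2_nth v n) \<Longrightarrow> u = v"
  by transfer blast

lemma square_summable_iff_L2_set:
  fixes u :: "int \<Rightarrow> 'h::real_normed_vector"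
  shows "(\<lambda>n. (norm (u n))\<^sup>2) summable_on UNIV \<longleftrightarrow> (\<exists>K. \<forall>F. finite F \<longrightarrow> L2_set (\<lambda>n. norm (u n)) F \<le> K)"
proof
  assume s: "(\<lambda>n. (norm (u n))\<^sup>2) summable_on UNIV"
  have "L2_set (\<lambda>n. norm (u n)) F \<le> sqrt (\<Sum>\<^sub>\<infinity>n. (norm (u n))\<^sup>2)" if "finite F" for F
    unfolding L2_set_def by (intro real_sqrt_le_mono finite_sum_le_infsum s that) auto
  then show "\<exists>K. \<forall>F. finite F \<longrightarrow> L2_set (\<lambda>n. norm (u n)) F \<le> K" by blast
next
  assume "\<exists>K. \<forall>F. finite F \<longrightarrow> L2_set (\<lambda>n. norm (u n)) F \<le> K"
  then obtain K where K: "\<And>F. finite F \<Longrightarrow> L2_set (\<lambda>n. norm (u n)) F \<le> K" by blast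
  have "(\<Sum>n\<in>F. (norm (u n))\<^sup>2) \<le> K\<^sup>2" if "finite F" for F
  proof -
    have "(L2_set (\<lambda>n. norm (u n)) F)\<^sup>2 \<le> K\<^sup>2" using K[OF that] by (intro power_mono) auto
    then show ?thesis by (simp add: L2_set_def sum_nonneg)
  qed
  then show "(\<lambda>n. (norm (u n))\<^sup>2) summable_on UNIV"
    by (intro nonneg_bdd_above_summable_on) (auto intro!: bdd_aboveI)
qed

lemma square_summable_add:
  fixes u v :: "int \<Rightarrow> 'h::real_normed_vector"
  assumes "(\<lambda>n. (norm (u n))\<^sup>2) summable_on UNIV" "(\<lambda>n. (norm (v n))\<^sup>2) summable_on UNIV"
  shows "(\<lambda>n. (norm (u n + v n))\<^sup>2) summable_on UNIV"
proof -
  obtain K L where KL: "\<And>F. finite F \<Longrightarrow> L2_set (\<lambda>n. norm (u n)) F \<le> K"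
    "\<And>F. finite F \<Longrightarrow> L2_set (\<lambda>n. norm (v n)) F \<le> L"
    using assms unfolding square_summable_iff_L2_set by blast
  have "L2_set (\<lambda>n. norm (u n + v n)) F \<le> K + L" if "finite F" for F
  proof -
    have "L2_set (\<lambda>n. norm (u n + v n)) F \<le> L2_set (\<lambda>n. norm (u n) + norm (v n)) F"
      by (intro L2_set_mono norm_triangle_ineq) auto
    also have "\<dots> \<le> L2_set (\<lambda>n. norm (u n)) F + L2_set (\<lambda>n. norm (v n)) F"
      by (rule L2_set_triangle_ineq)
    finally show ?thesis using KL[OF that] by linarith
  qed
  then show ?thesis unfolding square_summable_iff_L2_set by blast
qed

lemma square_summable_le:
  fixes u :: "int \<Rightarrow> 'h::real_normed_vector" and v :: "int \<Rightarrow> 'k::real_normed_vector"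
  assumes s: "(\<lambda>n. (norm (u n))\<^sup>2) summable_on UNIV" and le: "\<And>n. norm (v n) \<le> C * norm (u n)"
  shows "(\<lambda>n. (norm (v n))\<^sup>2) summable_on UNIV"
proof (rule summable_on_comparison_test)
  show "(\<lambda>n. C\<^sup>2 * (norm (u n))\<^sup>2) summable_on UNIV" by (intro summable_on_cmult_right s)
  show "(norm (v n))\<^sup>2 \<le> C\<^sup>2 * (norm (u n))\<^sup>2" for n
    using power_mono[OF le[of n], of 2] by (simp add: power_mult_distrib)
qed auto

instantiation l2 :: (chilbert_space) complex_vector
begin

lift_definition zero_l2 :: "'a l2" is "\<lambda>_. 0" by simp
lift_definition plus_l2 :: "'a l2 \<Rightarrow> 'a l2 \<Rightarrow> 'a l2" is "\<lambda>u v n. u n + v n"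
  by (rule square_summable_add)
lift_definition uminus_l2 :: "'a l2 \<Rightarrow> 'a l2" is "\<lambda>u n. - u n" by simp
lift_definition minus_l2 :: "'a l2 \<Rightarrow> 'a l2 \<Rightarrow> 'a l2" is "\<lambda>u v n. u n - v n"
  using square_summable_add[of _ "\<lambda>n. - v n" for v] by fastforce
lift_definition scaleR_l2 :: "real \<Rightarrow> 'a l2 \<Rightarrow> 'a l2" is "\<lambda>r u n. r *\<^sub>R u n"
  by (erule square_summable_le) (subst norm_scaleR, rule order_refl)
lift_definition scaleC_l2 :: "complex \<Rightarrow> 'a l2 \<Rightarrow> 'a l2" is "\<lambda>c u n. c *\<^sub>C u n"
  by (erule square_summable_le) (subst norm_scaleC, rule order_refl)

instance
  by standard (transfer, simp add: algebra_simps scaleC_add_right scaleC_add_left scaleC_scaleC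
      scaleR_scaleC[where 'a='a])+

end

lemma l2_nth_simps [simp]:
  "l2_nth 0 n = 0" "l2_nth (u + v) n = l2_nth u n + l2_nth v n" "l2_nth (- u) n = - l2_nth u n"
  "l2_nth (u - v) n = l2_nth u n - l2_nth v n" "l2_nth (r *\<^sub>R u) n = r *\<^sub>R l2_nth u n"
  "l2_nth (c *\<^sub>C u) n = c *\<^sub>C l2_nth u n"
  by (transfer, simp)+

instantiation l2 :: (chilbert_space) real_normed_vector
begin

definition norm_l2 :: "'a l2 \<Rightarrow> real"
  where "norm_l2 u = sqrt (\<Sum>\<^sub>\<infinity>n. (norm (l2_nth u n))\<^sup>2)"
definition dist_l2 :: "'a l2 \<Rightarrow> 'a l2 \<Rightarrow> real"
  where "dist_l2 u v = norm (u - v)"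
definition uniformity_l2 :: "('a l2 \<times> 'a l2) filter"
  where [code del]: "uniformity_l2 = (INF e\<in>{0 <..}. principal {(x, y). dist x y < e})"
definition open_l2 :: "'a l2 set \<Rightarrow> bool"
  where [code del]: "open_l2 S = (\<forall>x\<in>S. \<forall>\<^sub>F (x', y) in uniformity. x' = x \<longrightarrow> y \<in> S)"
definition sgn_l2 :: "'a l2 \<Rightarrow> 'a l2"
  where "sgn_l2 x = scaleR (inverse (norm x)) x"

lemma L2_set_le_norm_l2: "finite F \<Longrightarrow> L2_set (\<lambda>n. norm (l2_nth u n)) F \<le> norm u"
  unfolding L2_set_def norm_l2_def by (intro real_sqrt_le_mono finite_sum_le_infsum summable_l2) auto

lemma norm_l2_le:
  assumes "\<And>F. finite F \<Longrightarrow> L2_set (\<lambda>n. norm (l2_nth u n)) F \<le> K" shows "norm u \<le> K"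
proof -
  have K: "0 \<le> K" using assms[of "{}"] by simp
  have "(\<Sum>\<^sub>\<infinity>n. (norm (l2_nth u n))\<^sup>2) \<le> K\<^sup>2"
  proof (rule infsum_le_finite_sums[OF summable_l2])
    fix F :: "int set" assume F: "finite F"
    have "(L2_set (\<lambda>n. norm (l2_nth u n)) F)\<^sup>2 \<le> K\<^sup>2" using assms[OF F] by (intro power_mono) auto
    then show "(\<Sum>n\<in>F. (norm (l2_nth u n))\<^sup>2) \<le> K\<^sup>2" by (simp add: L2_set_def sum_nonneg)
  qed
  then show ?thesis unfolding norm_l2_def using K real_sqrt_le_mono by fastforce
qed

lemma norm_l2_nth: "norm (l2_nth u n) \<le> norm u"
  using L2_set_le_norm_l2[of "{n}" u] by (simp add: L2_set_def)

instance
proof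
  fix u v :: "'a l2" and r :: real
  show "dist u v = norm (u - v)" by (rule dist_l2_def)
  show "sgn u = inverse (norm u) *\<^sub>R u" by (rule sgn_l2_def)
  show "(uniformity :: ('a l2 \<times> 'a l2) filter) = (INF e\<in>{0 <..}. principal {(x, y). dist x y < e})"
    by (rule uniformity_l2_def)
  show "open S = (\<forall>x\<in>S. \<forall>\<^sub>F (x', y) in uniformity. x' = x \<longrightarrow> y \<in> S)" for S :: "'a l2 set"
    by (rule open_l2_def)
  show "norm u = 0 \<longleftrightarrow> u = 0"
  proof
    assume "norm u = 0"
    then have "l2_nth u n = 0" for n using norm_l2_nth[of u n] by simp
    then show "u = 0" by (intro l2_eqI) simp
  qed (simp add: norm_l2_def)
  show "norm (u + v) \<le> norm u + norm v"
  proof (rule norm_l2_le)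
    fix F :: "int set" assume F: "finite F"
    have "L2_set (\<lambda>n. norm (l2_nth (u + v) n)) F \<le> L2_set (\<lambda>n. norm (l2_nth u n) + norm (l2_nth v n)) F"
      by (intro L2_set_mono) (auto intro: norm_triangle_ineq)
    also have "\<dots> \<le> L2_set (\<lambda>n. norm (l2_nth u n)) F + L2_set (\<lambda>n. norm (l2_nth v n)) F"
      by (rule L2_set_triangle_ineq)
    finally show "L2_set (\<lambda>n. norm (l2_nth (u + v) n)) F \<le> norm u + norm v"
      using L2_set_le_norm_l2[OF F, of u] L2_set_le_norm_l2[OF F, of v] by linarith
  qed
  show "norm (r *\<^sub>R u) = \<bar>r\<bar> * norm u"
    by (simp add: norm_l2_def power_mult_distrib infsum_cmult_right' real_sqrt_mult)
qed

end

instantiation l2 :: (chilbert_space) chilbert_space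
begin

definition cinner_l2 :: "'a l2 \<Rightarrow> 'a l2 \<Rightarrow> complex"
  where "cinner_l2 u v = (\<Sum>\<^sub>\<infinity>n. cinner (l2_nth u n) (l2_nth v n))"

lemma summable_cinner_l2: "(\<lambda>n. cinner (l2_nth u n) (l2_nth v n)) summable_on UNIV"
proof (rule abs_summable_summable, rule summable_on_comparison_test)
  show "(\<lambda>n. (norm (l2_nth u n))\<^sup>2 + (norm (l2_nth v n))\<^sup>2) summable_on UNIV"
    by (intro summable_on_add summable_l2)
  fix n
  have "cmod (cinner (l2_nth u n) (l2_nth v n)) \<le> norm (l2_nth u n) * norm (l2_nth v n)"
    by (rule cinner_Cauchy_Schwarz)
  also have "\<dots> \<le> (norm (l2_nth u n))\<^sup>2 + (norm (l2_nth v n))\<^sup>2"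
    using sum_squares_bound[of "norm (l2_nth u n)" "norm (l2_nth v n)"]
      zero_le_power2[of "norm (l2_nth u n)"] zero_le_power2[of "norm (l2_nth v n)"]
      mult_nonneg_nonneg[OF norm_ge_zero[of "l2_nth u n"] norm_ge_zero[of "l2_nth v n"]] by linarith
  finally show "norm (cinner (l2_nth u n) (l2_nth v n)) \<le> (norm (l2_nth u n))\<^sup>2 + (norm (l2_nth v n))\<^sup>2" .
qed auto

instance
proof
  fix X :: "nat \<Rightarrow> 'a l2"
  assume X: "Cauchy X"
  have "Cauchy (\<lambda>m. l2_nth (X m) n)" for n
  proof (rule metric_CauchyI)
    fix e :: real assume "0 < e"
    then obtain M where "\<forall>m\<ge>M. \<forall>k\<ge>M. dist (X m) (X k) < e" using metric_CauchyD[OF X] by blast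
    moreover have "dist (l2_nth (X m) n) (l2_nth (X k) n) \<le> dist (X m) (X k)" for m k
      using norm_l2_nth[of "X m - X k" n] by (simp add: dist_norm)
    ultimately show "\<exists>M. \<forall>m\<ge>M. \<forall>k\<ge>M. dist (l2_nth (X m) n) (l2_nth (X k) n) < e"
      by (meson le_less_trans)
  qed
  then have "\<exists>l. (\<lambda>m. l2_nth (X m) n) \<longlonglongrightarrow> l" for n
    using Cauchy_convergent convergent_def by blast
  then obtain u where u: "\<And>n. (\<lambda>m. l2_nth (X m) n) \<longlonglongrightarrow> u n" by metis
  have close: "L2_set (\<lambda>n. norm (l2_nth (X m) n - u n)) F \<le> e"
    if F: "finite F" and M: "\<And>k. k \<ge> M \<Longrightarrow> norm (X m - X k) \<le> e" for F m e M
  proof (rule tendsto_upperbound)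
    show "(\<lambda>k. L2_set (\<lambda>n. norm (l2_nth (X m) n - l2_nth (X k) n)) F)
        \<longlonglongrightarrow> L2_set (\<lambda>n. norm (l2_nth (X m) n - u n)) F"
      unfolding L2_set_def by (intro tendsto_intros u)
    have "L2_set (\<lambda>n. norm (l2_nth (X m) n - l2_nth (X k) n)) F \<le> e" if "k \<ge> M" for k
      using L2_set_le_norm_l2[OF F, of "X m - X k"] M[OF that] by simp
    then show "eventually (\<lambda>k. L2_set (\<lambda>n. norm (l2_nth (X m) n - l2_nth (X k) n)) F \<le> e) sequentially"
      unfolding eventually_sequentially by blast
  qed simp
  have ev: "\<exists>M. \<forall>m\<ge>M. \<forall>k\<ge>M. norm (X m - X k) \<le> e" if "0 < e" for e
    using metric_CauchyD[OF X that] by (metis dist_norm less_imp_le)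
  obtain M where M: "\<And>m k. m \<ge> M \<Longrightarrow> k \<ge> M \<Longrightarrow> norm (X m - X k) \<le> 1" using ev[of 1] by auto
  have "(\<lambda>n. (norm (l2_nth (X M) n - u n))\<^sup>2) summable_on UNIV"
    unfolding square_summable_iff_L2_set using close[of _ M M 1] M by blast
  then have "(\<lambda>n. (norm (u n - l2_nth (X M) n))\<^sup>2) summable_on UNIV" by (simp add: norm_minus_commute)
  from square_summable_add[OF this summable_l2[of "X M"]]
  have U: "l2_nth (Abs_l2 u) = u" by (intro Abs_l2_inverse) simp
  have "X \<longlonglongrightarrow> Abs_l2 u"
  proof (rule metric_LIMSEQ_I)
    fix e :: real assume e: "0 < e"
    then obtain M where M: "\<And>m k. m \<ge> M \<Longrightarrow> k \<ge> M \<Longrightarrow> norm (X m - X k) \<le> e / 2" using ev[of "e/2"] by auto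
    have "norm (X m - Abs_l2 u) \<le> e / 2" if "m \<ge> M" for m
      by (rule norm_l2_le) (use close[of _ M m "e / 2"] M that in \<open>simp add: U\<close>)
    then show "\<exists>M. \<forall>m\<ge>M. dist (X m) (Abs_l2 u) < e" using e by (force simp: dist_norm)
  qed
  then show "convergent X" by (rule convergentI)
next
  fix x y z :: "'a l2" and a :: complex
  have "(\<Sum>\<^sub>\<infinity>n. cnj (cinner (l2_nth y n) (l2_nth x n))) = cnj (\<Sum>\<^sub>\<infinity>n. cinner (l2_nth y n) (l2_nth x n))"
    by simp
  then show "cinner x y = cnj (cinner y x)" unfolding cinner_l2_def by (metis (no_types, lifting) cinner_commute infsum_cong)
  show "cinner (x + y) z = cinner x z + cinner y z"
    by (simp add: cinner_l2_def cinner_simps infsum_add summable_cinner_l2)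
  show "cinner (a *\<^sub>C x) y = a * cinner x y"
    by (simp add: cinner_l2_def cinner_simps infsum_cmult_right')
  have "((\<lambda>n. (norm (l2_nth x n))\<^sup>2) has_sum (norm x)\<^sup>2) UNIV"
    using has_sum_infsum[OF summable_l2[of x]] by (simp add: norm_l2_def infsum_nonneg)
  from has_sum_of_real[OF this, where 'a=complex] show "cinner x x = complex_of_real ((norm x)\<^sup>2)"
    unfolding cinner_l2_def cinner_self by (rule infsumI)
qed

end

lift_definition l2_shift :: "int \<Rightarrow> 'h::chilbert_space l2 \<Rightarrow> 'h l2" is "\<lambda>k u n. u (n + k)"
proof -
  fix k :: int and u :: "int \<Rightarrow> 'h"
  assume "(\<lambda>n. (norm (u n))\<^sup>2) summable_on UNIV"
  then show "(\<lambda>n. (norm (u (n + k)))\<^sup>2) summable_on UNIV"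
    by (subst summable_on_reindex_bij_betw[of "\<lambda>n. n + k" UNIV UNIV "\<lambda>n. (norm (u n))\<^sup>2"])
       (auto simp: bij_plus_right)
qed

lift_definition l2_single :: "int \<Rightarrow> 'h::chilbert_space \<Rightarrow> 'h l2" is "\<lambda>i x n. if n = i then x else 0"
  by (rule summable_on_cong_neutral[THEN iffD1, OF _ _ _ summable_on_finite[of "{i}" for i]]) auto

lift_definition l2_map :: "'h::chilbert_space bop \<Rightarrow> 'h l2 \<Rightarrow> 'h l2" is "\<lambda>X u n. bop_apply X (u n)"
  by (erule square_summable_le) (rule norm_bop_apply)

lemma l2_nth_shift [simp]: "l2_nth (l2_shift k u) n = l2_nth u (n + k)" by transfer simp
lemma l2_nth_single: "l2_nth (l2_single i x) n = (if n = i then x else 0)" by transfer simp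
lemma l2_nth_map [simp]: "l2_nth (l2_map X u) n = bop_apply X (l2_nth u n)" by transfer simp

lemma norm_l2_shift: "norm (l2_shift k u) = norm u"
proof -
  have "(\<Sum>\<^sub>\<infinity>n. (norm (l2_nth u (n + k)))\<^sup>2) = (\<Sum>\<^sub>\<infinity>n. (norm (l2_nth u n))\<^sup>2)"
    by (rule infsum_reindex_bij_betw) (simp add: bij_plus_right)
  then show ?thesis by (simp add: norm_l2_def)
qed

lemma norm_l2_map: "norm (l2_map X u) \<le> norm X * norm u"
proof (rule norm_l2_le)
  fix F :: "int set" assume F: "finite F"
  have "L2_set (\<lambda>n. norm (l2_nth (l2_map X u) n)) F \<le> L2_set (\<lambda>n. norm X * norm (l2_nth u n)) F"
    by (intro L2_set_mono) (auto intro: norm_bop_apply)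
  also have "\<dots> = norm X * L2_set (\<lambda>n. norm (l2_nth u n)) F" by (simp add: L2_set_right_distrib)
  also have "\<dots> \<le> norm X * norm u" by (intro mult_left_mono L2_set_le_norm_l2 F) simp
  finally show "L2_set (\<lambda>n. norm (l2_nth (l2_map X u) n)) F \<le> norm X * norm u" .
qed

lemma cinner_l2_single: "cinner u (l2_single i x) = cinner (l2_nth u i) x"
proof -
  have "cinner u (l2_single i x) = (\<Sum>\<^sub>\<infinity>n. if n = i then cinner (l2_nth u i) x else 0)"
    unfolding cinner_l2_def by (intro infsum_cong) (simp add: l2_nth_single)
  also have "\<dots> = (\<Sum>\<^sub>\<infinity>n\<in>{i}. cinner (l2_nth u i) x)"
    by (rule infsum_cong_neutral) auto
  finally show ?thesis by simp
qed

lemma l2_single_linear: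
  "l2_single i (x + y) = l2_single i x + l2_single i y" "l2_single i (c *\<^sub>C x) = c *\<^sub>C l2_single i x"
  by (rule l2_eqI, simp add: l2_nth_single)+

text \<open>Positivity of Toeplitz matrices speaks only of finitely supported sequences; their density carries it
  over to the whole space.\<close>

lemma l2_truncation:
  fixes u :: "'h::chilbert_space l2"
  assumes e: "0 < e"
  obtains N :: nat where "norm (u - (\<Sum>i\<in>{- int N..int N}. l2_single i (l2_nth u i))) < e"
proof -
  let ?f = "\<lambda>n. (norm (l2_nth u n))\<^sup>2"
  have "(?f has_sum (\<Sum>\<^sub>\<infinity>n. ?f n)) UNIV" using summable_l2 by (rule has_sum_infsum)
  then have "(sum ?f \<longlongrightarrow> (\<Sum>\<^sub>\<infinity>n. ?f n)) (finite_subsets_at_top UNIV)" by (simp add: has_sum_def)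
  then have "eventually (\<lambda>F. dist (sum ?f F) (\<Sum>\<^sub>\<infinity>n. ?f n) < e\<^sup>2) (finite_subsets_at_top UNIV)"
    using e by (intro tendstoD) auto
  then obtain F0 where F0: "finite F0" "\<And>F. finite F \<Longrightarrow> F0 \<subseteq> F \<Longrightarrow> dist (sum ?f F) (\<Sum>\<^sub>\<infinity>n. ?f n) < e\<^sup>2"
    unfolding eventually_finite_subsets_at_top by auto
  obtain N :: nat where N: "\<And>i. i \<in> F0 \<Longrightarrow> nat \<bar>i\<bar> \<le> N"
    using finite_nat_set_iff_bounded_le[of "(\<lambda>i. nat \<bar>i\<bar>) ` F0"] F0(1) by auto
  define F where "F = {- int N..int N}"
  have F: "finite F" "F0 \<subseteq> F" using N by (force simp: F_def)+
  let ?v = "\<Sum>i\<in>F. l2_single i (l2_nth u i)"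
  have nth_sum: "l2_nth (\<Sum>i\<in>G. g i) n = (\<Sum>i\<in>G. l2_nth (g i) n)" for g :: "int \<Rightarrow> 'h l2" and G n
    by (induction G rule: infinite_finite_induct) auto
  have nth: "l2_nth (u - ?v) n = (if n \<in> F then 0 else l2_nth u n)" for n
    using F(1) by (simp add: nth_sum l2_nth_single)
  have "(\<Sum>\<^sub>\<infinity>n. (norm (l2_nth (u - ?v) n))\<^sup>2) = (\<Sum>\<^sub>\<infinity>n\<in>UNIV - F. ?f n)"
    by (rule infsum_cong_neutral) (auto simp: nth simp del: l2_nth_simps)
  also have "\<dots> = (\<Sum>\<^sub>\<infinity>n. ?f n) - sum ?f F"
    using F(1) by (subst infsum_Diff[OF summable_l2]) auto
  also have "\<dots> < e\<^sup>2" using F0(2)[OF F] by (simp add: dist_norm)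
  finally have "sqrt (\<Sum>\<^sub>\<infinity>n. (norm (l2_nth (u - ?v) n))\<^sup>2) < sqrt (e\<^sup>2)" by (rule real_sqrt_less_mono)
  then have "norm (u - ?v) < e" using e by (simp add: norm_l2_def)
  then show thesis using that unfolding F_def by blast
qed

text \<open>The operator with entries \<open>Y\<close> on the \<open>k\<close>-th diagonal and zero elsewhere.\<close>

definition l2_diagonal :: "'h::chilbert_space bop \<Rightarrow> int \<Rightarrow> 'h l2 bop"
  where "l2_diagonal Y k = (SOME D. \<forall>u. bop_apply D u = l2_map Y (l2_shift k u))"

lemma l2_diagonal: "bop_apply (l2_diagonal Y k) u = l2_map Y (l2_shift k u)"
proof -
  have "bounded_linear (\<lambda>u. l2_map Y (l2_shift k u))"
  proof (rule bounded_linear_intro[where K = "norm Y"])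
    show "norm (l2_map Y (l2_shift k x)) \<le> norm x * norm Y" for x
      using norm_l2_map[of Y "l2_shift k x"] by (simp add: norm_l2_shift mult.commute)
  qed (rule l2_eqI, simp add: bop_lin)+
  moreover have "l2_map Y (l2_shift k (\<i> *\<^sub>C u)) = \<i> *\<^sub>C l2_map Y (l2_shift k u)" for u
    by (rule l2_eqI) (simp add: bop_lin)
  ultimately have "\<exists>D. \<forall>u. bop_apply D u = l2_map Y (l2_shift k u)"
    using bop_of_fun[of "\<lambda>u. l2_map Y (l2_shift k u)"] by metis
  from someI_ex[OF this] show ?thesis unfolding l2_diagonal_def by blast
qed

lemma norm_l2_diagonal: "norm (l2_diagonal Y k) \<le> norm Y"
proof (rule norm_bop_le)
  fix u
  show "norm (bop_apply (l2_diagonal Y k) u) \<le> norm Y * norm u"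
    using norm_l2_map[of Y "l2_shift k u"] by (simp add: l2_diagonal norm_l2_shift)
qed simp

section \<open>Unitary dilations and Toeplitz forms\<close>

text \<open>The quadratic form of the hermitian block Toeplitz matrix with diagonal \<open>Z\<close> and entries \<open>X\<^sup>i\<^sup>-\<^sup>j\<close>
  for \<open>j < i\<close>. The other half of the matrix contributes the same real part, whence the factor \<open>2\<close>.\<close>

definition toeplitz_form :: "'h::chilbert_space bop \<Rightarrow> 'h bop \<Rightarrow> nat \<Rightarrow> (nat \<Rightarrow> 'h) \<Rightarrow> real"
  where "toeplitz_form Z X N h = (\<Sum>i<N. Re (cinner (bop_apply Z (h i)) (h i)) +
    2 * (\<Sum>j<i. Re (cinner (bop_apply (X ^ (i - j)) (h i)) (h j))))"

definition hilbert_space_of_type :: "'k::chilbert_space ip_space"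
  where "hilbert_space_of_type = \<lparr>carrier = UNIV, mult = undefined, one = undefined, zero = 0,
    add = (+), smult = scaleC, ip = cinner\<rparr>"

lemma hilbert_space_of_type_simps:
  "carrier (hilbert_space_of_type :: 'k::chilbert_space ip_space) = UNIV"
  "\<zero>\<^bsub>hilbert_space_of_type\<^esub> = (0 :: 'k)"
  "(x::'k) \<oplus>\<^bsub>hilbert_space_of_type\<^esub> y = x + y"
  "a \<odot>\<^bsub>hilbert_space_of_type\<^esub> x = a *\<^sub>C x"
  "ip hilbert_space_of_type x y = cinner x y"
  by (simp_all add: hilbert_space_of_type_def)

lemma abelian_group_of_type: "abelian_group (hilbert_space_of_type :: 'k::chilbert_space ip_space)"
  by (rule abelian_groupI)
     (auto simp: hilbert_space_of_type_simps algebra_simps intro!: exI[of _ "- x" for x])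

lemma minus_of_type: "(x::'k::chilbert_space) \<ominus>\<^bsub>hilbert_space_of_type\<^esub> y = x - y"
proof -
  interpret abelian_group "hilbert_space_of_type :: 'k ip_space" by (rule abelian_group_of_type)
  have "\<ominus>\<^bsub>hilbert_space_of_type\<^esub> y = - y"
    by (rule minus_equality) (auto simp: hilbert_space_of_type_simps)
  then show ?thesis by (simp add: a_minus_def hilbert_space_of_type_simps)
qed

lemma hilbert_space_of_type: "hilbert_space (hilbert_space_of_type :: 'k::chilbert_space ip_space)"
proof (intro hilbert_space.intro hilbert_space_axioms.intro)
  show "Module.module complex_ring (hilbert_space_of_type :: 'k ip_space)"
    by (rule moduleI[OF cring_complex_ring abelian_group_of_type])
       (auto simp: hilbert_space_of_type_simps scaleC_add_left scaleC_add_right scaleC_scaleC)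
  fix X :: "nat \<Rightarrow> 'k"
  assume C: "\<And>e. 0 < e \<Longrightarrow> \<exists>N. \<forall>m\<ge>N. \<forall>n\<ge>N.
    ip_norm hilbert_space_of_type (X m \<ominus>\<^bsub>hilbert_space_of_type\<^esub> X n) < e"
  have nrm: "ip_norm hilbert_space_of_type x = norm x" for x :: 'k
    by (simp add: ip_norm_def hilbert_space_of_type_simps Re_cinner_self)
  have "Cauchy X" using C unfolding Cauchy_def by (simp add: nrm minus_of_type dist_norm)
  then obtain x where "X \<longlonglongrightarrow> x" using Cauchy_convergent convergent_def by blast
  then have "(\<lambda>n. norm (X n - x)) \<longlonglongrightarrow> 0" by (simp add: LIM_zero_iff tendsto_norm_zero_iff)
  then show "\<exists>x\<in>carrier hilbert_space_of_type.
      (\<lambda>n. ip_norm hilbert_space_of_type (X n \<ominus>\<^bsub>hilbert_space_of_type\<^esub> x)) \<longlonglongrightarrow> 0"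
    by (auto simp: nrm minus_of_type hilbert_space_of_type_simps)
next
  fix x y :: 'k show "ip hilbert_space_of_type x y = cnj (ip hilbert_space_of_type y x)"
    unfolding hilbert_space_of_type_simps by (rule cinner_commute)
qed (auto simp: hilbert_space_of_type_simps cinner_simps Re_cinner_self)

lemma sum_triangle:
  fixes g :: "nat \<Rightarrow> nat \<Rightarrow> real"
  assumes "\<And>i j. g i j = g j i"
  shows "(\<Sum>i<N. \<Sum>j<N. g i j) = (\<Sum>i<N. g i i + 2 * (\<Sum>j<i. g i j))"
proof (induction N)
  case (Suc N)
  have "(\<Sum>j<N. g j N) = (\<Sum>j<N. g N j)" using assms by simp
  then show ?case using Suc by (simp add: sum.distrib)
qed simp

text \<open>The bi-infinite Toeplitz operator on sequences with symbol
  \<open>B + \<Sum>k\<ge>1. (z\<^sup>k X\<^sup>k + h.c.)\<close>.\<close>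

definition laurent_operator :: "'h::chilbert_space bop \<Rightarrow> 'h bop \<Rightarrow> 'h l2 bop"
  where "laurent_operator B X = l2_diagonal B 0 +
    (\<Sum>k. l2_diagonal (X ^ Suc k) (int (Suc k)) + bop_adj (l2_diagonal (X ^ Suc k) (int (Suc k))))"

lemma laurent_operator_sums:
  assumes X: "spectrum_in_disc X"
  shows "(\<lambda>k. l2_diagonal (X ^ Suc k) (int (Suc k)) + bop_adj (l2_diagonal (X ^ Suc k) (int (Suc k))))
    sums (laurent_operator B X - l2_diagonal B 0)"
proof -
  have "summable (\<lambda>k. 2 * norm (X ^ Suc k))"
    using spectrum_in_disc_summable[OF X] by (intro summable_mult) (subst summable_Suc_iff)
  then have "summable (\<lambda>k. l2_diagonal (X ^ Suc k) (int (Suc k)) + bop_adj (l2_diagonal (X ^ Suc k) (int (Suc k))))"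
  proof (rule summable_comparison_test'[where N = 0])
    fix k
    show "norm (l2_diagonal (X ^ Suc k) (int (Suc k)) + bop_adj (l2_diagonal (X ^ Suc k) (int (Suc k))))
        \<le> 2 * norm (X ^ Suc k)"
      by (rule order_trans[OF norm_triangle_ineq])
         (use norm_l2_diagonal[of "X ^ Suc k" "int (Suc k)"] in \<open>simp only: norm_adj\<close>)
  qed
  from summable_sums[OF this] show ?thesis unfolding laurent_operator_def by simp
qed

lemma laurent_operator_entry:
  assumes X: "spectrum_in_disc X"
  shows "cinner (bop_apply (laurent_operator B X) (l2_single i x)) (l2_single j y) =
    (if i = j then cinner (bop_apply B x) y
     else if j < i then cinner (bop_apply (X ^ nat (i - j)) x) y
     else cinner x (bop_apply (X ^ nat (j - i)) y))"
proof -
  have d: "cinner (bop_apply (l2_diagonal Y k) (l2_single i x)) (l2_single j y)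
      = (if i = j + k then cinner (bop_apply Y x) y else 0)" for Y :: "'a bop" and k i j x y
    by (auto simp: l2_diagonal cinner_l2_single l2_nth_single)
  have a: "cinner (bop_apply (bop_adj (l2_diagonal Y k)) (l2_single i x)) (l2_single j y)
      = (if j = i + k then cinner x (bop_apply Y y) else 0)" for Y :: "'a bop" and k
  proof -
    have "cinner (bop_apply (bop_adj (l2_diagonal Y k)) (l2_single i x)) (l2_single j y)
        = cnj (cinner (bop_apply (l2_diagonal Y k) (l2_single j y)) (l2_single i x))"
      unfolding adj_cinner' by (rule cinner_commute)
    also have "\<dots> = (if j = i + k then cinner x (bop_apply Y y) else 0)"
      unfolding d using cinner_commute[of x "bop_apply Y y"] by simp
    finally show ?thesis .
  qed
  define t where "t k = (if i = j + int (Suc k) then cinner (bop_apply (X ^ Suc k) x) y else 0) +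
    (if j = i + int (Suc k) then cinner x (bop_apply (X ^ Suc k) y) else 0)" for k
  have "(\<lambda>k. cinner (bop_apply (l2_diagonal (X ^ Suc k) (int (Suc k))
      + bop_adj (l2_diagonal (X ^ Suc k) (int (Suc k)))) (l2_single i x)) (l2_single j y))
      sums cinner (bop_apply (laurent_operator B X - l2_diagonal B 0) (l2_single i x)) (l2_single j y)"
    by (rule bounded_linear.sums[OF bounded_linear_bop_cinner laurent_operator_sums[OF X]])
  then have s: "t sums (cinner (bop_apply (laurent_operator B X) (l2_single i x)) (l2_single j y)
      - (if i = j then cinner (bop_apply B x) y else 0))"
    unfolding bop_apply_ring(1) bop_apply_diff cinner_add_left cinner_diff_left d a t_def[abs_def]
    by simp
  have "t sums (if i = j then 0 else if j < i then cinner (bop_apply (X ^ nat (i - j)) x) y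
     else cinner x (bop_apply (X ^ nat (j - i)) y))"
  proof -
    consider "i = j" | "j < i" | "i < j" by linarith
    then show ?thesis
    proof cases
      case 1
      then have "t = (\<lambda>_. 0)" by (auto simp: t_def)
      then show ?thesis using 1 by simp
    next
      case 2
      define m where "m = nat (i - j) - 1"
      have m: "i = j + int (Suc m)" "nat (i - j) = Suc m" using 2 by (auto simp: m_def)
      have "t = (\<lambda>k. if k = m then cinner (bop_apply (X ^ Suc m) x) y else 0)"
        by (rule ext) (use 2 in \<open>auto simp: t_def m(1) simp del: power_Suc of_nat_Suc\<close>)
      then show ?thesis using sums_single[of m "\<lambda>_. cinner (bop_apply (X ^ Suc m) x) y"] 2
        by (simp add: m(2) del: power_Suc)
    next
      case 3
      define m where "m = nat (j - i) - 1"
      have m: "j = i + int (Suc m)" "nat (j - i) = Suc m" using 3 by (auto simp: m_def)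
      have "t = (\<lambda>k. if k = m then cinner x (bop_apply (X ^ Suc m) y) else 0)"
        by (rule ext) (use 3 in \<open>auto simp: t_def m(1) simp del: power_Suc of_nat_Suc\<close>)
      then show ?thesis using sums_single[of m "\<lambda>_. cinner x (bop_apply (X ^ Suc m) y)"] 3
        by (simp add: m(2) del: power_Suc)
    qed
  qed
  from sums_unique2[OF s this] show ?thesis by (auto split: if_splits)
qed

text \<open>A sequence supported in \<open>{-N..N}\<close> becomes, after a translation that leaves the entries of the
  operator unchanged, an argument of a Toeplitz form.\<close>

lemma laurent_operator_positive:
  assumes X: "spectrum_in_disc X" and B: "bop_positive B"
    and pos: "\<And>N h. 0 \<le> toeplitz_form B X N h"
  shows "bop_positive (laurent_operator B X)"
proof (rule positiveI)
  let ?F = "laurent_operator B X"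
  have dB: "bop_adj (l2_diagonal B 0) = l2_diagonal B 0"
  proof (rule adj_eqI)
    fix u v
    show "cinner (bop_apply (l2_diagonal B 0) u) v = cinner u (bop_apply (l2_diagonal B 0) v)"
      by (simp add: cinner_l2_def l2_diagonal positive_symmetric[OF B])
  qed
  have "(\<lambda>k. bop_adj (l2_diagonal (X ^ Suc k) (int (Suc k)) + bop_adj (l2_diagonal (X ^ Suc k) (int (Suc k)))))
    sums bop_adj (?F - l2_diagonal B 0)"
    by (rule bounded_linear.sums[OF bounded_linear_adj laurent_operator_sums[OF X, of B]])
  then have "(\<lambda>k. l2_diagonal (X ^ Suc k) (int (Suc k)) + bop_adj (l2_diagonal (X ^ Suc k) (int (Suc k))))
    sums bop_adj (?F - l2_diagonal B 0)"
    unfolding adj_add adj_adj by (simp only: add.commute)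
  from sums_unique2[OF this laurent_operator_sums[OF X, of B]]
  show "bop_adj ?F = ?F" by (simp add: adj_diff dB)
  fix u
  have fin: "0 \<le> Re (cinner (bop_apply ?F v) v)"
    if v: "v = (\<Sum>i\<in>{- int N..int N}. l2_single i (l2_nth u i))" for v N
  proof -
    define M h where "M = 2 * N + 1" "h i = l2_nth u (int i - int N)" for i
    have "bij_betw (\<lambda>i. int i - int N) {..<M} {- int N..int N}"
      by (rule bij_betw_byWitness[where f' = "\<lambda>i. nat (i + int N)"]) (auto simp: M_h_def)
    from sum.reindex_bij_betw[OF this, of "\<lambda>i. l2_single i (l2_nth u i)"]
    have v': "v = (\<Sum>i<M. l2_single (int i - int N) (h i))" by (simp add: v M_h_def(2))
    define g where "g i j = Re (cinner (bop_apply ?F (l2_single (int i - int N) (h i)))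
      (l2_single (int j - int N) (h j)))" for i j
    have g: "g i j = (if i = j then Re (cinner (bop_apply B (h i)) (h i))
      else if j < i then Re (cinner (bop_apply (X ^ (i - j)) (h i)) (h j))
      else Re (cinner (bop_apply (X ^ (j - i)) (h j)) (h i)))" for i j
    proof -
      have n: "nat (int a - int N - (int b - int N)) = a - b" for a b by simp
      show ?thesis unfolding g_def laurent_operator_entry[OF X] n
        using Re_cinner_commute[of "h i" "bop_apply (X ^ (j - i)) (h j)"] by auto
    qed
    have "Re (cinner (bop_apply ?F v) v) = (\<Sum>j<M. \<Sum>i<M. g i j)"
      unfolding v' bop_apply_sum cinner_sum_left cinner_sum_right g_def Re_sum ..
    also have "\<dots> = (\<Sum>i<M. \<Sum>j<M. g i j)" by (rule sum.swap)
    also have "\<dots> = (\<Sum>i<M. g i i + 2 * (\<Sum>j<i. g i j))" by (rule sum_triangle) (auto simp: g)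
    also have "\<dots> = toeplitz_form B X M h"
      unfolding toeplitz_form_def
    proof (intro sum.cong refl)
      fix i
      have "(\<Sum>j<i. g i j) = (\<Sum>j<i. Re (cinner (bop_apply (X ^ (i - j)) (h i)) (h j)))"
        by (intro sum.cong) (auto simp: g)
      then show "g i i + 2 * (\<Sum>j<i. g i j) = Re (cinner (bop_apply B (h i)) (h i)) +
          2 * (\<Sum>j<i. Re (cinner (bop_apply (X ^ (i - j)) (h i)) (h j)))" by (simp add: g)
    qed
    finally show ?thesis using pos by simp
  qed
  have "\<exists>v. norm (u - v) < 1 / Suc n \<and> 0 \<le> Re (cinner (bop_apply ?F v) v)" for n
    using l2_truncation[of "1 / Suc n" u] fin by (metis zero_less_divide_1_iff of_nat_0_less_iff zero_less_Suc)
  then obtain v where v: "\<And>n. norm (u - v n) < 1 / Suc n" "\<And>n. 0 \<le> Re (cinner (bop_apply ?F (v n)) (v n))"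
    by metis
  have "(\<lambda>n. norm (u - v n)) \<longlonglongrightarrow> 0"
    by (rule tendsto_sandwich[OF _ _ tendsto_const LIMSEQ_inverse_real_of_nat])
       (use v(1) in \<open>auto simp: inverse_eq_divide intro!: always_eventually less_imp_le\<close>)
  then have "(\<lambda>n. v n - u) \<longlonglongrightarrow> 0"
    by (subst tendsto_norm_zero_iff[symmetric]) (simp add: norm_minus_commute)
  then have "v \<longlonglongrightarrow> u" by (rule LIM_zero_cancel)
  then have "(\<lambda>n. Re (cinner (bop_apply ?F (v n)) (v n))) \<longlonglongrightarrow> Re (cinner (bop_apply ?F u) u)"
    by (intro tendsto_intros)
  then show "0 \<le> Re (cinner (bop_apply ?F u) u)"
    by (rule LIMSEQ_le_const) (use v(2) in auto)
qed

text \<open>All diagonals commute with the shifts, and so do their adjoints, because the adjoint of a shift is the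
  inverse shift.\<close>

lemma shift_commutes_laurent_operator:
  fixes X :: "'h::chilbert_space bop"
  assumes X: "spectrum_in_disc X"
  shows "l2_diagonal 1 m * laurent_operator B X = laurent_operator B X * l2_diagonal 1 (m::int)"
proof -
  let ?S = "l2_diagonal 1 m :: 'h l2 bop" and ?D = "\<lambda>k. l2_diagonal (X ^ Suc k) (int (Suc k))"
  have com: "l2_diagonal 1 p * l2_diagonal Y k = l2_diagonal Y k * l2_diagonal 1 p" for Y :: "'h bop" and k p
    by (rule bop_eqI, rule l2_eqI) (simp add: l2_diagonal ac_simps)
  have adjS: "bop_adj ?S = l2_diagonal 1 (- m)"
  proof (rule adj_eqI)
    fix u v :: "'h l2"
    have "cinner (bop_apply ?S u) v = (\<Sum>\<^sub>\<infinity>n. cinner (l2_nth u (n + m)) (l2_nth v ((n + m) - m)))"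
      by (simp add: cinner_l2_def l2_diagonal)
    also have "\<dots> = (\<Sum>\<^sub>\<infinity>n. cinner (l2_nth u n) (l2_nth v (n - m)))"
      by (rule infsum_reindex_bij_betw[where g = "\<lambda>n. n + m"]) (simp add: bij_plus_right)
    also have "\<dots> = cinner u (bop_apply (l2_diagonal 1 (- m)) v)"
      by (simp add: cinner_l2_def l2_diagonal)
    finally show "cinner (bop_apply ?S u) v = cinner u (bop_apply (l2_diagonal 1 (- m)) v)" .
  qed
  have com': "?S * bop_adj (?D k) = bop_adj (?D k) * ?S" for k
  proof -
    have "?S * bop_adj (?D k) = bop_adj (?D k * bop_adj ?S)" by (simp add: adj_mult)
    also have "\<dots> = bop_adj (bop_adj ?S * ?D k)" unfolding adjS com ..
    finally show ?thesis by (simp add: adj_mult)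
  qed
  have eq: "?S * (?D k + bop_adj (?D k)) = (?D k + bop_adj (?D k)) * ?S" for k
    unfolding distrib_left distrib_right com com' ..
  have "(\<lambda>k. ?S * (?D k + bop_adj (?D k))) sums (?S * (laurent_operator B X - l2_diagonal B 0))"
    by (rule sums_mult[OF laurent_operator_sums[OF X]])
  moreover have "(\<lambda>k. ?S * (?D k + bop_adj (?D k))) sums ((laurent_operator B X - l2_diagonal B 0) * ?S)"
    unfolding eq by (rule sums_mult2[OF laurent_operator_sums[OF X]])
  ultimately have "?S * (laurent_operator B X - l2_diagonal B 0) = (laurent_operator B X - l2_diagonal B 0) * ?S"
    by (rule sums_unique2)
  then show ?thesis by (simp add: right_diff_distrib left_diff_distrib com)
qed

text \<open>If the Toeplitz operator \<open>F\<close> with entries \<open>X\<^sup>i\<^sup>-\<^sup>j\<close> and diagonal \<open>B\<close> is positive, the bilateral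
  shift dilates \<open>X\<close>: embed \<open>x\<close> as \<open>F\<^sup>1\<^sup>/\<^sup>2\<close> applied to the sequence with the single entry
  \<open>B\<^sup>-\<^sup>1\<^sup>/\<^sup>2 x\<close>. The square root commutes with the shift.\<close>

lemma dilation_classI:
  fixes B X :: "'h::chilbert_space bop"
  assumes B: "bop_strictly_positive B" and X: "spectrum_in_disc X"
    and pos: "\<And>N h. 0 \<le> toeplitz_form B X N h"
  shows "X \<in> dilation_class B"
proof -
  have Bp: "bop_positive B" using B by (simp add: bop_strictly_positive_def)
  let ?F = "laurent_operator B X"
  obtain G where G: "bop_positive G" "G * G = ?F" and comm: "\<And>C. C * ?F = ?F * C \<Longrightarrow> C * G = G * C"
    using positive_sqrt_exists[OF laurent_operator_positive[OF X Bp pos]] by blast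
  let ?S = "bop_inv_sqrt B"
  note S = bop_inv_sqrt[OF B]
  let ?K = "hilbert_space_of_type :: 'h l2 ip_space"
  define V where "V x = bop_apply G (l2_single 0 (bop_apply ?S x))" for x
  define U :: "'h l2 \<Rightarrow> 'h l2" where "U = l2_shift (- 1)"
  have U_bop: "U u = bop_apply (l2_diagonal 1 (- 1)) u" for u
    by (rule l2_eqI) (simp add: l2_diagonal U_def)
  have UG: "U (bop_apply G u) = bop_apply G (U u)" for u
    using comm[OF shift_commutes_laurent_operator[OF X, of "- 1" B]] unfolding U_bop
    by (metis bop_apply_ring(3))
  have Un: "(U ^^ n) (l2_single i x) = l2_single (i + int n) x" for n i x
    by (induction n) (auto intro!: l2_eqI simp: U_def l2_nth_single)
  have UnG: "(U ^^ n) (bop_apply G u) = bop_apply G ((U ^^ n) u)" for n u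
    by (induction n) (simp_all add: UG)
  have GG: "cinner (bop_apply G u) (bop_apply G v) = cinner (bop_apply ?F u) v" for u v
    using adj_cinner[of G "bop_apply G u" v] by (simp add: positive_adj[OF G(1)] flip: G(2))
  have UV: "cinner ((U ^^ n) (V x)) (V y)
      = cinner (bop_apply ?F (l2_single (int n) (bop_apply ?S x))) (l2_single 0 (bop_apply ?S y))" for n x y
    unfolding V_def UnG GG Un by simp
  have "cinner (V x) (V y) = cinner (bop_apply (?S * B * ?S) x) y" for x y
    using UV[of 0 x y] adj_cinner[of ?S "bop_apply B (bop_apply ?S x)" y]
    by (simp add: laurent_operator_entry[OF X] S(3))
  then have VV: "cinner (V x) (V y) = cinner x y" for x y by (simp add: S(4))
  have UVn: "cinner ((U ^^ n) (V x)) (V y) = cinner (bop_apply (?S * X ^ n * ?S) x) y" if "1 \<le> n" for n x y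
    using UV[of n x y] adj_cinner[of ?S "bop_apply (X ^ n) (bop_apply ?S x)" y] that
    by (simp add: laurent_operator_entry[OF X] S(3))
  have "isometric_embedding ?K V"
    by (auto simp: isometric_embedding_def hilbert_space_of_type_simps VV)
       (simp_all add: V_def bop_lin l2_single_linear)
  moreover have "unitary_on ?K U"
    unfolding unitary_on_def hilbert_space_of_type_simps
  proof (intro conjI ballI allI)
    show "bij U"
      by (rule bij_betw_byWitness[where f' = "l2_shift 1"]) (auto intro!: l2_eqI simp: U_def)
    fix u v :: "'h l2"
    show "cinner (U u) (U v) = cinner u v"
      unfolding cinner_l2_def U_def l2_nth_shift
      by (rule infsum_reindex_bij_betw, rule bij_betw_byWitness[where f' = "\<lambda>n. n + 1"]) auto
  qed (rule l2_eqI, simp add: U_def)+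
  moreover have "is_orth_proj ?K (range V) ((U ^^ n) (V h)) (V (bop_apply (?S * X ^ n * ?S) h))"
    if "1 \<le> n" for n h
    unfolding is_orth_proj_def minus_of_type hilbert_space_of_type_simps
    using UVn[OF that] by (auto simp: cinner_simps VV)
  ultimately have "X \<in> dilation_class_in TYPE('h l2) B"
    unfolding dilation_class_in_def using hilbert_space_of_type by blast
  then show ?thesis
    unfolding dilation_class_def using dilation_class_in_subset by blast
qed

lemma Cesaro_limit_nonneg:
  fixes e :: "nat \<Rightarrow> real"
  assumes pos: "\<And>N. 0 \<le> (\<Sum>n<N. e n)" and lim: "e \<longlonglongrightarrow> l"
  shows "0 \<le> l"
proof (rule ccontr)
  assume "\<not> 0 \<le> l"
  then have l: "l < l / 2" "l / 2 < 0" by auto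
  obtain N where N: "\<And>n. n \<ge> N \<Longrightarrow> e n < l / 2"
    using order_tendstoD(2)[OF lim l(1)] unfolding eventually_sequentially by blast
  have le: "(\<Sum>n<N + k. e n) \<le> (\<Sum>n<N. e n) + real k * (l / 2)" for k
  proof (induction k)
    case (Suc k)
    have "(\<Sum>n<N + Suc k. e n) = (\<Sum>n<N + k. e n) + e (N + k)" by simp
    moreover have "real (Suc k) * (l / 2) = real k * (l / 2) + l / 2" by (simp add: distrib_right)
    ultimately show ?case using Suc N[of "N + k"] by linarith
  qed simp
  obtain k where "(\<Sum>n<N. e n) < real k * (- (l / 2))"
    using ex_less_of_nat_mult[of "- (l / 2)" "\<Sum>n<N. e n"] l by auto
  then show False using le[of k] pos[of "N + k"] by simp
qed

text \<open>The vector \<open>\<Sum>n<N. z\<^sup>n U\<^sup>n h\<close> has a squared length that is, up to a factor \<open>N\<close>, a Cesaro mean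
  of the partial sums of \<open>\<langle>h, h\<rangle> + 2 Re (\<Sum>n\<ge>1. z\<^sup>n \<langle>U\<^sup>n h, h\<rangle>)\<close>.\<close>

lemma unitary_partial_sums_nonneg:
  assumes K: "hilbert_space K" and U: "unitary_on K U" and h: "h \<in> carrier K" and z: "cmod z = 1"
  shows "0 \<le> (\<Sum>M<N. Re (ip K h h) + 2 * Re (\<Sum>n<M. z ^ Suc n * ip K ((U ^^ Suc n) h) h))"
proof -
  interpret hilbert_space K by fact
  have UK: "U x \<in> carrier K" if "x \<in> carrier K" for x
    using U that by (auto simp: unitary_on_def dest: bij_betwE)
  have Uadd: "U (x \<oplus>\<^bsub>K\<^esub> y) = U x \<oplus>\<^bsub>K\<^esub> U y" if "x \<in> carrier K" "y \<in> carrier K" for x y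
    using U that by (simp add: unitary_on_def)
  have Usm: "U (a \<odot>\<^bsub>K\<^esub> x) = a \<odot>\<^bsub>K\<^esub> U x" if "x \<in> carrier K" for a x
    using U that by (simp add: unitary_on_def)
  have Uip: "ip K (U x) (U y) = ip K x y" if "x \<in> carrier K" "y \<in> carrier K" for x y
    using U that by (simp add: unitary_on_def)
  have UpK: "(U ^^ n) x \<in> carrier K" if "x \<in> carrier K" for n x
    using that by (induction n) (auto simp: UK)
  have Upadd: "(U ^^ n) (x \<oplus>\<^bsub>K\<^esub> a \<odot>\<^bsub>K\<^esub> U y) = (U ^^ n) x \<oplus>\<^bsub>K\<^esub> a \<odot>\<^bsub>K\<^esub> (U ^^ Suc n) y"
    if "x \<in> carrier K" "y \<in> carrier K" for n x y a
    by (induction n) (use that in \<open>simp_all add: UK UpK Uadd Usm\<close>)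
  \<comment> \<open>Horner's scheme for \<open>\<Sum>n<N. z\<^sup>n U\<^sup>n h\<close>.\<close>
  define k where "k = rec_nat \<zero>\<^bsub>K\<^esub> (\<lambda>_ x. h \<oplus>\<^bsub>K\<^esub> z \<odot>\<^bsub>K\<^esub> U x)"
  have k: "k 0 = \<zero>\<^bsub>K\<^esub>" "k (Suc N) = h \<oplus>\<^bsub>K\<^esub> z \<odot>\<^bsub>K\<^esub> U (k N)" for N
    by (simp_all add: k_def)
  have kK: "k N \<in> carrier K" for N
    by (induction N) (simp_all add: k h UK)
  have U0: "(U ^^ n) \<zero>\<^bsub>K\<^esub> = \<zero>\<^bsub>K\<^esub>" for n
  proof -
    have "U \<zero>\<^bsub>K\<^esub> = \<zero>\<^bsub>K\<^esub>"
      using Uip[of "\<zero>\<^bsub>K\<^esub>" "\<zero>\<^bsub>K\<^esub>"] ip_pos[of "U \<zero>\<^bsub>K\<^esub>"] UK[of "\<zero>\<^bsub>K\<^esub>"] by (force simp: ip_zero_left)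
    then show ?thesis by (induction n) auto
  qed
  have inner: "ip K ((U ^^ j) (k N)) h = (\<Sum>n<N. z ^ n * ip K ((U ^^ (n + j)) h) h)" for j N
  proof (induction N arbitrary: j)
    case 0
    then show ?case by (simp add: k U0 ip_zero_left h)
  next
    case (Suc N)
    have "ip K ((U ^^ j) (k (Suc N))) h = ip K ((U ^^ j) h) h + z * ip K ((U ^^ Suc j) (k N)) h"
      unfolding k(2) Upadd[OF h kK] using h kK
      by (simp add: ip_add_left ip_smult_left UpK UK del: funpow.simps)
    also have "\<dots> = ip K ((U ^^ j) h) h + (\<Sum>n<N. z ^ Suc n * ip K ((U ^^ (Suc n + j)) h) h)"
      unfolding Suc by (simp add: sum_distrib_left mult.assoc del: funpow.simps)
    finally show ?case by (simp add: sum.lessThan_Suc_shift del: funpow.simps sum.lessThan_Suc)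
  qed
  have "Re (ip K (k N) (k N))
      = (\<Sum>M<N. Re (ip K h h) + 2 * Re (\<Sum>n<M. z ^ Suc n * ip K ((U ^^ Suc n) h) h))"
  proof (induction N)
    case 0
    then show ?case by (simp add: k ip_zero_left)
  next
    case (Suc N)
    define w where "w = z \<odot>\<^bsub>K\<^esub> U (k N)"
    have wK: "w \<in> carrier K" unfolding w_def using kK UK by simp
    have "ip K h w = cnj (ip K w h)" using h wK by (rule ip_commute)
    then have "Re (ip K (k (Suc N)) (k (Suc N))) = Re (ip K h h) + 2 * Re (ip K w h) + Re (ip K w w)"
      unfolding k(2) w_def[symmetric] using h wK by (simp add: ip_add_left ip_add_right)
    also have "ip K w h = z * ip K (U (k N)) h" unfolding w_def using h kK UK by (intro ip_smult_left) auto
    also have "ip K w w = z * cnj z * ip K (k N) (k N)"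
      unfolding w_def using kK UK by (simp add: ip_smult_left ip_smult_right Uip)
    also have "z * cnj z = 1" using z by (simp add: complex_norm_square[symmetric])
    also have "z * ip K (U (k N)) h = (\<Sum>n<N. z ^ Suc n * ip K ((U ^^ Suc n) h) h)"
      using inner[of 1 N] by (simp add: sum_distrib_left mult.assoc)
    finally show ?case using Suc by simp
  qed
  then show ?thesis using ip_self_nonneg[OF kK] by metis
qed

text \<open>For \<open>h = B\<^sup>1\<^sup>/\<^sup>2 y\<close> the dilation gives \<open>\<langle>U\<^sup>n h, h\<rangle> = \<langle>X\<^sup>n y, y\<rangle>\<close> and \<open>\<langle>h, h\<rangle> = \<langle>B y, y\<rangle>\<close>. The power series
  converges on the circle, and its limit has the sign of the Cesaro means.\<close>

lemma dilation_classD: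
  fixes B X :: "'h::chilbert_space bop"
  assumes B: "bop_strictly_positive B" and X: "spectrum_in_disc X" and dil: "X \<in> dilation_class B"
    and z: "cmod z = 1"
  shows "0 \<le> Re (cinner (bop_apply B y) y) + 2 * Re (cinner (bop_apply (resolvent X z - 1) y) y)"
proof -
  let ?S = "bop_inv_sqrt B"
  note S = bop_inv_sqrt[OF B] and Q = bop_sqrt[OF B]
  obtain K :: "(int \<Rightarrow> 'h \<Rightarrow> complex) ip_space" and V :: "'h \<Rightarrow> int \<Rightarrow> 'h \<Rightarrow> complex" and U
    where K: "hilbert_space K" and V: "isometric_embedding K V" and U: "unitary_on K U"
      and proj: "\<And>n h. 1 \<le> n \<Longrightarrow> is_orth_proj K (range V) ((U ^^ n) (V h))
        (V (bop_apply (?S * X ^ n * ?S) h))"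
    using dil unfolding dilation_class_def dilation_class_in_def by blast
  interpret hilbert_space K by fact
  define h where "h = bop_apply (bop_sqrt B) y"
  have VK: "V x \<in> carrier K" and Vip: "ip K (V x) (V x') = cinner x x'" for x x'
    using V by (auto simp: isometric_embedding_def)
  have Un: "(U ^^ n) (V x) \<in> carrier K" for n x
    by (induction n) (use U VK in \<open>auto simp: unitary_on_def dest: bij_betwE\<close>)
  have Sh: "bop_apply ?S h = y" using S(1) unfolding h_def by (metis bop_apply_ring(3,4))
  have c: "ip K ((U ^^ Suc n) (V h)) (V h) = cinner (bop_apply (X ^ Suc n) y) y" for n
  proof -
    have "ip K ((U ^^ Suc n) (V h) \<ominus>\<^bsub>K\<^esub> V (bop_apply (?S * X ^ Suc n * ?S) h)) (V h) = 0"
      using proj[of "Suc n" h, OF le_add1[of 1 n, simplified plus_1_eq_Suc]] unfolding is_orth_proj_def by blast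
    then have "ip K ((U ^^ Suc n) (V h)) (V h) = cinner (bop_apply (?S * X ^ Suc n * ?S) h) h"
      using ip_diff_left[OF Un[of "Suc n" h] VK VK, of "bop_apply (?S * X ^ Suc n * ?S) h" h]
      by (simp add: Vip del: funpow.simps power_Suc)
    also have "\<dots> = cinner (bop_apply ?S (bop_apply (X ^ Suc n) y)) h"
      by (simp add: Sh del: power_Suc)
    also have "\<dots> = cinner (bop_apply (X ^ Suc n) y) y"
      by (simp only: adj_cinner[of ?S] S(3) Sh)
    finally show ?thesis .
  qed
  have hh: "Re (ip K (V h) (V h)) = Re (cinner (bop_apply B y) y)"
  proof -
    have "cinner h h = cinner (bop_apply (bop_sqrt B * bop_sqrt B) y) y"
      unfolding h_def using adj_cinner[of "bop_sqrt B" "bop_apply (bop_sqrt B) y" y]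
      by (simp add: positive_adj[OF Q(1)])
    then show ?thesis by (simp add: Vip Q(2))
  qed
  define e where "e M = Re (cinner (bop_apply B y) y) +
    2 * Re (\<Sum>n<M. z ^ Suc n * cinner (bop_apply (X ^ Suc n) y) y)" for M
  have "0 \<le> (\<Sum>M<N. e M)" for N
    using unitary_partial_sums_nonneg[OF K U VK[of h] z, of N] unfolding e_def c hh .
  moreover have "e \<longlonglongrightarrow> Re (cinner (bop_apply B y) y) + 2 * Re (cinner (bop_apply (resolvent X z - 1) y) y)"
  proof -
    have "(\<lambda>n. cinner (bop_apply (z ^ n *\<^sub>C X ^ n) y) y) sums cinner (bop_apply (resolvent X z) y) y"
      by (rule bounded_linear.sums[OF bounded_linear_bop_cinner resolvent_sums[OF X]]) (simp add: z)
    then have "(\<lambda>n. cinner (bop_apply (z ^ Suc n *\<^sub>C X ^ Suc n) y) y)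
        sums (cinner (bop_apply (resolvent X z) y) y - cinner y y)"
      by (subst sums_Suc_iff) simp
    then have "(\<lambda>M. \<Sum>n<M. z ^ Suc n * cinner (bop_apply (X ^ Suc n) y) y)
        \<longlonglongrightarrow> cinner (bop_apply (resolvent X z - 1) y) y"
      by (simp add: sums_def cinner_simps del: power_Suc)
    then show ?thesis unfolding e_def by (intro tendsto_intros)
  qed
  ultimately show ?thesis by (rule Cesaro_limit_nonneg)
qed

section \<open>The double-layer kernel on the two boundary circles\<close>

lemma bop_invertible_scaleC:
  assumes "bop_invertible X" "a \<noteq> 0" shows "bop_invertible (a *\<^sub>C (X::'h::chilbert_space bop))"
proof -
  obtain S where "S * X = 1" "X * S = 1" using assms(1) by (auto simp: bop_invertible_def)
  then have "(inverse a *\<^sub>C S) * (a *\<^sub>C X) = 1" "(a *\<^sub>C X) * (inverse a *\<^sub>C S) = 1"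
    using assms(2) by (simp_all add: bop_scaleC_mult_left bop_scaleC_mult_right scaleC_scaleC)
  then show ?thesis unfolding bop_invertible_def by blast
qed

context
  fixes R :: real and T :: "'h::chilbert_space bop"
  assumes R: "R > 1" and spec: "bop_spectrum T \<subseteq> annulus R"
begin

lemma outside_invertible: "cmod z \<le> 1 / R \<or> R \<le> cmod z \<Longrightarrow> bop_invertible (z *\<^sub>C 1 - T)"
  using spec by (auto simp: bop_spectrum_def annulus_def subset_iff)

lemma T_invertible: "bop_invertible T"
proof -
  have "bop_invertible ((- 1) *\<^sub>C (0 *\<^sub>C 1 - T))"
    using R by (intro bop_invertible_scaleC outside_invertible) auto
  then show ?thesis by (simp add: scaleC_minus_left)
qed

lemma one_minus_outer:
  fixes z :: complex
  assumes "z \<noteq> 0"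
  shows "1 - z *\<^sub>C ((1 / R) *\<^sub>R T) = (z / R) *\<^sub>C ((R / z) *\<^sub>C 1 - T)"
  by (rule bop_eqI) (use assms R in \<open>simp add: scaleC_diff_right scaleC_scaleC scaleR_scaleC[where 'a='h]\<close>)

lemma one_minus_inner: "1 - z *\<^sub>C ((1 / R) *\<^sub>R bop_inv T) = ((- 1) *\<^sub>C ((z / R) *\<^sub>C 1 - T)) * bop_inv T"
proof -
  have "((- 1) *\<^sub>C ((z / R) *\<^sub>C 1 - T)) * bop_inv T = T * bop_inv T - ((z / R) *\<^sub>C 1) * bop_inv T"
    by (simp add: scaleC_minus_left left_diff_distrib)
  also have "\<dots> = 1 - z *\<^sub>C ((1 / R) *\<^sub>R bop_inv T)"
    unfolding bop_inv_mult[OF T_invertible] 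
    by (rule bop_eqI) (simp add: bop_scaleC_mult_left scaleR_scaleC[where 'a='h] scaleC_scaleC)
  finally show ?thesis by simp
qed

lemma spectrum_in_disc_outer: "spectrum_in_disc ((1 / R) *\<^sub>R T)"
  unfolding spectrum_in_disc_def
proof (intro allI impI)
  fix z :: complex assume z: "cmod z \<le> 1"
  show "bop_invertible (1 - z *\<^sub>C ((1 / R) *\<^sub>R T))"
  proof (cases "z = 0")
    case True
    then show ?thesis by (auto simp: bop_invertible_def intro!: exI[of _ 1])
  next
    case False
    have "R \<le> cmod (R / z)" using z False R by (simp add: norm_divide field_simps mult_left_le)
    then show ?thesis unfolding one_minus_outer[OF False]
      using False R by (intro bop_invertible_scaleC outside_invertible) auto
  qed
qed

lemma spectrum_in_disc_inner: "spectrum_in_disc ((1 / R) *\<^sub>R bop_inv T)"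
  unfolding spectrum_in_disc_def one_minus_inner
proof (intro allI impI bop_invertible_mult bop_invertible_scaleC outside_invertible)
  fix z :: complex assume z: "cmod z \<le> 1"
  show "cmod (z / R) \<le> 1 / R \<or> R \<le> cmod (z / R)" using z R by (simp add: norm_divide divide_right_mono)
  show "bop_invertible (bop_inv T)"
    using bop_inv_mult[OF T_invertible] unfolding bop_invertible_def by blast
qed simp

end

text \<open>The operator-valued Poisson kernel \<open>\<Sum>n\<ge>1. (z\<^sup>n X\<^sup>n + h.c.)\<close> without its constant term.\<close>

definition poisson_kernel :: "'h::chilbert_space bop \<Rightarrow> complex \<Rightarrow> 'h bop"
  where "poisson_kernel X z = (resolvent X z - 1) + bop_adj (resolvent X z - 1)"

lemma poisson_kernel_adj: "bop_adj (poisson_kernel X z) = poisson_kernel X z"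
  by (simp add: poisson_kernel_def adj_add add.commute)

lemma cinner_poisson_kernel:
  "cinner (bop_apply (poisson_kernel X z) x) y =
    cinner (bop_apply (resolvent X z - 1) x) y + cnj (cinner (bop_apply (resolvent X z - 1) y) x)"
proof -
  have "cinner (bop_apply (bop_adj (resolvent X z - 1)) x) y = cnj (cinner (bop_apply (resolvent X z - 1) y) x)"
    unfolding adj_cinner' by (rule cinner_commute)
  then show ?thesis by (simp only: poisson_kernel_def bop_apply_ring(1) cinner_add_left)
qed

lemma continuous_on_poisson_kernel:
  assumes X: "spectrum_in_disc X" shows "continuous_on S (\<lambda>t. poisson_kernel X (cis (- t)))"
proof -
  have c: "continuous_on S (\<lambda>t. resolvent X (cis (- t)) - 1)"
    by (intro continuous_intros continuous_on_resolvent[OF X]) auto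
  then show ?thesis unfolding poisson_kernel_def
    by (intro continuous_on_add bounded_linear.continuous_on[OF bounded_linear_adj])
qed

text \<open>On the circle \<open>z = e\<^sup>-\<^sup>i\<^sup>t\<close> the Taylor series of the resolvent is a Fourier series: the frequency
  \<open>-n\<close> carries the coefficient \<open>X\<^sup>n\<close>.\<close>

lemma has_integral_resolvent:
  assumes X: "spectrum_in_disc X"
  shows "((\<lambda>t. cis (of_int k * t) * cinner (bop_apply (resolvent X (cis (- t)) - 1) x) y) has_integral
    (if k \<ge> 1 then complex_of_real (2 * pi) * cinner (bop_apply (X ^ nat k) x) y else 0)) {0..2 * pi}"
proof -
  define c where "c n = cinner (bop_apply (X ^ n) x) y" for n
  define a where "a m = (if m \<le> - 1 then c (nat (- m)) else 0)" for m :: int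
  define f where "f t = cinner (bop_apply (resolvent X (cis (- t)) - 1) x) y" for t
  have cn: "norm (c n) \<le> norm (X ^ n) * (norm x * norm y)" for n
  proof -
    have "norm (c n) \<le> norm (bop_apply (X ^ n) x) * norm y" unfolding c_def by (rule cinner_Cauchy_Schwarz)
    also have "\<dots> \<le> norm (X ^ n) * norm x * norm y" by (intro mult_right_mono norm_bop_apply) simp
    finally show ?thesis by (simp add: mult.assoc)
  qed
  have sc: "summable (\<lambda>n. norm (c n))"
    by (rule summable_comparison_test'[OF summable_mult2[OF spectrum_in_disc_summable[OF X], of "norm x * norm y"], of 0])
       (use cn in simp)
  let ?i = "\<lambda>n. - int (Suc n)"
  have inj: "inj ?i" by (auto simp: inj_on_def)
  have rng: "range ?i = {m. m \<le> - 1}"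
  proof -
    have "m \<in> range ?i" if "m \<le> - 1" for m using that by (intro image_eqI[of _ _ "nat (- m - 1)"]) auto
    then show ?thesis by auto
  qed
  have ai: "a (?i n) = c (Suc n)" for n by (simp add: a_def del: of_nat_Suc)
  have UN: "(h has_sum s) UNIV" if "(\<lambda>n. h (?i n)) sums s" "summable (\<lambda>n. norm (h (?i n)))"
    "\<And>m. \<not> m \<le> - 1 \<Longrightarrow> h m = 0" for h :: "int \<Rightarrow> 'b::banach" and s
  proof -
    have "((\<lambda>n. h (?i n)) has_sum s) UNIV" using that(1,2) by (rule norm_summable_imp_has_sum[rotated])
    then have "(h has_sum s) (range ?i)" using inj by (subst has_sum_reindex) (auto simp: o_def)
    then show ?thesis by (subst has_sum_cong_neutral[of "range ?i" UNIV]) (use that(3) rng in auto)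
  qed
  have sc': "summable (\<lambda>n. norm (c (Suc n)))" using sc by (subst summable_Suc_iff)
  have "((\<lambda>m. norm (a m)) has_sum (\<Sum>n. norm (c (Suc n)))) UNIV"
    by (rule UN) (unfold ai, use sc' summable_sums in \<open>auto simp: a_def\<close>)
  then have sa: "(\<lambda>m. norm (a m)) summable_on UNIV" by (rule has_sum_imp_summable)
  have "((\<lambda>m. a m * cis (of_int m * t)) has_sum f t) UNIV" for t
  proof (rule UN)
    have pw: "cis (of_int (?i n) * t) = cis (- t) ^ Suc n" for n
      by (simp only: Complex.DeMoivre) (simp add: algebra_simps)
    have "(\<lambda>n. cinner (bop_apply (cis (- t) ^ n *\<^sub>C X ^ n) x) y) sums cinner (bop_apply (resolvent X (cis (- t))) x) y"
      by (rule bounded_linear.sums[OF bounded_linear_bop_cinner resolvent_sums[OF X]]) simp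
    then have "(\<lambda>n. cinner (bop_apply (cis (- t) ^ Suc n *\<^sub>C X ^ Suc n) x) y) sums
        (cinner (bop_apply (resolvent X (cis (- t))) x) y - cinner x y)"
      by (subst sums_Suc_iff) simp
    then show "(\<lambda>n. a (?i n) * cis (of_int (?i n) * t)) sums f t"
      unfolding ai pw by (simp add: f_def c_def cinner_simps mult.commute del: power_Suc)
    show "summable (\<lambda>n. norm (a (?i n) * cis (of_int (?i n) * t)))"
      unfolding ai using sc' by (simp add: norm_mult)
  qed (simp add: a_def)
  from has_integral_Fourier_coefficient[OF sa this, of "- k"]
  show ?thesis by (cases "k \<ge> 1") (simp_all add: f_def a_def c_def mult.commute)
qed

lemma has_integral_cnj: "(f has_integral I) S \<Longrightarrow> ((\<lambda>t. cnj (f t)) has_integral cnj I) S"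
  using has_integral_linear[OF _ bounded_linear_cnj] by (force simp: o_def)

lemma has_integral_poisson_kernel:
  assumes X: "spectrum_in_disc X"
  shows "((\<lambda>t. cis (of_int k * t) * cinner (bop_apply (poisson_kernel X (cis (- t))) x) y) has_integral
    complex_of_real (2 * pi) * (if k \<ge> 1 then cinner (bop_apply (X ^ nat k) x) y
      else if k \<le> - 1 then cnj (cinner (bop_apply (X ^ nat (- k)) y) x) else 0)) {0..2 * pi}"
proof -
  have "((\<lambda>t. cis (of_int k * t) * cinner (bop_apply (resolvent X (cis (- t)) - 1) x) y
      + cnj (cis (of_int (- k) * t) * cinner (bop_apply (resolvent X (cis (- t)) - 1) y) x)) has_integral
    (if k \<ge> 1 then complex_of_real (2 * pi) * cinner (bop_apply (X ^ nat k) x) y else 0)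
    + cnj (if - k \<ge> 1 then complex_of_real (2 * pi) * cinner (bop_apply (X ^ nat (- k)) y) x else 0)) {0..2 * pi}"
    by (intro has_integral_add has_integral_cnj has_integral_resolvent X)
  moreover have "(if k \<ge> 1 then complex_of_real (2 * pi) * cinner (bop_apply (X ^ nat k) x) y else 0)
    + cnj (if - k \<ge> 1 then complex_of_real (2 * pi) * cinner (bop_apply (X ^ nat (- k)) y) x else 0)
    = complex_of_real (2 * pi) * (if k \<ge> 1 then cinner (bop_apply (X ^ nat k) x) y
      else if k \<le> - 1 then cnj (cinner (bop_apply (X ^ nat (- k)) y) x) else 0)" by auto
  ultimately show ?thesis unfolding cinner_poisson_kernel
    by (simp add: distrib_left cis_cnj)
qed

lemma has_integral_rescale:
  fixes g :: "real \<Rightarrow> 'a::banach"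
  assumes "(g has_integral I) {0..b}" "0 < m" "0 \<le> b"
  shows "((\<lambda>s. m *\<^sub>R g (m * s)) has_integral I) {0..b / m}"
proof -
  have "((\<lambda>x. g (m *\<^sub>R x + 0)) has_integral (1 / \<bar>m\<bar> ^ DIM(real)) *\<^sub>R I)
      ((\<lambda>x. (1 / m) *\<^sub>R x + - ((1 / m) *\<^sub>R 0)) ` cbox 0 b)"
    using assms by (intro has_integral_affinity) auto
  moreover have "(\<lambda>x. (1 / m) *\<^sub>R x + - ((1 / m) *\<^sub>R 0)) ` cbox 0 b = {0..b / m}"
    using assms image_mult_atLeastAtMost[of "1 / m" 0 b] by simp
  ultimately have "((\<lambda>x. g (m * x)) has_integral (1 / m) *\<^sub>R I) {0..b / m}" using assms by simp
  from has_integral_cmul[OF this, of m] show ?thesis using assms by simp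
qed

text \<open>The inner circle is traversed clockwise.\<close>

lemma has_integral_circle_reflect:
  fixes F :: "complex \<Rightarrow> 'a::banach"
  assumes "((\<lambda>t. F (cis t)) has_integral I) {0..2 * pi}"
  shows "((\<lambda>t. F (cis (- t))) has_integral I) {0..2 * pi}"
proof -
  have "((\<lambda>x. F (cis (- 1 *\<^sub>R x + 2 * pi))) has_integral (1 / \<bar>- 1\<bar> ^ DIM(real)) *\<^sub>R I)
      ((\<lambda>x. (1 / - 1) *\<^sub>R x + - ((1 / - 1) *\<^sub>R (2 * pi))) ` cbox 0 (2 * pi))"
    using assms by (intro has_integral_affinity) auto
  moreover have "(\<lambda>x. (1 / - 1) *\<^sub>R x + - ((1 / - 1) *\<^sub>R (2 * pi))) ` cbox 0 (2 * pi) = {0..2 * pi}"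
    by (auto intro!: image_eqI[of _ _ "2 * pi - x" for x])
  moreover have "cis (- 1 *\<^sub>R x + 2 * pi) = cis (- x)" for x
    by (simp add: complex_eq_iff cos_diff sin_diff)
  ultimately show ?thesis by simp
qed

lemma dlp_kernel_eq:
  assumes "bop_invertible (\<sigma> s *\<^sub>C 1 - T)"
    and Y: "Y = vector_derivative \<sigma> (at s) *\<^sub>C bop_inv (\<sigma> s *\<^sub>C 1 - T)"
  shows "dlp_kernel \<sigma> s T = (1 / (2 * complex_of_real pi * \<i>)) *\<^sub>C (Y - bop_adj Y)"
proof -
  have "cnj (\<sigma> s) *\<^sub>C 1 - bop_adj T = bop_adj (\<sigma> s *\<^sub>C 1 - T)" by (simp add: adj_diff adj_scaleC)
  then show ?thesis unfolding dlp_kernel_def Y Let_def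
    by (simp add: bop_inv_adj[OF assms(1)] adj_scaleC)
qed

lemma boundary_points:
  fixes R :: real
  assumes R: "R > 1"
  shows "R * cis t \<in> closure (annulus R)" "cis t / R \<in> closure (annulus R)"
proof -
  have "1 / R \<le> R" using R by (simp add: field_simps) (smt (verit) mult_less_cancel_left2)
  then show "R * cis t \<in> closure (annulus R)" "cis t / R \<in> closure (annulus R)"
    using R by (simp_all add: closure_annulus norm_mult norm_divide)
qed

context
  fixes R :: real and T :: "'h::chilbert_space bop"
  assumes R: "R > 1" and spec: "bop_spectrum T \<subseteq> annulus R"
begin

text \<open>With \<open>z = e\<^sup>-\<^sup>i\<^sup>s\<^sup>/\<^sup>R\<close> the boundary point is \<open>\<sigma> = R / z\<close>, so that \<open>\<sigma>' = (i / R) \<sigma>\<close> and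
  \<open>\<sigma> (\<sigma> - T)\<^sup>-\<^sup>1 = (1 - z T / R)\<^sup>-\<^sup>1\<close>. Adding the adjoint produces the constant term \<open>2\<close>.\<close>

lemma dlp_kernel_outer:
  "dlp_kernel (outer_circle R) s T = (1 / R) *\<^sub>R (1 / (2 * pi)) *\<^sub>R
    (poisson_kernel ((1 / R) *\<^sub>R T) (cis (- (s / R))) + 2 *\<^sub>R 1)"
proof -
  let ?X = "(1 / R) *\<^sub>R T"
  define z where "z = cis (- (s / R))"
  have z: "z \<noteq> 0" "cmod z = 1" by (auto simp: z_def)
  have s: "outer_circle R s = R / z" by (simp add: outer_circle_def z_def divide_inverse)
  have "(outer_circle R has_vector_derivative (\<i> / R) * (R / z)) (at s)"
    unfolding s[symmetric] unfolding outer_circle_def cis_conv_exp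
    using R by (auto intro!: derivative_eq_intros has_vector_derivative_real_field)
  then have d: "vector_derivative (outer_circle R) (at s) = (\<i> / R) * (R / z)"
    by (rule vector_derivative_at)
  have inv: "bop_invertible ((R / z) *\<^sub>C 1 - T)"
    by (rule outside_invertible[OF R spec]) (use R z in \<open>simp add: norm_divide\<close>)
  have Xi: "bop_invertible (1 - z *\<^sub>C ?X)"
    using spectrum_in_disc_outer[OF R spec] z by (simp add: spectrum_in_disc_def)
  note r = resolvent_mult[OF Xi]
  have e: "(R / z) *\<^sub>C 1 - T = (R / z) *\<^sub>C (1 - z *\<^sub>C ?X)"
    unfolding one_minus_outer[OF R spec z(1)] using R z by (simp add: scaleC_scaleC)
  have "bop_inv ((R / z) *\<^sub>C 1 - T) = (z / R) *\<^sub>C resolvent ?X z"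
    by (rule bop_inv_eqI) (unfold e, use r R z in \<open>simp_all add: bop_scaleC_mult_left bop_scaleC_mult_right scaleC_scaleC\<close>)
  then have Y: "(\<i> / R) *\<^sub>C resolvent ?X z = vector_derivative (outer_circle R) (at s) *\<^sub>C bop_inv (outer_circle R s *\<^sub>C 1 - T)"
    unfolding d s using R z by (simp add: scaleC_scaleC)
  have "dlp_kernel (outer_circle R) s T = (1 / (2 * complex_of_real pi * \<i>)) *\<^sub>C
      ((\<i> / R) *\<^sub>C resolvent ?X z - bop_adj ((\<i> / R) *\<^sub>C resolvent ?X z))"
    by (rule dlp_kernel_eq[OF _ Y]) (simp add: s inv)
  also have "(\<i> / R) *\<^sub>C resolvent ?X z - bop_adj ((\<i> / R) *\<^sub>C resolvent ?X z)
      = (\<i> / R) *\<^sub>C (resolvent ?X z + bop_adj (resolvent ?X z))"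
    by (simp add: adj_scaleC scaleC_add_right scaleC_minus_left)
  also have "resolvent ?X z + bop_adj (resolvent ?X z) = poisson_kernel ?X z + 2 *\<^sub>R 1"
    by (simp add: poisson_kernel_def adj_diff scaleR_2)
  also have "(1 / (2 * complex_of_real pi * \<i>)) *\<^sub>C (\<i> / R) *\<^sub>C (poisson_kernel ?X z + 2 *\<^sub>R 1)
      = (1 / R) *\<^sub>R (1 / (2 * pi)) *\<^sub>R (poisson_kernel ?X z + 2 *\<^sub>R 1)"
    by (simp add: scaleC_scaleC scaleR_scaleC[where 'a="'h bop"] mult.commute mult.left_commute)
  finally show ?thesis by (simp add: z_def)
qed

text \<open>With \<open>z = e\<^sup>-\<^sup>i\<^sup>R\<^sup>s\<close> the boundary point is \<open>\<sigma> = z / R\<close>, so that \<open>\<sigma>' = - i R \<sigma>\<close>, and for \<open>Q = T\<^sup>-\<^sup>1 / R\<close>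
  one has \<open>\<sigma> (\<sigma> - T)\<^sup>-\<^sup>1 = - z Q (1 - z Q)\<^sup>-\<^sup>1 = 1 - (1 - z Q)\<^sup>-\<^sup>1\<close>. On this circle the constant term
  cancels.\<close>

lemma dlp_kernel_inner:
  "dlp_kernel (inner_circle R) s T = R *\<^sub>R (1 / (2 * pi)) *\<^sub>R
    poisson_kernel ((1 / R) *\<^sub>R bop_inv T) (cis (- (R * s)))"
proof -
  let ?X = "(1 / R) *\<^sub>R bop_inv T"
  define z where "z = cis (- (R * s))"
  have z: "z \<noteq> 0" "cmod z = 1" by (auto simp: z_def)
  have s: "inner_circle R s = z / R" by (simp add: inner_circle_def z_def)
  have "(inner_circle R has_vector_derivative (- \<i> * R) * (z / R)) (at s)"
    unfolding s[symmetric] unfolding inner_circle_def cis_conv_exp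
    using R by (auto intro!: derivative_eq_intros has_vector_derivative_real_field)
  then have d: "vector_derivative (inner_circle R) (at s) = (- \<i> * R) * (z / R)"
    by (rule vector_derivative_at)
  have inv: "bop_invertible ((z / R) *\<^sub>C 1 - T)"
    by (rule outside_invertible[OF R spec]) (use R z in \<open>simp add: norm_divide\<close>)
  have Xi: "bop_invertible (1 - z *\<^sub>C ?X)"
    using spectrum_in_disc_inner[OF R spec] z by (simp add: spectrum_in_disc_def)
  note r = resolvent_mult[OF Xi]
  note Ti = bop_inv_mult[OF T_invertible[OF R spec]]
  have e: "(z / R) *\<^sub>C 1 - T = (- 1) *\<^sub>C ((1 - z *\<^sub>C ?X) * T)"
    unfolding one_minus_inner[OF R spec] by (simp add: mult.assoc Ti scaleC_minus_left)
  have "bop_inv ((z / R) *\<^sub>C 1 - T) = (- 1) *\<^sub>C (bop_inv T * resolvent ?X z)"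
  proof (rule bop_inv_eqI)
    have "bop_inv T * resolvent ?X z * ((1 - z *\<^sub>C ?X) * T) = bop_inv T * (resolvent ?X z * (1 - z *\<^sub>C ?X)) * T"
      by (simp only: mult.assoc)
    also have "\<dots> = 1" unfolding r by (simp add: Ti)
    finally show "(- 1) *\<^sub>C (bop_inv T * resolvent ?X z) * ((z / R) *\<^sub>C 1 - T) = 1"
      unfolding e by (simp add: bop_scaleC_mult_left bop_scaleC_mult_right scaleC_scaleC)
    have "(1 - z *\<^sub>C ?X) * T * (bop_inv T * resolvent ?X z) = (1 - z *\<^sub>C ?X) * (T * bop_inv T) * resolvent ?X z"
      by (simp only: mult.assoc)
    also have "\<dots> = 1" unfolding Ti by (simp add: r)
    finally show "((z / R) *\<^sub>C 1 - T) * (- 1) *\<^sub>C (bop_inv T * resolvent ?X z) = 1"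
      unfolding e by (simp add: bop_scaleC_mult_left bop_scaleC_mult_right scaleC_scaleC)
  qed
  moreover have "(z / R) *\<^sub>C (bop_inv T * resolvent ?X z) = resolvent ?X z - 1"
  proof -
    have "(z / R) *\<^sub>C (bop_inv T * resolvent ?X z) = (z *\<^sub>C ?X) * resolvent ?X z"
      by (simp add: bop_scaleC_mult_left scaleC_scaleC scaleR_scaleC[where 'a="'h bop"])
    then show ?thesis using r(2) by (simp add: left_diff_distrib algebra_simps)
  qed
  moreover have "((- \<i> * R) * (z / R)) *\<^sub>C (- 1) *\<^sub>C Z = (\<i> * R) *\<^sub>C (z / R) *\<^sub>C Z" for Z :: "'h bop"
    by (simp only: scaleC_scaleC, rule arg_cong[where f = "\<lambda>a. a *\<^sub>C Z"]) (simp add: mult_ac)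
  ultimately have Y: "(\<i> * R) *\<^sub>C (resolvent ?X z - 1) = vector_derivative (inner_circle R) (at s) *\<^sub>C bop_inv (inner_circle R s *\<^sub>C 1 - T)"
    unfolding d s by (simp only:)
  have "dlp_kernel (inner_circle R) s T = (1 / (2 * complex_of_real pi * \<i>)) *\<^sub>C
      ((\<i> * R) *\<^sub>C (resolvent ?X z - 1) - bop_adj ((\<i> * R) *\<^sub>C (resolvent ?X z - 1)))"
    by (rule dlp_kernel_eq[OF _ Y]) (simp add: s inv)
  also have "(\<i> * R) *\<^sub>C (resolvent ?X z - 1) - bop_adj ((\<i> * R) *\<^sub>C (resolvent ?X z - 1))
      = (\<i> * R) *\<^sub>C poisson_kernel ?X z"
    unfolding poisson_kernel_def adj_scaleC by (simp add: scaleC_add_right scaleC_minus_left)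
  also have "(1 / (2 * complex_of_real pi * \<i>)) *\<^sub>C (\<i> * R) *\<^sub>C poisson_kernel ?X z
      = R *\<^sub>R (1 / (2 * pi)) *\<^sub>R poisson_kernel ?X z"
    by (simp add: scaleC_scaleC scaleR_scaleC[where 'a="'h bop"])
  finally show ?thesis by (simp add: z_def)
qed

text \<open>Since both circles see the same constant Laurent coefficient, an arbitrary operator \<open>A\<close> can be
  moved from the density on the outer circle to the one on the inner circle.\<close>

lemma dlp_map_has_integral:
  assumes c: "c > - 2" and f: "f \<in> annulus_algebra R"
  shows "((\<lambda>t. (1 / (2 * pi * (2 + c))) *\<^sub>R
      (f (R * cis t) *\<^sub>C (poisson_kernel ((1 / R) *\<^sub>R T) (cis (- t)) + ((2 + c) *\<^sub>R 1 - A)) +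
       f (cis (- t) / R) *\<^sub>C (poisson_kernel ((1 / R) *\<^sub>R bop_inv T) (cis (- t)) + A)))
    has_integral dlp_map R c T f) {0..2 * pi}"
proof -
  let ?P = "(1 / R) *\<^sub>R T" and ?Q = "(1 / R) *\<^sub>R bop_inv T"
  have fc: "continuous_on (closure (annulus R)) f" using f by (simp add: annulus_algebra_def)
  have fo: "continuous_on S (\<lambda>t. f (R * cis t))" for S
    by (rule continuous_on_compose2[OF fc]) (auto intro!: continuous_intros boundary_points[OF R])
  have fi: "continuous_on S (\<lambda>t. f (cis (- t) / R))" for S
    by (rule continuous_on_compose2[OF fc]) (use R in \<open>auto intro!: continuous_intros boundary_points\<close>)
  have cP: "continuous_on S (\<lambda>t. poisson_kernel ?P (cis (- t)))" for S
    by (rule continuous_on_poisson_kernel[OF spectrum_in_disc_outer[OF R spec]])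
  have cQ: "continuous_on S (\<lambda>t. poisson_kernel ?Q (cis (- t)))" for S
    by (rule continuous_on_poisson_kernel[OF spectrum_in_disc_inner[OF R spec]])
  define go where "go t = (1 / (2 * pi)) *\<^sub>R f (R * cis t) *\<^sub>C (poisson_kernel ?P (cis (- t)) + 2 *\<^sub>R 1)" for t
  define gi where "gi t = (1 / (2 * pi)) *\<^sub>R f (cis (- t) / R) *\<^sub>C poisson_kernel ?Q (cis (- t))" for t
  have sc: "a *\<^sub>C r *\<^sub>R X = r *\<^sub>R a *\<^sub>C X" for a r and X :: "'h bop"
    by (simp add: scaleR_scaleC[where 'a="'h bop"] scaleC_scaleC mult.commute)
  have o: "(go has_integral integral {0..2 * pi} go) {0..2 * pi}" unfolding go_def
    by (intro integrable_integral integrable_continuous_real continuous_intros fo cP)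
  have i: "(gi has_integral integral {0..2 * pi} gi) {0..2 * pi}" unfolding gi_def
    by (intro integrable_integral integrable_continuous_real continuous_intros fi cQ)
  have "((\<lambda>s. (1 / R) *\<^sub>R go ((1 / R) * s)) has_integral integral {0..2 * pi} go) {0..2 * pi / (1 / R)}"
    by (rule has_integral_rescale[OF o]) (use R in auto)
  moreover have "(1 / R) *\<^sub>R go ((1 / R) * s) = f (outer_circle R s) *\<^sub>C dlp_kernel (outer_circle R) s T" for s
    unfolding dlp_kernel_outer go_def by (simp add: outer_circle_def sc)
  ultimately have io: "integral {0..2 * pi * R} (\<lambda>s. f (outer_circle R s) *\<^sub>C dlp_kernel (outer_circle R) s T)
      = integral {0..2 * pi} go" by (simp add: integral_unique)
  have "((\<lambda>s. R *\<^sub>R gi (R * s)) has_integral integral {0..2 * pi} gi) {0..2 * pi / R}"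
    by (rule has_integral_rescale[OF i]) (use R in auto)
  moreover have "R *\<^sub>R gi (R * s) = f (inner_circle R s) *\<^sub>C dlp_kernel (inner_circle R) s T" for s
    unfolding dlp_kernel_inner gi_def by (simp add: inner_circle_def sc)
  ultimately have ii: "integral {0..2 * pi / R} (\<lambda>s. f (inner_circle R s) *\<^sub>C dlp_kernel (inner_circle R) s T)
      = integral {0..2 * pi} gi" by (simp add: integral_unique)
  have D: "((\<lambda>t. go t + gi t) has_integral dlp_integral R T f) {0..2 * pi}"
    unfolding dlp_integral_def io ii by (intro has_integral_add o i)
  let ?a = "laurent_coeffs R f 0"
  have RR: "1 / R \<le> R" using R by (simp add: field_simps) (smt (verit) mult_less_cancel_left2)
  have mo: "((\<lambda>t. f (R * cis t)) has_integral complex_of_real (2 * pi) * ?a) {0..2 * pi}"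
    using Laurent_constant_coefficient[OF R f, of R] RR by simp
  have "((\<lambda>t. f (complex_of_real (1 / R) * cis t)) has_integral complex_of_real (2 * pi) * ?a) {0..2 * pi}"
    using Laurent_constant_coefficient[OF R f, of "1 / R"] RR by simp
  then have mi: "((\<lambda>t. f (cis (- t) / R)) has_integral complex_of_real (2 * pi) * ?a) {0..2 * pi}"
    using has_integral_circle_reflect[of "\<lambda>z. f (complex_of_real (1 / R) * z)"] by simp
  have sB: "((\<lambda>t. g t *\<^sub>C B) has_integral I *\<^sub>C B) {0..2 * pi}"
    if "(g has_integral I) {0..2 * pi}" for g I and B :: "'h bop"
    using has_integral_linear[OF that bounded_bilinear.bounded_linear_left[OF bounded_bilinear_scaleC_bop, of B]]
    by (simp add: o_def)
  have "((\<lambda>t. (1 / (2 + c)) *\<^sub>R ((go t + gi t) + (1 / (2 * pi)) *\<^sub>R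
      (f (R * cis t) *\<^sub>C (c *\<^sub>R 1 - A) + f (cis (- t) / R) *\<^sub>C A))) has_integral
      (1 / (2 + c)) *\<^sub>R (dlp_integral R T f + (1 / (2 * pi)) *\<^sub>R
      ((complex_of_real (2 * pi) * ?a) *\<^sub>C (c *\<^sub>R 1 - A) + (complex_of_real (2 * pi) * ?a) *\<^sub>C A))) {0..2 * pi}"
    by (intro has_integral_cmul has_integral_add D sB mo mi)
  moreover have "(1 / (2 + c)) *\<^sub>R (dlp_integral R T f + (1 / (2 * pi)) *\<^sub>R
      ((complex_of_real (2 * pi) * ?a) *\<^sub>C (c *\<^sub>R 1 - A) + (complex_of_real (2 * pi) * ?a) *\<^sub>C A)) = dlp_map R c T f"
    unfolding dlp_map_def scaleC_add_right[symmetric]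
    by (simp add: scaleR_scaleC[where 'a="'h bop"] scaleC_scaleC mult.commute)
  moreover have "(1 / (2 + c)) *\<^sub>R ((go t + gi t) + (1 / (2 * pi)) *\<^sub>R
      (f (R * cis t) *\<^sub>C (c *\<^sub>R 1 - A) + f (cis (- t) / R) *\<^sub>C A)) = (1 / (2 * pi * (2 + c))) *\<^sub>R
      (f (R * cis t) *\<^sub>C (poisson_kernel ?P (cis (- t)) + ((2 + c) *\<^sub>R 1 - A)) +
       f (cis (- t) / R) *\<^sub>C (poisson_kernel ?Q (cis (- t)) + A))" for t
  proof -
    have "(2 + c) *\<^sub>R (1::'h bop) - A = 2 *\<^sub>R 1 + (c *\<^sub>R 1 - A)" by (simp add: scaleR_add_left)
    then show ?thesis unfolding go_def gi_def
      by (simp only: scaleC_add_right scaleR_add_right scaleR_scaleR) (simp add: mult.commute)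
  qed
  ultimately show ?thesis by simp
qed

end

section \<open>Norms of matrices of operators\<close>

lemma L2_set_norm_scaleR:
  "0 \<le> t \<Longrightarrow> L2_set (\<lambda>j. norm (t *\<^sub>R x j)) A = t * L2_set (\<lambda>j. norm (x j)) A"
  by (simp add: L2_set_right_distrib)

lemma L2_set_sum_le:
  fixes M :: "nat \<Rightarrow> nat \<Rightarrow> 'a \<Rightarrow> 'a::real_normed_vector"
  assumes M: "\<And>i j x. i < m \<Longrightarrow> j < m \<Longrightarrow> norm (M i j x) \<le> K i j * norm x"
    and K: "\<And>i j. 0 \<le> K i j" and x: "L2_set (\<lambda>j. norm (x j)) {..<m} \<le> 1"
  shows "L2_set (\<lambda>i. norm (\<Sum>j<m. M i j (x j))) {..<m} \<le> (\<Sum>i<m. \<Sum>j<m. K i j)"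
proof -
  have xj: "norm (x j) \<le> 1" if "j < m" for j
    using member_le_L2_set[of "{..<m}" j "\<lambda>j. norm (x j)"] that x by simp
  have "L2_set (\<lambda>i. norm (\<Sum>j<m. M i j (x j))) {..<m} \<le> (\<Sum>i<m. norm (\<Sum>j<m. M i j (x j)))"
    by (rule L2_set_le_sum) simp
  also have "\<dots> \<le> (\<Sum>i<m. \<Sum>j<m. K i j)"
  proof (intro sum_mono order_trans[OF norm_sum])
    fix i j assume ij: "i \<in> {..<m}" "j \<in> {..<m}"
    then have "norm (M i j (x j)) \<le> K i j * norm (x j)" by (intro M) auto
    also have "\<dots> \<le> K i j" using xj[of j] ij K[of i j] by (simp add: mult_left_le)
    finally show "norm (M i j (x j)) \<le> K i j" .
  qed
  finally show ?thesis .
qed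

lemma matrix_opnormI:
  fixes M :: "nat \<Rightarrow> nat \<Rightarrow> 'a \<Rightarrow> 'a::real_normed_vector"
  assumes "\<And>x. L2_set (\<lambda>j. norm (x j)) {..<m} \<le> 1 \<Longrightarrow> L2_set (\<lambda>i. norm (\<Sum>j<m. M i j (x j))) {..<m} \<le> C"
  shows "matrix_opnorm m M \<le> C"
  unfolding matrix_opnorm_def using assms by (intro cSUP_least) (auto simp: L2_set_def intro!: exI[of _ "\<lambda>_. 0"])

lemma matrix_opnorm_le_sum:
  fixes M :: "nat \<Rightarrow> nat \<Rightarrow> 'a \<Rightarrow> 'a::real_normed_vector"
  assumes "\<And>i j x. i < m \<Longrightarrow> j < m \<Longrightarrow> norm (M i j x) \<le> K i j * norm x" "\<And>i j. 0 \<le> K i j"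
  shows "matrix_opnorm m M \<le> (\<Sum>i<m. \<Sum>j<m. K i j)"
  using assms by (intro matrix_opnormI L2_set_sum_le)

lemma matrix_opnorm_ball:
  fixes M :: "nat \<Rightarrow> nat \<Rightarrow> 'a \<Rightarrow> 'a::real_normed_vector"
  assumes lin: "\<And>i j. i < m \<Longrightarrow> j < m \<Longrightarrow> bounded_linear (M i j)"
    and y: "L2_set (\<lambda>j. norm (y j)) {..<m} \<le> 1"
  shows "L2_set (\<lambda>i. norm (\<Sum>j<m. M i j (y j))) {..<m} \<le> matrix_opnorm m M"
proof -
  define K where "K i j = onorm (M i j)" for i j
  define K' where "K' i j = (if i < m \<and> j < m then K i j else 0)" for i j
  have K': "norm (M i j x) \<le> K' i j * norm x" if "i < m" "j < m" for i j x
    using onorm[OF lin[OF that]] that by (simp add: K'_def K_def)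
  have K0: "0 \<le> K' i j" for i j using onorm_pos_le[OF lin] by (simp add: K'_def K_def)
  have bdd: "bdd_above ((\<lambda>x. L2_set (\<lambda>i. norm (\<Sum>j<m. M i j (x j))) {..<m})
      ` {x. L2_set (\<lambda>j. norm (x j)) {..<m} \<le> 1})"
    using L2_set_sum_le[OF K' K0] by (intro bdd_aboveI) auto
  show ?thesis
    unfolding matrix_opnorm_def by (rule cSUP_upper[OF _ bdd]) (use y in simp)
qed

lemma matrix_opnorm_nonneg:
  fixes M :: "nat \<Rightarrow> nat \<Rightarrow> 'a \<Rightarrow> 'a::real_normed_vector"
  assumes "\<And>i j. i < m \<Longrightarrow> j < m \<Longrightarrow> bounded_linear (M i j)"
  shows "0 \<le> matrix_opnorm m M"
proof -
  have "L2_set (\<lambda>i. norm (\<Sum>j<m. M i j 0)) {..<m} \<le> matrix_opnorm m M"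
    using assms by (rule matrix_opnorm_ball) (simp_all add: L2_set_def)
  then show ?thesis using L2_set_nonneg order_trans by blast
qed

lemma matrix_opnorm_bound:
  fixes M :: "nat \<Rightarrow> nat \<Rightarrow> 'a \<Rightarrow> 'a::real_normed_vector"
  assumes lin: "\<And>i j. i < m \<Longrightarrow> j < m \<Longrightarrow> bounded_linear (M i j)"
  shows "L2_set (\<lambda>i. norm (\<Sum>j<m. M i j (x j))) {..<m} \<le> matrix_opnorm m M * L2_set (\<lambda>j. norm (x j)) {..<m}"
proof -
  have ball: "L2_set (\<lambda>i. norm (\<Sum>j<m. M i j (y j))) {..<m} \<le> matrix_opnorm m M"
    if "L2_set (\<lambda>j. norm (y j)) {..<m} \<le> 1" for y
    using lin that by (rule matrix_opnorm_ball)
  define r where "r = L2_set (\<lambda>j. norm (x j)) {..<m}"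
  have r0: "0 \<le> r" by (simp add: r_def)
  show ?thesis
  proof (cases "r = 0")
    case True
    then have "x j = 0" if "j < m" for j
      using that by (simp add: r_def L2_set_eq_0_iff)
    then have "M i j (x j) = 0" if "i < m" "j < m" for i j
      using that linear_0[OF bounded_linear.linear[OF lin[OF that]]] by simp
    then have "L2_set (\<lambda>i. norm (\<Sum>j<m. M i j (x j))) {..<m} = L2_set (\<lambda>i. 0) {..<m}"
      by (intro L2_set_cong) (auto intro!: sum.neutral)
    then show ?thesis using True by (simp add: r_def L2_set_def)
  next
    case False
    then have r: "0 < r" using r0 by simp
    have e: "L2_set (\<lambda>j. norm ((1 / r) *\<^sub>R x j)) {..<m} = (1 / r) * r"
      unfolding r_def using r by (intro L2_set_norm_scaleR) (simp add: r_def)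
    have r1: "(1 / r) * r = 1" using r by simp
    have "L2_set (\<lambda>i. norm (\<Sum>j<m. M i j ((1 / r) *\<^sub>R x j))) {..<m} \<le> matrix_opnorm m M"
      by (rule ball) (simp only: e r1 order_refl)
    moreover have "L2_set (\<lambda>i. norm (\<Sum>j<m. M i j ((1 / r) *\<^sub>R x j))) {..<m}
        = L2_set (\<lambda>i. (1 / r) * norm (\<Sum>j<m. M i j (x j))) {..<m}"
    proof (intro L2_set_cong refl)
      fix i assume i: "i \<in> {..<m}"
      have "(\<Sum>j<m. M i j ((1 / r) *\<^sub>R x j)) = (1 / r) *\<^sub>R (\<Sum>j<m. M i j (x j))"
        unfolding scaleR_sum_right
        by (intro sum.cong refl linear_scale[OF bounded_linear.linear[OF lin]]) (use i in auto)
      then show "norm (\<Sum>j<m. M i j ((1 / r) *\<^sub>R x j)) = (1 / r) * norm (\<Sum>j<m. M i j (x j))"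
        using r by simp
    qed
    moreover have "\<dots> = (1 / r) * L2_set (\<lambda>i. norm (\<Sum>j<m. M i j (x j))) {..<m}"
      by (rule L2_set_right_distrib[symmetric]) (use r in simp)
    ultimately have "(1 / r) * L2_set (\<lambda>i. norm (\<Sum>j<m. M i j (x j))) {..<m} \<le> matrix_opnorm m M"
      by (simp only:)
    then show ?thesis using r unfolding r_def[symmetric] by (simp add: field_simps)
  qed
qed

lemma orthonormal_norm_sum:
  assumes "orthonormal k e"
  shows "(norm (\<Sum>l<k. d l *\<^sub>C (e l :: 'h::chilbert_space)))\<^sup>2 = (\<Sum>l<k. (cmod (d l))\<^sup>2)"
proof -
  have "cinner (\<Sum>l<k. d l *\<^sub>C e l) (\<Sum>l<k. d l *\<^sub>C e l)
      = (\<Sum>i<k. \<Sum>l<k. d l * (cnj (d i) * cinner (e l) (e i)))"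
    by (simp add: cinner_sum_left cinner_sum_right cinner_scaleC_left cinner_scaleC_right sum_distrib_left
        mult.left_commute)
  also have "\<dots> = (\<Sum>i<k. \<Sum>l<k. if l = i then d i * cnj (d i) else 0)"
    using assms by (intro sum.cong) (auto simp: orthonormal_def)
  also have "\<dots> = (\<Sum>i<k. d i * cnj (d i))" by simp
  also have "\<dots> = (\<Sum>i<k. complex_of_real ((cmod (d i))\<^sup>2))"
    by (simp only: complex_norm_square)
  finally have "complex_of_real ((norm (\<Sum>l<k. d l *\<^sub>C e l))\<^sup>2) = complex_of_real (\<Sum>i<k. (cmod (d i))\<^sup>2)"
    by (simp only: cinner_self of_real_sum)
  then show ?thesis by (simp only: of_real_eq_iff)
qed

text \<open>A scalar matrix has the same norm on \<open>H\<^sup>m\<close> as on \<open>\<complex>\<^sup>m\<close>: expand the vectors in a finite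
  orthonormal system and apply the scalar bound to each coordinate.\<close>

lemma scalar_matrix_amplification:
  fixes \<xi> :: "nat \<Rightarrow> 'h::chilbert_space" and a :: "nat \<Rightarrow> nat \<Rightarrow> complex"
  assumes C: "matrix_opnorm m (\<lambda>i j w. a i j * w) \<le> C"
  shows "L2_set (\<lambda>i. norm (\<Sum>j<m. a i j *\<^sub>C \<xi> j)) {..<m} \<le> C * L2_set (\<lambda>j. norm (\<xi> j)) {..<m}"
proof -
  have scalar: "L2_set (\<lambda>i. cmod (\<Sum>j<m. a i j * w j)) {..<m} \<le> C * L2_set (\<lambda>j. cmod (w j)) {..<m}" for w
    using matrix_opnorm_bound[of m "\<lambda>i j w. a i j * w" w] C
    by (meson L2_set_nonneg bounded_linear_mult_right mult_right_mono order_trans)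
  obtain k e where on: "orthonormal k e"
    and ex: "\<And>v. v \<in> set (map \<xi> [0..<m]) \<Longrightarrow> v = (\<Sum>l<k. cinner v (e l) *\<^sub>C e l)"
    using orthonormal_basis_exists[of "map \<xi> [0..<m]"] by metis
  define c where "c j l = cinner (\<xi> j) (e l)" for j l
  have xi: "\<xi> j = (\<Sum>l<k. c j l *\<^sub>C e l)" if "j < m" for j
    using ex[of "\<xi> j"] that by (simp add: c_def)
  have s: "(\<Sum>j<m. a i j *\<^sub>C \<xi> j) = (\<Sum>l<k. (\<Sum>j<m. a i j * c j l) *\<^sub>C e l)" for i
  proof -
    have scs: "a *\<^sub>C sum f S = (\<Sum>x\<in>S. a *\<^sub>C f x)" for a and f :: "nat \<Rightarrow> 'h" and S
      by (induction S rule: infinite_finite_induct) (auto simp: scaleC_add_right)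
    have ssc: "sum f S *\<^sub>C x = (\<Sum>y\<in>S. f y *\<^sub>C x)" for f :: "nat \<Rightarrow> complex" and x :: 'h and S
      by (induction S rule: infinite_finite_induct) (auto simp: scaleC_add_left)
    have "(\<Sum>j<m. a i j *\<^sub>C \<xi> j) = (\<Sum>j<m. \<Sum>l<k. (a i j * c j l) *\<^sub>C e l)"
      by (intro sum.cong refl) (subst xi, simp, simp add: scs scaleC_scaleC)
    also have "\<dots> = (\<Sum>l<k. \<Sum>j<m. (a i j * c j l) *\<^sub>C e l)" by (rule sum.swap)
    finally show ?thesis by (simp add: ssc)
  qed
  have C0: "0 \<le> C"
    using matrix_opnorm_nonneg[of m "\<lambda>i j w. a i j * w"] C by (simp add: bounded_linear_mult_right)
  have "(\<Sum>i<m. (norm (\<Sum>j<m. a i j *\<^sub>C \<xi> j))\<^sup>2) = (\<Sum>i<m. \<Sum>l<k. (cmod (\<Sum>j<m. a i j * c j l))\<^sup>2)"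
    unfolding s orthonormal_norm_sum[OF on] ..
  also have "\<dots> = (\<Sum>l<k. \<Sum>i<m. (cmod (\<Sum>j<m. a i j * c j l))\<^sup>2)" by (rule sum.swap)
  also have "\<dots> \<le> (\<Sum>l<k. C\<^sup>2 * (\<Sum>j<m. (cmod (c j l))\<^sup>2))"
  proof (rule sum_mono)
    fix l
    have "(L2_set (\<lambda>i. cmod (\<Sum>j<m. a i j * c j l)) {..<m})\<^sup>2 \<le> (C * L2_set (\<lambda>j. cmod (c j l)) {..<m})\<^sup>2"
      by (intro power_mono scalar) simp
    then show "(\<Sum>i<m. (cmod (\<Sum>j<m. a i j * c j l))\<^sup>2) \<le> C\<^sup>2 * (\<Sum>j<m. (cmod (c j l))\<^sup>2)"
      by (simp add: L2_set_def sum_nonneg power_mult_distrib)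
  qed
  also have "\<dots> = C\<^sup>2 * (\<Sum>j<m. \<Sum>l<k. (cmod (c j l))\<^sup>2)"
    by (simp add: sum_distrib_left sum.swap[of _ "{..<k}"])
  also have "(\<Sum>j<m. \<Sum>l<k. (cmod (c j l))\<^sup>2) = (\<Sum>j<m. (norm (\<xi> j))\<^sup>2)"
    by (intro sum.cong refl) (subst xi, simp, simp add: orthonormal_norm_sum[OF on])
  finally have "sqrt (\<Sum>i<m. (norm (\<Sum>j<m. a i j *\<^sub>C \<xi> j))\<^sup>2) \<le> sqrt (C\<^sup>2 * (\<Sum>j<m. (norm (\<xi> j))\<^sup>2))"
    by (rule real_sqrt_le_mono)
  then show ?thesis using C0 by (simp add: L2_set_def real_sqrt_mult)
qed

text \<open>With \<open>G = F\<^sup>1\<^sup>/\<^sup>2\<close> the left side is the real part of \<open>\<langle>a (G x), G y\<rangle>\<close>. The bound is left as a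
  sum of squares, since these, unlike the product of the lengths, can be integrated when \<open>F\<close> varies.\<close>

lemma scalar_matrix_positive_form:
  fixes x y :: "nat \<Rightarrow> 'h::chilbert_space"
  assumes F: "bop_positive F" and C: "matrix_opnorm m (\<lambda>i j w. a i j * w) \<le> C" "0 \<le> C"
  shows "Re (\<Sum>i<m. \<Sum>j<m. a i j * cinner (bop_apply F (x j)) (y i))
    \<le> C / 2 * ((\<Sum>j<m. Re (cinner (bop_apply F (x j)) (x j))) + (\<Sum>i<m. Re (cinner (bop_apply F (y i)) (y i))))"
proof -
  obtain G where G: "bop_positive G" "G * G = F"
    using positive_sqrt_exists[OF F] by blast
  have GG: "cinner (bop_apply F u) v = cinner (bop_apply G u) (bop_apply G v)" for u v
    using adj_cinner[of G "bop_apply G u" v] by (simp add: positive_adj[OF G(1)] flip: G(2))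
  let ?X = "L2_set (\<lambda>j. norm (bop_apply G (x j))) {..<m}" and ?Y = "L2_set (\<lambda>i. norm (bop_apply G (y i))) {..<m}"
  let ?S = "\<lambda>i. \<Sum>j<m. a i j *\<^sub>C bop_apply G (x j)"
  have "Re (\<Sum>i<m. \<Sum>j<m. a i j * cinner (bop_apply F (x j)) (y i))
      = (\<Sum>i<m. Re (cinner (?S i) (bop_apply G (y i))))"
    by (simp add: cinner_sum_left cinner_scaleC_left GG)
  also have "\<dots> \<le> (\<Sum>i<m. \<bar>norm (?S i)\<bar> * \<bar>norm (bop_apply G (y i))\<bar>)"
    using cinner_Cauchy_Schwarz complex_Re_le_cmod by (intro sum_mono) (force intro: order_trans)
  also have "\<dots> \<le> L2_set (\<lambda>i. norm (?S i)) {..<m} * ?Y" by (rule L2_set_mult_ineq)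
  also have "\<dots> \<le> C * ?X * ?Y"
    by (intro mult_right_mono scalar_matrix_amplification C) simp
  also have "\<dots> \<le> C / 2 * (?X\<^sup>2 + ?Y\<^sup>2)"
    using C(2) sum_squares_bound[of ?X ?Y] by (simp add: mult.assoc mult_left_mono)
  also have "?X\<^sup>2 + ?Y\<^sup>2 = (\<Sum>j<m. Re (cinner (bop_apply F (x j)) (x j))) + (\<Sum>i<m. Re (cinner (bop_apply F (y i)) (y i)))"
    by (simp add: L2_set_def sum_nonneg GG Re_cinner_self)
  finally show ?thesis .
qed

section \<open>Dilations imply complete contractivity\<close>

lemma annulus_algebra_bounded:
  assumes R: "R > 1" and f: "\<And>i j. i < m \<Longrightarrow> j < m \<Longrightarrow> f i j \<in> annulus_algebra R"
  obtains C where "0 \<le> C" "\<And>z. z \<in> closure (annulus R) \<Longrightarrow> (\<Sum>i<m. \<Sum>j<m. cmod (f i j z)) \<le> C"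
proof -
  let ?K = "closure (annulus R)"
  have "bounded (annulus R)" by (rule boundedI[of _ R]) (auto simp: annulus_def)
  then have K: "compact ?K" by (simp add: compact_closure)
  have "continuous_on ?K (\<lambda>z. \<Sum>i<m. \<Sum>j<m. cmod (f i j z))"
    using f by (intro continuous_intros) (auto simp: annulus_algebra_def)
  then have "bounded ((\<lambda>z. \<Sum>i<m. \<Sum>j<m. cmod (f i j z)) ` ?K)"
    by (intro compact_imp_bounded compact_continuous_image K)
  then obtain C where C: "\<And>z. z \<in> ?K \<Longrightarrow> norm (\<Sum>i<m. \<Sum>j<m. cmod (f i j z)) \<le> C"
    unfolding bounded_iff by blast
  have "1 \<in> ?K" using R by (simp add: closure_annulus)
  then have "0 \<le> C" using C[of 1] norm_ge_zero order_trans by blast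
  moreover have "(\<Sum>i<m. \<Sum>j<m. cmod (f i j z)) \<le> C" if "z \<in> ?K" for z
    using C[OF that] by (simp add: abs_le_iff)
  ultimately show thesis by (rule that)
qed

lemma scalar_matrix_opnorm_le: "matrix_opnorm m (\<lambda>i j w. a i j * w) \<le> (\<Sum>i<m. \<Sum>j<m. cmod (a i j))"
  by (rule matrix_opnorm_le_sum) (auto simp: norm_mult)

lemma scalar_matrix_opnorm_nonneg: "0 \<le> matrix_opnorm m (\<lambda>i j w. a i j * (w::complex))"
  by (rule matrix_opnorm_nonneg) (rule bounded_linear_mult_right)

text \<open>The bound of \<open>scalar_matrix_positive_form\<close> at each boundary point is integrated over the boundary. The
  densities have total mass \<open>2 + c\<close>, as the Poisson kernels have mean zero, so the forms on the right
  have the mean \<open>(2 + c) C / 2 (\<parallel>x\<parallel>\<^sup>2 + \<parallel>y\<parallel>\<^sup>2)\<close>, which is at most \<open>(2 + c) C\<close> on unit vectors.\<close>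

lemma CDLA_if_positive_kernels:
  fixes T :: "'h::chilbert_space bop"
  assumes R: "R > 1" and c: "c > - 2" and spec: "bop_spectrum T \<subseteq> annulus R"
    and Fo: "\<And>t. bop_positive (poisson_kernel ((1 / R) *\<^sub>R T) (cis (- t)) + ((2 + c) *\<^sub>R 1 - A))"
    and Fi: "\<And>t. bop_positive (poisson_kernel ((1 / R) *\<^sub>R bop_inv T) (cis (- t)) + A)"
  shows "T \<in> CDLA R c"
  unfolding CDLA_def
proof (intro CollectI allI impI matrix_opnormI)
  fix m :: nat and f :: "nat \<Rightarrow> nat \<Rightarrow> complex \<Rightarrow> complex" and x :: "nat \<Rightarrow> 'h"
  assume f: "\<forall>i<m. \<forall>j<m. f i j \<in> annulus_algebra R" and x: "L2_set (\<lambda>j. norm (x j)) {..<m} \<le> 1"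
  define C where "C = (SUP z\<in>closure (annulus R). matrix_opnorm m (\<lambda>i j w. f i j z * w))"
  let ?P = "(1 / R) *\<^sub>R T" and ?Q = "(1 / R) *\<^sub>R bop_inv T"
  define O1 where "O1 t = poisson_kernel ?P (cis (- t)) + ((2 + c) *\<^sub>R 1 - A)" for t
  define I1 where "I1 t = poisson_kernel ?Q (cis (- t)) + A" for t
  obtain D where D: "\<And>z. z \<in> closure (annulus R) \<Longrightarrow> (\<Sum>i<m. \<Sum>j<m. cmod (f i j z)) \<le> D"
    using annulus_algebra_bounded[OF R, of m f] f by metis
  have "bdd_above ((\<lambda>z. matrix_opnorm m (\<lambda>i j w. f i j z * w)) ` closure (annulus R))"
    using order_trans[OF scalar_matrix_opnorm_le D] by (intro bdd_aboveI2)
  then have fC: "matrix_opnorm m (\<lambda>i j w. f i j z * w) \<le> C" if "z \<in> closure (annulus R)" for z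
    unfolding C_def using that by (intro cSUP_upper)
  have C0: "0 \<le> C"
    using order_trans[OF scalar_matrix_opnorm_nonneg fC[OF boundary_points(1)[OF R]]] .
  let ?S = "\<lambda>i j. dlp_map R c T (f i j)"
  define v where "v i = (\<Sum>j<m. bop_apply (?S i j) (x j))" for i
  define q where "q = L2_set (\<lambda>i. norm (v i)) {..<m}"
  have key: "Re (\<Sum>i<m. cinner (v i) (y i)) \<le> C" if y: "L2_set (\<lambda>j. norm (y j)) {..<m} \<le> 1" for y
  proof -
    define k where "k = 1 / (2 * pi * (2 + c))"
    have k: "0 < k" using c by (simp add: k_def)
    have lin: "bounded_linear (\<lambda>X. Re (cinner (bop_apply X (x j)) (y i)))" for i j
      by (rule bounded_linear_compose[OF bounded_linear_Re bounded_linear_bop_cinner])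
    have h1: "((\<lambda>t. k * Re (f i j (R * cis t) * cinner (bop_apply (O1 t) (x j)) (y i) +
        f i j (cis (- t) / R) * cinner (bop_apply (I1 t) (x j)) (y i))) has_integral
        Re (cinner (bop_apply (?S i j) (x j)) (y i))) {0..2 * pi}" if "i < m" "j < m" for i j
      using has_integral_linear[OF dlp_map_has_integral[OF R spec c, of "f i j" A] lin[of j i]] f that
      by (simp add: o_def O1_def[symmetric] I1_def[symmetric] k_def[symmetric] cinner_simps
          del: bop_apply_ring(1))
         (simp add: cinner_simps)
    have "((\<lambda>t. \<Sum>i<m. \<Sum>j<m. k * Re (f i j (R * cis t) * cinner (bop_apply (O1 t) (x j)) (y i) +
        f i j (cis (- t) / R) * cinner (bop_apply (I1 t) (x j)) (y i))) has_integral
        (\<Sum>i<m. \<Sum>j<m. Re (cinner (bop_apply (?S i j) (x j)) (y i)))) {0..2 * pi}"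
      by (intro has_integral_sum h1) auto
    moreover have "(\<Sum>i<m. \<Sum>j<m. Re (cinner (bop_apply (?S i j) (x j)) (y i))) = Re (\<Sum>i<m. cinner (v i) (y i))"
      by (simp add: v_def cinner_sum_left)
    ultimately have I1': "((\<lambda>t. \<Sum>i<m. \<Sum>j<m. k * Re (f i j (R * cis t) * cinner (bop_apply (O1 t) (x j)) (y i) +
        f i j (cis (- t) / R) * cinner (bop_apply (I1 t) (x j)) (y i))) has_integral
        Re (\<Sum>i<m. cinner (v i) (y i))) {0..2 * pi}" by simp
    define h where "h t u = Re (cinner (bop_apply (O1 t) u) u) + Re (cinner (bop_apply (I1 t) u) u)" for t u
    have hint: "((\<lambda>t. h t u) has_integral 2 * pi * (2 + c) * (norm u)\<^sup>2) {0..2 * pi}" for u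
    proof -
      have pk: "((\<lambda>t. Re (cinner (bop_apply (poisson_kernel X (cis (- t))) u) u)) has_integral 0) {0..2 * pi}"
        if "spectrum_in_disc X" for X
        using has_integral_linear[OF has_integral_poisson_kernel[OF that, of 0 u u] bounded_linear_Re]
        by (simp add: o_def)
      have "((\<lambda>t. Re (cinner (bop_apply (poisson_kernel ?P (cis (- t))) u) u)
          + Re (cinner (bop_apply (poisson_kernel ?Q (cis (- t))) u) u) + (2 + c) * (norm u)\<^sup>2) has_integral
          0 + 0 + (2 * pi - 0) *\<^sub>R ((2 + c) * (norm u)\<^sup>2)) {0..2 * pi}"
        by (intro has_integral_add pk spectrum_in_disc_outer[OF R spec] spectrum_in_disc_inner[OF R spec])
           (use has_integral_const_real[of "(2 + c) * (norm u)\<^sup>2" 0 "2 * pi"] in simp)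
      then show ?thesis
        by (simp add: h_def O1_def I1_def cinner_simps Re_cinner_self algebra_simps)
    qed
    have "((\<lambda>t. k * (C / 2 * ((\<Sum>j<m. h t (x j)) + (\<Sum>i<m. h t (y i))))) has_integral
        k * (C / 2 * ((\<Sum>j<m. 2 * pi * (2 + c) * (norm (x j))\<^sup>2) + (\<Sum>i<m. 2 * pi * (2 + c) * (norm (y i))\<^sup>2)))) {0..2 * pi}"
      by (intro has_integral_mult_right has_integral_add has_integral_sum hint) auto
    moreover have "(\<Sum>i<m. \<Sum>j<m. k * Re (f i j (R * cis t) * cinner (bop_apply (O1 t) (x j)) (y i) +
        f i j (cis (- t) / R) * cinner (bop_apply (I1 t) (x j)) (y i)))
        \<le> k * (C / 2 * ((\<Sum>j<m. h t (x j)) + (\<Sum>i<m. h t (y i))))" for t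
    proof -
      have o: "Re (\<Sum>i<m. \<Sum>j<m. f i j (R * cis t) * cinner (bop_apply (O1 t) (x j)) (y i))
        \<le> C / 2 * ((\<Sum>j<m. Re (cinner (bop_apply (O1 t) (x j)) (x j))) + (\<Sum>i<m. Re (cinner (bop_apply (O1 t) (y i)) (y i))))"
        by (rule scalar_matrix_positive_form[OF Fo[folded O1_def] fC[OF boundary_points(1)[OF R]] C0])
      have i: "Re (\<Sum>i<m. \<Sum>j<m. f i j (cis (- t) / R) * cinner (bop_apply (I1 t) (x j)) (y i))
        \<le> C / 2 * ((\<Sum>j<m. Re (cinner (bop_apply (I1 t) (x j)) (x j))) + (\<Sum>i<m. Re (cinner (bop_apply (I1 t) (y i)) (y i))))"
        by (rule scalar_matrix_positive_form[OF Fi[folded I1_def] fC[OF boundary_points(2)[OF R]] C0])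
      have "(\<Sum>i<m. \<Sum>j<m. k * Re (f i j (R * cis t) * cinner (bop_apply (O1 t) (x j)) (y i) +
        f i j (cis (- t) / R) * cinner (bop_apply (I1 t) (x j)) (y i)))
        = k * (Re (\<Sum>i<m. \<Sum>j<m. f i j (R * cis t) * cinner (bop_apply (O1 t) (x j)) (y i))
        + Re (\<Sum>i<m. \<Sum>j<m. f i j (cis (- t) / R) * cinner (bop_apply (I1 t) (x j)) (y i)))"
        by (simp only: Re_sum plus_complex.sel(1) sum.distrib sum_distrib_left[symmetric])
      also have "\<dots> \<le> k * (C / 2 * ((\<Sum>j<m. h t (x j)) + (\<Sum>i<m. h t (y i))))"
        using o i k by (intro mult_left_mono) (auto simp: h_def sum.distrib algebra_simps)
      finally show ?thesis .
    qed
    ultimately have "Re (\<Sum>i<m. cinner (v i) (y i)) \<le>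
        k * (C / 2 * ((\<Sum>j<m. 2 * pi * (2 + c) * (norm (x j))\<^sup>2) + (\<Sum>i<m. 2 * pi * (2 + c) * (norm (y i))\<^sup>2)))"
      using has_integral_le[OF I1'] by blast
    also have "\<dots> = k * (2 * pi * (2 + c)) * (C / 2 * ((L2_set (\<lambda>j. norm (x j)) {..<m})\<^sup>2 + (L2_set (\<lambda>j. norm (y j)) {..<m})\<^sup>2))"
      by (simp only: sum_distrib_left[symmetric]) (simp add: L2_set_def sum_nonneg algebra_simps)
    also have "k * (2 * pi * (2 + c)) = 1" using c by (simp add: k_def)
    also have "1 * (C / 2 * ((L2_set (\<lambda>j. norm (x j)) {..<m})\<^sup>2 + (L2_set (\<lambda>j. norm (y j)) {..<m})\<^sup>2)) \<le> C / 2 * (1 + 1)"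
      using C0 x y unfolding mult_1 by (intro mult_left_mono add_mono power_le_one) auto
    finally show ?thesis by simp
  qed
  have "q \<le> C"
  proof (cases "q = 0")
    case False
    then have q: "0 < q" by (simp add: q_def order.not_eq_order_implies_strict)
    \<comment> \<open>The unit vector in the direction of \<open>v\<close> attains the norm.\<close>
    have "Re (\<Sum>i<m. cinner (v i) ((1 / q) *\<^sub>R v i)) \<le> C"
    proof (rule key)
      have "L2_set (\<lambda>j. norm ((1 / q) *\<^sub>R v j)) {..<m} = (1 / q) * q"
        unfolding q_def using q by (intro L2_set_norm_scaleR) (simp add: q_def)
      then show "L2_set (\<lambda>j. norm ((1 / q) *\<^sub>R v j)) {..<m} \<le> 1" using q by (simp only:) simp
    qed
    moreover have "Re (\<Sum>i<m. cinner (v i) ((1 / q) *\<^sub>R v i)) = (1 / q) * q\<^sup>2"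
      by (simp add: cinner_simps Re_cinner_self q_def L2_set_def sum_nonneg flip: sum_divide_distrib)
    ultimately show ?thesis using q by (simp add: power2_eq_square)
  qed (simp add: C0)
  then show "L2_set (\<lambda>i. norm (\<Sum>j<m. bop_apply (?S i j) (x j))) {..<m} \<le> C"
    by (simp add: q_def v_def)
qed

lemma positive_poisson_kernel:
  assumes B: "bop_strictly_positive B" and X: "spectrum_in_disc X" and dil: "X \<in> dilation_class B"
  shows "bop_positive (poisson_kernel X (cis (- t)) + B)"
proof (rule positiveI)
  have "bop_positive B" using B by (simp add: bop_strictly_positive_def)
  then show "bop_adj (poisson_kernel X (cis (- t)) + B) = poisson_kernel X (cis (- t)) + B"
    by (simp only: adj_add poisson_kernel_adj positive_adj)
  show "0 \<le> Re (cinner (bop_apply (poisson_kernel X (cis (- t)) + B) y) y)" for y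
    using dilation_classD[OF B X dil, of "cis (- t)" y]
    by (simp add: cinner_add_left cinner_poisson_kernel del: bop_apply_diff)
qed

section \<open>Complete contractivity implies complete positivity\<close>

lemma annulus_algebra_const [intro]: "(\<lambda>_. a) \<in> annulus_algebra R"
  by (simp add: annulus_algebra_def)

lemma annulus_algebra_linear [intro]:
  "f \<in> annulus_algebra R \<Longrightarrow> g \<in> annulus_algebra R \<Longrightarrow> (\<lambda>z. a * f z + b * g z) \<in> annulus_algebra R"
  by (auto simp: annulus_algebra_def intro!: continuous_intros holomorphic_intros)

lemma has_integral_cis_const:
  "((\<lambda>t. cis (of_int k * t) * a) has_integral (if k = 0 then complex_of_real (2 * pi) * a else 0)) {0..2 * pi}"
  using has_integral_mult_left[OF has_integral_cis[of k], of a] by (cases "k = 0") simp_all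

lemma L2_set_dualI:
  assumes "\<And>y. L2_set (\<lambda>i. cmod (y i)) {..<m} \<le> 1 \<Longrightarrow> cmod (\<Sum>i<m. v i * cnj (y i)) \<le> K" "0 \<le> K"
  shows "L2_set (\<lambda>i. cmod (v i)) {..<m} \<le> K"
proof -
  define q where "q = L2_set (\<lambda>i. cmod (v i)) {..<m}"
  show ?thesis
  proof (cases "q = 0")
    case False
    then have q: "0 < q" by (simp add: q_def order.not_eq_order_implies_strict)
    have "L2_set (\<lambda>i. cmod ((1 / q) *\<^sub>R v i)) {..<m} = (1 / q) * q"
      unfolding q_def using q by (intro L2_set_norm_scaleR) (simp add: q_def)
    also have "\<dots> = 1" using q by simp
    finally have "cmod (\<Sum>i<m. v i * cnj ((1 / q) *\<^sub>R v i)) \<le> K" by (intro assms(1)) (simp only: order_refl)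
    moreover have "(\<Sum>i<m. v i * cnj ((1 / q) *\<^sub>R v i)) = complex_of_real ((1 / q) * (\<Sum>i<m. (cmod (v i))\<^sup>2))"
      unfolding sum_distrib_left of_real_sum of_real_mult[of "1 / q"] complex_norm_square
      by (simp add: scaleR_conv_of_real mult_ac)
    moreover have "(1 / q) * (\<Sum>i<m. (cmod (v i))\<^sup>2) = q"
    proof -
      have "(\<Sum>i<m. (cmod (v i))\<^sup>2) = q\<^sup>2" by (simp add: q_def L2_set_def sum_nonneg)
      then show ?thesis using q by (simp add: power2_eq_square)
    qed
    ultimately have "cmod (complex_of_real q) \<le> K" by (simp only:)
    then show ?thesis using q by (simp add: q_def[symmetric])
  qed (use assms(2) in \<open>simp add: q_def\<close>)
qed

context
  fixes R c :: real and T :: "'h::chilbert_space bop"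
  assumes R: "R > 1" and c: "c > - 2" and spec: "bop_spectrum T \<subseteq> annulus R"
begin

lemma dlp_map_linear:
  assumes f: "f \<in> annulus_algebra R" and g: "g \<in> annulus_algebra R"
  shows "dlp_map R c T (\<lambda>z. a * f z + b * g z) = a *\<^sub>C dlp_map R c T f + b *\<^sub>C dlp_map R c T g"
proof -
  define k where "k = 1 / (2 * pi * (2 + c))"
  define O1 where "O1 t = poisson_kernel ((1 / R) *\<^sub>R T) (cis (- t)) + ((2 + c) *\<^sub>R 1 - 0)" for t
  define I1 where "I1 t = poisson_kernel ((1 / R) *\<^sub>R bop_inv T) (cis (- t)) + 0" for t
  note I = dlp_map_has_integral[OF R spec c, of _ 0, folded O1_def I1_def k_def]
  have lin: "bounded_linear (\<lambda>X::'h bop. a *\<^sub>C X)" for a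
    by (rule bounded_bilinear.bounded_linear_right[OF bounded_bilinear_scaleC_bop])
  have "((\<lambda>t. a *\<^sub>C (k *\<^sub>R (f (R * cis t) *\<^sub>C O1 t + f (cis (- t) / R) *\<^sub>C I1 t)) +
      b *\<^sub>C (k *\<^sub>R (g (R * cis t) *\<^sub>C O1 t + g (cis (- t) / R) *\<^sub>C I1 t))) has_integral
      a *\<^sub>C dlp_map R c T f + b *\<^sub>C dlp_map R c T g) {0..2 * pi}"
    using has_integral_add[OF has_integral_linear[OF I[OF f] lin] has_integral_linear[OF I[OF g] lin]]
    by (simp add: o_def)
  moreover have "a *\<^sub>C (k *\<^sub>R (u *\<^sub>C X + v *\<^sub>C Y)) + b *\<^sub>C (k *\<^sub>R (u' *\<^sub>C X + v' *\<^sub>C Y))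
      = k *\<^sub>R ((a * u + b * u') *\<^sub>C X + (a * v + b * v') *\<^sub>C Y)" for u v u' v' and X Y :: "'h bop"
    by (simp add: scaleR_scaleC[where 'a="'h bop"] scaleC_add_right scaleC_add_left scaleC_scaleC ac_simps)
  ultimately show ?thesis
    using has_integral_unique[OF I[OF annulus_algebra_linear[OF f g, of a b]]] by simp
qed

lemma has_integral_dlp_form:
  assumes f: "f \<in> annulus_algebra R"
  shows "((\<lambda>t. 1 / (2 * pi * (2 + c)) *
      (f (R * cis t) * cinner (bop_apply (poisson_kernel ((1 / R) *\<^sub>R T) (cis (- t)) + (2 + c) *\<^sub>R 1) x) y +
       f (cis (- t) / R) * cinner (bop_apply (poisson_kernel ((1 / R) *\<^sub>R bop_inv T) (cis (- t))) x) y))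
    has_integral cinner (bop_apply (dlp_map R c T f) x) y) {0..2 * pi}"
  using has_integral_linear[OF dlp_map_has_integral[OF R spec c f, of 0] bounded_linear_bop_cinner[of x y]]
  by (simp only: o_def bop_apply_ring(2) cinner_scaleR_left bop_apply_ring(1)[of "_ *\<^sub>C _"]
      bop_apply_scaleC_left cinner_add_left[of "_ *\<^sub>C _"] cinner_scaleC_left diff_zero add_0_right)

lemma dlp_map_one: "dlp_map R c T (\<lambda>_. 1) = 1"
proof (rule bop_eq_cinnerI)
  fix x y :: 'h
  let ?k = "1 / (2 * pi * (2 + c))"
  let ?P = "(1 / R) *\<^sub>R T" and ?Q = "(1 / R) *\<^sub>R bop_inv T"
  have pk: "((\<lambda>t. cinner (bop_apply (poisson_kernel X (cis (- t))) x) y) has_integral 0) {0..2 * pi}"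
    if "spectrum_in_disc X" for X
    using has_integral_poisson_kernel[OF that, of 0 x y] by simp
  have "((\<lambda>t. ?k * ((cinner (bop_apply (poisson_kernel ?P (cis (- t))) x) y + cis (of_int 0 * t) * ((2 + c) * cinner x y)) +
      cinner (bop_apply (poisson_kernel ?Q (cis (- t))) x) y)) has_integral
      ?k * ((0 + (if (0::int) = 0 then complex_of_real (2 * pi) * ((2 + c) * cinner x y) else 0)) + 0)) {0..2 * pi}"
    by (intro has_integral_mult_right has_integral_add pk spectrum_in_disc_outer[OF R spec]
        spectrum_in_disc_inner[OF R spec] has_integral_cis_const)
  moreover have "2 + complex_of_real c \<noteq> 0"
    using c by (metis add.commute add_eq_0_iff less_irrefl of_real_eq_iff of_real_minus of_real_numeral)
  ultimately have "((\<lambda>t. ?k * (1 * cinner (bop_apply (poisson_kernel ?P (cis (- t)) + (2 + c) *\<^sub>R 1) x) y +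
      1 * cinner (bop_apply (poisson_kernel ?Q (cis (- t))) x) y)) has_integral cinner x y) {0..2 * pi}"
    by (simp add: cinner_simps)
  from has_integral_unique[OF has_integral_dlp_form[OF annulus_algebra_const[of 1], of x y] this]
  show "cinner (bop_apply (dlp_map R c T (\<lambda>_. 1)) x) y = cinner (bop_apply 1 x) y" by simp
qed

lemma circle_or_annulus:
  assumes "z \<in> closure (annulus R)" "z \<notin> annulus R" shows "cmod z = R \<or> cmod z = 1 / R"
  using assms unfolding closure_annulus[OF R] by (auto simp: annulus_def)

text \<open>For small \<open>t > 0\<close> the matrix \<open>1 - t f\<close> has norm at most \<open>1 + t\<^sup>2 C\<^sup>2 / 2\<close> on the boundary, hence
  on the whole annulus. Applying the contraction and letting \<open>t\<close> tend to zero leaves the sign of the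
  real part of the image of \<open>f\<close>.\<close>

lemma CDLA_Re_nonneg:
  fixes x :: "nat \<Rightarrow> 'h" and f :: "nat \<Rightarrow> nat \<Rightarrow> complex \<Rightarrow> complex"
  assumes T: "T \<in> CDLA R c" and f: "\<And>i j. f i j \<in> annulus_algebra R"
    and bdry: "\<And>z \<xi>. cmod z = R \<or> cmod z = 1 / R \<Longrightarrow> 0 \<le> Re (\<Sum>i<m. \<Sum>j<m. f i j z * (\<xi> j * cnj (\<xi> i)))"
  shows "0 \<le> Re (\<Sum>i<m. \<Sum>j<m. cinner (bop_apply (dlp_map R c T (f i j)) (x j)) (x i))"
proof (cases "m = 0")
  case False
  let ?K = "closure (annulus R)"
  obtain C where C: "0 \<le> C" "\<And>z. z \<in> ?K \<Longrightarrow> (\<Sum>i<m. \<Sum>j<m. cmod (f i j z)) \<le> C"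
    using annulus_algebra_bounded[OF R, of m f] f by metis
  define E where "E = Re (\<Sum>i<m. \<Sum>j<m. cinner (bop_apply (dlp_map R c T (f i j)) (x j)) (x i))"
  define N where "N = L2_set (\<lambda>j. norm (x j)) {..<m}"
  have main: "- (t * E) \<le> t\<^sup>2 * C\<^sup>2 / 2 * N\<^sup>2" if t: "0 < t" for t
  proof -
    define g where "g i j z = (if i = j then 1 else 0) * 1 + (- complex_of_real t) * f i j z" for i j z
    define \<kappa> where "\<kappa> = 1 + t\<^sup>2 * C\<^sup>2 / 2"
    have \<kappa>: "0 \<le> \<kappa>" by (simp add: \<kappa>_def add_nonneg_nonneg)
    have g: "g i j \<in> annulus_algebra R" for i j unfolding g_def by (intro annulus_algebra_linear annulus_algebra_const f)
    have on_circle: "cmod (\<Sum>i<m. (\<Sum>j<m. g i j z * \<xi> j) * cnj (y i)) \<le> \<kappa>"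
      if z: "cmod z = R \<or> cmod z = 1 / R" and \<xi>: "L2_set (\<lambda>j. cmod (\<xi> j)) {..<m} \<le> 1"
        and y: "L2_set (\<lambda>i. cmod (y i)) {..<m} \<le> 1" for z \<xi> y
    proof -
      define u where "u i = (\<Sum>j<m. f i j z * \<xi> j)" for i
      have zK: "z \<in> ?K"
      proof -
        have "1 / R \<le> R" using R by (simp add: field_simps) (smt (verit) mult_less_cancel_left2)
        then show ?thesis using z R by (auto simp: closure_annulus)
      qed
      have v: "(\<Sum>j<m. g i j z * \<xi> j) = \<xi> i - t * u i" if "i < m" for i
      proof -
        have "(\<Sum>j<m. g i j z * \<xi> j) = (\<Sum>j<m. (if i = j then \<xi> j else 0) - t * (f i j z * \<xi> j))"
          by (intro sum.cong) (auto simp: g_def algebra_simps)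
        then show ?thesis using that by (simp add: sum_subtractf u_def sum_distrib_left)
      qed
      have "L2_set (\<lambda>i. cmod (u i)) {..<m} \<le> C * L2_set (\<lambda>j. cmod (\<xi> j)) {..<m}"
        using scalar_matrix_amplification[of m "\<lambda>i j. f i j z" C \<xi>]
          order_trans[OF scalar_matrix_opnorm_le C(2)[OF zK]] by (simp add: u_def scaleC_complex_def)
      also have "\<dots> \<le> C" using \<xi> C(1) by (simp add: mult_left_le)
      finally have "(L2_set (\<lambda>i. cmod (u i)) {..<m})\<^sup>2 \<le> C\<^sup>2" by (intro power_mono) auto
      then have u: "(\<Sum>i<m. (cmod (u i))\<^sup>2) \<le> C\<^sup>2" by (simp add: L2_set_def sum_nonneg)
      have "(L2_set (\<lambda>j. cmod (\<xi> j)) {..<m})\<^sup>2 \<le> 1" using \<xi> by (intro power_le_one) auto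
      then have x1: "(\<Sum>i<m. (cmod (\<xi> i))\<^sup>2) \<le> 1" by (simp add: L2_set_def sum_nonneg)
      have "(\<Sum>i<m. (cmod (\<xi> i - t * u i))\<^sup>2)
          = (\<Sum>i<m. (cmod (\<xi> i))\<^sup>2 - 2 * t * Re (u i * cnj (\<xi> i)) + t\<^sup>2 * (cmod (u i))\<^sup>2)"
        by (intro sum.cong refl)
           (simp add: norm_diff_square cinner_complex_def norm_mult power_mult_distrib algebra_simps)
      also have "\<dots> = (\<Sum>i<m. (cmod (\<xi> i))\<^sup>2) - 2 * t * Re (\<Sum>i<m. u i * cnj (\<xi> i)) + t\<^sup>2 * (\<Sum>i<m. (cmod (u i))\<^sup>2)"
        by (simp only: sum.distrib sum_subtractf sum_distrib_left Re_sum)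
      also have "(\<Sum>i<m. u i * cnj (\<xi> i)) = (\<Sum>i<m. \<Sum>j<m. f i j z * (\<xi> j * cnj (\<xi> i)))"
        by (simp add: u_def sum_distrib_right mult.assoc)
      finally have "(\<Sum>i<m. (cmod (\<xi> i - t * u i))\<^sup>2) \<le> 1 + t\<^sup>2 * C\<^sup>2"
        using bdry[OF z, of \<xi>] t u x1 mult_left_mono[OF u, of "t\<^sup>2"] by (smt (verit) mult_nonneg_nonneg zero_le_power2)
      also have "\<dots> \<le> \<kappa>\<^sup>2"
      proof -
        have "\<kappa>\<^sup>2 = 1 + t\<^sup>2 * C\<^sup>2 + (t\<^sup>2 * C\<^sup>2 / 2)\<^sup>2" by (simp add: \<kappa>_def power2_sum)
        then show ?thesis by simp
      qed
      finally have L: "L2_set (\<lambda>i. cmod (\<xi> i - t * u i)) {..<m} \<le> \<kappa>"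
        using \<kappa> by (simp add: L2_set_def real_le_lsqrt sum_nonneg)
      have "cmod (\<Sum>i<m. (\<Sum>j<m. g i j z * \<xi> j) * cnj (y i)) \<le> (\<Sum>i<m. \<bar>cmod (\<xi> i - t * u i)\<bar> * \<bar>cmod (y i)\<bar>)"
        by (rule order_trans[OF norm_sum]) (simp add: v norm_mult)
      also have "\<dots> \<le> L2_set (\<lambda>i. cmod (\<xi> i - t * u i)) {..<m} * L2_set (\<lambda>i. cmod (y i)) {..<m}"
        by (rule L2_set_mult_ineq)
      also have "\<dots> \<le> \<kappa> * 1" using L y \<kappa> by (intro mult_mono) auto
      finally show ?thesis by simp
    qed
    have inside: "cmod (\<Sum>i<m. (\<Sum>j<m. g i j z * \<xi> j) * cnj (y i)) \<le> \<kappa>"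
      if z: "z \<in> ?K" and \<xi>: "L2_set (\<lambda>j. cmod (\<xi> j)) {..<m} \<le> 1"
        and y: "L2_set (\<lambda>i. cmod (y i)) {..<m} \<le> 1" for z \<xi> y
    proof (cases "z \<in> annulus R")
      case True
      show ?thesis
      proof (rule maximum_modulus_frontier[OF _ _ _ _ True])
        show "(\<lambda>z. \<Sum>i<m. (\<Sum>j<m. g i j z * \<xi> j) * cnj (y i)) holomorphic_on interior (annulus R)"
          using g by (intro holomorphic_intros) (auto simp: annulus_algebra_def interior_open open_annulus)
        show "continuous_on ?K (\<lambda>z. \<Sum>i<m. (\<Sum>j<m. g i j z * \<xi> j) * cnj (y i))"
          using g by (intro continuous_intros) (auto simp: annulus_algebra_def)
        show "bounded (annulus R)" by (rule boundedI[of _ R]) (auto simp: annulus_def)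
        fix w assume "w \<in> frontier (annulus R)"
        then have "w \<in> ?K" "w \<notin> annulus R" by (auto simp: frontier_def interior_open open_annulus)
        then show "cmod (\<Sum>i<m. (\<Sum>j<m. g i j w * \<xi> j) * cnj (y i)) \<le> \<kappa>"
          by (intro on_circle circle_or_annulus \<xi> y)
      qed
    qed (intro on_circle circle_or_annulus z \<xi> y)
    have gn: "matrix_opnorm m (\<lambda>i j w. g i j z * w) \<le> \<kappa>" if "z \<in> ?K" for z
      by (rule matrix_opnormI, rule L2_set_dualI, rule inside[OF that]) (assumption | rule \<kappa>)+
    have "matrix_opnorm m (\<lambda>i j. bop_apply (dlp_map R c T (g i j)))
        \<le> (SUP z\<in>?K. matrix_opnorm m (\<lambda>i j w. g i j z * w))"
      using T False g unfolding CDLA_def by simp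
    also have "\<dots> \<le> \<kappa>"
    proof (rule cSUP_least)
      have "1 \<in> ?K" using R by (simp add: closure_annulus)
      then show "?K \<noteq> {}" by (metis empty_iff)
      show "matrix_opnorm m (\<lambda>i j w. g i j z * w) \<le> \<kappa>" if "z \<in> ?K" for z
        by (rule gn[OF that])
    qed
    finally have op: "matrix_opnorm m (\<lambda>i j. bop_apply (dlp_map R c T (g i j))) \<le> \<kappa>" .
    have S: "dlp_map R c T (g i j) = (if i = j then 1 else 0) *\<^sub>C 1 + (- complex_of_real t) *\<^sub>C dlp_map R c T (f i j)" for i j
      unfolding g_def using dlp_map_linear[OF annulus_algebra_const[of 1] f, of "if i = j then 1 else 0" "- complex_of_real t" i j]
      by (simp add: dlp_map_one)
    let ?w = "\<lambda>i. \<Sum>j<m. bop_apply (dlp_map R c T (g i j)) (x j)"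
    have "Re (\<Sum>i<m. cinner (?w i) (x i)) \<le> (\<Sum>i<m. \<bar>norm (?w i)\<bar> * \<bar>norm (x i)\<bar>)"
      unfolding Re_sum using cinner_Cauchy_Schwarz complex_Re_le_cmod by (intro sum_mono) (force intro: order_trans)
    also have "\<dots> \<le> L2_set (\<lambda>i. norm (?w i)) {..<m} * N" unfolding N_def by (rule L2_set_mult_ineq)
    also have "\<dots> \<le> (\<kappa> * N) * N"
    proof (rule mult_right_mono)
      have "L2_set (\<lambda>i. norm (?w i)) {..<m} \<le> matrix_opnorm m (\<lambda>i j. bop_apply (dlp_map R c T (g i j))) * N"
        unfolding N_def by (rule matrix_opnorm_bound) (rule bounded_linear_bop_apply)
      also have "\<dots> \<le> \<kappa> * N" using op by (intro mult_right_mono) (auto simp: N_def)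
      finally show "L2_set (\<lambda>i. norm (?w i)) {..<m} \<le> \<kappa> * N" .
    qed (simp add: N_def)
    finally have up: "Re (\<Sum>i<m. cinner (?w i) (x i)) \<le> \<kappa> * N\<^sup>2" by (simp add: power2_eq_square mult.assoc)
    have "cinner (?w i) (x i) = cinner (x i) (x i) - t * (\<Sum>j<m. cinner (bop_apply (dlp_map R c T (f i j)) (x j)) (x i))"
      if "i < m" for i
    proof -
      have "cinner (?w i) (x i) = (\<Sum>j<m. (if i = j then cinner (x j) (x i) else 0)
          - t * cinner (bop_apply (dlp_map R c T (f i j)) (x j)) (x i))"
        unfolding S cinner_sum_left
        by (intro sum.cong refl) (auto simp: cinner_simps scaleC_minus_left)
      then show ?thesis using that by (simp add: sum_subtractf sum_distrib_left)
    qed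
    then have "(\<Sum>i<m. cinner (?w i) (x i)) = (\<Sum>i<m. cinner (x i) (x i))
        - t * (\<Sum>i<m. \<Sum>j<m. cinner (bop_apply (dlp_map R c T (f i j)) (x j)) (x i))"
      by (simp add: sum_subtractf sum_distrib_left)
    moreover have "Re (\<Sum>i<m. cinner (x i) (x i)) = N\<^sup>2"
      by (simp add: Re_cinner_self N_def L2_set_def sum_nonneg)
    ultimately have "Re (\<Sum>i<m. cinner (?w i) (x i)) = N\<^sup>2 - t * E" by (simp add: E_def)
    then show ?thesis using up by (simp add: \<kappa>_def distrib_right)
  qed
  have "0 \<le> E"
  proof (rule ccontr)
    assume "\<not> 0 \<le> E"
    then have E: "0 < - E" by simp
    define B where "B = C\<^sup>2 * N\<^sup>2 + 1"
    have B: "0 < B" by (simp add: B_def add_nonneg_pos)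
    \<comment> \<open>For this \<open>t\<close> the quadratic error is at most half of the linear term \<open>- t E\<close>.\<close>
    define t where "t = - E / B"
    have t: "0 < t" unfolding t_def using E B by (rule divide_pos_pos)
    have "t * (- E) \<le> t * (t * (C\<^sup>2 * N\<^sup>2 / 2))" using main[OF t] by (simp add: power2_eq_square mult.assoc)
    then have "- E \<le> t * (C\<^sup>2 * N\<^sup>2 / 2)" using t by (simp only: mult_le_cancel_left_pos)
    also have "\<dots> \<le> t * (B / 2)" using t by (intro mult_left_mono) (auto simp: B_def)
    also have "\<dots> = - E / 2" using B by (simp add: t_def)
    finally show False using E by simp
  qed
  then show ?thesis by (simp add: E_def)
qed simp

end

section \<open>Matrix-valued trigonometric squares\<close>

text \<open>The coefficients solve the boundary conditions for \<open>\<phi>\<^sub>k = c\<^sub>k z\<^sup>k\<close>, with real \<open>c\<^sub>k\<close>: comparing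
  the factors of \<open>e\<^sup>i\<^sup>k\<^sup>t\<close> at \<open>z = R e\<^sup>i\<^sup>t\<close> and of \<open>e\<^sup>-\<^sup>i\<^sup>k\<^sup>t\<close> at \<open>z = e\<^sup>-\<^sup>i\<^sup>t / R\<close>, the function
  \<open>\<phi>\<^sub>k + cnj \<phi>\<^sub>-\<^sub>k\<close> equals \<open>e\<^sup>i\<^sup>k\<^sup>t\<close> on the outer circle and vanishes on the inner one if
  \<open>c\<^sub>k R\<^sup>k + c\<^sub>-\<^sub>k R\<^sup>-\<^sup>k = 1\<close> and \<open>c\<^sub>k R\<^sup>-\<^sup>k + c\<^sub>-\<^sub>k R\<^sup>k = 0\<close>. For \<open>k = 0\<close> these conditions contradict each other;
  the constant \<open>1/2\<close> gives the value \<open>1\<close> on both circles.\<close>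

definition outer_symbol :: "real \<Rightarrow> int \<Rightarrow> complex \<Rightarrow> complex"
  where "outer_symbol R k z = (if k = 0 then 1 / 2
    else complex_of_real (R powi k / (R powi (2 * k) - R powi (- (2 * k)))) * z powi k)"

text \<open>The inversion \<open>z \<mapsto> 1 / z\<close> exchanges the circles. A square on the outer circle drags its mean along to
  the inner circle; for a square on the inner circle the mean is subtracted everywhere instead. In a
  family of squares with equal total means on the two circles, these corrections cancel.\<close>

definition boundary_symbol :: "real \<Rightarrow> bool \<Rightarrow> int \<Rightarrow> complex \<Rightarrow> complex"
  where "boundary_symbol R b k z =
    (if b then outer_symbol R k z else if k = 0 then 0 else outer_symbol R k (1 / z))"

lemma outer_symbol_values:
  assumes R: "R > 1"
  shows "outer_symbol R k (R * cis t) + cnj (outer_symbol R (- k) (R * cis t)) = cis (of_int k * t)"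
    and "outer_symbol R k (cis (- t) / R) + cnj (outer_symbol R (- k) (cis (- t) / R)) = (if k = 0 then 1 else 0)"
proof -
  define a d where "a = R powi k" "d = R powi (2 * k) - R powi (- (2 * k))"
  have a: "a \<noteq> 0" "R powi (- k) = 1 / a" using R by (auto simp: a_d_def power_int_minus divide_inverse)
  have da: "d = a\<^sup>2 - 1 / a\<^sup>2"
    using R by (simp add: a_d_def power_int_minus power_int_mult divide_inverse mult.commute power_int_power' flip: power_int_mult)
  have d0: "d \<noteq> 0" if "k \<noteq> 0"
  proof -
    have "R powi (2 * k) \<noteq> R powi (- (2 * k))"
      using R that power_int_strict_increasing[of "2 * k" "- (2 * k)" R]
        power_int_strict_increasing[of "- (2 * k)" "2 * k" R] by (cases "k > 0") auto
    then show ?thesis by (simp add: a_d_def)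
  qed
  have cisp: "(complex_of_real R * cis t) powi j = complex_of_real (R powi j) * cis (of_int j * t)"
    "(cis (- t) / complex_of_real R) powi j = cis (- (of_int j * t)) / complex_of_real (R powi j)" for j
    by (simp_all add: power_int_mult_distrib power_int_divide_distrib cis_power_int)
  have sym1: "outer_symbol R k z = complex_of_real (a / d) * z powi k" if "k \<noteq> 0" for z
    using that by (simp add: outer_symbol_def a_d_def)
  have sym2: "outer_symbol R (- k) z = complex_of_real (- (1 / a) / d) * z powi (- k)" if "k \<noteq> 0" for z
  proof -
    have "R powi (2 * (- k)) - R powi (- (2 * (- k))) = - d" by (simp add: a_d_def)
    then have "outer_symbol R (- k) z = complex_of_real (1 / a / (- d)) * z powi (- k)"
      using that by (simp only: outer_symbol_def a(2) neg_equal_0_iff_equal if_False)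
    also have "1 / a / (- d) = - (1 / a) / d" by simp
    finally show ?thesis .
  qed
  note sym = sym1 sym2
  have cc: "cnj (cis (of_int (- k) * t)) = cis (of_int k * t)" "cnj (cis (- (of_int (- k) * t))) = cis (- (of_int k * t))"
    by (simp_all add: cis_cnj)
  show "outer_symbol R k (R * cis t) + cnj (outer_symbol R (- k) (R * cis t)) = cis (of_int k * t)"
  proof (cases "k = 0")
    case False
    have "outer_symbol R k (R * cis t) + cnj (outer_symbol R (- k) (R * cis t))
        = complex_of_real (a / d * a + (- (1 / a) / d) * (1 / a)) * cis (of_int k * t)"
      unfolding sym[OF False] cisp complex_cnj_mult cc a_d_def(1)[symmetric] a(2) complex_cnj_complex_of_real
      by (simp only: of_real_add of_real_mult distrib_right mult.assoc)
    also have "a / d * a + (- (1 / a) / d) * (1 / a) = (a\<^sup>2 - 1 / a\<^sup>2) / d"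
      by (simp add: power2_eq_square diff_divide_distrib)
    also have "\<dots> = 1" using d0[OF False] by (simp add: da)
    finally show ?thesis by simp
  qed (simp add: outer_symbol_def)
  show "outer_symbol R k (cis (- t) / R) + cnj (outer_symbol R (- k) (cis (- t) / R)) = (if k = 0 then 1 else 0)"
  proof (cases "k = 0")
    case False
    have "outer_symbol R k (cis (- t) / R) + cnj (outer_symbol R (- k) (cis (- t) / R))
        = complex_of_real (a / d / a + (- (1 / a) / d) / (1 / a)) * cis (- (of_int k * t))"
      unfolding sym[OF False] cisp complex_cnj_mult complex_cnj_divide cc a_d_def(1)[symmetric] a(2) complex_cnj_complex_of_real
      by (simp only: of_real_add of_real_divide distrib_right times_divide_eq_right times_divide_eq_left)
    also have "a / d / a + (- (1 / a) / d) / (1 / a) = 0" using a(1) by simp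
    finally show ?thesis using False by simp
  qed (simp add: outer_symbol_def)
qed

lemma boundary_symbol_values:
  assumes R: "R > 1"
  shows "boundary_symbol R b k (R * cis t) + cnj (boundary_symbol R b (- k) (R * cis t)) =
      (if b then cis (of_int k * t) else 0)"
    and "boundary_symbol R b k (cis (- t) / R) + cnj (boundary_symbol R b (- k) (cis (- t) / R)) =
      (if b then if k = 0 then 1 else 0 else if k = 0 then 0 else cis (of_int k * t))"
proof -
  have i: "1 / (complex_of_real R * cis t) = cis (- t) / R" "1 / (cis (- t) / complex_of_real R) = R * cis t"
    "complex_of_real R / cis (- t) = R * cis t"
    using R by (simp_all add: divide_inverse)
  show "boundary_symbol R b k (R * cis t) + cnj (boundary_symbol R b (- k) (R * cis t)) =
      (if b then cis (of_int k * t) else 0)"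
    using outer_symbol_values[OF R, of k t] by (auto simp: boundary_symbol_def i)
  show "boundary_symbol R b k (cis (- t) / R) + cnj (boundary_symbol R b (- k) (cis (- t) / R)) =
      (if b then if k = 0 then 1 else 0 else if k = 0 then 0 else cis (of_int k * t))"
    using outer_symbol_values[OF R, of k t] by (auto simp: boundary_symbol_def i)
qed

lemma boundary_symbol_in_algebra:
  assumes R: "R > 1" shows "boundary_symbol R b k \<in> annulus_algebra R"
proof -
  have nz: "z \<noteq> 0" if "z \<in> closure (annulus R)" for z
    using that R unfolding closure_annulus[OF R] by (auto simp: field_simps)
  have nz': "z \<noteq> 0" if "z \<in> annulus R" for z using nz that closure_subset by blast
  have zp: "(\<lambda>z. z powi j) \<in> annulus_algebra R" for j
  proof -
    have "continuous_on (closure (annulus R)) (\<lambda>z. z powi j)"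
      by (rule continuous_on_power_int) (use nz in \<open>auto intro: continuous_on_id\<close>)
    moreover have "(\<lambda>z. z powi j) holomorphic_on annulus R"
      by (rule holomorphic_on_power_int) (use nz' in \<open>auto intro: holomorphic_on_id\<close>)
    ultimately show ?thesis by (simp add: annulus_algebra_def)
  qed
  have inv: "(1 / z) powi k = z powi (- k)" for z :: complex
    by (simp add: power_int_inverse power_int_minus divide_inverse)
  have zc: "(\<lambda>z. a * z powi j) \<in> annulus_algebra R" for a j
    using annulus_algebra_linear[OF zp[of j] zp[of j], of a 0] by simp
  show ?thesis unfolding boundary_symbol_def[abs_def] outer_symbol_def inv
    by (cases b; cases "k = 0") (simp_all only: simp_thms if_True if_False zc annulus_algebra_const)
qed

lemma annulus_algebra_add: "f \<in> annulus_algebra R \<Longrightarrow> g \<in> annulus_algebra R \<Longrightarrow> (\<lambda>z. f z + g z) \<in> annulus_algebra R"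
  using annulus_algebra_linear[of f R g 1 1] by simp

lemma annulus_algebra_sum:
  "(\<And>i. i \<in> I \<Longrightarrow> f i \<in> annulus_algebra R) \<Longrightarrow> (\<lambda>z. \<Sum>i\<in>I. f i z) \<in> annulus_algebra R"
  by (induction I rule: infinite_finite_induct) (auto intro: annulus_algebra_add)

lemma annulus_algebra_sum_list:
  "(\<And>x. x \<in> set xs \<Longrightarrow> f x \<in> annulus_algebra R) \<Longrightarrow> (\<lambda>z. \<Sum>x\<leftarrow>xs. f x z) \<in> annulus_algebra R"
  by (induction xs) (auto intro: annulus_algebra_add)

text \<open>Exchanging \<open>n\<close> and \<open>p\<close> conjugates the form of a hermitian operator, so the real part symmetrizes the
  coefficients.\<close>

lemma hermitian_double_sum:
  fixes h :: "nat \<Rightarrow> 'h::chilbert_space"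
  assumes Y: "bop_adj Y = Y"
  shows "2 * Re (\<Sum>n<N. \<Sum>p<N. \<kappa> (int n - int p) * cinner (bop_apply Y (h n)) (h p)) =
    Re (\<Sum>n<N. \<Sum>p<N. (\<kappa> (int n - int p) + cnj (\<kappa> (- (int n - int p)))) * cinner (bop_apply Y (h n)) (h p))"
proof -
  let ?S = "\<Sum>n<N. \<Sum>p<N. \<kappa> (int n - int p) * cinner (bop_apply Y (h n)) (h p)"
  have "cnj ?S = (\<Sum>n<N. \<Sum>p<N. cnj (\<kappa> (int n - int p)) * cinner (bop_apply Y (h p)) (h n))"
    unfolding cnj_sum complex_cnj_mult
    by (intro sum.cong refl arg_cong2[where f = "(*)"]) (metis Y adj_cinner cinner_commute)
  also have "\<dots> = (\<Sum>p<N. \<Sum>n<N. cnj (\<kappa> (int n - int p)) * cinner (bop_apply Y (h p)) (h n))" by (rule sum.swap)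
  finally have c: "cnj ?S = (\<Sum>n<N. \<Sum>p<N. cnj (\<kappa> (- (int n - int p))) * cinner (bop_apply Y (h n)) (h p))" by simp
  have "2 * Re ?S = Re (?S + cnj ?S)" by simp
  also have "?S + cnj ?S = (\<Sum>n<N. \<Sum>p<N. (\<kappa> (int n - int p) + cnj (\<kappa> (- (int n - int p)))) * cinner (bop_apply Y (h n)) (h p))"
    unfolding c by (simp only: distrib_right sum.distrib)
  finally show ?thesis .
qed

text \<open>The frequencies \<open>n - p\<close> of the square of \<open>\<Sum>n. e\<^sup>i\<^sup>n\<^sup>t h n\<close> pick the coefficients \<open>X\<^sup>n\<^sup>-\<^sup>p\<close> from the Poisson
  kernel.\<close>

lemma toeplitz_form_integral:
  fixes h :: "nat \<Rightarrow> 'h::chilbert_space"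
  assumes X: "spectrum_in_disc X"
  shows "((\<lambda>t. Re (\<Sum>n<N. \<Sum>p<N. cis (of_int (int n - int p) * t) *
      cinner (bop_apply (poisson_kernel X (cis (- t)) + r *\<^sub>R 1) (h n)) (h p)))
    has_integral 2 * pi * toeplitz_form (r *\<^sub>R 1) X N h) {0..2 * pi}"
proof -
  define G where "G n p = (let k = int n - int p in
    complex_of_real (2 * pi) * (if k \<ge> 1 then cinner (bop_apply (X ^ nat k) (h n)) (h p)
      else if k \<le> - 1 then cnj (cinner (bop_apply (X ^ nat (- k)) (h p)) (h n)) else 0) +
    (if k = 0 then complex_of_real (2 * pi) * (r * cinner (h n) (h p)) else 0))" for n p
  have i: "((\<lambda>t. cis (of_int (int n - int p) * t) *
      cinner (bop_apply (poisson_kernel X (cis (- t)) + r *\<^sub>R 1) (h n)) (h p)) has_integral G n p) {0..2 * pi}" for n p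
  proof -
    have "((\<lambda>t. cis (of_int (int n - int p) * t) * cinner (bop_apply (poisson_kernel X (cis (- t))) (h n)) (h p)
        + cis (of_int (int n - int p) * t) * (r * cinner (h n) (h p))) has_integral G n p) {0..2 * pi}"
      unfolding G_def Let_def by (intro has_integral_add has_integral_poisson_kernel X has_integral_cis_const)
    then show ?thesis by (simp add: cinner_simps distrib_left)
  qed
  have "((\<lambda>t. \<Sum>n<N. \<Sum>p<N. cis (of_int (int n - int p) * t) *
      cinner (bop_apply (poisson_kernel X (cis (- t)) + r *\<^sub>R 1) (h n)) (h p))
    has_integral (\<Sum>n<N. \<Sum>p<N. G n p)) {0..2 * pi}"
    by (intro has_integral_sum i) auto
  from has_integral_linear[OF this bounded_linear_Re]
  have "((\<lambda>t. Re (\<Sum>n<N. \<Sum>p<N. cis (of_int (int n - int p) * t) *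
      cinner (bop_apply (poisson_kernel X (cis (- t)) + r *\<^sub>R 1) (h n)) (h p)))
    has_integral Re (\<Sum>n<N. \<Sum>p<N. G n p)) {0..2 * pi}"
    unfolding o_def .
  moreover have "Re (\<Sum>n<N. \<Sum>p<N. G n p) = 2 * pi * toeplitz_form (r *\<^sub>R 1) X N h"
  proof -
    define g where "g n p = Re (G n p) / (2 * pi)" for n p
    have g: "g n p = (if p < n then Re (cinner (bop_apply (X ^ (n - p)) (h n)) (h p))
        else if n < p then Re (cinner (bop_apply (X ^ (p - n)) (h p)) (h n)) else Re (r * cinner (h n) (h p)))" for n p
    proof -
      consider "p < n" | "n < p" | "n = p" by linarith
      then show ?thesis
        by cases (auto simp: g_def G_def Let_def nat_diff_distrib of_nat_diff simp flip: of_nat_diff)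
    qed
    have "Re (\<Sum>n<N. \<Sum>p<N. G n p) = 2 * pi * (\<Sum>n<N. \<Sum>p<N. g n p)"
      unfolding Re_sum sum_distrib_left by (simp add: g_def)
    also have "(\<Sum>n<N. \<Sum>p<N. g n p) = (\<Sum>n<N. g n n + 2 * (\<Sum>p<n. g n p))"
      by (rule sum_triangle) (auto simp: g)
    also have "\<dots> = toeplitz_form (r *\<^sub>R 1) X N h"
      unfolding toeplitz_form_def by (intro sum.cong refl arg_cong2[where f = "(+)"]) (auto simp: g cinner_simps)
    finally show ?thesis .
  qed
  ultimately show ?thesis by simp
qed

text \<open>A list of triples \<open>(b, N, h)\<close> represents a family of squares; the flag \<open>b\<close> tells whether the
  square lives on the outer or on the inner circle. \<open>signed_gram\<close> is the difference of the means on
  the two circles.\<close>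

type_synonym 'h squares = "(bool \<times> nat \<times> (nat \<Rightarrow> 'h)) list"

definition rank_one :: "'h::chilbert_space \<Rightarrow> 'h \<Rightarrow> 'h bop"
  where "rank_one x y = (SOME D. \<forall>u. bop_apply D u = cinner u y *\<^sub>C x)"

lemma rank_one [simp]: "bop_apply (rank_one x y) u = cinner u y *\<^sub>C x"
proof -
  have "bounded_linear (\<lambda>u. cinner u y *\<^sub>C x)"
    by (rule bounded_linear_compose[OF bounded_bilinear.bounded_linear_left[OF bounded_bilinear_scaleC]
          bounded_bilinear.bounded_linear_left[OF bounded_bilinear_cinner]])
  then have "\<exists>D. \<forall>u. bop_apply D u = cinner u y *\<^sub>C x"
    using bop_of_fun[of "\<lambda>u. cinner u y *\<^sub>C x"] by (metis cinner_scaleC_left scaleC_scaleC)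
  from someI_ex[OF this] show ?thesis unfolding rank_one_def by blast
qed

definition signed_gram :: "'h::chilbert_space squares \<Rightarrow> 'h bop"
  where "signed_gram L = (\<Sum>(b, N, h)\<leftarrow>L. (if b then 1 else - 1) *\<^sub>R (\<Sum>n<N. rank_one (h n) (h n)))"

text \<open>The mean of the squares against the kernels \<open>k\<^sub>P + r\<close> on the outer and \<open>k\<^sub>Q\<close> on the inner circle.\<close>

definition squares_value :: "real \<Rightarrow> 'h::chilbert_space bop \<Rightarrow> 'h bop \<Rightarrow> 'h squares \<Rightarrow> real"
  where "squares_value r P Q L =
    (\<Sum>(b, N, h)\<leftarrow>L. toeplitz_form ((if b then r else 0) *\<^sub>R 1) (if b then P else Q) N h)"

lemma cinner_signed_gram:
  "Re (cinner (bop_apply (signed_gram L) v) v)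
    = (\<Sum>(b, N, h)\<leftarrow>L. (if b then 1 else - 1) * (\<Sum>n<N. (cmod (cinner (h n) v))\<^sup>2))"
proof (induction L)
  case (Cons x L)
  obtain b N h where x: "x = (b, N, h)" by (cases x)
  have "Re (cinner v (h n) * cinner (h n) v) = (cmod (cinner (h n) v))\<^sup>2" for n
    by (subst cinner_commute[of v]) (simp add: cmod_power2, simp add: power2_eq_square)
  moreover have "bop_apply (\<Sum>n<N. rank_one (h n) (h n)) v = (\<Sum>n<N. cinner v (h n) *\<^sub>C h n)"
    by (induction N) auto
  ultimately have "Re (cinner (bop_apply (\<Sum>n<N. rank_one (h n) (h n)) v) v) = (\<Sum>n<N. (cmod (cinner (h n) v))\<^sup>2)"
    by (simp add: cinner_sum_left cinner_scaleC_left)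
  then show ?case using Cons by (simp add: x signed_gram_def cinner_simps)
qed (simp add: signed_gram_def)

lemma sum_list_matrix_form:
  "(\<Sum>i<m. \<Sum>j<m. (\<Sum>x\<leftarrow>L. F x i j) * B i j) = (\<Sum>x\<leftarrow>L. \<Sum>i<m. \<Sum>j<m. F x i j * (B i j :: complex))"
  by (induction L) (simp_all add: distrib_right sum.distrib)

lemma matrix_form_expand:
  fixes e :: "nat \<Rightarrow> 'h::chilbert_space"
  shows "(\<Sum>i<m. \<Sum>j<m. (\<Sum>n<N. \<Sum>p<N. s n p * (c n j * cnj (c p i))) * cinner (bop_apply Y (e j)) (e i))
    = (\<Sum>n<N. \<Sum>p<N. s n p * cinner (bop_apply Y (\<Sum>j<m. c n j *\<^sub>C e j)) (\<Sum>i<m. c p i *\<^sub>C e i))"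
proof -
  have "(\<Sum>n<N. \<Sum>p<N. s n p * cinner (bop_apply Y (\<Sum>j<m. c n j *\<^sub>C e j)) (\<Sum>i<m. c p i *\<^sub>C e i))
      = (\<Sum>n<N. \<Sum>p<N. \<Sum>i<m. \<Sum>j<m. s n p * (c n j * cnj (c p i)) * cinner (bop_apply Y (e j)) (e i))"
    by (simp add: bop_apply_sum bop_lin cinner_sum_left cinner_sum_right cinner_scaleC_left
        cinner_scaleC_right sum_distrib_left mult_ac)
  also have "\<dots> = (\<Sum>n<N. \<Sum>i<m. \<Sum>p<N. \<Sum>j<m. s n p * (c n j * cnj (c p i)) * cinner (bop_apply Y (e j)) (e i))"
    by (intro sum.cong refl) (rule sum.swap)
  also have "\<dots> = (\<Sum>n<N. \<Sum>i<m. \<Sum>j<m. \<Sum>p<N. s n p * (c n j * cnj (c p i)) * cinner (bop_apply Y (e j)) (e i))"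
    by (intro sum.cong refl) (rule sum.swap)
  also have "\<dots> = (\<Sum>i<m. \<Sum>n<N. \<Sum>j<m. \<Sum>p<N. s n p * (c n j * cnj (c p i)) * cinner (bop_apply Y (e j)) (e i))"
    by (rule sum.swap)
  also have "\<dots> = (\<Sum>i<m. \<Sum>j<m. \<Sum>n<N. \<Sum>p<N. s n p * (c n j * cnj (c p i)) * cinner (bop_apply Y (e j)) (e i))"
    by (intro sum.cong refl) (rule sum.swap)
  finally show ?thesis by (simp add: sum_distrib_right)
qed

lemma exponential_square:
  fixes a :: "nat \<Rightarrow> complex"
  shows "Re (\<Sum>n<N. \<Sum>p<N. cis (of_int (int n - int p) * t) * (a n * cnj (a p))) = (cmod (\<Sum>n<N. cis (n * t) * a n))\<^sup>2"
proof -
  let ?s = "\<Sum>n<N. cis (n * t) * a n"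
  have c: "cis (of_int (int n - int p) * t) = cis (n * t) * cnj (cis (p * t))" for n p :: nat
    by (simp add: cis_cnj cis_mult left_diff_distrib)
  have "?s * cnj ?s = (\<Sum>n<N. \<Sum>p<N. (cis (n * t) * a n) * cnj (cis (p * t) * a p))"
    by (simp only: cnj_sum sum_product)
  also have "\<dots> = (\<Sum>n<N. \<Sum>p<N. cis (of_int (int n - int p) * t) * (a n * cnj (a p)))"
    by (intro sum.cong refl) (simp only: c complex_cnj_mult, simp only: mult_ac)
  finally have "?s * cnj ?s = (\<Sum>n<N. \<Sum>p<N. cis (of_int (int n - int p) * t) * (a n * cnj (a p)))" .
  moreover have "?s * cnj ?s = complex_of_real ((cmod ?s)\<^sup>2)" by (simp only: complex_norm_square)
  ultimately show ?thesis by (metis Re_complex_of_real)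
qed

lemma diagonal_double_sum:
  "(\<Sum>n<N. \<Sum>p<N. (if int n - int p = 0 then 1 else 0) * f n p) = (\<Sum>n<N. f n (n::nat) :: complex)"
proof -
  have "(\<Sum>n<N. \<Sum>p<N. (if int n - int p = 0 then 1 else 0) * f n p) = (\<Sum>n<N. \<Sum>p<N. if n = p then f n p else 0)"
    by (intro sum.cong) auto
  then show ?thesis by simp
qed

lemma Re_sum_list: "Re (\<Sum>x\<leftarrow>xs. f x) = (\<Sum>x\<leftarrow>xs. Re (f x))"
  by (induction xs) auto

lemma has_integral_sum_list:
  "(\<And>x. x \<in> set xs \<Longrightarrow> ((f x) has_integral I x) S) \<Longrightarrow> ((\<lambda>t. \<Sum>x\<leftarrow>xs. f x t) has_integral (\<Sum>x\<leftarrow>xs. I x)) S"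
  by (induction xs) (auto intro: has_integral_add)

text \<open>The square of a sequence \<open>h\<close> on one circle and its mean on the other, evaluated against
  hermitian operators \<open>Y\<close> and \<open>Y'\<close> at a point \<open>R e\<^sup>i\<^sup>t\<close> and at \<open>e\<^sup>-\<^sup>i\<^sup>t / R\<close>.\<close>

lemma squares_on_boundary:
  fixes h :: "nat \<Rightarrow> 'h::chilbert_space" and N :: nat
  assumes R: "R > 1" and Y: "bop_adj Y = Y"
  defines "\<Phi> b z \<equiv> \<Sum>n<N. \<Sum>p<N. boundary_symbol R b (int n - int p) z * cinner (bop_apply Y (h n)) (h p)"
    and "full t \<equiv> Re (\<Sum>n<N. \<Sum>p<N. cis (of_int (int n - int p) * t) * cinner (bop_apply Y (h n)) (h p))"
    and "diag \<equiv> Re (\<Sum>n<N. cinner (bop_apply Y (h n)) (h n))"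
  shows "2 * Re (\<Phi> b (R * cis t)) = (if b then full t else 0)"
    and "2 * Re (\<Phi> b (cis (- t) / R)) = (if b then diag else full t - diag)"
proof -
  note H = hermitian_double_sum[OF Y, of "\<lambda>k. boundary_symbol R b k z" h N for z]
  note V = boundary_symbol_values[OF R, of b _ t]
  show "2 * Re (\<Phi> b (R * cis t)) = (if b then full t else 0)"
    unfolding \<Phi>_def H V full_def by simp
  have d: "(\<Sum>n<N. \<Sum>p<N. (if int n - int p = 0 then 1 else 0) * cinner (bop_apply Y (h n)) (h p)) =
      (\<Sum>n<N. cinner (bop_apply Y (h n)) (h n))" by (rule diagonal_double_sum)
  show "2 * Re (\<Phi> b (cis (- t) / R)) = (if b then diag else full t - diag)"
  proof (cases b)
    case True
    then show ?thesis unfolding \<Phi>_def H V diag_def using d by (simp only: if_True)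
  next
    case False
    have "(\<Sum>n<N. \<Sum>p<N. (if int n - int p = 0 then 0 else cis (of_int (int n - int p) * t)) * cinner (bop_apply Y (h n)) (h p))
        = (\<Sum>n<N. \<Sum>p<N. cis (of_int (int n - int p) * t) * cinner (bop_apply Y (h n)) (h p)
          - (if int n - int p = 0 then 1 else 0) * cinner (bop_apply Y (h n)) (h p))"
      by (intro sum.cong refl) auto
    also have "\<dots> = (\<Sum>n<N. \<Sum>p<N. cis (of_int (int n - int p) * t) * cinner (bop_apply Y (h n)) (h p))
        - (\<Sum>n<N. cinner (bop_apply Y (h n)) (h n))"
      unfolding sum_subtractf d ..
    finally show ?thesis unfolding \<Phi>_def H V diag_def full_def using False by (simp only: if_False minus_complex.sel)
  qed
qed

text \<open>In an orthonormal basis \<open>e\<close> of the span of all coefficients, the squares become twice the real part of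
  a matrix \<open>f\<close> over the algebra: the surplus of the means on the inner circle is the form of
  \<open>signed_gram L\<close>, which is zero. The form of \<open>S f\<close> at \<open>e\<close> is then nonnegative and, by integration
  against the kernels, a positive multiple of the wanted value.\<close>

lemma squares_value_nonneg:
  fixes T :: "'h::chilbert_space bop" and L :: "'h squares"
  assumes R: "R > 1" and c: "c > - 2" and spec: "bop_spectrum T \<subseteq> annulus R"
    and T: "T \<in> CDLA R c" and L: "signed_gram L = 0"
  shows "0 \<le> squares_value (2 + c) ((1 / R) *\<^sub>R T) ((1 / R) *\<^sub>R bop_inv T) L"
proof -
  let ?P = "(1 / R) *\<^sub>R T" and ?Q = "(1 / R) *\<^sub>R bop_inv T"
  have sP: "spectrum_in_disc ?P" and sQ: "spectrum_in_disc ?Q"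
    using spectrum_in_disc_outer[OF R spec] spectrum_in_disc_inner[OF R spec] by auto
  define vs where "vs = concat (map (\<lambda>(b, N, h). map h [0..<N]) L)"
  obtain m e where on: "orthonormal m e"
    and "\<forall>v\<in>set vs. v = (\<Sum>l<m. cinner v (e l) *\<^sub>C e l)"
    using orthonormal_basis_exists[of vs] by metis
  then have ex: "(\<Sum>l<m. cinner (h n) (e l) *\<^sub>C e l) = h n" if "(b, N, h) \<in> set L" "n < N" for b N h n
    using that by (force simp: vs_def)
  define F where "F x i j z = (case x of (b, N, h) \<Rightarrow> \<Sum>n<N. \<Sum>p<N. boundary_symbol R b (int n - int p) z *
    (cinner (h n) (e j) * cnj (cinner (h p) (e i))))" for x :: "bool \<times> nat \<times> (nat \<Rightarrow> 'h)" and i j z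
  define f where "f i j z = (\<Sum>x\<leftarrow>L. F x i j z)" for i j z
  have alg: "f i j \<in> annulus_algebra R" for i j
  proof -
    have "(\<lambda>z. boundary_symbol R b k z * a) \<in> annulus_algebra R" for b k a
      using annulus_algebra_linear[OF boundary_symbol_in_algebra[OF R, of b k] boundary_symbol_in_algebra[OF R, of b k], of a 0]
      by (simp add: mult.commute)
    then have "F x i j \<in> annulus_algebra R" for x
      unfolding F_def by (cases x) (auto intro!: annulus_algebra_sum)
    then show ?thesis unfolding f_def[abs_def] by (intro annulus_algebra_sum_list)
  qed
  have mat: "(\<Sum>i<m. \<Sum>j<m. f i j z * cinner (bop_apply Y (u j)) (u i)) = (\<Sum>(b, N, h)\<leftarrow>L. \<Sum>n<N. \<Sum>p<N.
      boundary_symbol R b (int n - int p) z * cinner (bop_apply Y (\<Sum>j<m. cinner (h n) (e j) *\<^sub>C u j)) (\<Sum>j<m. cinner (h p) (e j) *\<^sub>C u j))"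
    for z and Y :: "'k::chilbert_space bop" and u
    unfolding f_def sum_list_matrix_form
    by (intro arg_cong[where f = sum_list] map_cong refl) (auto simp: F_def matrix_form_expand)
  have bdry: "0 \<le> Re (\<Sum>i<m. \<Sum>j<m. f i j z * (\<xi> j * cnj (\<xi> i)))" if z: "cmod z = R \<or> cmod z = 1 / R" for z \<xi>
  proof -
    \<comment> \<open>The form of the matrix at \<open>\<xi>\<close> is the form of the squares in the direction \<open>v\<close>.\<close>
    define v where "v = (\<Sum>j<m. cnj (\<xi> j) *\<^sub>C e j)"
    have a: "(\<Sum>j<m. cinner (h n) (e j) *\<^sub>C \<xi> j) = cinner (h n) v" for h :: "nat \<Rightarrow> 'h" and n
      by (simp add: v_def cinner_sum_right cinner_scaleC_right scaleC_complex_def mult.commute)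
    define full where "full t x = (case x of (b, N, h) \<Rightarrow> (cmod (\<Sum>n<N. cis (real n * t) * cinner (h n) v))\<^sup>2)"
      for t and x :: "bool \<times> nat \<times> (nat \<Rightarrow> 'h)"
    define diag where "diag x = (case x of (b, N, h) \<Rightarrow> (\<Sum>n<N. (cmod (cinner (h n) v))\<^sup>2))"
      for x :: "bool \<times> nat \<times> (nat \<Rightarrow> 'h)"
    define \<Phi> where "\<Phi> w x = (case x of (b, N, h) \<Rightarrow> \<Sum>n<N. \<Sum>p<N. boundary_symbol R b (int n - int p) w *
      cinner (bop_apply 1 (cinner (h n) v)) (cinner (h p) v))" for w and x :: "bool \<times> nat \<times> (nat \<Rightarrow> 'h)"
    have S: "(\<Sum>i<m. \<Sum>j<m. f i j w * (\<xi> j * cnj (\<xi> i))) = (\<Sum>x\<leftarrow>L. \<Phi> w x)" for w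
      using mat[of w 1 \<xi>] unfolding a \<Phi>_def by (simp add: cinner_complex_def)
    have P: "2 * Re (\<Phi> (R * cis t) x) = (if fst x then full t x else 0)"
      "2 * Re (\<Phi> (cis (- t) / R) x) = (if fst x then diag x else full t x - diag x)" for t x
    proof -
      obtain b N h where x: "x = (b, N, h)" by (cases x)
      have dg: "Re (\<Sum>n<N. cinner (bop_apply 1 (cinner (h n) v)) (cinner (h n) v)) = diag x"
        by (simp add: x diag_def Re_cinner_self)
      have fl: "Re (\<Sum>n<N. \<Sum>p<N. cis (of_int (int n - int p) * t) *
          cinner (bop_apply 1 (cinner (h n) v)) (cinner (h p) v)) = full t x"
        using exponential_square[of t "\<lambda>n. cinner (h n) v" N] by (simp add: x full_def cinner_complex_def)
      show "2 * Re (\<Phi> (R * cis t) x) = (if fst x then full t x else 0)"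
        "2 * Re (\<Phi> (cis (- t) / R) x) = (if fst x then diag x else full t x - diag x)"
        using squares_on_boundary[OF R adj_one, where N = N and b = b and t = t and h = "\<lambda>n. cinner (h n) v"] unfolding dg fl
        by (simp_all add: \<Phi>_def x)
    qed
    have full0: "0 \<le> full t x" for t x by (cases x) (simp add: full_def)
    \<comment> \<open>The two circles are parametrized in opposite directions.\<close>
    define t where "t = (if cmod z = R then Arg z else - Arg z)"
    consider "z = R * cis t" | "z = cis (- t) / R"
    proof (cases "cmod z = R")
      case True
      then have "z = R * cis t" using rcis_cmod_Arg[of z] by (simp add: t_def rcis_def)
      then show thesis using that by blast
    next
      case False
      then have "z = cis (- t) / R" using z rcis_cmod_Arg[of z] by (simp add: t_def rcis_def)
      then show thesis using that by blast
    qed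
    then show ?thesis
    proof cases
      case 1
      have "2 * Re (\<Sum>x\<leftarrow>L. \<Phi> z x) = (\<Sum>x\<leftarrow>L. if fst x then full t x else 0)"
        unfolding Re_sum_list sum_list_const_mult[symmetric] 1 P ..
      also have "0 \<le> \<dots>" by (rule sum_list_nonneg) (auto simp: full0)
      finally show ?thesis unfolding S by simp
    next
      case 2
      have "2 * Re (\<Sum>x\<leftarrow>L. \<Phi> z x) = (\<Sum>x\<leftarrow>L. if fst x then diag x else full t x - diag x)"
        unfolding Re_sum_list sum_list_const_mult[symmetric] 2 P ..
      also have "\<dots> = (\<Sum>x\<leftarrow>L. (if fst x then 0 else full t x) + (if fst x then 1 else - 1) * diag x)"
        by (intro arg_cong[where f = sum_list] map_cong refl) auto
      also have "\<dots> = (\<Sum>x\<leftarrow>L. if fst x then 0 else full t x) + (\<Sum>x\<leftarrow>L. (if fst x then 1 else - 1) * diag x)"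
        by (rule sum_list_addf)
      also have "(\<Sum>x\<leftarrow>L. (if fst x then 1 else - 1) * diag x) = Re (cinner (bop_apply (signed_gram L) v) v)"
        unfolding cinner_signed_gram by (intro arg_cong[where f = sum_list] map_cong refl) (auto simp: diag_def)
      also have "\<dots> = 0" by (simp add: L)
      also have "0 \<le> (\<Sum>x\<leftarrow>L. if fst x then 0 else full t x) + 0" unfolding add_0_right
        by (rule sum_list_nonneg) (auto simp: full0)
      finally show ?thesis unfolding S by simp
    qed
  qed
  define k where "k = 1 / (2 * pi * (2 + c))"
  have k: "0 < k" using c by (simp add: k_def)
  define Yo where "Yo t = poisson_kernel ?P (cis (- t)) + (2 + c) *\<^sub>R 1" for t
  define Yi where "Yi t = poisson_kernel ?Q (cis (- t))" for t
  have Yadj: "bop_adj (Yo t) = Yo t" "bop_adj (Yi t) = Yi t" for t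
    by (simp_all add: Yo_def Yi_def adj_add adj_scaleR poisson_kernel_adj)
  define E where "E = Re (\<Sum>i<m. \<Sum>j<m. cinner (bop_apply (dlp_map R c T (f i j)) (e j)) (e i))"
  have E0: "0 \<le> E" unfolding E_def by (rule CDLA_Re_nonneg[OF R c spec T alg bdry])
  define G where "G t Y w x = (case x of (b, N, h) \<Rightarrow> \<Sum>n<N. \<Sum>p<N. boundary_symbol R b (int n - int p) w *
    cinner (bop_apply Y (h n)) (h p))" for t :: real and Y and w and x :: "bool \<times> nat \<times> (nat \<Rightarrow> 'h)"
  have mate: "(\<Sum>i<m. \<Sum>j<m. f i j w * cinner (bop_apply Y (e j)) (e i)) = (\<Sum>x\<leftarrow>L. G t Y w x)" for t w Y
    unfolding mat G_def
    by (intro arg_cong[where f = sum_list] map_cong refl) (auto simp: ex intro!: sum.cong)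
  have "((\<lambda>t. \<Sum>i<m. \<Sum>j<m. k * (f i j (R * cis t) * cinner (bop_apply (Yo t) (e j)) (e i) +
      f i j (cis (- t) / R) * cinner (bop_apply (Yi t) (e j)) (e i))) has_integral
      (\<Sum>i<m. \<Sum>j<m. cinner (bop_apply (dlp_map R c T (f i j)) (e j)) (e i))) {0..2 * pi}"
    unfolding Yo_def Yi_def k_def by (intro has_integral_sum has_integral_dlp_form[OF R c spec alg]) auto
  moreover have "(\<Sum>i<m. \<Sum>j<m. k * (f i j (R * cis t) * cinner (bop_apply (Yo t) (e j)) (e i) +
      f i j (cis (- t) / R) * cinner (bop_apply (Yi t) (e j)) (e i)))
      = k * ((\<Sum>x\<leftarrow>L. G t (Yo t) (R * cis t) x) + (\<Sum>x\<leftarrow>L. G t (Yi t) (cis (- t) / R) x))" for t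
    unfolding mate[symmetric] by (simp only: sum_distrib_left[symmetric] sum.distrib)
  ultimately have "((\<lambda>t. k * ((\<Sum>x\<leftarrow>L. G t (Yo t) (R * cis t) x) + (\<Sum>x\<leftarrow>L. G t (Yi t) (cis (- t) / R) x))) has_integral
      (\<Sum>i<m. \<Sum>j<m. cinner (bop_apply (dlp_map R c T (f i j)) (e j)) (e i))) {0..2 * pi}" by simp
  from has_integral_mult_right[OF has_integral_linear[OF this bounded_linear_Re], of "2 / k"]
  have 1: "((\<lambda>t. 2 * Re (\<Sum>x\<leftarrow>L. G t (Yo t) (R * cis t) x) + 2 * Re (\<Sum>x\<leftarrow>L. G t (Yi t) (cis (- t) / R) x))
      has_integral 2 / k * E) {0..2 * pi}"
    using k by (simp add: o_def E_def algebra_simps)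
  define I where "I x = (case x of (b, N, h) \<Rightarrow>
    2 * pi * toeplitz_form ((if b then 2 + c else 0) *\<^sub>R 1) (if b then ?P else ?Q) N h)" for x :: "bool \<times> nat \<times> (nat \<Rightarrow> 'h)"
  have "((\<lambda>t. 2 * Re (G t (Yo t) (R * cis t) x) + 2 * Re (G t (Yi t) (cis (- t) / R) x)) has_integral I x) {0..2 * pi}" for x
  proof -
    obtain b N h where x: "x = (b, N, h)" by (cases x)
    have eq: "2 * Re (G t (Yo t) (R * cis t) x) + 2 * Re (G t (Yi t) (cis (- t) / R) x)
      = (if b then Re (\<Sum>n<N. \<Sum>p<N. cis (of_int (int n - int p) * t) * cinner (bop_apply (Yo t) (h n)) (h p))
          + Re (\<Sum>n<N. cinner (bop_apply (Yi t) (h n)) (h n))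
        else Re (\<Sum>n<N. \<Sum>p<N. cis (of_int (int n - int p) * t) * cinner (bop_apply (Yi t) (h n)) (h p))
          - Re (\<Sum>n<N. cinner (bop_apply (Yi t) (h n)) (h n)))" for t
      using squares_on_boundary(1)[OF R Yadj(1), where N = N and b = b and t = t and h = h]
        squares_on_boundary(2)[OF R Yadj(2), where N = N and b = b and t = t and h = h]
      by (simp add: G_def x)
    have d: "((\<lambda>t. Re (\<Sum>n<N. cinner (bop_apply (Yi t) (h n)) (h n))) has_integral 0) {0..2 * pi}"
    proof -
      have "((\<lambda>t. \<Sum>n<N. cinner (bop_apply (Yi t) (h n)) (h n)) has_integral (\<Sum>n<N. 0)) {0..2 * pi}"
        unfolding Yi_def using has_integral_poisson_kernel[OF sQ, of 0] by (intro has_integral_sum) auto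
      from has_integral_linear[OF this bounded_linear_Re] show ?thesis by (simp add: o_def)
    qed
    have o: "((\<lambda>t. Re (\<Sum>n<N. \<Sum>p<N. cis (of_int (int n - int p) * t) * cinner (bop_apply (Yo t) (h n)) (h p)))
        has_integral 2 * pi * toeplitz_form ((2 + c) *\<^sub>R 1) ?P N h) {0..2 * pi}"
      unfolding Yo_def by (rule toeplitz_form_integral[OF sP])
    have i: "((\<lambda>t. Re (\<Sum>n<N. \<Sum>p<N. cis (of_int (int n - int p) * t) * cinner (bop_apply (Yi t) (h n)) (h p)))
        has_integral 2 * pi * toeplitz_form (0 *\<^sub>R 1) ?Q N h) {0..2 * pi}"
      using toeplitz_form_integral[OF sQ, where N = N and r = 0 and h = h] by (simp add: Yi_def)
    show ?thesis
    proof (cases b)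
      case True
      then show ?thesis unfolding eq unfolding I_def x prod.case
        using has_integral_add[OF o d] by (simp only: if_True add_0_right)
    next
      case False
      then show ?thesis unfolding eq unfolding I_def x prod.case
        using has_integral_diff[OF i d] by (simp only: if_False diff_zero)
    qed
  qed
  then have "((\<lambda>t. \<Sum>x\<leftarrow>L. 2 * Re (G t (Yo t) (R * cis t) x) + 2 * Re (G t (Yi t) (cis (- t) / R) x)) has_integral (\<Sum>x\<leftarrow>L. I x)) {0..2 * pi}"
    by (intro has_integral_sum_list)
  then have "((\<lambda>t. 2 * Re (\<Sum>x\<leftarrow>L. G t (Yo t) (R * cis t) x) + 2 * Re (\<Sum>x\<leftarrow>L. G t (Yi t) (cis (- t) / R) x))
      has_integral (\<Sum>x\<leftarrow>L. I x)) {0..2 * pi}"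
    by (simp only: sum_list_addf sum_list_const_mult Re_sum_list)
  from has_integral_unique[OF this 1] have "0 \<le> (\<Sum>x\<leftarrow>L. I x)" using E0 k by simp
  also have "(\<Sum>x\<leftarrow>L. I x) = 2 * pi * squares_value (2 + c) ?P ?Q L"
    unfolding squares_value_def sum_list_const_mult[symmetric]
    by (intro arg_cong[where f = sum_list] map_cong refl) (auto simp: I_def)
  finally show ?thesis using pi_gt_zero by (simp add: zero_le_mult_iff)
qed

section \<open>The separating operator\<close>

lemma toeplitz_form_scale:
  "toeplitz_form Z X N (\<lambda>n. a *\<^sub>R h n) = a\<^sup>2 * toeplitz_form Z X N h"
  by (simp add: toeplitz_form_def bop_lin cinner_simps sum_distrib_left power2_eq_square algebra_simps)

lemma rank_one_add: "rank_one (x + y) z = rank_one x z + rank_one y z" "rank_one x (y + z) = rank_one x y + rank_one x z"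
  by (rule bop_eqI, simp add: scaleC_add_right scaleC_add_left cinner_simps)+

lemma rank_one_scaleR: "rank_one (a *\<^sub>R x) y = a *\<^sub>R rank_one x y" "rank_one x (a *\<^sub>R y) = a *\<^sub>R rank_one x y"
  by (rule bop_eqI, simp add: scaleR_scaleC[where 'a='a] scaleC_scaleC cinner_simps mult.commute)+

text \<open>The infimum of \<open>squares_value\<close> over all representations of an operator as a signed Gramian is a
  sublinear function of the operator; it is finite because representations of \<open>0\<close> have nonnegative
  value. On the rank one operators \<open>u \<mapsto> \<langle>u, x\<rangle> x\<close> a linear minorant \<open>g\<close> is a quadratic form in \<open>x\<close>,
  with values between \<open>0\<close> and \<open>r \<parallel>x\<parallel>\<^sup>2\<close> by the squares of length one; its polarization is the form of
  \<open>A\<close>. The squares on the outer circle bound \<open>A\<close> from above, those on the inner circle from below.\<close>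

lemma separating_operator_exists:
  fixes P Q :: "'h::chilbert_space bop"
  assumes r: "0 \<le> r" and key: "\<And>L. signed_gram L = 0 \<Longrightarrow> 0 \<le> squares_value r P Q L"
  obtains A where "bop_adj A = A" "\<And>N h. 0 \<le> toeplitz_form (r *\<^sub>R 1 - A) P N h"
    "\<And>N h. 0 \<le> toeplitz_form A Q N h"
proof -
  let ?v = "squares_value r P Q"
  have app: "signed_gram (L @ M) = signed_gram L + signed_gram M" "?v (L @ M) = ?v L + ?v M" for L M
    by (simp_all add: signed_gram_def squares_value_def)
  define sc where "sc a L = map (\<lambda>(b, N, h). (b, N, \<lambda>n. sqrt a *\<^sub>R h n)) L" for a and L :: "'h squares"
  have rs: "(\<Sum>n<N. rank_one (sqrt a *\<^sub>R h n) (sqrt a *\<^sub>R h n)) = a *\<^sub>R (\<Sum>n<N. rank_one (h n) (h n))"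
    if "0 \<le> a" for a N and h :: "nat \<Rightarrow> 'h"
    using that by (induction N) (simp_all add: rank_one_scaleR scaleR_add_right)
  have sc: "signed_gram (sc a L) = a *\<^sub>R signed_gram L" "?v (sc a L) = a * ?v L" if "0 \<le> a" for a L
    using that by (induction L)
      (auto simp: sc_def signed_gram_def squares_value_def rs toeplitz_form_scale scaleR_add_right distrib_left)
  \<comment> \<open>Exchanging the circles changes the sign of the Gramian.\<close>
  define ng where "ng L = map (\<lambda>(b, N, h). (\<not> b, N, h)) L" for L :: "'h squares"
  have ng: "signed_gram (ng L) = - signed_gram L" for L
    by (induction L) (auto simp: ng_def signed_gram_def)
  define W where "W = range (signed_gram :: 'h squares \<Rightarrow> 'h bop)"
  have WI: "signed_gram L \<in> W" for L by (simp add: W_def)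
  have W: "subspace W"
  proof (rule subspaceI)
    show "0 \<in> W" using WI[of "[]"] by (simp add: signed_gram_def)
    fix x assume "x \<in> W"
    then obtain L where L: "x = signed_gram L" unfolding W_def by (rule rangeE)
    show "x + y \<in> W" if y: "y \<in> W" for y
    proof -
      obtain M where "y = signed_gram M" using y unfolding W_def by (rule rangeE)
      then show ?thesis using WI[of "L @ M"] by (simp add: L app)
    qed
    show "a *\<^sub>R x \<in> W" for a
    proof (cases "0 \<le> a")
      case True
      then show ?thesis using WI[of "sc a L"] by (simp add: L sc)
    next
      case False
      then show ?thesis using WI[of "sc (- a) (ng L)"] by (simp add: L sc ng)
    qed
  qed
  define V where "V x = {?v L |L. signed_gram L = x}" for x
  define p where "p x = Inf (V x)" for x
  have ne: "V x \<noteq> {}" if "x \<in> W" for x using that by (auto simp: V_def W_def)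
  have bdd: "bdd_below (V x)" if x: "x \<in> W" for x
  proof -
    obtain M where M: "x = signed_gram M" using x unfolding W_def by (rule rangeE)
    have "- ?v (ng M) \<le> ?v L" if "signed_gram L = x" for L
      using key[of "L @ ng M"] that by (simp add: app ng M)
    then show ?thesis unfolding V_def by (intro bdd_belowI) auto
  qed
  have ple: "p (signed_gram L) \<le> ?v L" for L
    unfolding p_def by (rule cInf_lower[OF _ bdd]) (auto simp: V_def W_def)
  have near: "\<exists>L. signed_gram L = x \<and> ?v L < p x + \<epsilon>" if "x \<in> W" "0 < \<epsilon>" for x \<epsilon>
    using cInf_lessD[OF ne[OF that(1)], of "p x + \<epsilon>"] that(2) by (auto simp: p_def V_def)
  have sub: "sublinear_on W p"
    unfolding sublinear_on_def
  proof (intro conjI ballI allI impI)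
    fix x y assume xy: "x \<in> W" "y \<in> W"
    show "p (x + y) \<le> p x + p y"
    proof (rule field_le_epsilon)
      fix \<epsilon> :: real assume "0 < \<epsilon>"
      then have e2: "0 < \<epsilon> / 2" by simp
      obtain L M where "signed_gram L = x" "?v L < p x + \<epsilon> / 2" "signed_gram M = y" "?v M < p y + \<epsilon> / 2"
        using near[OF xy(1) e2] near[OF xy(2) e2] by blast
      then show "p (x + y) \<le> p x + p y + \<epsilon>" using ple[of "L @ M"] by (simp add: app)
    qed
  next
    have le: "p (t *\<^sub>R x) \<le> t * p x" if t: "0 < t" and x: "x \<in> W" for t x
    proof (rule field_le_epsilon)
      fix \<epsilon> :: real assume "0 < \<epsilon>"
      then obtain L where L: "signed_gram L = x" "?v L < p x + \<epsilon> / t" using near[OF x, of "\<epsilon> / t"] t by auto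
      have "p (t *\<^sub>R x) \<le> t * ?v L" using ple[of "sc t L"] t by (simp add: sc L(1))
      also have "\<dots> \<le> t * (p x + \<epsilon> / t)" using L(2) t by simp
      finally show "p (t *\<^sub>R x) \<le> t * p x + \<epsilon>" using t by (simp add: distrib_left)
    qed
    fix t :: real and x assume t: "0 < t" and x: "x \<in> W"
    have "p ((1 / t) *\<^sub>R (t *\<^sub>R x)) \<le> (1 / t) * p (t *\<^sub>R x)"
      using t x subspace_scale[OF W x] by (intro le) auto
    then have "t * p x \<le> p (t *\<^sub>R x)" using t by (simp add: field_simps)
    then show "p (t *\<^sub>R x) = t * p x" using le[OF t x] by simp
  qed
  obtain g where gadd: "\<And>x y. x \<in> W \<Longrightarrow> y \<in> W \<Longrightarrow> g (x + y) = g x + g y"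
    and gsc: "\<And>t x. x \<in> W \<Longrightarrow> g (t *\<^sub>R x) = t * g x" and gp: "\<And>x. x \<in> W \<Longrightarrow> g x \<le> p x"
    by (rule Hahn_Banach_sublinear[OF W sub]) blast
  have gle: "g (signed_gram L) \<le> ?v L" for L
    using order_trans[OF gp ple] by (simp add: W_def)
  have r1: "rank_one x x \<in> W" for x
  proof -
    have "signed_gram [(True, 1, \<lambda>_. x)] = rank_one x x" by (simp add: signed_gram_def)
    then show ?thesis using WI[of "[(True, 1, \<lambda>_. x)]"] by simp
  qed
  define q where "q x = g (rank_one x x)" for x
  have g0: "g 0 = 0" using gsc[OF subspace_0[OF W], of 0] by simp
  have gsum: "g (\<Sum>n<N. rank_one (h n) (h n)) = (\<Sum>n<N. q (h n)) \<and> (\<Sum>n<N. rank_one (h n) (h n)) \<in> W"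
    for N :: nat and h
    by (induction N) (auto simp: q_def g0 gadd r1 intro: subspace_0[OF W] subspace_add[OF W])
  have up: "(\<Sum>n<N. q (h n)) \<le> toeplitz_form (r *\<^sub>R 1) P N h" for N h
    using gle[of "[(True, N, h)]"] by (simp add: signed_gram_def squares_value_def gsum)
  have low: "- (\<Sum>n<N. q (h n)) \<le> toeplitz_form (0 *\<^sub>R 1) Q N h" for N h
    using gle[of "[(False, N, h)]"] gsc[OF conjunct2[OF gsum], of "- 1"] by (simp add: signed_gram_def squares_value_def gsum)
  have q1: "q x \<le> r * (norm x)\<^sup>2" "0 \<le> q x" for x
    using up[where h = "\<lambda>_. x" and N = 1] low[where h = "\<lambda>_. x" and N = 1] by (simp_all add: toeplitz_form_def cinner_simps Re_cinner_self)
  define s where "s x y = (1 / 2) *\<^sub>R (rank_one x y + rank_one y x)" for x y :: 'h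
  have s_polar: "s x y = (1 / 4) *\<^sub>R (rank_one (x + y) (x + y) + (- 1) *\<^sub>R rank_one (x + (- 1) *\<^sub>R y) (x + (- 1) *\<^sub>R y))" for x y
  proof -
    have "rank_one (x + y) (x + y) + (- 1) *\<^sub>R rank_one (x + (- 1) *\<^sub>R y) (x + (- 1) *\<^sub>R y)
        = 2 *\<^sub>R (rank_one x y + rank_one y x)"
      by (simp only: rank_one_add rank_one_scaleR scaleR_add_right) (simp add: scaleR_2)
    then show ?thesis by (simp only: s_def scaleR_scaleR) simp
  qed
  have sW: "s x y \<in> W" for x y
    unfolding s_polar by (intro subspace_scale[OF W] subspace_add[OF W] r1)
  define b where "b x y = g (s x y)" for x y
  have b_polar: "b x y = (q (x + y) - q (x + (- 1) *\<^sub>R y)) / 4" for x y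
  proof -
    have "b x y = (1 / 4) * (g (rank_one (x + y) (x + y)) + (- 1) * g (rank_one (x + (- 1) *\<^sub>R y) (x + (- 1) *\<^sub>R y)))"
      unfolding b_def s_polar
      by (subst gsc, intro subspace_add[OF W] subspace_scale[OF W] r1, subst gadd, rule r1,
          rule subspace_scale[OF W r1], subst gsc, rule r1, rule refl)
    then show ?thesis by (simp add: q_def)
  qed
  have bq: "b x x = q x" for x
  proof -
    have "s x x = rank_one x x" by (rule bop_eqI) (simp add: s_def flip: scaleR_2)
    then show ?thesis by (simp add: b_def q_def)
  qed
  have bsym: "b x y = b y x" for x y by (simp add: b_def s_def add.commute)
  have badd: "b (x + x') y = b x y + b x' y" for x x' y
  proof -
    have "s (x + x') y = s x y + s x' y"
      by (simp add: s_def rank_one_add scaleR_add_right)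
    then show ?thesis unfolding b_def by (simp add: gadd sW)
  qed
  have bsc: "b (a *\<^sub>R x) y = a * b x y" for a x y
  proof -
    have "s (a *\<^sub>R x) y = a *\<^sub>R s x y"
      by (simp add: s_def rank_one_scaleR scaleR_add_right mult.commute)
    then show ?thesis unfolding b_def by (simp add: gsc sW)
  qed
  have bsc': "b x (a *\<^sub>R y) = a * b x y" for a x y using bsc bsym by metis
  have unit: "\<bar>b x y\<bar> \<le> r" if xy: "norm x = 1" "norm y = 1" for x y
  proof -
    have n: "norm (x + y) \<le> 2" "norm (x + (- 1) *\<^sub>R y) \<le> 2"
      using norm_triangle_ineq[of x y] norm_triangle_ineq4[of x y] xy by auto
    have "r * (norm (x + y))\<^sup>2 \<le> r * 4" "r * (norm (x + (- 1) *\<^sub>R y))\<^sup>2 \<le> r * 4"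
      using power_mono[OF n(1), of 2] power_mono[OF n(2), of 2] r by (auto intro!: mult_left_mono)
    then show ?thesis
      using q1[of "x + y"] q1[of "x + (- 1) *\<^sub>R y"] unfolding b_polar by (simp add: abs_le_iff)
  qed
  have bb: "bounded_bilinear b"
  proof (rule bounded_bilinear.intro)
    have "\<bar>b x y\<bar> \<le> norm x * norm y * r" for x y
    proof (cases "x = 0 \<or> y = 0")
      case True
      then have "b x y = 0" using bsc[of 0 x y] bsc'[of x 0 y] by auto
      then show ?thesis using r by simp
    next
      case False
      have "b x y = norm x * norm y * b (sgn x) (sgn y)"
        using False by (simp add: sgn_div_norm bsc bsc' field_simps)
      moreover have "\<bar>b (sgn x) (sgn y)\<bar> \<le> r" using False by (intro unit) (auto simp: norm_sgn)
      ultimately show ?thesis by (simp add: abs_mult mult_left_mono)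
    qed
    then show "\<exists>K. \<forall>x y. norm (b x y) \<le> norm x * norm y * K" by auto
    show "b x (y + y') = b x y + b x y'" for x y y' using badd bsym by metis
  qed (simp_all add: badd bsc bsc')
  have binv: "b (\<i> *\<^sub>C x) (\<i> *\<^sub>C y) = b x y" for x y
  proof -
    have "- (\<i> * w * \<i>) = w" for w by (simp add: complex_eq_iff)
    then have "s (\<i> *\<^sub>C x) (\<i> *\<^sub>C y) = s x y"
      by (intro bop_eqI) (simp add: s_def cinner_simps scaleC_scaleC)
    then show ?thesis by (simp add: b_def)
  qed
  obtain A where A: "\<And>x y. Re (cinner (bop_apply A x) y) = b x y"
    using bop_of_form[OF bb binv] by blast
  have sym: "Re (cinner (bop_apply A x) y) = Re (cinner x (bop_apply A y))" for x y
    using A bsym Re_cinner_commute by metis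
  have "bop_adj A = A"
  proof (rule adj_eqI, rule complex_eqI)
    fix x y
    show "Re (cinner (bop_apply A x) y) = Re (cinner x (bop_apply A y))" by (rule sym)
    show "Im (cinner (bop_apply A x) y) = Im (cinner x (bop_apply A y))"
      using sym[of x "\<i> *\<^sub>C y"] unfolding Im_cinner by (simp add: bop_lin)
  qed
  moreover have "0 \<le> toeplitz_form (r *\<^sub>R 1 - A) P N h" for N h
  proof -
    have "toeplitz_form (r *\<^sub>R 1 - A) P N h = toeplitz_form (r *\<^sub>R 1) P N h - (\<Sum>n<N. q (h n))"
      by (simp add: toeplitz_form_def cinner_simps A bq sum_subtractf sum.distrib)
    then show ?thesis using up by simp
  qed
  moreover have "0 \<le> toeplitz_form A Q N h" for N h
  proof -
    have "toeplitz_form A Q N h = toeplitz_form (0 *\<^sub>R 1) Q N h + (\<Sum>n<N. q (h n))"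
      by (simp add: toeplitz_form_def cinner_simps A bq sum.distrib)
    then show ?thesis using low[where N = N and h = h] by simp
  qed
  ultimately show thesis by (rule that)
qed

text \<open>Sequences of length two in the Toeplitz form give \<open>\<parallel>X x\<parallel>\<^sup>2 \<le> (\<parallel>B\<parallel> + 1) \<langle>B x, x\<rangle>\<close>, so invertibility
  of \<open>X\<close> bounds \<open>B\<close> from below.\<close>

lemma toeplitz_form_strictly_positive:
  fixes B X :: "'h::chilbert_space bop"
  assumes adj: "bop_adj B = B" and pos: "\<And>N h. 0 \<le> toeplitz_form B X N h" and X: "bop_invertible X"
  shows "bop_strictly_positive B"
proof -
  have B: "bop_positive B"
    by (rule positiveI[OF adj]) (use pos[of 1 "\<lambda>_. x" for x] in \<open>simp add: toeplitz_form_def\<close>)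
  define s where "s = 1 / (norm B + 1)"
  have s: "0 < s" "s * norm B \<le> 1" by (auto simp: s_def add_nonneg_pos)
  have lower: "s * (norm (bop_apply X x))\<^sup>2 \<le> Re (cinner (bop_apply B x) x)" for x
  proof -
    define y where "y = bop_apply X x"
    \<comment> \<open>The weight \<open>s\<close> is so small that the square of \<open>s X x\<close> in the form of \<open>B\<close> is absorbed.\<close>
    have "0 \<le> toeplitz_form B X 2 (\<lambda>n. if n = 0 then (- s) *\<^sub>R y else x)" by (rule pos)
    then have "0 \<le> s * (s * Re (cinner (bop_apply B y) y)) + (Re (cinner (bop_apply B x) x) - 2 * (s * (norm y)\<^sup>2))"
      by (simp add: toeplitz_form_def numeral_2_eq_2 bop_lin cinner_simps Re_cinner_self flip: y_def)
    moreover have "s * (s * Re (cinner (bop_apply B y) y)) \<le> s * (norm y)\<^sup>2"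
    proof (rule mult_left_mono)
      have "s * Re (cinner (bop_apply B y) y) \<le> s * (norm B * (norm y)\<^sup>2)"
        using s positive_Re_le by (intro mult_left_mono) auto
      also have "\<dots> \<le> 1 * (norm y)\<^sup>2" unfolding mult.assoc[symmetric] using s by (intro mult_right_mono) auto
      finally show "s * Re (cinner (bop_apply B y) y) \<le> (norm y)\<^sup>2" by simp
    qed (use s in simp)
    ultimately show ?thesis by (simp add: y_def)
  qed
  define K where "K = norm (bop_inv X) + 1"
  have K: "0 < K" by (simp add: K_def add_nonneg_pos)
  have "bop_invertible B"
  proof (rule positive_bounded_below_invertible[OF B])
    show "0 < s / K\<^sup>2" using s K by simp
    fix x
    have "norm x = norm (bop_apply (bop_inv X * X) x)" by (simp only: bop_inv_mult[OF X]) simp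
    also have "\<dots> \<le> norm (bop_inv X) * norm (bop_apply X x)" using norm_bop_apply by simp
    also have "\<dots> \<le> K * norm (bop_apply X x)" by (intro mult_right_mono) (auto simp: K_def)
    finally have "(norm x)\<^sup>2 \<le> (K * norm (bop_apply X x))\<^sup>2" by (rule power_mono) simp
    then have "(norm x)\<^sup>2 \<le> K\<^sup>2 * (norm (bop_apply X x))\<^sup>2" by (simp only: power_mult_distrib)
    then have "s * ((norm x)\<^sup>2 / K\<^sup>2) \<le> s * (norm (bop_apply X x))\<^sup>2"
      using K s by (intro mult_left_mono) (auto simp: pos_divide_le_eq mult.commute)
    then show "s / K\<^sup>2 * (norm x)\<^sup>2 \<le> Re (cinner (bop_apply B x) x)" using lower[of x] by simp
  qed
  then show ?thesis using B by (simp add: bop_strictly_positive_def)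
qed

theorem theorem1p2:
  fixes T :: "'h::chilbert_space bop" and R c :: real
  assumes "R > 1" and "c > -2" and "bop_spectrum T \<subseteq> annulus R"
  shows "T \<in> CDLA R c \<longleftrightarrow>
    (\<exists>A :: 'h bop. bop_strictly_positive A \<and> bop_strictly_positive ((2 + c) *\<^sub>R 1 - A) \<and>
      (1 / R) *\<^sub>R T \<in> dilation_class ((2 + c) *\<^sub>R 1 - A) \<and>
      (1 / R) *\<^sub>R bop_inv T \<in> dilation_class A)"
proof
  let ?P = "(1 / R) *\<^sub>R T" and ?Q = "(1 / R) *\<^sub>R bop_inv T"
  have sP: "spectrum_in_disc ?P" and sQ: "spectrum_in_disc ?Q"
    using spectrum_in_disc_outer[OF assms(1,3)] spectrum_in_disc_inner[OF assms(1,3)] by auto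
  {
    assume T: "T \<in> CDLA R c"
    obtain A where A: "bop_adj A = A" and P: "\<And>N h. 0 \<le> toeplitz_form ((2 + c) *\<^sub>R 1 - A) ?P N h"
      and Q: "\<And>N h. 0 \<le> toeplitz_form A ?Q N h"
      using separating_operator_exists[of "2 + c" ?P ?Q] squares_value_nonneg[OF assms T] assms(2) by auto
    have T': "bop_inv T * T = 1" "T * bop_inv T = 1"
      using bop_inv_mult[OF T_invertible[OF assms(1,3)]] by auto
    have "bop_invertible ?P" unfolding bop_invertible_def
      using T' assms(1) by (intro exI[of _ "R *\<^sub>R bop_inv T"]) simp
    moreover have "bop_invertible ?Q" unfolding bop_invertible_def
      using T' assms(1) by (intro exI[of _ "R *\<^sub>R T"]) simp
    ultimately have "bop_strictly_positive ((2 + c) *\<^sub>R 1 - A)" "bop_strictly_positive A"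
      using toeplitz_form_strictly_positive[OF _ P] toeplitz_form_strictly_positive[OF A Q]
      by (auto simp: adj_diff adj_scaleR A)
    then show "\<exists>A :: 'h bop. bop_strictly_positive A \<and> bop_strictly_positive ((2 + c) *\<^sub>R 1 - A) \<and>
      ?P \<in> dilation_class ((2 + c) *\<^sub>R 1 - A) \<and> ?Q \<in> dilation_class A"
      using dilation_classI[OF _ sP P] dilation_classI[OF _ sQ Q] by blast
  next
    assume "\<exists>A :: 'h bop. bop_strictly_positive A \<and> bop_strictly_positive ((2 + c) *\<^sub>R 1 - A) \<and>
      ?P \<in> dilation_class ((2 + c) *\<^sub>R 1 - A) \<and> ?Q \<in> dilation_class A"
    then obtain A :: "'h bop" where A: "bop_strictly_positive A" "bop_strictly_positive ((2 + c) *\<^sub>R 1 - A)"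
      "?P \<in> dilation_class ((2 + c) *\<^sub>R 1 - A)" "?Q \<in> dilation_class A" by blast
    show "T \<in> CDLA R c"
      by (rule CDLA_if_positive_kernels[OF assms, of A])
         (rule positive_poisson_kernel[OF A(2) sP A(3)] positive_poisson_kernel[OF A(1) sQ A(4)])+
  }
qed

end
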